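(* Let $\nu:[0,\infty)\to\overline{\mathbb R}$ be strictly positive and locally integrable and let $\sigma:[0,\infty)\to\overline{\mathbb R}$ be locally square integrable. Suppose that the function $$\kappa:(0,\infty)\to\mathbb R,\qquad \kappa(t)=\frac{\int_{[0,t]}\sigma^2(r)\,dr}{\int_{[0,t]}\nu(r)\,dr}$$ is bounded in the vicinity of $0$. Then for every $T\in\mathbb N$ there exist $s\in\mathbb R$ and a map $u:(0,T]\times\mathbb R\to\mathcal G_s$, $(t,x)\mapsto u_{t,x}$, such that: (1) $(Su_{t,\cdot}(\varphi))_{t>0}$ is a Dirac sequence for all $\varphi\in S(\mathbb R)$, i.e. for all $\varphi,g\in S(\mathbb R)$, $\lim_{t\to0}\int_{\mathbb R}Su_{t,x}(\varphi)g(x)\,dx=g(0)$; (2) for Lebesgue-a.e. $t\in(0,T]$ and all $x\in\mathbb R$, $u$ is once differentiable with respect to $t$ and twice differentiable with respect to $x$ at $(t,x)$ (derivatives in $(S)'$), and satisfies $$\frac{\partial u_{t,x}}{\partial t}=\frac12\nu(t)\frac{\partial^2u_{t,x}}{\partial x^2}+\sigma(t)\,w_t\diamond\frac{\partial u_{t,x}}{\partial x};$$ (3) in particular, for every $s\in\mathbb R$ and $t\in(0,T]$ with $2^s\kappa(t)<1$ one has $u_{t,x}\in\mathcal G_s$ for all $x\in\mathbb R$.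
   Context: White noise setting. $\overline{\mathbb R}$ denotes the extended real numbers. $S(\mathbb R)$ is the real Schwartz space with the norms $\|\varphi\|_p=\|A^p\varphi\|_{L^2(\mathbb R)}$, $p\in\mathbb N_0$, where $A=-\frac{d^2}{dx^2}+x^2+1$, and completions $\mathcal H_p$, with duals $\mathcal H_{-p}$. $\mu$ is the probability measure on $S'(\mathbb R)$ with $\int e^{i\langle\varphi,\omega\rangle}d\mu(\omega)=e^{-\frac12\|\varphi\|^2_{L^2(\mathbb R)}}$. Each $F\in L^2(\mu)$ (complex valued) has a unique Wiener-Itô chaos decomposition $F=\sum_n\langle f^{(n)},:\cdot^{\otimes n}:\rangle$ with symmetric $f^{(n)}\in L^2_{\mathbb C}(\mathbb R^n)$ and $\|F\|^2=\sum_n n!\|f^{(n)}\|^2_{L^2}$. The Hida test function space $(S)$ is the intersection over $p\in\mathbb N$ (projective limit) of the Hilbert spaces of $F$ with $f^{(n)}\in\mathcal H_{p,\mathbb C}^{\hat\otimes n}$ and $\sum_n n!\|f^{(n)}\|_p^2<\infty$; $(S)'$ is its dual (inductive limit of the dual Hilbert spaces). Each $\Phi\in(S)'$ has a generalised chaos decomposition $\Phi=\sum_n\langle\Phi^{(n)},:\cdot^{\otimes n}:\rangle$ with, for some $p$, $\Phi^{(n)}\in\mathcal H_{-p,\mathbb C}^{\hat\otimes n}$ for all $n$. Its $S$-transform is $S\Phi(\varphi)=\sum_n\langle\varphi^{\otimes n},\Phi^{(n)}\rangle$, $\varphi\in S(\mathbb R)$ (the pairing of $\Phi$ with the Wick exponential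 $:\exp(\langle\varphi,\cdot\rangle):=\sum_n\frac1{n!}\langle\varphi^{\otimes n},:\cdot^{\otimes n}:\rangle\in(S)$), and it determines $\Phi$. For $s\in\mathbb R$, $\mathcal G_s$ is the Hilbert space of all $\Phi\in(S)'$ whose kernels $\Phi^{(n)}$ are symmetric elements of $L^2_{\mathbb C}(\mathbb R^n)$ with $\sum_n n!\,2^{sn}\|\Phi^{(n)}\|_{L^2}^2<\infty$ (this is the domain of the second quantisation of $(\sqrt2)^sId$, and its dual-type completion for negative $s$); $\mathcal G_0=L^2(\mu)$. White noise: $w_t\in(S)'$ is $w_t=\langle\delta_t,\cdot\rangle$, with $\delta_t$ the Dirac distribution at $t$, so $Sw_t(\varphi)=\varphi(t)$. The Wick product $\Phi\diamond\Psi\in(S)'$ of $\Phi,\Psi\in(S)'$ is defined by $S(\Phi\diamond\Psi)=S\Phi\cdot S\Psi$. *)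

theory Defs
  imports "HOL-Probability.Probability"
begin

section \<open>Square integrable functions\<close>

text \<open>Elements of an \<open>L\<^sup>2\<close> space are represented by functions; every notion below is
  invariant under changes on null sets.\<close>

definition square_integrable :: "'a measure \<Rightarrow> ('a \<Rightarrow> 'b::{banach, second_countable_topology}) \<Rightarrow> bool" where
  "square_integrable M f \<longleftrightarrow> f \<in> borel_measurable M \<and> integrable M (\<lambda>x. (norm (f x))\<^sup>2)"

definition l2norm :: "'a measure \<Rightarrow> ('a \<Rightarrow> 'b::{banach, second_countable_topology}) \<Rightarrow> real" where
  "l2norm M f = sqrt (\<integral>x. (norm (f x))\<^sup>2 \<partial>M)"

definition l2_lim :: "'a measure \<Rightarrow> (nat \<Rightarrow> 'a \<Rightarrow> complex) \<Rightarrow> ('a \<Rightarrow> complex) \<Rightarrow> bool" where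
  "l2_lim M g f \<longleftrightarrow>
     (\<forall>k. square_integrable M (g k)) \<and> square_integrable M f \<and>
     (\<lambda>k. l2norm M (\<lambda>x. g k x - f x)) \<longlonglongrightarrow> 0"

section \<open>Schwartz functions and tempered distributions\<close>

definition schwartz :: "(real \<Rightarrow> real) set" where
  "schwartz = {\<phi>. (\<forall>m x. ((deriv ^^ m) \<phi>) differentiable (at x)) \<and>
                 (\<forall>k m. bounded (range (\<lambda>x. x ^ k * (deriv ^^ m) \<phi> x)))}"

definition opA :: "(real \<Rightarrow> real) \<Rightarrow> real \<Rightarrow> real" where
  "opA \<phi> = (\<lambda>x. - deriv (deriv \<phi>) x + (x\<^sup>2 + 1) * \<phi> x)"

definition schwartz_norm :: "nat \<Rightarrow> (real \<Rightarrow> real) \<Rightarrow> real" where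
  "schwartz_norm p \<phi> = l2norm lborel ((opA ^^ p) \<phi>)"

type_synonym functional = "(real \<Rightarrow> real) \<Rightarrow> real"

text \<open>The dual \<open>S'(\<real>)\<close>. The value \<open>0\<close> off \<^const>\<open>schwartz\<close> makes a distribution the same
  thing as its restriction to \<^const>\<open>schwartz\<close>.\<close>

definition tempered :: "functional set" where
  "tempered = {\<omega>.
     (\<forall>\<phi>\<in>schwartz. \<forall>\<psi>\<in>schwartz. \<forall>a b. \<omega> (\<lambda>x. a * \<phi> x + b * \<psi> x) = a * \<omega> \<phi> + b * \<omega> \<psi>) \<and>
     (\<exists>p C. \<forall>\<phi>\<in>schwartz. \<bar>\<omega> \<phi>\<bar> \<le> C * schwartz_norm p \<phi>) \<and>
     (\<forall>\<phi>. \<phi> \<notin> schwartz \<longrightarrow> \<omega> \<phi> = 0)}"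

text \<open>White noise measure, on the \<open>\<sigma>\<close>-algebra generated by the evaluations; it exists and is
  unique by the Bochner-Minlos theorem.\<close>

definition white_noise_measure :: "functional measure \<Rightarrow> bool" where
  "white_noise_measure M \<longleftrightarrow>
     prob_space M \<and> space M = tempered \<and>
     sets M = sigma_sets tempered
       {{\<omega> \<in> tempered. \<omega> \<phi> \<in> B} | \<phi> B. \<phi> \<in> schwartz \<and> B \<in> sets borel} \<and>
     (\<forall>\<phi>\<in>schwartz. (\<integral>\<omega>. exp (\<i> * complex_of_real (\<omega> \<phi>)) \<partial>M)
        = exp (- (1/2) * complex_of_real ((l2norm lborel \<phi>)\<^sup>2)))"

section \<open>Kernels: symmetric functions of \<open>n\<close> real variables\<close>

abbreviation Rn :: "nat \<Rightarrow> (nat \<Rightarrow> real) measure" where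
  "Rn n \<equiv> Pi\<^sub>M {..<n} (\<lambda>_. lborel)"

type_synonym kernel = "(nat \<Rightarrow> real) \<Rightarrow> complex"

definition sym_kernel :: "nat \<Rightarrow> kernel \<Rightarrow> bool" where
  "sym_kernel n f \<longleftrightarrow> square_integrable (Rn n) f \<and>
     (\<forall>\<pi>. \<pi> permutes {..<n} \<longrightarrow> (AE x in Rn n. f (\<lambda>i. x (\<pi> i)) = f x))"

text \<open>A list of pairs \<open>(c, \<phi>)\<close> stands for the element \<open>\<Sum> c \<phi>\<^sup>\<otimes>\<^sup>n\<close> of the
  complexified algebraic symmetric tensor power of \<open>S(\<real>)\<close>; by polarization all elements
  arise like this.\<close>

type_synonym tensor = "(complex \<times> (real \<Rightarrow> real)) list"

definition schwartz_tensor :: "tensor \<Rightarrow> bool" where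
  "schwartz_tensor cs \<longleftrightarrow> (\<forall>(c, \<phi>) \<in> set cs. \<phi> \<in> schwartz)"

definition tensor_fun :: "nat \<Rightarrow> tensor \<Rightarrow> kernel" where
  "tensor_fun n cs x = (\<Sum>(c, \<phi>)\<leftarrow>cs. c * complex_of_real (\<Prod>i<n. \<phi> (x i)))"

definition tensor_opA :: "nat \<Rightarrow> tensor \<Rightarrow> tensor" where
  "tensor_opA p cs = map (\<lambda>(c, \<phi>). (c, (opA ^^ p) \<phi>)) cs"

text \<open>The closure in \<open>L\<^sup>2\<close> of the operator \<open>(A\<^sup>p)\<^sup>\<otimes>\<^sup>n\<close> on symmetric Schwartz tensors, as a
  relation. Its domain is the completion of these tensors for the norm
  \<open>\<parallel>(A\<^sup>p)\<^sup>\<otimes>\<^sup>n f\<parallel>\<close>, that is, the \<open>n\<close>-th symmetric Hilbert tensor power of the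
  complexified \<open>H\<^sub>p\<close>; the norm of that space is the norm of the image.\<close>

definition closed_opA :: "nat \<Rightarrow> nat \<Rightarrow> kernel \<Rightarrow> kernel \<Rightarrow> bool" where
  "closed_opA p n f h \<longleftrightarrow> (\<exists>cs. (\<forall>k. schwartz_tensor (cs k)) \<and>
     l2_lim (Rn n) (\<lambda>k. tensor_fun n (cs k)) f \<and>
     l2_lim (Rn n) (\<lambda>k. tensor_fun n (tensor_opA p (cs k))) h)"

definition kernel_space :: "nat \<Rightarrow> nat \<Rightarrow> kernel set" where
  "kernel_space p n = {f. \<exists>h. closed_opA p n f h}"

definition kernel_norm :: "nat \<Rightarrow> nat \<Rightarrow> kernel \<Rightarrow> real" where
  "kernel_norm p n f = (THE r. \<exists>h. closed_opA p n f h \<and> r = l2norm (Rn n) h)"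

section \<open>Wiener-Ito chaos decomposition\<close>

text \<open>\<open>\<langle>\<phi>\<^sup>\<otimes>\<^sup>n, :\<omega>\<^sup>\<otimes>\<^sup>n:\<rangle>\<close>: the Hermite polynomial of degree \<open>n\<close> with parameter
  \<open>\<parallel>\<phi>\<parallel>\<^sup>2\<close>, evaluated at \<open>\<langle>\<phi>, \<omega>\<rangle>\<close>.\<close>

definition wick_power :: "nat \<Rightarrow> (real \<Rightarrow> real) \<Rightarrow> functional \<Rightarrow> real" where
  "wick_power n \<phi> \<omega> = (\<Sum>k\<le>n div 2. fact n / (fact k * fact (n - 2 * k)) *
     (- (1/2) * (l2norm lborel \<phi>)\<^sup>2) ^ k * \<omega> \<phi> ^ (n - 2 * k))"

definition tensor_wick :: "nat \<Rightarrow> tensor \<Rightarrow> functional \<Rightarrow> complex" where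
  "tensor_wick n cs \<omega> = (\<Sum>(c, \<phi>)\<leftarrow>cs. c * complex_of_real (wick_power n \<phi> \<omega>))"

text \<open>\<open>G = \<langle>f, :\<cdot>\<^sup>\<otimes>\<^sup>n:\<rangle>\<close> for symmetric \<open>f \<in> L\<^sup>2\<close>, by \<open>L\<^sup>2\<close>-continuous extension from
  Schwartz tensors.\<close>

definition wick_pairing ::
  "functional measure \<Rightarrow> nat \<Rightarrow> kernel \<Rightarrow> (functional \<Rightarrow> complex) \<Rightarrow> bool" where
  "wick_pairing M n f G \<longleftrightarrow> sym_kernel n f \<and> (\<exists>cs. (\<forall>k. schwartz_tensor (cs k)) \<and>
     l2_lim (Rn n) (\<lambda>k. tensor_fun n (cs k)) f \<and>
     l2_lim M (\<lambda>k. tensor_wick n (cs k)) G)"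

definition has_chaos ::
  "functional measure \<Rightarrow> (functional \<Rightarrow> complex) \<Rightarrow> (nat \<Rightarrow> kernel) \<Rightarrow> bool" where
  "has_chaos M F f \<longleftrightarrow> (\<exists>G. (\<forall>n. wick_pairing M n (f n) (G n)) \<and>
     l2_lim M (\<lambda>N \<omega>. \<Sum>n<N. G n \<omega>) F)"

text \<open>The kernels of \<open>F\<close>, unique up to null sets.\<close>

definition chaos_kernel :: "functional measure \<Rightarrow> (functional \<Rightarrow> complex) \<Rightarrow> nat \<Rightarrow> kernel" where
  "chaos_kernel M F = (SOME f. has_chaos M F f)"

section \<open>Hida test functions and distributions\<close>

definition hida_space :: "functional measure \<Rightarrow> nat \<Rightarrow> (functional \<Rightarrow> complex) set" where
  "hida_space M p = {F. \<exists>f. has_chaos M F f \<and> (\<forall>n. f n \<in> kernel_space p n) \<and>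
     summable (\<lambda>n. fact n * (kernel_norm p n (f n))\<^sup>2)}"

definition hida_norm :: "functional measure \<Rightarrow> nat \<Rightarrow> (functional \<Rightarrow> complex) \<Rightarrow> real" where
  "hida_norm M p F = sqrt (\<Sum>n. fact n * (kernel_norm p n (chaos_kernel M F n))\<^sup>2)"

definition hida_test :: "functional measure \<Rightarrow> (functional \<Rightarrow> complex) set" where
  "hida_test M = (\<Inter>p. hida_space M p)"

type_synonym hida_functional = "(functional \<Rightarrow> complex) \<Rightarrow> complex"

text \<open>The dual of the Hilbert space \<^term>\<open>hida_space M p\<close>, whose elements are determined by
  their values on the dense subspace \<^term>\<open>hida_test M\<close> (and are \<open>0\<close> elsewhere by
  convention). The pairing is bilinear. The bound implies that almost everywhere equal test
  functions get the same value.\<close>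

definition hida_dual :: "functional measure \<Rightarrow> nat \<Rightarrow> hida_functional set" where
  "hida_dual M p = {\<Phi>.
     (\<forall>F\<in>hida_test M. \<forall>G\<in>hida_test M. \<forall>a b.
        \<Phi> (\<lambda>\<omega>. a * F \<omega> + b * G \<omega>) = a * \<Phi> F + b * \<Phi> G) \<and>
     (\<exists>C. \<forall>F\<in>hida_test M. cmod (\<Phi> F) \<le> C * hida_norm M p F) \<and>
     (\<forall>F. F \<notin> hida_test M \<longrightarrow> \<Phi> F = 0)}"

definition hida_dual_norm :: "functional measure \<Rightarrow> nat \<Rightarrow> hida_functional \<Rightarrow> real" where
  "hida_dual_norm M p \<Phi> = (SUP F\<in>{F \<in> hida_test M. hida_norm M p F \<le> 1}. cmod (\<Phi> F))"

definition hida_dist :: "functional measure \<Rightarrow> hida_functional set" where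
  "hida_dist M = (\<Union>p. hida_dual M p)"

text \<open>A base of neighbourhoods of \<open>0\<close> for the locally convex inductive limit topology of
  the spaces \<^term>\<open>hida_dual M p\<close>: the absolutely convex sets that meet each of
  them in a neighbourhood of \<open>0\<close>.\<close>

definition hida_nhds0 :: "functional measure \<Rightarrow> hida_functional set set" where
  "hida_nhds0 M = {V. V \<subseteq> hida_dist M \<and>
     (\<forall>\<Phi>\<in>V. \<forall>\<Psi>\<in>V. \<forall>a b. cmod a + cmod b \<le> 1 \<longrightarrow> (\<lambda>F. a * \<Phi> F + b * \<Psi> F) \<in> V) \<and>
     (\<forall>p. \<exists>\<epsilon>>0. {\<Phi> \<in> hida_dual M p. hida_dual_norm M p \<Phi> < \<epsilon>} \<subseteq> V)}"

definition has_hida_derivative ::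
  "functional measure \<Rightarrow> (real \<Rightarrow> hida_functional) \<Rightarrow> hida_functional \<Rightarrow> real \<Rightarrow> real set \<Rightarrow> bool" where
  "has_hida_derivative M f D t A \<longleftrightarrow> D \<in> hida_dist M \<and> (\<forall>r\<in>insert t A. f r \<in> hida_dist M) \<and>
     (\<forall>V\<in>hida_nhds0 M. \<forall>\<^sub>F r in at t within A.
        (\<lambda>F. (f r F - f t F) / complex_of_real (r - t) - D F) \<in> V)"

section \<open>S-transform, Wick product, white noise\<close>

definition wick_exp :: "(real \<Rightarrow> real) \<Rightarrow> functional \<Rightarrow> complex" where
  "wick_exp \<phi> \<omega> = (\<Sum>n. complex_of_real (wick_power n \<phi> \<omega> / fact n))"

definition S_transform :: "hida_functional \<Rightarrow> (real \<Rightarrow> real) \<Rightarrow> complex" where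
  "S_transform \<Phi> \<phi> = \<Phi> (wick_exp \<phi>)"

definition wick_product ::
  "functional measure \<Rightarrow> hida_functional \<Rightarrow> hida_functional \<Rightarrow> hida_functional" where
  "wick_product M \<Phi> \<Psi> = (THE \<Theta>. \<Theta> \<in> hida_dist M \<and>
     (\<forall>\<phi>\<in>schwartz. S_transform \<Theta> \<phi> = S_transform \<Phi> \<phi> * S_transform \<Psi> \<phi>))"

text \<open>\<open>w\<^sub>t = \<langle>\<delta>\<^sub>t, \<cdot>\<rangle>\<close>: only the first chaos contributes, and \<open>\<delta>\<^sub>t\<close> evaluates
  the continuous representative of the first kernel of the test function.\<close>

definition white_noise :: "functional measure \<Rightarrow> real \<Rightarrow> hida_functional" where
  "white_noise M t F = (if F \<in> hida_test M
     then THE z. \<exists>\<phi>. continuous_on UNIV \<phi> \<and>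
       (AE x in Rn 1. chaos_kernel M F 1 x = \<phi> (x 0)) \<and> z = \<phi> t
     else 0)"

text \<open>\<open>G\<^sub>s\<close>: the generalised kernels of \<open>\<Phi>\<close> are given by symmetric \<open>L\<^sup>2\<close> functions.\<close>

definition space_G :: "functional measure \<Rightarrow> real \<Rightarrow> hida_functional set" where
  "space_G M s = {\<Phi> \<in> hida_dist M. \<exists>f. (\<forall>n. sym_kernel n (f n)) \<and>
     summable (\<lambda>n. fact n * 2 powr (s * real n) * (l2norm (Rn n) (f n))\<^sup>2) \<and>
     (\<forall>F\<in>hida_test M.
        (\<lambda>n. fact n * (\<integral>x. f n x * chaos_kernel M F n x \<partial>Rn n)) sums \<Phi> F)}"

section \<open>Coefficients and Dirac sequences\<close>

text \<open>Local (square) integrability on \<open>[0, \<infinity>)\<close> of extended real functions; they are then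
  finite almost everywhere, and \<^const>\<open>real_of_ereal\<close> changes them on a null set only.\<close>

definition locally_integrable :: "(real \<Rightarrow> ereal) \<Rightarrow> bool" where
  "locally_integrable f \<longleftrightarrow> f \<in> borel_measurable (lebesgue_on {0..}) \<and>
     (\<forall>t\<ge>0. (\<integral>\<^sup>+r\<in>{0..t}. e2ennreal \<bar>f r\<bar> \<partial>lebesgue) < \<infinity>)"

definition locally_square_integrable :: "(real \<Rightarrow> ereal) \<Rightarrow> bool" where
  "locally_square_integrable f \<longleftrightarrow> f \<in> borel_measurable (lebesgue_on {0..}) \<and>
     (\<forall>t\<ge>0. (\<integral>\<^sup>+r\<in>{0..t}. e2ennreal ((f r)\<^sup>2) \<partial>lebesgue) < \<infinity>)"

definition kappa :: "(real \<Rightarrow> ereal) \<Rightarrow> (real \<Rightarrow> ereal) \<Rightarrow> real \<Rightarrow> real" where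
  "kappa \<nu> \<sigma> t = (LINT r:{0..t}|lebesgue. (real_of_ereal (\<sigma> r))\<^sup>2) /
                 (LINT r:{0..t}|lebesgue. real_of_ereal (\<nu> r))"

definition dirac_sequence :: "real \<Rightarrow> (real \<Rightarrow> real \<Rightarrow> complex) \<Rightarrow> bool" where
  "dirac_sequence T f \<longleftrightarrow> (\<forall>g\<in>schwartz.
     (\<forall>t\<in>{0<..T}. integrable lborel (\<lambda>x. f t x * complex_of_real (g x))) \<and>
     ((\<lambda>t. \<integral>x. f t x * complex_of_real (g x) \<partial>lborel) \<longlongrightarrow> complex_of_real (g 0)) (at_right 0))"

end

theory Submission
  imports Defs "HOL-Real_Asymp.Real_Asymp"
begin

text \<open>Write \<open>N(t)\<close> for the integral of \<open>\<nu>\<close> over \<open>[0, t]\<close> and \<open>p\<^sub>N\<close> for the centred Gaussian density of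
  variance \<open>N\<close>. The solution is the one with
  \<open>S u\<^sub>t\<^sub>,\<^sub>x(\<phi>) = p\<^sub>N\<^sub>(\<^sub>t\<^sub>)(x + \<integral>\<^sub>0\<^sup>t \<sigma> \<phi>)\<close>, whose \<open>n\<close>-th kernel is
  \<open>p\<^sub>N\<^sub>(\<^sub>t\<^sub>)\<^sup>(\<^sup>n\<^sup>)(x) / n!\<close> times the tensor power of \<open>\<sigma> 1\<^sub>[\<^sub>0\<^sub>,\<^sub>t\<^sub>]\<close>. Gaussian moments bound
  \<open>p\<^sub>N\<^sup>(\<^sup>n\<^sup>)\<close> by about \<open>sqrt (n! / N\<^sup>n)\<close>, which puts \<open>u\<^sub>t\<^sub>,\<^sub>x\<close> in \<open>G\<^sub>s\<close> as soon as \<open>2\<^sup>s \<kappa>(t) < 1\<close>.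

  Everything takes place in one space \<open>hida_dual M p\<close>, with \<open>p\<close> such that \<open>\<kappa> < 4\<^sup>p\<close> on \<open>(0, T]\<close>:
  \<open>A \<ge> 2\<close> makes the norm of \<open>\<sigma> 1\<^sub>[\<^sub>0\<^sub>,\<^sub>t\<^sub>]\<close> in \<open>H\<^sub>-\<^sub>p\<close> smaller by \<open>2\<^sup>p\<close>, and \<open>\<delta>\<^sub>t\<close> also lies there. An
  element of this space is represented by its sequence of homogeneous forms on \<open>S(\<real>)\<close>, and products
  of functionals bounded in \<open>H\<^sub>-\<^sub>p\<close> are bounded on the tensor powers by Schur's product
  theorem. The \<open>t\<close>-derivative exists at the Lebesgue points of \<open>\<nu>\<close>, \<open>\<sigma>\<close> and \<open>\<sigma>\<^sup>2\<close>, where the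
  difference quotients of \<open>\<sigma> 1\<^sub>[\<^sub>0\<^sub>,\<^sub>t\<^sub>]\<close> tend to \<open>\<sigma>(t) \<delta>\<^sub>t\<close> in \<open>H\<^sub>-\<^sub>p\<close>; the Wick product is then
  identified by injectivity of the \<open>S\<close>-transform.\<close>

section \<open>Square integrable functions\<close>

text \<open>The kernels of the time derivative contain a factor \<open>\<delta>\<^sub>t\<close>,
  which is not a square integrable function. For this reason elements are described by the values
  \<open>P n \<phi>\<close> on Schwartz functions, extended formally to lists; a bound by the norm
  of the represented tensor makes such a value depend on the tensor alone and extends it to limits.
  A derivative in the inductive limit is obtained in the norm of one dual Hilbert space, so one
  \<open>p\<close> has to serve all times; boundedness of \<kappa> near 0 provides it. The
  inequality between \<kappa> and \<open>4 ^ p\<close> is strict, and this gap carries the analysis: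
  the variance may be lowered and the norm of the functional raised a little without losing
  summability. The gap absorbs, uniformly in \<open>n\<close>, the factor \<open>n\<close> of the
  product rule, the binomial remainders of a perturbed \<open>n\<close>-th power and the Taylor
  remainders of the density. Derivatives of the Gaussian density are handled through Fourier
  integrals: differentiation in space or in the variance is a factor \<xi> or a multiple of its
  square, and every estimate becomes one of absolute Gaussian moments.\<close>

definition l2_inner :: "'a measure \<Rightarrow> ('a \<Rightarrow> complex) \<Rightarrow> ('a \<Rightarrow> complex) \<Rightarrow> complex" where
  "l2_inner M f g = (\<integral>x. f x * cnj (g x) \<partial>M)"

lemma square_integrable_zero [simp]: "square_integrable M (\<lambda>_. 0)"
  by (simp add: square_integrable_def)

lemma square_integrable_measurable: "square_integrable M f \<Longrightarrow> f \<in> borel_measurable M"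
  by (simp add: square_integrable_def)

lemma square_integrable_integrable: "square_integrable M f \<Longrightarrow> integrable M (\<lambda>x. (norm (f x))\<^sup>2)"
  by (simp add: square_integrable_def)

lemma square_integrable_scale:
  fixes f :: "'a \<Rightarrow> 'b::{banach, second_countable_topology, real_normed_field}"
  assumes "square_integrable M f"
  shows "square_integrable M (\<lambda>x. a * f x)"
  using assms unfolding square_integrable_def by (auto simp: norm_mult power_mult_distrib)

lemma norm_add_sq_le: "(norm (a + b))\<^sup>2 \<le> 2 * (norm a)\<^sup>2 + 2 * (norm (b::'b::real_normed_vector))\<^sup>2"
proof -
  have "(norm (a + b))\<^sup>2 \<le> (norm a + norm b)\<^sup>2" by (simp add: norm_triangle_ineq power_mono)
  also have "\<dots> \<le> 2 * (norm a)\<^sup>2 + 2 * (norm b)\<^sup>2"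
    using sum_squares_bound[of "norm a" "norm b"] by (simp add: power2_sum)
  finally show ?thesis .
qed

lemma square_integrable_add:
  assumes "square_integrable M f" "square_integrable M g"
  shows "square_integrable M (\<lambda>x. f x + g x)"
proof -
  have "integrable M (\<lambda>x. (norm (f x + g x))\<^sup>2)"
  proof (rule Bochner_Integration.integrable_bound)
    show "integrable M (\<lambda>x. 2 * (norm (f x))\<^sup>2 + 2 * (norm (g x))\<^sup>2)"
      using assms by (auto simp: square_integrable_def)
    show "(\<lambda>x. (norm (f x + g x))\<^sup>2) \<in> borel_measurable M"
      using assms[THEN square_integrable_measurable] by measurable
  qed (auto intro!: norm_add_sq_le)
  with assms show ?thesis unfolding square_integrable_def by auto
qed

lemma square_integrable_diff:
  fixes f g :: "'a \<Rightarrow> 'b::{banach, second_countable_topology, real_normed_field}"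
  assumes "square_integrable M f" "square_integrable M g"
  shows "square_integrable M (\<lambda>x. f x - g x)"
  using square_integrable_add[OF assms(1) square_integrable_scale[OF assms(2), of "-1"]] by simp

lemma square_integrable_sum:
  assumes "\<And>i. i \<in> I \<Longrightarrow> square_integrable M (f i)"
  shows "square_integrable M (\<lambda>x. \<Sum>i\<in>I. f i x)"
  using assms by (induction I rule: infinite_finite_induct) (auto intro: square_integrable_add)

lemma square_integrable_mult_integrable:
  fixes f g :: "'a \<Rightarrow> 'b::{banach, second_countable_topology, real_normed_field}"
  assumes "square_integrable M f" "square_integrable M g"
  shows "integrable M (\<lambda>x. f x * g x)"
proof (rule Bochner_Integration.integrable_bound)
  show "integrable M (\<lambda>x. (norm (f x))\<^sup>2 + (norm (g x))\<^sup>2)"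
    using assms by (auto simp: square_integrable_def)
  show "(\<lambda>x. f x * g x) \<in> borel_measurable M"
    using assms[THEN square_integrable_measurable] by measurable
  show "AE x in M. norm (f x * g x) \<le> norm ((norm (f x))\<^sup>2 + (norm (g x))\<^sup>2)"
  proof (rule AE_I2)
    fix x
    have "2 * norm (f x) * norm (g x) \<le> (norm (f x))\<^sup>2 + (norm (g x))\<^sup>2" by (rule sum_squares_bound)
    moreover have "0 \<le> norm (f x) * norm (g x)" by simp
    ultimately show "norm (f x * g x) \<le> norm ((norm (f x))\<^sup>2 + (norm (g x))\<^sup>2)"
      unfolding norm_mult real_norm_def by linarith
  qed
qed

lemma square_integrable_cnj: "square_integrable M f \<Longrightarrow> square_integrable M (\<lambda>x. cnj (f x))"
  unfolding square_integrable_def by (auto simp: borel_measurable_complex_iff)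

lemma square_integrable_of_real:
  "square_integrable M f \<Longrightarrow> square_integrable M (\<lambda>x. complex_of_real (f x))"
  unfolding square_integrable_def by auto

lemma square_integrable_norm: "square_integrable M f \<Longrightarrow> square_integrable M (\<lambda>x. norm (f x))"
  unfolding square_integrable_def by auto

lemma square_integrable_cong_AE:
  assumes "square_integrable M f" "g \<in> borel_measurable M" "AE x in M. f x = g x"
  shows "square_integrable M g"
proof -
  have "integrable M (\<lambda>x. (norm (f x))\<^sup>2) = integrable M (\<lambda>x. (norm (g x))\<^sup>2)"
    by (rule integrable_cong_AE) (use assms in \<open>auto simp: square_integrable_def\<close>)
  with assms show ?thesis by (auto simp: square_integrable_def)
qed

lemma l2norm_nonneg [simp]: "0 \<le> l2norm M f"
  by (simp add: l2norm_def)

lemma l2norm_sq: "(l2norm M f)\<^sup>2 = (\<integral>x. (norm (f x))\<^sup>2 \<partial>M)"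
  by (simp add: l2norm_def)

lemma l2norm_zero [simp]: "l2norm M (\<lambda>_. 0) = 0"
  by (simp add: l2norm_def)

lemma l2norm_of_real: "l2norm M (\<lambda>x. complex_of_real (f x)) = l2norm M f"
  by (simp add: l2norm_def)

lemma l2norm_norm: "l2norm M (\<lambda>x. norm (f x)) = l2norm M f"
  by (simp add: l2norm_def)

lemma l2norm_scale:
  fixes f :: "'a \<Rightarrow> 'b::{banach, second_countable_topology, real_normed_field}"
  shows "l2norm M (\<lambda>x. a * f x) = norm a * l2norm M f"
  by (simp add: l2norm_def norm_mult power_mult_distrib real_sqrt_mult)

lemma l2norm_cong_AE:
  assumes "f \<in> borel_measurable M" "g \<in> borel_measurable M" "AE x in M. f x = g x"
  shows "l2norm M f = l2norm M g"
  unfolding l2norm_def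
  by (intro arg_cong[of _ _ sqrt] integral_cong_AE) (use assms in auto)

lemma l2norm_eq_0_AE:
  assumes "square_integrable M f" "l2norm M f = 0"
  shows "AE x in M. f x = 0"
proof -
  have "(\<integral>x. (norm (f x))\<^sup>2 \<partial>M) = 0" using assms(2) l2norm_sq[of M f] by simp
  then have "AE x in M. (norm (f x))\<^sup>2 = 0"
    using integral_nonneg_eq_0_iff_AE[OF square_integrable_integrable[OF assms(1)]] by auto
  then show ?thesis by simp
qed

text \<open>Cauchy-Schwarz: \<open>2 |f| |g| \<le> c |f|\<^sup>2 + |g|\<^sup>2 / c\<close> with the optimal \<open>c\<close>.\<close>

lemma l2_Cauchy_Schwarz:
  fixes f g :: "'a \<Rightarrow> 'b::{banach, second_countable_topology, real_normed_field}"
  assumes f: "square_integrable M f" and g: "square_integrable M g"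
  shows "norm (\<integral>x. f x * g x \<partial>M) \<le> l2norm M f * l2norm M g"
proof -
  define F G where "F = l2norm M f" and "G = l2norm M g"
  have F0: "0 \<le> F" and G0: "0 \<le> G" by (auto simp: F_def G_def)
  note fg = square_integrable_mult_integrable[OF f g]
  have key: "2 * norm (\<integral>x. f x * g x \<partial>M) \<le> c * F\<^sup>2 + G\<^sup>2 / c" if "c > 0" for c
  proof -
    have "2 * norm (\<integral>x. f x * g x \<partial>M) \<le> 2 * (\<integral>x. norm (f x * g x) \<partial>M)"
      by simp
    also have "\<dots> = (\<integral>x. 2 * norm (f x * g x) \<partial>M)" by simp
    also have "\<dots> \<le> (\<integral>x. c * (norm (f x))\<^sup>2 + (norm (g x))\<^sup>2 / c \<partial>M)"
    proof (rule integral_mono)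
      show "integrable M (\<lambda>x. 2 * norm (f x * g x))" using fg by auto
      show "integrable M (\<lambda>x. c * (norm (f x))\<^sup>2 + (norm (g x))\<^sup>2 / c)"
        using f g by (auto simp: square_integrable_def)
      fix x
      have "0 \<le> (c * norm (f x) - norm (g x))\<^sup>2 / c" using that by simp
      also have "\<dots> = c * (norm (f x))\<^sup>2 + (norm (g x))\<^sup>2 / c - 2 * (norm (f x) * norm (g x))"
        using that by (simp add: power2_eq_square field_simps)
      finally show "2 * norm (f x * g x) \<le> c * (norm (f x))\<^sup>2 + (norm (g x))\<^sup>2 / c"
        by (simp add: norm_mult)
    qed
    also have "\<dots> = c * F\<^sup>2 + G\<^sup>2 / c"
      using f g by (simp add: square_integrable_def F_def G_def l2norm_sq)
    finally show ?thesis .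
  qed
  have "norm (\<integral>x. f x * g x \<partial>M) \<le> F * G"
  proof (cases "F = 0 \<or> G = 0")
    case False
    then have pos: "F > 0" "G > 0" using F0 G0 by auto
    have "2 * norm (\<integral>x. f x * g x \<partial>M) \<le> (G/F) * F\<^sup>2 + G\<^sup>2 / (G/F)"
      by (rule key) (use pos in simp)
    also have "\<dots> = 2 * (F * G)" using pos by (simp add: power2_eq_square field_simps)
    finally show ?thesis by simp
  next
    case True
    have "AE x in M. f x * g x = 0"
      using True l2norm_eq_0_AE[OF f] l2norm_eq_0_AE[OF g] by (auto simp: F_def G_def)
    then have "(\<integral>x. f x * g x \<partial>M) = 0"
      by (intro integral_eq_zero_AE)
    then show ?thesis using True by auto
  qed
  then show ?thesis by (simp add: F_def G_def)
qed

lemma cmod_l2_inner_le: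
  assumes "square_integrable M f" "square_integrable M g"
  shows "cmod (l2_inner M f g) \<le> l2norm M f * l2norm M g"
proof -
  have "l2norm M (\<lambda>x. cnj (g x)) = l2norm M g" by (simp add: l2norm_def)
  then show ?thesis
    unfolding l2_inner_def using l2_Cauchy_Schwarz[OF assms(1) square_integrable_cnj[OF assms(2)]] by simp
qed

text \<open>The values lie in a mere Banach space, so the cross term is bounded by Cauchy-Schwarz
  for the real functions \<open>norm (f x)\<close> and \<open>norm (g x)\<close>.\<close>

lemma l2norm_triangle:
  fixes f g :: "'a \<Rightarrow> 'b::{banach, second_countable_topology}"
  assumes f: "square_integrable M f" and g: "square_integrable M g"
  shows "l2norm M (\<lambda>x. f x + g x) \<le> l2norm M f + l2norm M g"
proof (rule power2_le_imp_le)
  note fn = square_integrable_norm[OF f] and gn = square_integrable_norm[OF g]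
  note fg = square_integrable_mult_integrable[OF fn gn]
  have "(l2norm M (\<lambda>x. f x + g x))\<^sup>2 \<le>
      (\<integral>x. (norm (f x))\<^sup>2 + (norm (g x))\<^sup>2 + 2 * (norm (f x) * norm (g x)) \<partial>M)"
    unfolding l2norm_sq
  proof (rule integral_mono)
    show "integrable M (\<lambda>x. (norm (f x + g x))\<^sup>2)"
      using square_integrable_add[OF f g] by (rule square_integrable_integrable)
    show "integrable M (\<lambda>x. (norm (f x))\<^sup>2 + (norm (g x))\<^sup>2 + 2 * (norm (f x) * norm (g x)))"
      using f g fg by (auto simp: square_integrable_def)
    fix x
    have "(norm (f x + g x))\<^sup>2 \<le> (norm (f x) + norm (g x))\<^sup>2" by (simp add: norm_triangle_ineq power_mono)
    then show "(norm (f x + g x))\<^sup>2 \<le> (norm (f x))\<^sup>2 + (norm (g x))\<^sup>2 + 2 * (norm (f x) * norm (g x))"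
      by (simp add: power2_sum)
  qed
  also have "\<dots> = (l2norm M f)\<^sup>2 + (l2norm M g)\<^sup>2 + 2 * (\<integral>x. norm (f x) * norm (g x) \<partial>M)"
    using f g fg by (simp add: square_integrable_def l2norm_sq)
  also have "(\<integral>x. norm (f x) * norm (g x) \<partial>M) \<le> l2norm M f * l2norm M g"
    using l2_Cauchy_Schwarz[OF fn gn] by (simp add: l2norm_norm)
  finally show "(l2norm M (\<lambda>x. f x + g x))\<^sup>2 \<le> (l2norm M f + l2norm M g)\<^sup>2"
    by (simp add: power2_sum)
qed simp

lemma l2norm_triangle_diff:
  fixes f g :: "'a \<Rightarrow> 'b::{banach, second_countable_topology, real_normed_field}"
  assumes "square_integrable M f" "square_integrable M g"
  shows "l2norm M f \<le> l2norm M g + l2norm M (\<lambda>x. f x - g x)"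
  using l2norm_triangle[OF assms(2) square_integrable_diff[OF assms]] by simp

lemma l2norm_diff_commute:
  "l2norm M (\<lambda>x. f x - g x) = l2norm M (\<lambda>x. g x - f x)"
  by (simp add: l2norm_def norm_minus_commute)

section \<open>Inner products and convergence in \<open>L\<^sup>2\<close>\<close>

lemma l2_inner_self:
  assumes "square_integrable M f"
  shows "l2_inner M f f = complex_of_real ((l2norm M f)\<^sup>2)"
proof -
  have "l2_inner M f f = (\<integral>x. complex_of_real ((norm (f x))\<^sup>2) \<partial>M)"
    unfolding l2_inner_def by (intro Bochner_Integration.integral_cong) (auto simp: complex_norm_square simp flip: of_real_power)
  also have "\<dots> = complex_of_real ((l2norm M f)\<^sup>2)" by (simp only: integral_complex_of_real l2norm_sq)
  finally show ?thesis .
qed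

lemma l2_inner_add_left:
  assumes "square_integrable M f" "square_integrable M g" "square_integrable M h"
  shows "l2_inner M (\<lambda>x. f x + g x) h = l2_inner M f h + l2_inner M g h"
  unfolding l2_inner_def
  using square_integrable_mult_integrable[OF assms(1) square_integrable_cnj[OF assms(3)]]
     square_integrable_mult_integrable[OF assms(2) square_integrable_cnj[OF assms(3)]]
  by (simp add: distrib_right)

lemma l2_inner_scale_left: "l2_inner M (\<lambda>x. a * f x) h = a * l2_inner M f h"
  unfolding l2_inner_def by (simp add: mult.assoc)

lemma l2_inner_diff_left:
  assumes "square_integrable M f" "square_integrable M g" "square_integrable M h"
  shows "l2_inner M (\<lambda>x. f x - g x) h = l2_inner M f h - l2_inner M g h"
  using l2_inner_add_left[OF assms(1) square_integrable_scale[OF assms(2), of "-1"] assms(3)]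
    l2_inner_scale_left[of M "-1" g h] by simp

lemma l2_inner_commute:
  "l2_inner M g f = cnj (l2_inner M f g)"
  unfolding l2_inner_def Bochner_Integration.integral_cnj[symmetric] by (simp add: mult.commute)

lemma l2_inner_zero_right [simp]: "l2_inner M f (\<lambda>_. 0) = 0" "l2_inner M (\<lambda>_. 0) f = 0"
  by (simp_all add: l2_inner_def)

lemma l2_inner_diff_right:
  assumes "square_integrable M f" "square_integrable M g" "square_integrable M h"
  shows "l2_inner M h (\<lambda>x. f x - g x) = l2_inner M h f - l2_inner M h g"
  using l2_inner_diff_left[OF assms] by (metis complex_cnj_diff l2_inner_commute)

lemma l2_inner_sum_left:
  assumes "\<And>i. i \<in> I \<Longrightarrow> square_integrable M (f i)" "square_integrable M h"
  shows "l2_inner M (\<lambda>x. \<Sum>i\<in>I. f i x) h = (\<Sum>i\<in>I. l2_inner M (f i) h)"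
  using assms
  by (induction I rule: infinite_finite_induct) (auto simp: l2_inner_add_left square_integrable_sum)

lemma l2_limD:
  assumes "l2_lim M g f"
  shows "\<And>k. square_integrable M (g k)" "square_integrable M f"
    "(\<lambda>k. l2norm M (\<lambda>x. g k x - f x)) \<longlonglongrightarrow> 0"
  using assms by (auto simp: l2_lim_def)

lemma l2_lim_const: "square_integrable M f \<Longrightarrow> l2_lim M (\<lambda>_. f) f"
  by (simp add: l2_lim_def)

lemma l2_lim_combine:
  assumes "l2_lim M g f" "l2_lim M g' f'"
  shows "l2_lim M (\<lambda>k x. a * g k x + b * g' k x) (\<lambda>x. a * f x + b * f' x)"
proof -
  note 1 = l2_limD[OF assms(1)] and 2 = l2_limD[OF assms(2)]
  have "(\<lambda>k. l2norm M (\<lambda>x. (a * g k x + b * g' k x) - (a * f x + b * f' x))) \<longlonglongrightarrow> 0"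
  proof (rule Lim_null_comparison)
    show "\<forall>\<^sub>F k in sequentially. norm (l2norm M (\<lambda>x. (a * g k x + b * g' k x) - (a * f x + b * f' x))) \<le>
      cmod a * l2norm M (\<lambda>x. g k x - f x) + cmod b * l2norm M (\<lambda>x. g' k x - f' x)"
    proof (intro always_eventually allI)
      fix k
      have "l2norm M (\<lambda>x. a * (g k x - f x) + b * (g' k x - f' x)) \<le>
          l2norm M (\<lambda>x. a * (g k x - f x)) + l2norm M (\<lambda>x. b * (g' k x - f' x))"
        by (intro l2norm_triangle square_integrable_scale square_integrable_diff 1 2)
      also have "\<dots> = cmod a * l2norm M (\<lambda>x. g k x - f x) + cmod b * l2norm M (\<lambda>x. g' k x - f' x)"
        by (simp only: l2norm_scale)
      finally show "norm (l2norm M (\<lambda>x. (a * g k x + b * g' k x) - (a * f x + b * f' x))) \<le>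
        cmod a * l2norm M (\<lambda>x. g k x - f x) + cmod b * l2norm M (\<lambda>x. g' k x - f' x)"
        by (simp add: l2norm_scale algebra_simps)
    qed
    show "(\<lambda>k. cmod a * l2norm M (\<lambda>x. g k x - f x) + cmod b * l2norm M (\<lambda>x. g' k x - f' x)) \<longlonglongrightarrow> 0"
      using 1(3) 2(3) by (auto intro!: tendsto_eq_intros)
  qed
  then show ?thesis unfolding l2_lim_def
    by (auto intro!: square_integrable_add square_integrable_scale 1 2)
qed

lemma l2_lim_diff:
  assumes "l2_lim M g f" "l2_lim M g' f'"
  shows "l2_lim M (\<lambda>k x. g k x - g' k x) (\<lambda>x. f x - f' x)"
  using l2_lim_combine[OF assms, of 1 "-1"] by simp

lemma l2_lim_norm:
  assumes "l2_lim M g f"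
  shows "(\<lambda>k. l2norm M (g k)) \<longlonglongrightarrow> l2norm M f"
proof -
  note 1 = l2_limD[OF assms]
  have "\<bar>l2norm M (g k) - l2norm M f\<bar> \<le> l2norm M (\<lambda>x. g k x - f x)" for k
    using l2norm_triangle_diff[OF 1(1) 1(2), of k] l2norm_triangle_diff[OF 1(2) 1(1), of k]
      l2norm_diff_commute[of M f "g k"] by linarith
  then have "(\<lambda>k. l2norm M (g k) - l2norm M f) \<longlonglongrightarrow> 0"
    by (intro Lim_null_comparison[OF _ 1(3)]) auto
  then show ?thesis by (rule LIM_zero_cancel)
qed

lemma l2_lim_inner:
  assumes "l2_lim M g f" "square_integrable M h"
  shows "(\<lambda>k. l2_inner M (g k) h) \<longlonglongrightarrow> l2_inner M f h"
proof -
  note 1 = l2_limD[OF assms(1)]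
  have "(\<lambda>k. l2_inner M (g k) h - l2_inner M f h) \<longlonglongrightarrow> 0"
  proof (rule Lim_null_comparison)
    show "\<forall>\<^sub>F k in sequentially. norm (l2_inner M (g k) h - l2_inner M f h) \<le> l2norm M (\<lambda>x. g k x - f x) * l2norm M h"
      using cmod_l2_inner_le[OF square_integrable_diff[OF 1(1,2)] assms(2)]
      by (simp add: l2_inner_diff_left[OF 1(1,2) assms(2)])
    show "(\<lambda>k. l2norm M (\<lambda>x. g k x - f x) * l2norm M h) \<longlonglongrightarrow> 0"
      using 1(3) by (auto intro!: tendsto_eq_intros)
  qed
  then show ?thesis by (rule LIM_zero_cancel)
qed

lemma l2_lim_cong_AE:
  assumes "l2_lim M g f" "AE x in M. f x = f' x" "f' \<in> borel_measurable M"
  shows "l2_lim M g f'"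
proof -
  note 1 = l2_limD[OF assms(1)]
  have f': "square_integrable M f'" by (rule square_integrable_cong_AE[OF 1(2) assms(3,2)])
  have "l2norm M (\<lambda>x. g k x - f x) = l2norm M (\<lambda>x. g k x - f' x)" for k
    by (rule l2norm_cong_AE)
      (use assms(2) 1 f' in \<open>auto intro!: square_integrable_diff square_integrable_measurable\<close>)
  with 1 f' show ?thesis by (auto simp: l2_lim_def)
qed

text \<open>Fatou's lemma replaces completeness: the pointwise limit of an \<open>L\<^sup>2\<close>-Cauchy sequence is
  its \<open>L\<^sup>2\<close> limit.\<close>

lemma l2_lim_of_pointwise:
  assumes g: "\<And>k. square_integrable M (g k)"
    and lim: "\<And>x. x \<in> space M \<Longrightarrow> (\<lambda>k. g k x) \<longlonglongrightarrow> f x"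
    and e: "e \<longlonglongrightarrow> 0" and cauchy: "\<And>j k. k \<le> j \<Longrightarrow> l2norm M (\<lambda>x. g j x - g k x) \<le> e k"
  shows "l2_lim M g f"
proof -
  have gm: "\<And>k. g k \<in> borel_measurable M" using g by (rule square_integrable_measurable)
  have fm: "f \<in> borel_measurable M"
    by (rule borel_measurable_LIMSEQ_metric[OF gm lim])
  have e0: "0 \<le> e k" for k using cauchy[of k k] by simp
  have bound: "(\<integral>\<^sup>+x. ennreal ((norm (f x - g k x))\<^sup>2) \<partial>M) \<le> ennreal ((e k)\<^sup>2)" for k
  proof -
    have "(\<integral>\<^sup>+x. ennreal ((norm (f x - g k x))\<^sup>2) \<partial>M) =
        (\<integral>\<^sup>+x. liminf (\<lambda>j. ennreal ((norm (g j x - g k x))\<^sup>2)) \<partial>M)"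
    proof (rule nn_integral_cong)
      fix x assume "x \<in> space M"
      then have "(\<lambda>j. ennreal ((norm (g j x - g k x))\<^sup>2)) \<longlonglongrightarrow> ennreal ((norm (f x - g k x))\<^sup>2)"
        by (intro tendsto_ennrealI tendsto_power tendsto_norm tendsto_diff lim tendsto_const)
      then show "ennreal ((norm (f x - g k x))\<^sup>2) = liminf (\<lambda>j. ennreal ((norm (g j x - g k x))\<^sup>2))"
        by (rule lim_imp_Liminf[symmetric, rotated]) simp
    qed
    also have "\<dots> \<le> liminf (\<lambda>j. \<integral>\<^sup>+x. ennreal ((norm (g j x - g k x))\<^sup>2) \<partial>M)"
      by (rule nn_integral_liminf) (use gm in measurable)
    also have "\<dots> \<le> ennreal ((e k)\<^sup>2)"
    proof (rule Liminf_le)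
      show "\<forall>\<^sub>F j in sequentially. (\<integral>\<^sup>+x. ennreal ((norm (g j x - g k x))\<^sup>2) \<partial>M) \<le> ennreal ((e k)\<^sup>2)"
        using eventually_ge_at_top[of k]
      proof eventually_elim
        case (elim j)
        have "(\<integral>\<^sup>+x. ennreal ((norm (g j x - g k x))\<^sup>2) \<partial>M) = ennreal ((l2norm M (\<lambda>x. g j x - g k x))\<^sup>2)"
          unfolding l2norm_sq
          by (rule nn_integral_eq_integral) (use square_integrable_diff[OF g g, of j k] in \<open>auto simp: square_integrable_def\<close>)
        also have "\<dots> \<le> ennreal ((e k)\<^sup>2)"
          using cauchy[OF elim] by (intro ennreal_leI power_mono) auto
        finally show ?case .
      qed
    qed simp
    finally show ?thesis .
  qed
  have sq: "square_integrable M (\<lambda>x. f x - g k x)" for k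
    unfolding square_integrable_def
  proof
    show "(\<lambda>x. f x - g k x) \<in> borel_measurable M" using fm gm by measurable
    then show "integrable M (\<lambda>x. (norm (f x - g k x))\<^sup>2)"
      using bound[of k] by (intro integrableI_bounded) (auto simp: less_top[symmetric] top_unique)
  qed
  have f: "square_integrable M f" using square_integrable_add[OF sq[of 0] g[of 0]] by simp
  have "l2norm M (\<lambda>x. g k x - f x) \<le> e k" for k
  proof (rule power2_le_imp_le)
    have "ennreal ((l2norm M (\<lambda>x. f x - g k x))\<^sup>2) \<le> ennreal ((e k)\<^sup>2)"
      unfolding l2norm_sq using bound[of k] nn_integral_eq_integral[OF square_integrable_integrable[OF sq[of k]]] by simp
    then show "(l2norm M (\<lambda>x. g k x - f x))\<^sup>2 \<le> (e k)\<^sup>2"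
      by (subst l2norm_diff_commute) (simp add: ennreal_le_iff)
  qed (rule e0)
  then have "(\<lambda>k. l2norm M (\<lambda>x. g k x - f x)) \<longlonglongrightarrow> 0"
    by (intro Lim_null_comparison[OF _ e]) auto
  then show ?thesis using g f by (auto simp: l2_lim_def)
qed

section \<open>Schwartz functions\<close>

abbreviation ip :: "(real \<Rightarrow> real) \<Rightarrow> (real \<Rightarrow> real) \<Rightarrow> real" where
  "ip \<phi> \<psi> \<equiv> \<integral>x. \<phi> x * \<psi> x \<partial>lborel"

lemma schwartz_has_field_derivative:
  "\<phi> \<in> schwartz \<Longrightarrow> ((deriv ^^ m) \<phi> has_field_derivative (deriv ^^ Suc m) \<phi> x) (at x)"
  using DERIV_deriv_iff_real_differentiable[of "(deriv ^^ m) \<phi>" x] by (simp add: schwartz_def)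

lemma schwartz_DERIV: "\<phi> \<in> schwartz \<Longrightarrow> (\<phi> has_field_derivative deriv \<phi> x) (at x)"
  using schwartz_has_field_derivative[of \<phi> 0 x] by simp

lemma schwartz_bounded: "\<phi> \<in> schwartz \<Longrightarrow> bounded (range (\<lambda>x. x ^ k * (deriv ^^ m) \<phi> x))"
  by (simp add: schwartz_def)

lemma schwartz_isCont: "\<phi> \<in> schwartz \<Longrightarrow> isCont \<phi> x"
  using schwartz_DERIV DERIV_isCont by blast

lemma schwartz_measurable: "\<phi> \<in> schwartz \<Longrightarrow> \<phi> \<in> borel_measurable borel"
  by (intro borel_measurable_continuous_onI continuous_at_imp_continuous_on) (auto intro: schwartz_isCont)

text \<open>Membership in \<open>schwartz\<close> speaks of iterated \<open>deriv\<close>. A guessed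
  sequence \<open>D\<close> of derivatives identifies all of them at once, so a closure property
  reduces to a formula for the \<open>m\<close>-th derivative.\<close>

lemma schwartzI:
  assumes "\<And>m x. (D m has_field_derivative D (Suc m) x) (at x)"
    and "\<And>k m. bounded (range (\<lambda>x. x ^ k * D m x))"
  shows "D 0 \<in> schwartz" "(deriv ^^ m) (D 0) = D m"
proof -
  have eq: "(deriv ^^ m) (D 0) = D m" for m
  proof (induction m)
    case (Suc m)
    have "deriv (D m) = D (Suc m)"
      using assms(1)[of m] by (intro ext DERIV_imp_deriv)
    with Suc show ?case by simp
  qed simp
  then show "(deriv ^^ m) (D 0) = D m" .
  have "D m differentiable (at x)" for m x
    using assms(1)[of m x] by (auto simp: real_differentiable_def)
  with assms(2) show "D 0 \<in> schwartz" by (simp add: schwartz_def eq)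
qed

lemma bounded_range_add:
  fixes f g :: "real \<Rightarrow> real"
  assumes "bounded (range f)" "bounded (range g)"
  shows "bounded (range (\<lambda>x. a * f x + b * g x))"
proof -
  obtain B C where "\<And>x. \<bar>f x\<bar> \<le> B" "\<And>x. \<bar>g x\<bar> \<le> C"
    using assms by (auto simp: bounded_iff)
  then have "\<bar>a * f x + b * g x\<bar> \<le> \<bar>a\<bar> * B + \<bar>b\<bar> * C" for x
    by (intro order_trans[OF abs_triangle_ineq] add_mono) (auto simp: abs_mult intro: mult_left_mono)
  then show ?thesis unfolding bounded_iff by auto
qed

lemma schwartz_lin:
  assumes "\<phi> \<in> schwartz" "\<psi> \<in> schwartz"
  shows "(\<lambda>x. a * \<phi> x + b * \<psi> x) \<in> schwartz"
    "(deriv ^^ m) (\<lambda>x. a * \<phi> x + b * \<psi> x) = (\<lambda>x. a * (deriv ^^ m) \<phi> x + b * (deriv ^^ m) \<psi> x)"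
proof -
  let ?D = "\<lambda>m x. a * (deriv ^^ m) \<phi> x + b * (deriv ^^ m) \<psi> x"
  have 1: "(?D m has_field_derivative ?D (Suc m) x) (at x)" for m x
    by (intro DERIV_add DERIV_cmult schwartz_has_field_derivative assms)
  have 2: "bounded (range (\<lambda>x. x ^ k * ?D m x))" for k m
    using bounded_range_add[OF schwartz_bounded[OF assms(1)] schwartz_bounded[OF assms(2)], of a k m b k m]
    by (simp add: algebra_simps)
  show "(\<lambda>x. a * \<phi> x + b * \<psi> x) \<in> schwartz" "(deriv ^^ m) (\<lambda>x. a * \<phi> x + b * \<psi> x) = ?D m"
    using schwartzI(1)[of ?D] schwartzI(2)[of ?D m] 1 2 by auto
qed

lemma schwartz_scale: "\<phi> \<in> schwartz \<Longrightarrow> (\<lambda>x. a * \<phi> x) \<in> schwartz"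
  using schwartz_lin(1)[of \<phi> \<phi> a 0] by simp

lemma schwartz_zero: "(\<lambda>_. 0) \<in> schwartz"
  using schwartzI(1)[of "\<lambda>_ _. 0"] by auto

lemma schwartz_deriv: "\<phi> \<in> schwartz \<Longrightarrow> deriv \<phi> \<in> schwartz"
proof -
  assume a: "\<phi> \<in> schwartz"
  have "(deriv ^^ m) (deriv \<phi>) = (deriv ^^ Suc m) \<phi>" for m by (simp add: funpow_swap1)
  moreover have "(deriv ^^ Suc m) \<phi> differentiable (at x)" "bounded (range (\<lambda>x. x ^ k * (deriv ^^ Suc m) \<phi> x))" for k m x
    using a unfolding schwartz_def by blast+
  ultimately show ?thesis unfolding schwartz_def by simp
qed

lemma schwartz_times_id:
  assumes "\<phi> \<in> schwartz"
  shows "(\<lambda>x. x * \<phi> x) \<in> schwartz"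
proof -
  \<comment> \<open>Leibniz rule. For \<open>m = 0\<close> the truncated index \<open>m - 1\<close>
    is harmless because of the factor \<open>m\<close>.\<close>
  let ?D = "\<lambda>m x. x * (deriv ^^ m) \<phi> x + real m * (deriv ^^ (m - 1)) \<phi> x"
  have 1: "(?D m has_field_derivative ?D (Suc m) x) (at x)" for m x
  proof (cases m)
    case 0
    then show ?thesis using schwartz_has_field_derivative[OF assms, of 0 x]
      by (auto intro!: derivative_eq_intros simp: algebra_simps)
  next
    case (Suc n)
    then show ?thesis
      using schwartz_has_field_derivative[OF assms, of n x] schwartz_has_field_derivative[OF assms, of m x]
      by (auto intro!: derivative_eq_intros simp: algebra_simps)
  qed
  have 2: "bounded (range (\<lambda>x. x ^ k * ?D m x))" for k m
    using bounded_range_add[OF schwartz_bounded[OF assms] schwartz_bounded[OF assms], of 1 "Suc k" m "real m" k "m - 1"]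
    by (simp add: algebra_simps)
  from schwartzI(1)[of ?D] 1 2 show ?thesis by simp
qed

text \<open>This one rate of decay already yields integrability, square integrability and vanishing
  boundary terms in integrations by parts.\<close>

lemma schwartz_decay:
  assumes "\<phi> \<in> schwartz"
  obtains C where "\<And>x. \<bar>\<phi> x\<bar> \<le> C * inverse (1 + x\<^sup>2)" "C > 0"
proof -
  have "bounded (range (\<lambda>x. 1 * (x ^ 0 * (deriv ^^ 0) \<phi> x) + 1 * (x ^ 2 * (deriv ^^ 0) \<phi> x)))"
    by (intro bounded_range_add schwartz_bounded assms)
  then obtain C where C: "\<And>x. \<bar>\<phi> x + x\<^sup>2 * \<phi> x\<bar> \<le> C" by (auto simp: bounded_iff)
  have "\<bar>\<phi> x\<bar> \<le> (\<bar>C\<bar> + 1) * inverse (1 + x\<^sup>2)" for x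
  proof -
    have "\<phi> x + x\<^sup>2 * \<phi> x = (1 + x\<^sup>2) * \<phi> x" by (simp add: algebra_simps)
    then have "(1 + x\<^sup>2) * \<bar>\<phi> x\<bar> \<le> \<bar>C\<bar> + 1" using C[of x] by (simp add: abs_mult)
    moreover have "1 + x\<^sup>2 > 0" by (simp add: add_pos_nonneg)
    ultimately show ?thesis by (simp add: field_simps)
  qed
  then show thesis using that[of "\<bar>C\<bar> + 1"] by simp
qed

lemma integrable_inverse_1_plus_sq: "integrable lborel (\<lambda>x::real. inverse (1 + x\<^sup>2))"
  using integrable_inverse_1_plus_square by (simp add: set_integrable_def)

lemma schwartz_square_integrable:
  assumes "\<phi> \<in> schwartz"
  shows "square_integrable lborel \<phi>"
proof -
  obtain C where C: "\<And>x. \<bar>\<phi> x\<bar> \<le> C * inverse (1 + x\<^sup>2)" "C > 0" using schwartz_decay[OF assms] by blast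
  have "integrable lborel (\<lambda>x. (norm (\<phi> x))\<^sup>2)"
  proof (rule Bochner_Integration.integrable_bound)
    show "integrable lborel (\<lambda>x::real. C\<^sup>2 * inverse (1 + x\<^sup>2))"
      using integrable_inverse_1_plus_sq by simp
    show "(\<lambda>x. (norm (\<phi> x))\<^sup>2) \<in> borel_measurable lborel"
      using schwartz_measurable[OF assms] by simp
    show "AE x in lborel. norm ((norm (\<phi> x))\<^sup>2) \<le> norm (C\<^sup>2 * inverse (1 + x\<^sup>2))"
    proof (rule AE_I2)
      fix x :: real
      have i: "0 \<le> inverse (1 + x\<^sup>2)" "inverse (1 + x\<^sup>2) \<le> 1"
        by (auto simp: add_nonneg_nonneg inverse_le_1_iff add_pos_nonneg)
      have "\<bar>\<phi> x\<bar>\<^sup>2 \<le> (C * inverse (1 + x\<^sup>2))\<^sup>2" using C(1)[of x] by (intro power_mono) auto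
      also have "\<dots> \<le> C\<^sup>2 * inverse (1 + x\<^sup>2)"
        using i mult_right_mono[OF i(2) i(1)]
        by (simp add: power_mult_distrib power2_eq_square[of "inverse _"] mult_left_mono)
      finally show "norm ((norm (\<phi> x))\<^sup>2) \<le> norm (C\<^sup>2 * inverse (1 + x\<^sup>2))" by (simp add: i)
    qed
  qed
  with schwartz_measurable[OF assms] show ?thesis by (simp add: square_integrable_def)
qed

lemma schwartz_integrable:
  assumes "\<phi> \<in> schwartz"
  shows "integrable lborel \<phi>"
proof -
  obtain C where C: "\<And>x. \<bar>\<phi> x\<bar> \<le> C * inverse (1 + x\<^sup>2)" "C > 0" using schwartz_decay[OF assms] by blast
  show ?thesis
  proof (rule Bochner_Integration.integrable_bound)
    show "integrable lborel (\<lambda>x::real. C * inverse (1 + x\<^sup>2))"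
      using integrable_inverse_1_plus_sq by simp
    show "AE x in lborel. norm (\<phi> x) \<le> norm (C * inverse (1 + x\<^sup>2))"
      using C by (auto simp: abs_mult)
  qed (use schwartz_measurable[OF assms] in simp)
qed

lemma schwartz_tendsto_0:
  assumes "\<phi> \<in> schwartz"
  shows "(\<phi> \<longlongrightarrow> 0) at_top" "(\<phi> \<longlongrightarrow> 0) at_bot"
proof -
  obtain C where C: "\<And>x. \<bar>\<phi> x\<bar> \<le> C * inverse (1 + x\<^sup>2)" "C > 0" using schwartz_decay[OF assms] by blast
  have *: "\<bar>\<phi> x\<bar> \<le> C * inverse \<bar>x\<bar>" if "x \<noteq> 0" for x
  proof -
    have "\<bar>x\<bar> \<le> 1 + x\<^sup>2" using sum_squares_bound[of 1 "\<bar>x\<bar>"] by (simp add: )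
    then have "inverse (1 + x\<^sup>2) \<le> inverse \<bar>x\<bar>" using that by (intro le_imp_inverse_le) auto
    then have "C * inverse (1 + x\<^sup>2) \<le> C * inverse \<bar>x\<bar>" using C(2) by (intro mult_left_mono) auto
    with C(1)[of x] show ?thesis by linarith
  qed
  have "((\<lambda>x::real. C * inverse \<bar>x\<bar>) \<longlongrightarrow> C * 0) at_infinity"
    using filterlim_norm_at_top[where 'a=real] unfolding real_norm_def[abs_def]
    by (intro tendsto_intros tendsto_inverse_0_at_top)
  then have "(\<phi> \<longlongrightarrow> 0) at_infinity"
    using * by (intro Lim_null_comparison[of \<phi> "\<lambda>x. C * inverse \<bar>x\<bar>"])
      (auto simp: eventually_at_infinity intro!: exI[of _ 1])
  then show "(\<phi> \<longlongrightarrow> 0) at_top" "(\<phi> \<longlongrightarrow> 0) at_bot"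
    by (auto intro: tendsto_mono at_top_le_at_infinity at_bot_le_at_infinity)
qed

lemma schwartz_mult_integrable:
  "\<phi> \<in> schwartz \<Longrightarrow> \<psi> \<in> schwartz \<Longrightarrow> integrable lborel (\<lambda>x. \<phi> x * \<psi> x)"
  by (intro square_integrable_mult_integrable schwartz_square_integrable)

lemma schwartz_by_parts:
  assumes "\<phi> \<in> schwartz" "\<psi> \<in> schwartz"
  shows "ip (deriv \<phi>) \<psi> = - ip \<phi> (deriv \<psi>)"
proof -
  let ?f = "\<lambda>x. deriv \<phi> x * \<psi> x + \<phi> x * deriv \<psi> x"
  note S = assms schwartz_deriv[OF assms(1)] schwartz_deriv[OF assms(2)]
  have int: "integrable lborel ?f"
    by (intro Bochner_Integration.integrable_add schwartz_mult_integrable S)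
  have lim: "((\<lambda>x. \<phi> x * \<psi> x) \<longlongrightarrow> 0) at_top" "((\<lambda>x. \<phi> x * \<psi> x) \<longlongrightarrow> 0) at_bot"
    using schwartz_tendsto_0[OF assms(1)] schwartz_tendsto_0[OF assms(2)] by (auto intro!: tendsto_eq_intros)
  have "(LBINT x=-\<infinity>..\<infinity>. ?f x) = 0 - 0"
  proof (rule interval_integral_FTC_integrable)
    fix x
    show "((\<lambda>x. \<phi> x * \<psi> x) has_vector_derivative ?f x) (at x)"
      unfolding has_real_derivative_iff_has_vector_derivative[symmetric]
      using schwartz_DERIV[OF assms(1), of x] schwartz_DERIV[OF assms(2), of x]
      by (auto intro!: derivative_eq_intros)
    show "isCont ?f x" by (intro continuous_intros schwartz_isCont S)
  next
    show "(((\<lambda>x. \<phi> x * \<psi> x) \<circ> real_of_ereal) \<longlongrightarrow> 0) (at_right (-\<infinity>))"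
      using lim(2) by (simp add: ereal_tendsto_simps)
    show "(((\<lambda>x. \<phi> x * \<psi> x) \<circ> real_of_ereal) \<longlongrightarrow> 0) (at_left \<infinity>)"
      using lim(1) by (simp add: ereal_tendsto_simps)
  qed (use int in \<open>auto simp: set_integrable_def\<close>)
  then have "(\<integral>x. ?f x \<partial>lborel) = 0"
    by (simp add: interval_lebesgue_integral_def set_lebesgue_integral_def)
  then show ?thesis
    using Bochner_Integration.integral_add[OF schwartz_mult_integrable[OF S(3,2)] schwartz_mult_integrable[OF S(1,4)]]
    by simp
qed

lemma ip_commute: "ip \<phi> \<psi> = ip \<psi> \<phi>"
  by (simp add: mult.commute)

lemma ip_lin_left:
  assumes "\<phi> \<in> schwartz" "\<psi> \<in> schwartz" "\<theta> \<in> schwartz"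
  shows "ip (\<lambda>x. a * \<phi> x + b * \<psi> x) \<theta> = a * ip \<phi> \<theta> + b * ip \<psi> \<theta>"
  using schwartz_mult_integrable[OF assms(1,3)] schwartz_mult_integrable[OF assms(2,3)]
  by (simp add: distrib_right mult.assoc)

lemma l2norm_sq_ip: "(l2norm lborel \<phi>)\<^sup>2 = ip \<phi> \<phi>"
  unfolding l2norm_sq by (simp add: power2_eq_square)

lemma ip_le_l2norm:
  "\<phi> \<in> schwartz \<Longrightarrow> \<psi> \<in> schwartz \<Longrightarrow> \<bar>ip \<phi> \<psi>\<bar> \<le> l2norm lborel \<phi> * l2norm lborel \<psi>"
  using l2_Cauchy_Schwarz[OF schwartz_square_integrable schwartz_square_integrable, of \<phi> \<psi>] by simp

subsection \<open>The operator \<open>A\<close>\<close>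

lemma opA_schwartz: assumes "\<phi> \<in> schwartz" shows "opA \<phi> \<in> schwartz"
proof -
  have "(\<lambda>x. (-1) * deriv (deriv \<phi>) x + 1 * (1 * (x * (x * \<phi> x)) + 1 * \<phi> x)) \<in> schwartz"
    by (intro schwartz_lin schwartz_deriv schwartz_times_id assms)
  moreover have "(\<lambda>x. (-1) * deriv (deriv \<phi>) x + 1 * (1 * (x * (x * \<phi> x)) + 1 * \<phi> x)) = opA \<phi>"
    by (auto simp: opA_def power2_eq_square algebra_simps)
  ultimately show ?thesis by simp
qed

lemma opA_pow_schwartz: "\<phi> \<in> schwartz \<Longrightarrow> (opA ^^ p) \<phi> \<in> schwartz"
  by (induction p) (auto intro: opA_schwartz)

lemma opA_lin:
  assumes "\<phi> \<in> schwartz" "\<psi> \<in> schwartz"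
  shows "opA (\<lambda>x. a * \<phi> x + b * \<psi> x) = (\<lambda>x. a * opA \<phi> x + b * opA \<psi> x)"
  using schwartz_lin(2)[OF assms, of 2 a b] by (auto simp: opA_def numeral_2_eq_2 algebra_simps)

lemma opA_pow_lin:
  assumes "\<phi> \<in> schwartz" "\<psi> \<in> schwartz"
  shows "(opA ^^ p) (\<lambda>x. a * \<phi> x + b * \<psi> x) = (\<lambda>x. a * (opA ^^ p) \<phi> x + b * (opA ^^ p) \<psi> x)"
  by (induction p) (simp_all add: opA_lin opA_pow_schwartz assms)

lemma ip_opA:
  assumes "\<phi> \<in> schwartz" "\<psi> \<in> schwartz"
  shows "ip (opA \<phi>) \<psi> = ip (deriv \<phi>) (deriv \<psi>) + ip (\<lambda>x. x * \<phi> x) (\<lambda>x. x * \<psi> x) + ip \<phi> \<psi>"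
proof -
  note i = schwartz_mult_integrable[OF schwartz_deriv[OF schwartz_deriv[OF assms(1)]] assms(2)]
    schwartz_mult_integrable[OF schwartz_times_id[OF assms(1)] schwartz_times_id[OF assms(2)]]
    schwartz_mult_integrable[OF assms]
  have "opA \<phi> x * \<psi> x = - (deriv (deriv \<phi>) x * \<psi> x) + (x * \<phi> x) * (x * \<psi> x) + \<phi> x * \<psi> x" for x
    by (simp add: opA_def power2_eq_square algebra_simps)
  then have "ip (opA \<phi>) \<psi> = - ip (deriv (deriv \<phi>)) \<psi> + ip (\<lambda>x. x * \<phi> x) (\<lambda>x. x * \<psi> x) + ip \<phi> \<psi>"
    using i by simp
  then show ?thesis using schwartz_by_parts[OF schwartz_deriv[OF assms(1)] assms(2)] by simp
qed

lemma ip_opA_commute: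
  assumes "\<phi> \<in> schwartz" "\<psi> \<in> schwartz"
  shows "ip (opA \<phi>) \<psi> = ip \<phi> (opA \<psi>)"
  unfolding ip_opA[OF assms] using ip_opA[OF assms(2,1)] by (simp add: mult.commute)

lemma ip_opA_pow_commute:
  assumes "\<phi> \<in> schwartz" "\<psi> \<in> schwartz"
  shows "ip ((opA ^^ p) \<phi>) \<psi> = ip \<phi> ((opA ^^ p) \<psi>)"
  using assms
proof (induction p arbitrary: \<psi>)
  case (Suc p)
  have "ip ((opA ^^ Suc p) \<phi>) \<psi> = ip ((opA ^^ p) \<phi>) (opA \<psi>)"
    using Suc.prems by (simp add: ip_opA_commute opA_pow_schwartz)
  also have "\<dots> = ip \<phi> ((opA ^^ p) (opA \<psi>))" using Suc by (intro Suc.IH opA_schwartz) auto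
  finally show ?case by (simp add: funpow_swap1)
qed simp

text \<open>The ground state of \<open>- d\<^sup>2/dx\<^sup>2 + x\<^sup>2\<close> has energy 1:
  \<open>\<parallel>\<phi>'\<parallel>\<^sup>2 + \<parallel>x\<phi>\<parallel>\<^sup>2 = \<parallel>\<phi>' + x\<phi>\<parallel>\<^sup>2 + \<parallel>\<phi>\<parallel>\<^sup>2\<close>.\<close>

lemma ip_opA_ge:
  assumes "\<phi> \<in> schwartz"
  shows "2 * ip \<phi> \<phi> \<le> ip (opA \<phi>) \<phi>"
proof -
  let ?x = "\<lambda>x. x * \<phi> x"
  note x = schwartz_times_id[OF assms] and d = schwartz_deriv[OF assms]
  have dx: "deriv ?x = (\<lambda>x. 1 * \<phi> x + 1 * (x * deriv \<phi> x))"
  proof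
    fix y
    show "deriv ?x y = 1 * \<phi> y + 1 * (y * deriv \<phi> y)"
      using schwartz_DERIV[OF assms, of y] by (intro DERIV_imp_deriv) (auto intro!: derivative_eq_intros)
  qed
  have "ip (deriv \<phi>) ?x = - ip \<phi> (deriv ?x)" by (rule schwartz_by_parts[OF assms x])
  also have "ip \<phi> (deriv ?x) = ip (deriv ?x) \<phi>" by (rule ip_commute)
  also have "\<dots> = ip \<phi> \<phi> + ip (\<lambda>x. x * deriv \<phi> x) \<phi>"
    unfolding dx using ip_lin_left[OF assms schwartz_times_id[OF d] assms, of 1 1] by simp
  also have "ip (\<lambda>x. x * deriv \<phi> x) \<phi> = ip (deriv \<phi>) ?x" by (simp add: ac_simps)
  finally have 1: "2 * ip (deriv \<phi>) ?x = - ip \<phi> \<phi>" by simp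
  have "0 \<le> ip (\<lambda>x. deriv \<phi> x + x * \<phi> x) (\<lambda>x. deriv \<phi> x + x * \<phi> x)" by simp
  also have "\<dots> = (\<integral>x. deriv \<phi> x * deriv \<phi> x + ?x x * ?x x + 2 * (deriv \<phi> x * ?x x) \<partial>lborel)"
    by (simp add: algebra_simps)
  also have "\<dots> = ip (deriv \<phi>) (deriv \<phi>) + ip ?x ?x + 2 * ip (deriv \<phi>) ?x"
    using schwartz_mult_integrable[OF d d] schwartz_mult_integrable[OF x x] schwartz_mult_integrable[OF d x]
    by simp
  finally show ?thesis using 1 ip_opA[OF assms assms] by simp
qed

text \<open>From the form bound to the norm bound: Cauchy-Schwarz bounds the quadratic form of
  \<open>A\<close> by a product of norms, from which one factor is cancelled. Hence each further
  power of \<open>A\<close> at least doubles the norm.\<close>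

lemma l2norm_opA_ge:
  assumes "\<phi> \<in> schwartz"
  shows "2 * l2norm lborel \<phi> \<le> l2norm lborel (opA \<phi>)"
proof -
  have "2 * (l2norm lborel \<phi>)\<^sup>2 \<le> l2norm lborel (opA \<phi>) * l2norm lborel \<phi>"
    using ip_opA_ge[OF assms] ip_le_l2norm[OF opA_schwartz[OF assms] assms] by (simp add: l2norm_sq_ip)
  then have "(2 * l2norm lborel \<phi>) * l2norm lborel \<phi> \<le> l2norm lborel (opA \<phi>) * l2norm lborel \<phi>"
    by (simp add: power2_eq_square)
  moreover have "0 < l2norm lborel \<phi>" if "l2norm lborel \<phi> \<noteq> 0"
    using that l2norm_nonneg[of lborel \<phi>] by linarith
  ultimately show ?thesis
    by (cases "l2norm lborel \<phi> = 0") (auto intro: mult_right_le_imp_le)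
qed

lemma schwartz_norm_Suc_ge:
  "\<phi> \<in> schwartz \<Longrightarrow> 2 * schwartz_norm p \<phi> \<le> schwartz_norm (Suc p) \<phi>"
  unfolding schwartz_norm_def using l2norm_opA_ge[OF opA_pow_schwartz] by simp

lemma schwartz_norm_ge:
  assumes "\<phi> \<in> schwartz"
  shows "2 ^ k * schwartz_norm p \<phi> \<le> schwartz_norm (p + k) \<phi>"
proof (induction k)
  case (Suc k)
  have "2 ^ Suc k * schwartz_norm p \<phi> \<le> 2 * schwartz_norm (p + k) \<phi>" using Suc by simp
  also have "\<dots> \<le> schwartz_norm (Suc (p + k)) \<phi>" by (rule schwartz_norm_Suc_ge[OF assms])
  finally show ?case by simp
qed simp

lemma schwartz_norm_nonneg [simp]: "0 \<le> schwartz_norm p \<phi>"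
  by (simp add: schwartz_norm_def)

lemma schwartz_norm_mono: "\<phi> \<in> schwartz \<Longrightarrow> p \<le> q \<Longrightarrow> schwartz_norm p \<phi> \<le> schwartz_norm q \<phi>"
proof -
  assume a: "\<phi> \<in> schwartz" "p \<le> q"
  have "1 * schwartz_norm p \<phi> \<le> 2 ^ (q - p) * schwartz_norm p \<phi>"
    by (intro mult_right_mono) auto
  with schwartz_norm_ge[OF a(1), of "q - p" p] a(2) show ?thesis by simp
qed

text \<open>The quadratic form of \<open>A\<close> contains the Sobolev norm of order one, and it is
  at most the square of the norm of \<open>A \<phi>\<close> because \<open>A\<close> increases
  norms. Through this, point evaluations become continuous on \<open>H\<^sub>1\<close>.\<close>

lemma l2norm_schwartz_sobolev:
  assumes "\<phi> \<in> schwartz"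
  shows "(l2norm lborel \<phi>)\<^sup>2 + (l2norm lborel (deriv \<phi>))\<^sup>2 \<le> (schwartz_norm 1 \<phi>)\<^sup>2"
proof -
  have "(l2norm lborel \<phi>)\<^sup>2 + (l2norm lborel (deriv \<phi>))\<^sup>2 + ip (\<lambda>x. x * \<phi> x) (\<lambda>x. x * \<phi> x)= ip (opA \<phi>) \<phi>"
    using ip_opA[OF assms assms] by (simp add: l2norm_sq_ip)
  moreover have "0 \<le> ip (\<lambda>x. x * \<phi> x) (\<lambda>x. x * \<phi> x)" by (intro integral_nonneg_AE) simp
  moreover have "ip (opA \<phi>) \<phi> \<le> l2norm lborel (opA \<phi>) * l2norm lborel \<phi>"
    using ip_le_l2norm[OF opA_schwartz[OF assms] assms] by simp
  moreover have "\<dots> \<le> l2norm lborel (opA \<phi>) * l2norm lborel (opA \<phi>)"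
    using l2norm_opA_ge[OF assms] l2norm_nonneg[of lborel \<phi>] by (intro mult_left_mono) (linarith, simp)
  ultimately have "(l2norm lborel \<phi>)\<^sup>2 + (l2norm lborel (deriv \<phi>))\<^sup>2 \<le> l2norm lborel (opA \<phi>) * l2norm lborel (opA \<phi>)"
    by linarith
  then show ?thesis by (simp add: schwartz_norm_def power2_eq_square)
qed

text \<open>Integrate the derivative of \<open>\<phi>\<^sup>2\<close> from \<open>s\<close> to
  \<open>t\<close> and let \<open>s\<close> tend to minus infinity. In other words,
  \<open>\<delta>\<^sub>t\<close> has norm at most 1 in the dual of \<open>H\<^sub>1\<close>,
  uniformly in \<open>t\<close>.\<close>

lemma schwartz_sup_le:
  assumes "\<phi> \<in> schwartz"
  shows "\<bar>\<phi> t\<bar> \<le> schwartz_norm 1 \<phi>"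
proof (rule power2_le_imp_le)
  let ?f = "\<lambda>x. deriv \<phi> x * \<phi> x + \<phi> x * deriv \<phi> x"
  note S = assms schwartz_deriv[OF assms]
  have "(\<phi> t)\<^sup>2 - (\<phi> s)\<^sup>2 \<le> (schwartz_norm 1 \<phi>)\<^sup>2" if "s \<le> t" for s
  proof -
    have "(\<integral>x. ?f x * indicator {s..t} x \<partial>lborel) = \<phi> t * \<phi> t - \<phi> s * \<phi> s"
    proof (rule integral_FTC_Icc_real[OF that])
      fix x
      show "((\<lambda>x. \<phi> x * \<phi> x) has_field_derivative ?f x) (at x)"
        using schwartz_DERIV[OF assms, of x] by (auto intro!: derivative_eq_intros)
      show "isCont ?f x" by (intro continuous_intros schwartz_isCont S)
    qed
    then have "(\<phi> t)\<^sup>2 - (\<phi> s)\<^sup>2 = (\<integral>x. ?f x * indicator {s..t} x \<partial>lborel)"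
      by (simp add: power2_eq_square)
    also have "\<dots> \<le> (\<integral>x. (norm (\<phi> x))\<^sup>2 + (norm (deriv \<phi> x))\<^sup>2 \<partial>lborel)"
    proof (rule integral_mono)
      show "integrable lborel (\<lambda>x. ?f x * indicator {s..t} x)"
        by (intro integrable_mult_indicator[where 'b=real, simplified mult.commute, simplified] Bochner_Integration.integrable_add schwartz_mult_integrable S
            integrable_real_mult_indicator) auto
      show "integrable lborel (\<lambda>x. (norm (\<phi> x))\<^sup>2 + (norm (deriv \<phi> x))\<^sup>2)"
        using schwartz_square_integrable[OF S(1)] schwartz_square_integrable[OF S(2)]
        by (auto simp: square_integrable_def)
      fix x
      have "?f x \<le> (norm (\<phi> x))\<^sup>2 + (norm (deriv \<phi> x))\<^sup>2"
        using sum_squares_bound[of "\<phi> x" "deriv \<phi> x"] by (simp add: algebra_simps)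
      then show "?f x * indicator {s..t} x \<le> (norm (\<phi> x))\<^sup>2 + (norm (deriv \<phi> x))\<^sup>2"
        by (auto split: split_indicator)
    qed
    also have "\<dots> = (l2norm lborel \<phi>)\<^sup>2 + (l2norm lborel (deriv \<phi>))\<^sup>2"
      using schwartz_square_integrable[OF S(1)] schwartz_square_integrable[OF S(2)]
      by (simp add: square_integrable_def l2norm_sq)
    finally show ?thesis using l2norm_schwartz_sobolev[OF assms] by linarith
  qed
  moreover have "((\<lambda>s. (\<phi> t)\<^sup>2 - (\<phi> s)\<^sup>2) \<longlongrightarrow> (\<phi> t)\<^sup>2 - 0\<^sup>2) at_bot"
    by (intro tendsto_intros schwartz_tendsto_0[OF assms])
  ultimately have "(\<phi> t)\<^sup>2 - 0\<^sup>2 \<le> (schwartz_norm 1 \<phi>)\<^sup>2"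
    by (intro tendsto_upperbound[where F=at_bot]) (auto simp: eventually_at_bot_linorder intro!: exI[of _ t])
  then show "\<bar>\<phi> t\<bar>\<^sup>2 \<le> (schwartz_norm 1 \<phi>)\<^sup>2" by simp
qed simp

text \<open>Cauchy-Schwarz for the derivative on the segment. In the dual of
  \<open>H\<^sub>1\<close> the map from \<open>t\<close> to \<open>\<delta>\<^sub>t\<close> is
  therefore Hoelder continuous of order 1/2, which is needed for difference quotients in
  time.\<close>

lemma schwartz_Holder:
  assumes "\<phi> \<in> schwartz"
  shows "\<bar>\<phi> t - \<phi> s\<bar> \<le> sqrt \<bar>t - s\<bar> * schwartz_norm 1 \<phi>"
proof -
  have *: "\<bar>\<phi> t - \<phi> s\<bar> \<le> sqrt \<bar>t - s\<bar> * schwartz_norm 1 \<phi>" if "s \<le> t" for s t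
  proof -
    note d = schwartz_deriv[OF assms]
    have sq: "square_integrable lborel (indicat_real {s..t})"
    proof -
      have "(\<lambda>x. (norm (indicat_real {s..t} x))\<^sup>2) = indicat_real {s..t}" by (auto simp: indicator_def)
      moreover have "integrable lborel (indicat_real {s..t})"
        by (rule integrable_real_indicator) (auto simp: emeasure_lborel_Icc_eq)
      ultimately show ?thesis by (simp add: square_integrable_def)
    qed
    have "(\<integral>x. deriv \<phi> x * indicator {s..t} x \<partial>lborel) = \<phi> t - \<phi> s"
      by (rule integral_FTC_Icc_real[OF that]) (auto intro: schwartz_DERIV assms schwartz_isCont d)
    then have "\<bar>\<phi> t - \<phi> s\<bar> \<le> l2norm lborel (deriv \<phi>) * l2norm lborel (indicat_real {s..t})"
      using l2_Cauchy_Schwarz[OF schwartz_square_integrable[OF d] sq] by simp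
    also have "l2norm lborel (indicat_real {s..t}) = sqrt (t - s)"
    proof -
      have "(\<lambda>x. (norm (indicat_real {s..t} x))\<^sup>2) = indicat_real {s..t}" by (auto simp: indicator_def)
      then show ?thesis using that by (simp add: l2norm_def)
    qed
    also have "l2norm lborel (deriv \<phi>) \<le> schwartz_norm 1 \<phi>"
    proof (rule power2_le_imp_le)
      show "(l2norm lborel (deriv \<phi>))\<^sup>2 \<le> (schwartz_norm 1 \<phi>)\<^sup>2"
        using l2norm_schwartz_sobolev[OF assms] zero_le_power2[of "l2norm lborel \<phi>"] by linarith
    qed simp
    finally show ?thesis using that by (simp add: mult.commute mult_right_mono)
  qed
  show ?thesis
    using *[of s t] *[of t s] by (cases "s \<le> t") (auto simp: abs_minus_commute)
qed

section \<open>Schwartz tensors and positive definite kernels\<close>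

text \<open>The formal linear extension to lists. It makes sense for arbitrary \<open>P\<close>; two
  lists that represent the same tensor get the same value only once \<open>P\<close> is bounded in
  the sense of \<open>hform\<close>.\<close>

definition lin :: "((real \<Rightarrow> real) \<Rightarrow> complex) \<Rightarrow> tensor \<Rightarrow> complex" where
  "lin P cs = (\<Sum>(c, \<phi>)\<leftarrow>cs. c * P \<phi>)"

text \<open>Sesquilinear in the coefficients for a real kernel \<open>K\<close>. The iterated form
  lets facts about \<open>lin\<close> be applied in each argument.\<close>

definition gram :: "((real \<Rightarrow> real) \<Rightarrow> (real \<Rightarrow> real) \<Rightarrow> real) \<Rightarrow> tensor \<Rightarrow> tensor \<Rightarrow> complex" where
  "gram K cs es = lin (\<lambda>\<phi>. cnj (lin (\<lambda>\<psi>. complex_of_real (K \<phi> \<psi>)) es)) cs"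

definition tscale :: "complex \<Rightarrow> tensor \<Rightarrow> tensor" where
  "tscale a cs = map (\<lambda>(c, \<phi>). (a * c, \<phi>)) cs"

text \<open>Moves a rank one factor of a kernel into the coefficients, see
  \<open>gram_treweight\<close>; in this way a Schur product with a rank one kernel is again a Gram
  sum of the other factor.\<close>

definition treweight :: "((real \<Rightarrow> real) \<Rightarrow> real) \<Rightarrow> tensor \<Rightarrow> tensor" where
  "treweight h cs = map (\<lambda>(c, \<phi>). (c * complex_of_real (h \<phi>), \<phi>)) cs"

lemma lin_simps [simp]:
  "lin P [] = 0" "lin P ((c, \<phi>) # cs) = c * P \<phi> + lin P cs"
  by (simp_all add: lin_def)

lemma schwartz_tensor_simps [simp]:
  "schwartz_tensor []" "schwartz_tensor ((c, \<phi>) # cs) \<longleftrightarrow> \<phi> \<in> schwartz \<and> schwartz_tensor cs"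
  by (auto simp: schwartz_tensor_def)

lemma schwartz_tensor_append [simp]:
  "schwartz_tensor (cs @ es) \<longleftrightarrow> schwartz_tensor cs \<and> schwartz_tensor es"
  by (auto simp: schwartz_tensor_def)

lemma schwartz_tensor_ops [simp]:
  "schwartz_tensor (tscale a cs) \<longleftrightarrow> schwartz_tensor cs"
  "schwartz_tensor (treweight h cs) \<longleftrightarrow> schwartz_tensor cs"
  by (auto simp: schwartz_tensor_def tscale_def treweight_def)

lemma schwartz_tensor_opA [simp]: "schwartz_tensor cs \<Longrightarrow> schwartz_tensor (tensor_opA p cs)"
  by (auto simp: schwartz_tensor_def tensor_opA_def opA_pow_schwartz)

lemma lin_append [simp]: "lin P (cs @ es) = lin P cs + lin P es"
  by (simp add: lin_def)

lemma lin_tscale [simp]: "lin P (tscale a cs) = a * lin P cs"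
  by (induction cs) (auto simp: tscale_def algebra_simps)

lemma lin_treweight: "lin P (treweight h cs) = lin (\<lambda>\<phi>. complex_of_real (h \<phi>) * P \<phi>) cs"
  by (induction cs) (auto simp: treweight_def algebra_simps)

lemma lin_tensor_opA: "lin P (tensor_opA p cs) = lin (\<lambda>\<phi>. P ((opA ^^ p) \<phi>)) cs"
  by (induction cs) (auto simp: tensor_opA_def)

lemma tensor_opA_append [simp]: "tensor_opA p (cs @ es) = tensor_opA p cs @ tensor_opA p es"
  by (simp add: tensor_opA_def)

lemma tensor_opA_tscale [simp]: "tensor_opA p (tscale a cs) = tscale a (tensor_opA p cs)"
  by (induction cs) (auto simp: tensor_opA_def tscale_def)

lemma lin_cong:
  assumes "schwartz_tensor cs" "\<And>\<phi>. \<phi> \<in> schwartz \<Longrightarrow> P \<phi> = Q \<phi>"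
  shows "lin P cs = lin Q cs"
  using assms(1) by (induction cs) (auto simp: assms(2))

lemma lin_lin: "lin (\<lambda>\<phi>. a * P \<phi> + b * Q \<phi>) cs = a * lin P cs + b * lin Q cs"
  by (induction cs) (auto simp: algebra_simps)

lemma lin_mult_left: "lin (\<lambda>\<phi>. a * P \<phi>) cs = a * lin P cs"
  by (induction cs) (auto simp: algebra_simps)

lemma tensor_fun_lin: "tensor_fun n cs x = lin (\<lambda>\<phi>. complex_of_real (\<Prod>i<n. \<phi> (x i))) cs"
  by (simp add: tensor_fun_def lin_def)

lemma tensor_wick_lin: "tensor_wick n cs \<omega> = lin (\<lambda>\<phi>. complex_of_real (wick_power n \<phi> \<omega>)) cs"
  by (simp add: tensor_wick_def lin_def)

lemma gram_cong:
  assumes "schwartz_tensor cs" "schwartz_tensor es"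
    "\<And>\<phi> \<psi>. \<phi> \<in> schwartz \<Longrightarrow> \<psi> \<in> schwartz \<Longrightarrow> K \<phi> \<psi> = L \<phi> \<psi>"
  shows "gram K cs es = gram L cs es"
  unfolding gram_def using assms by (intro lin_cong arg_cong[of _ _ cnj]) auto

lemma gram_lin: "gram (\<lambda>\<phi> \<psi>. a * K \<phi> \<psi> + b * L \<phi> \<psi>) cs es = of_real a * gram K cs es + of_real b * gram L cs es"
  by (simp add: gram_def lin_lin)

lemma gram_tensor_opA:
  "gram K (tensor_opA p cs) (tensor_opA q es) = gram (\<lambda>\<phi> \<psi>. K ((opA ^^ p) \<phi>) ((opA ^^ q) \<psi>)) cs es"
  by (simp add: gram_def lin_tensor_opA)

lemma gram_rank1:
  "gram (\<lambda>\<phi> \<psi>. h \<phi> * h \<psi>) cs cs = complex_of_real ((cmod (lin (\<lambda>\<phi>. complex_of_real (h \<phi>)) cs))\<^sup>2)"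
proof -
  let ?z = "lin (\<lambda>\<phi>. complex_of_real (h \<phi>)) cs"
  have "lin (\<lambda>\<psi>. complex_of_real (h \<phi> * h \<psi>)) cs = complex_of_real (h \<phi>) * ?z" for \<phi>
    by (subst lin_mult_left[symmetric]) simp
  then have "gram (\<lambda>\<phi> \<psi>. h \<phi> * h \<psi>) cs cs = lin (\<lambda>\<phi>. cnj ?z * complex_of_real (h \<phi>)) cs"
    unfolding gram_def by (simp add: mult.commute)
  also have "\<dots> = cnj ?z * ?z" by (rule lin_mult_left)
  finally show ?thesis by (simp add: complex_norm_square[symmetric] mult.commute[of "cnj _"])
qed

lemma integral_lin:
  assumes "schwartz_tensor cs" "\<And>\<phi>. \<phi> \<in> schwartz \<Longrightarrow> integrable M (P \<phi>)"
  shows "integrable M (\<lambda>x. lin (\<lambda>\<phi>. P \<phi> x) cs)"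
    "(\<integral>x. lin (\<lambda>\<phi>. P \<phi> x) cs \<partial>M) = lin (\<lambda>\<phi>. \<integral>x. P \<phi> x \<partial>M) cs"
proof -
  have "integrable M (\<lambda>x. lin (\<lambda>\<phi>. P \<phi> x) cs) \<and>
    (\<integral>x. lin (\<lambda>\<phi>. P \<phi> x) cs \<partial>M) = lin (\<lambda>\<phi>. \<integral>x. P \<phi> x \<partial>M) cs"
    using assms(1) by (induction cs) (auto simp: assms(2))
  then show "integrable M (\<lambda>x. lin (\<lambda>\<phi>. P \<phi> x) cs)"
    "(\<integral>x. lin (\<lambda>\<phi>. P \<phi> x) cs \<partial>M) = lin (\<lambda>\<phi>. \<integral>x. P \<phi> x \<partial>M) cs" by auto
qed

lemma square_integrable_lin:
  assumes "schwartz_tensor cs" "\<And>\<phi>. \<phi> \<in> schwartz \<Longrightarrow> square_integrable M (X \<phi>)"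
  shows "square_integrable M (\<lambda>x. lin (\<lambda>\<phi>. complex_of_real (X \<phi> x)) cs)"
  using assms(1)
  by (induction cs) (auto intro!: square_integrable_add square_integrable_scale square_integrable_of_real assms(2))

lemma l2_inner_lin_left:
  assumes "schwartz_tensor cs" "\<And>\<phi>. \<phi> \<in> schwartz \<Longrightarrow> square_integrable M (X \<phi>)" "square_integrable M h"
  shows "l2_inner M (\<lambda>x. lin (\<lambda>\<phi>. complex_of_real (X \<phi> x)) cs) h =
    lin (\<lambda>\<phi>. l2_inner M (\<lambda>x. complex_of_real (X \<phi> x)) h) cs"
  using assms(1)
proof (induction cs)
  case (Cons a cs)
  obtain c \<phi> where a: "a = (c, \<phi>)" by force
  with Cons have s: "\<phi> \<in> schwartz" "schwartz_tensor cs" by auto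
  have "l2_inner M (\<lambda>x. c * complex_of_real (X \<phi> x) + lin (\<lambda>\<phi>. complex_of_real (X \<phi> x)) cs) h =
      l2_inner M (\<lambda>x. c * complex_of_real (X \<phi> x)) h + l2_inner M (\<lambda>x. lin (\<lambda>\<phi>. complex_of_real (X \<phi> x)) cs) h"
    by (intro l2_inner_add_left square_integrable_scale square_integrable_of_real square_integrable_lin assms s)
  note e = this
  have "l2_inner M (\<lambda>x. c * complex_of_real (X \<phi> x)) h = c * l2_inner M (\<lambda>x. complex_of_real (X \<phi> x)) h"
    by (rule l2_inner_scale_left)
  note f = e[unfolded this Cons.IH[OF s(2)]]
  show ?case unfolding a lin_simps by (rule f)
qed (simp only: lin_simps l2_inner_zero_right)

lemma l2_inner_lin:
  assumes cs: "schwartz_tensor cs" "\<And>\<phi>. \<phi> \<in> schwartz \<Longrightarrow> square_integrable M (X \<phi>)"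
    and es: "schwartz_tensor es" "\<And>\<phi>. \<phi> \<in> schwartz \<Longrightarrow> square_integrable M (Y \<phi>)"
  shows "l2_inner M (\<lambda>x. lin (\<lambda>\<phi>. complex_of_real (X \<phi> x)) cs) (\<lambda>x. lin (\<lambda>\<phi>. complex_of_real (Y \<phi> x)) es) =
    gram (\<lambda>\<phi> \<psi>. \<integral>x. X \<phi> x * Y \<psi> x \<partial>M) cs es"
proof -
  have r: "l2_inner M h (\<lambda>x. lin (\<lambda>\<phi>. complex_of_real (Y \<phi> x)) es) =
      cnj (lin (\<lambda>\<psi>. l2_inner M (\<lambda>x. complex_of_real (Y \<psi> x)) h) es)" if "square_integrable M h" for h
    by (subst l2_inner_commute) (simp only: l2_inner_lin_left[OF es that])
  have i: "l2_inner M (\<lambda>x. complex_of_real (Y \<psi> x)) (\<lambda>x. complex_of_real (X \<phi> x)) =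
      complex_of_real (\<integral>x. X \<phi> x * Y \<psi> x \<partial>M)" for \<phi> \<psi>
    by (simp add: l2_inner_def mult.commute flip: of_real_mult)
  show ?thesis
    unfolding gram_def
    by (subst l2_inner_lin_left[OF cs square_integrable_lin[OF es]])
       (simp_all only: r[OF square_integrable_of_real[OF cs(2)]] i cong: lin_cong[OF cs(1)])
qed

lemma tensor_prod_square_integrable:
  assumes "\<And>i. i < n \<Longrightarrow> square_integrable lborel (\<phi> i :: real \<Rightarrow> real)"
  shows "square_integrable (Rn n) (\<lambda>x. \<Prod>i<n. \<phi> i (x i))"
proof -
  interpret product_sigma_finite "\<lambda>_::nat. lborel :: real measure" by standard
  have [measurable]: "\<And>i. i < n \<Longrightarrow> \<phi> i \<in> borel_measurable lborel"
    using assms[THEN square_integrable_measurable] by simp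
  have "integrable (Rn n) (\<lambda>x. \<Prod>i<n. (norm (\<phi> i (x i)))\<^sup>2)"
    by (intro product_integrable_prod) (use assms in \<open>auto simp: square_integrable_def\<close>)
  moreover have "(\<lambda>x. \<Prod>i<n. \<phi> i (x i)) \<in> borel_measurable (Rn n)"
    by (intro borel_measurable_prod measurable_compose[OF measurable_component_singleton]) auto
  ultimately show ?thesis
    by (simp add: square_integrable_def prod_power_distrib abs_prod)
qed

lemma tensor_prod_inner:
  fixes \<phi> \<psi> :: "nat \<Rightarrow> real \<Rightarrow> real"
  assumes "\<And>i. i < n \<Longrightarrow> square_integrable lborel (\<phi> i)" "\<And>i. i < n \<Longrightarrow> square_integrable lborel (\<psi> i)"
  shows "(\<integral>x. (\<Prod>i<n. \<phi> i (x i)) * (\<Prod>i<n. \<psi> i (x i)) \<partial>Rn n) = (\<Prod>i<n. ip (\<phi> i) (\<psi> i))"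
proof -
  interpret product_sigma_finite "\<lambda>_::nat. lborel :: real measure" by standard
  have "(\<integral>x. (\<Prod>i<n. \<phi> i (x i) * \<psi> i (x i)) \<partial>Rn n) = (\<Prod>i<n. ip (\<phi> i) (\<psi> i))"
    by (intro product_integral_prod square_integrable_mult_integrable assms) auto
  then show ?thesis by (simp add: prod.distrib)
qed

lemma tensor_fun_square_integrable [intro]:
  "schwartz_tensor cs \<Longrightarrow> square_integrable (Rn n) (tensor_fun n cs)"
  unfolding tensor_fun_lin[abs_def]
  by (intro square_integrable_lin tensor_prod_square_integrable schwartz_square_integrable)

text \<open>By Fubini the inner product of two tensor powers factorises. Norms of tensors are
  thereby Gram sums of a power of a kernel, and comparing norms becomes comparing kernels.\<close>

lemma tensor_fun_inner:
  assumes "schwartz_tensor cs" "schwartz_tensor es"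
  shows "l2_inner (Rn n) (tensor_fun n cs) (tensor_fun n es) = gram (\<lambda>\<phi> \<psi>. ip \<phi> \<psi> ^ n) cs es"
proof -
  have "l2_inner (Rn n) (tensor_fun n cs) (tensor_fun n es) =
      gram (\<lambda>\<phi> \<psi>. \<integral>x. (\<Prod>i<n. \<phi> (x i)) * (\<Prod>i<n. \<psi> (x i)) \<partial>Rn n) cs es"
    unfolding tensor_fun_lin[abs_def]
    by (intro l2_inner_lin assms tensor_prod_square_integrable schwartz_square_integrable)
  also have "\<dots> = gram (\<lambda>\<phi> \<psi>. ip \<phi> \<psi> ^ n) cs es"
    using tensor_prod_inner[of n "\<lambda>_. _" "\<lambda>_. _", OF schwartz_square_integrable schwartz_square_integrable]
    by (intro gram_cong assms) simp
  finally show ?thesis .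
qed

lemma tensor_fun_norm:
  assumes "schwartz_tensor cs"
  shows "(l2norm (Rn n) (tensor_fun n cs))\<^sup>2 = Re (gram (\<lambda>\<phi> \<psi>. ip \<phi> \<psi> ^ n) cs cs)"
  using l2_inner_self[OF tensor_fun_square_integrable[OF assms, of n]] tensor_fun_inner[OF assms assms, of n]
  by simp

lemma tensor_fun_append: "tensor_fun n (cs @ es) x = tensor_fun n cs x + tensor_fun n es x"
  by (simp add: tensor_fun_lin)

lemma tensor_fun_tscale: "tensor_fun n (tscale a cs) x = a * tensor_fun n cs x"
  by (simp add: tensor_fun_lin)

section \<open>Positive definite kernels and Schur products\<close>

definition psd :: "((real \<Rightarrow> real) \<Rightarrow> (real \<Rightarrow> real) \<Rightarrow> real) \<Rightarrow> bool" where
  "psd K \<longleftrightarrow> (\<forall>cs. schwartz_tensor cs \<longrightarrow> 0 \<le> Re (gram K cs cs))"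

text \<open>Schur's product theorem says that \<^const>\<open>psd\<close> kernels have this property.\<close>

definition schur :: "((real \<Rightarrow> real) \<Rightarrow> (real \<Rightarrow> real) \<Rightarrow> real) \<Rightarrow> bool" where
  "schur H \<longleftrightarrow> (\<forall>K. psd K \<longrightarrow> psd (\<lambda>\<phi> \<psi>. K \<phi> \<psi> * H \<phi> \<psi>))"

definition psd_le where "psd_le K L \<longleftrightarrow> psd (\<lambda>\<phi> \<psi>. L \<phi> \<psi> - K \<phi> \<psi>)"

lemma psd_add: "psd K \<Longrightarrow> psd L \<Longrightarrow> psd (\<lambda>\<phi> \<psi>. K \<phi> \<psi> + L \<phi> \<psi>)"
  using gram_lin[of 1 K 1 L] by (auto simp: psd_def)

lemma schur_one: "schur (\<lambda>_ _. 1)"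
  by (simp add: schur_def)

lemma schur_mult: "schur H \<Longrightarrow> schur H' \<Longrightarrow> schur (\<lambda>\<phi> \<psi>. H \<phi> \<psi> * H' \<phi> \<psi>)"
  by (simp add: schur_def mult.assoc[symmetric])

lemma schur_power: "schur H \<Longrightarrow> schur (\<lambda>\<phi> \<psi>. H \<phi> \<psi> ^ n)"
  by (induction n) (auto intro: schur_one schur_mult)

lemma gram_treweight:
  "gram (\<lambda>\<phi> \<psi>. K \<phi> \<psi> * (h \<phi> * h \<psi>)) cs cs = gram K (treweight h cs) (treweight h cs)"
proof -
  have "lin (\<lambda>\<psi>. complex_of_real (K \<phi> \<psi> * (h \<phi> * h \<psi>))) cs =
      complex_of_real (h \<phi>) * lin (\<lambda>\<psi>. complex_of_real (h \<psi>) * complex_of_real (K \<phi> \<psi>)) cs" for \<phi>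
    by (subst lin_mult_left[symmetric]) (simp add: ac_simps)
  then show ?thesis unfolding gram_def lin_treweight by simp
qed

lemma schur_rank1: "schur (\<lambda>\<phi> \<psi>. h \<phi> * h \<psi>)"
  by (simp add: schur_def psd_def gram_treweight)

text \<open>The kernel is an integral of rank one kernels. With the integral taken out of the Gram
  sum, the integrand at \<open>x\<close> is the Gram sum of \<open>K\<close> with coefficients
  reweighted by \<open>h \<phi> x\<close>, hence nonnegative.\<close>

lemma schur_integral:
  assumes h: "\<And>\<phi>. \<phi> \<in> schwartz \<Longrightarrow> square_integrable N (h \<phi> :: 'a \<Rightarrow> real)"
  shows "schur (\<lambda>\<phi> \<psi>. \<integral>x. h \<phi> x * h \<psi> x \<partial>N)"
  unfolding schur_def psd_def
proof (intro allI impI)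
  fix K cs assume K: "\<forall>cs. schwartz_tensor cs \<longrightarrow> 0 \<le> Re (gram K cs cs)" and cs: "schwartz_tensor cs"
  have i: "integrable N (\<lambda>x. complex_of_real (K \<phi> \<psi> * (h \<phi> x * h \<psi> x)))"
    if "\<phi> \<in> schwartz" "\<psi> \<in> schwartz" for \<phi> \<psi>
    using square_integrable_mult_integrable[OF h[OF that(1)] h[OF that(2)]] by (intro integrable_of_real) auto
  have j: "integrable N (\<lambda>x. cnj (lin (\<lambda>\<psi>. complex_of_real (K \<phi> \<psi> * (h \<phi> x * h \<psi> x))) cs))"
    if "\<phi> \<in> schwartz" for \<phi>
    using integral_lin(1)[OF cs i[OF that]] by (subst complex_integrable_cnj) auto
  have "gram (\<lambda>\<phi> \<psi>. K \<phi> \<psi> * (\<integral>x. h \<phi> x * h \<psi> x \<partial>N)) cs cs =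
      lin (\<lambda>\<phi>. \<integral>x. cnj (lin (\<lambda>\<psi>. complex_of_real (K \<phi> \<psi> * (h \<phi> x * h \<psi> x))) cs) \<partial>N) cs"
    unfolding gram_def
  proof (rule lin_cong[OF cs])
    fix \<phi> assume \<phi>: "\<phi> \<in> schwartz"
    have "lin (\<lambda>\<psi>. complex_of_real (K \<phi> \<psi> * (\<integral>x. h \<phi> x * h \<psi> x \<partial>N))) cs =
      lin (\<lambda>\<psi>. \<integral>x. complex_of_real (K \<phi> \<psi> * (h \<phi> x * h \<psi> x)) \<partial>N) cs"
      by (simp only: integral_complex_of_real integral_mult_right_zero)
    also have "\<dots> = (\<integral>x. lin (\<lambda>\<psi>. complex_of_real (K \<phi> \<psi> * (h \<phi> x * h \<psi> x))) cs \<partial>N)"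
      by (rule integral_lin(2)[OF cs i[OF \<phi>], symmetric])
    finally show "cnj (lin (\<lambda>\<psi>. complex_of_real (K \<phi> \<psi> * (\<integral>x. h \<phi> x * h \<psi> x \<partial>N))) cs) =
      (\<integral>x. cnj (lin (\<lambda>\<psi>. complex_of_real (K \<phi> \<psi> * (h \<phi> x * h \<psi> x))) cs) \<partial>N)"
      by (simp only: Bochner_Integration.integral_cnj)
  qed
  also have "\<dots> = (\<integral>x. gram (\<lambda>\<phi> \<psi>. K \<phi> \<psi> * (h \<phi> x * h \<psi> x)) cs cs \<partial>N)"
    unfolding gram_def by (rule integral_lin(2)[OF cs j, symmetric])
  also have "\<dots> = (\<integral>x. gram K (treweight (\<lambda>\<phi>. h \<phi> x) cs) (treweight (\<lambda>\<phi>. h \<phi> x) cs) \<partial>N)"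
    by (simp only: gram_treweight)
  finally have eq: "gram (\<lambda>\<phi> \<psi>. K \<phi> \<psi> * (\<integral>x. h \<phi> x * h \<psi> x \<partial>N)) cs cs =
    (\<integral>x. gram K (treweight (\<lambda>\<phi>. h \<phi> x) cs) (treweight (\<lambda>\<phi>. h \<phi> x) cs) \<partial>N)" .
  have "integrable N (\<lambda>x. gram (\<lambda>\<phi> \<psi>. K \<phi> \<psi> * (h \<phi> x * h \<psi> x)) cs cs)"
    unfolding gram_def by (rule integral_lin(1)[OF cs j])
  then have "integrable N (\<lambda>x. gram K (treweight (\<lambda>\<phi>. h \<phi> x) cs) (treweight (\<lambda>\<phi>. h \<phi> x) cs))"
    by (simp only: gram_treweight)
  then have "Re (\<integral>x. gram K (treweight (\<lambda>\<phi>. h \<phi> x) cs) (treweight (\<lambda>\<phi>. h \<phi> x) cs) \<partial>N) =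
    (\<integral>x. Re (gram K (treweight (\<lambda>\<phi>. h \<phi> x) cs) (treweight (\<lambda>\<phi>. h \<phi> x) cs)) \<partial>N)"
    by simp
  also have "\<dots> \<ge> 0" using K cs by (intro integral_nonneg_AE AE_I2) auto
  finally show "0 \<le> Re (gram (\<lambda>\<phi> \<psi>. K \<phi> \<psi> * (\<integral>x. h \<phi> x * h \<psi> x \<partial>N)) cs cs)" by (simp only: eq)
qed

lemma schur_ip_opA: "schur (\<lambda>\<phi> \<psi>. ip ((opA ^^ p) \<phi>) ((opA ^^ p) \<psi>))"
  by (intro schur_integral schwartz_square_integrable opA_pow_schwartz)

lemma schur_const: "0 \<le> c \<Longrightarrow> schur (\<lambda>_ _. c)"
  using schur_rank1[of "\<lambda>_. sqrt c"] by simp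

text \<open>The difference of the products splits as \<open>L * (L' - K') + (L - K) * K'\<close>, so
  only \<open>L\<close> and \<open>K'\<close> have to act as Schur multipliers.\<close>

lemma psd_le_mult:
  assumes "psd_le K L" "psd_le K' L'" "schur K'" "schur L"
  shows "psd_le (\<lambda>\<phi> \<psi>. K \<phi> \<psi> * K' \<phi> \<psi>) (\<lambda>\<phi> \<psi>. L \<phi> \<psi> * L' \<phi> \<psi>)"
proof -
  have "psd (\<lambda>\<phi> \<psi>. (L' \<phi> \<psi> - K' \<phi> \<psi>) * L \<phi> \<psi> + (L \<phi> \<psi> - K \<phi> \<psi>) * K' \<phi> \<psi>)"
    using assms by (intro psd_add) (auto simp: schur_def psd_le_def)
  moreover have "(\<lambda>\<phi> \<psi>. (L' \<phi> \<psi> - K' \<phi> \<psi>) * L \<phi> \<psi> + (L \<phi> \<psi> - K \<phi> \<psi>) * K' \<phi> \<psi>) =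
      (\<lambda>\<phi> \<psi>. L \<phi> \<psi> * L' \<phi> \<psi> - K \<phi> \<psi> * K' \<phi> \<psi>)"
    by (simp add: algebra_simps fun_eq_iff)
  ultimately show ?thesis by (simp add: psd_le_def)
qed

lemma psd_le_refl: "psd_le K K"
proof -
  have "gram (\<lambda>_ _. 0) cs cs = 0" for cs using gram_lin[of 0 "\<lambda>_ _. 0" 0 "\<lambda>_ _. 0" cs cs] by simp
  then show ?thesis by (simp add: psd_le_def psd_def)
qed

lemma psd_le_power:
  assumes "psd_le K L" "schur K" "schur L"
  shows "psd_le (\<lambda>\<phi> \<psi>. K \<phi> \<psi> ^ n) (\<lambda>\<phi> \<psi>. L \<phi> \<psi> ^ n)"
proof (induction n)
  case 0
  show ?case using psd_le_refl by simp
next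
  case (Suc n)
  then show ?case by (simp add: psd_le_mult assms schur_power)
qed

lemma psd_leD: "psd_le K L \<Longrightarrow> schwartz_tensor cs \<Longrightarrow> Re (gram K cs cs) \<le> Re (gram L cs cs)"
  using gram_lin[of 1 L "-1" K cs cs] by (auto simp: psd_le_def psd_def)

text \<open>A complex combination splits into two real ones, on which a real symmetric form is nonnegative.\<close>

lemma psd_bilinear:
  assumes lin: "\<And>\<phi> \<psi> \<theta> a b. \<phi> \<in> schwartz \<Longrightarrow> \<psi> \<in> schwartz \<Longrightarrow> \<theta> \<in> schwartz \<Longrightarrow>
      K (\<lambda>x. a * \<phi> x + b * \<psi> x) \<theta> = a * K \<phi> \<theta> + b * K \<psi> \<theta>"
    and sym: "\<And>\<phi> \<psi>. \<phi> \<in> schwartz \<Longrightarrow> \<psi> \<in> schwartz \<Longrightarrow> K \<phi> \<psi> = K \<psi> \<phi>"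
    and pos: "\<And>\<phi>. \<phi> \<in> schwartz \<Longrightarrow> 0 \<le> K \<phi> \<phi>"
  shows "psd K"
  unfolding psd_def
proof (intro allI impI)
  fix cs :: tensor assume cs: "schwartz_tensor cs"
  define r where "r f es = (\<lambda>x. \<Sum>(c::complex, \<phi>::real \<Rightarrow> real)\<leftarrow>es. (f c :: real) * \<phi> x)" for f es
  have r0: "r f [] = (\<lambda>_. 0)" for f by (simp add: r_def)
  have rc: "r f ((c, \<phi>) # es) = (\<lambda>x. f c * \<phi> x + 1 * r f es x)" for f c \<phi> es by (simp add: r_def)
  have rS: "r f es \<in> schwartz" if "schwartz_tensor es" for f es
    using that by (induction es) (auto simp: r0 rc schwartz_zero schwartz_lin(1)[where b=1, simplified])
  have K0: "K (\<lambda>_. 0) \<theta> = 0" if "\<theta> \<in> schwartz" for \<theta>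
    using lin[OF schwartz_zero schwartz_zero that, of 0 0] by simp
  have Kc: "K (r f ((c, \<phi>) # es)) \<theta> = f c * K \<phi> \<theta> + K (r f es) \<theta>"
    if "\<phi> \<in> schwartz" "schwartz_tensor es" "\<theta> \<in> schwartz" for f c \<phi> es \<theta>
    unfolding rc using lin[OF that(1) rS[OF that(2)] that(3), of "f c" 1] by simp
  have A: "lin (\<lambda>\<psi>. complex_of_real (K \<phi> \<psi>)) es = Complex (K (r Re es) \<phi>) (K (r Im es) \<phi>)"
    if "\<phi> \<in> schwartz" "schwartz_tensor es" for \<phi> es
    using that(2)
  proof (induction es)
    case Nil
    then show ?case using K0[OF that(1)] by (simp add: r0 complex_eq_iff)
  next
    case (Cons a es)
    then show ?case using that(1) sym[of \<phi> "snd a"]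
      by (cases a) (auto simp: Kc complex_eq_iff)
  qed
  have B: "Re (lin (\<lambda>\<phi>. cnj (lin (\<lambda>\<psi>. complex_of_real (K \<phi> \<psi>)) cs)) es) =
    K (r Re es) (r Re cs) + K (r Im es) (r Im cs)" if "schwartz_tensor es" for es
    using that
  proof (induction es)
    case Nil
    then show ?case using K0[OF rS[OF cs]] by (simp add: r0)
  next
    case (Cons a es)
    then show ?case using rS[OF cs] sym
      by (cases a) (auto simp: Kc A[OF _ cs])
  qed
  show "0 \<le> Re (gram K cs cs)"
    unfolding gram_def B[OF cs] using pos rS[OF cs] by (simp add: add_nonneg_nonneg)
qed

abbreviation ipA :: "nat \<Rightarrow> (real \<Rightarrow> real) \<Rightarrow> (real \<Rightarrow> real) \<Rightarrow> real" where
  "ipA p \<phi> \<psi> \<equiv> ip ((opA ^^ p) \<phi>) ((opA ^^ p) \<psi>)"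

lemma ipA_lin_left:
  assumes "\<phi> \<in> schwartz" "\<psi> \<in> schwartz" "\<theta> \<in> schwartz"
  shows "ipA p (\<lambda>x. a * \<phi> x + b * \<psi> x) \<theta> = a * ipA p \<phi> \<theta> + b * ipA p \<psi> \<theta>"
  unfolding opA_pow_lin[OF assms(1,2)] by (intro ip_lin_left opA_pow_schwartz assms)

lemma ipA_self: "ipA p \<phi> \<phi> = (schwartz_norm p \<phi>)\<^sup>2"
  by (simp only: schwartz_norm_def l2norm_sq_ip)

lemma tensor_opA_norm:
  assumes "schwartz_tensor cs"
  shows "(l2norm (Rn n) (tensor_fun n (tensor_opA p cs)))\<^sup>2 = Re (gram (\<lambda>\<phi> \<psi>. ipA p \<phi> \<psi> ^ n) cs cs)"
  using tensor_fun_norm[OF schwartz_tensor_opA[OF assms]] by (simp only: gram_tensor_opA)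

lemma tensor_opA_norm_mono:
  assumes "p \<le> q" "schwartz_tensor cs"
  shows "l2norm (Rn n) (tensor_fun n (tensor_opA p cs)) \<le> l2norm (Rn n) (tensor_fun n (tensor_opA q cs))"
proof (rule power2_le_imp_le)
  have "psd_le (ipA p) (ipA q)"
    unfolding psd_le_def
  proof (rule psd_bilinear)
    fix \<phi> assume \<phi>: "\<phi> \<in> schwartz"
    have "(schwartz_norm p \<phi>)\<^sup>2 \<le> (schwartz_norm q \<phi>)\<^sup>2"
      by (intro power_mono schwartz_norm_mono assms \<phi>) auto
    then show "0 \<le> ipA q \<phi> \<phi> - ipA p \<phi> \<phi>" unfolding ipA_self by linarith
  next
    fix \<phi> \<psi> \<theta> a b assume S: "\<phi> \<in> schwartz" "\<psi> \<in> schwartz" "\<theta> \<in> schwartz"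
    show "ipA q (\<lambda>x. a * \<phi> x + b * \<psi> x) \<theta> - ipA p (\<lambda>x. a * \<phi> x + b * \<psi> x) \<theta> =
        a * (ipA q \<phi> \<theta> - ipA p \<phi> \<theta>) + b * (ipA q \<psi> \<theta> - ipA p \<psi> \<theta>)"
      by (simp only: ipA_lin_left[OF S]) (simp add: algebra_simps)
  qed (simp only: mult.commute)
  then have "psd_le (\<lambda>\<phi> \<psi>. ipA p \<phi> \<psi> ^ n) (\<lambda>\<phi> \<psi>. ipA q \<phi> \<psi> ^ n)"
    by (intro psd_le_power schur_ip_opA)
  from psd_leD[OF this assms(2)]
  show "(l2norm (Rn n) (tensor_fun n (tensor_opA p cs)))\<^sup>2 \<le> (l2norm (Rn n) (tensor_fun n (tensor_opA q cs)))\<^sup>2"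
    by (simp only: tensor_opA_norm[OF assms(2)])
qed simp

subsection \<open>Bounded homogeneous forms\<close>

text \<open>\<open>P\<close> stands for the \<open>n\<close>-homogeneous form \<open>\<phi>\<^sup>\<otimes>\<^sup>n \<mapsto> P \<phi>\<close> on Schwartz tensors;
  \<open>c\<close> bounds its norm in the dual of the \<open>n\<close>-th tensor power of \<open>H\<^sub>p\<close>.\<close>

definition hform :: "nat \<Rightarrow> nat \<Rightarrow> ((real \<Rightarrow> real) \<Rightarrow> complex) \<Rightarrow> real \<Rightarrow> bool" where
  "hform p n P c \<longleftrightarrow> 0 \<le> c \<and> (\<forall>cs. schwartz_tensor cs \<longrightarrow>
     cmod (lin P cs) \<le> c * l2norm (Rn n) (tensor_fun n (tensor_opA p cs)))"

text \<open>Real linear functionals of norm at most \<open>c\<close> in the dual of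
  \<open>H\<^sub>p\<close>. The forms used later are built from powers and products of these;
  \<open>c\<close> is any bound, so that it can be traded for a better one.\<close>

definition lbound :: "nat \<Rightarrow> ((real \<Rightarrow> real) \<Rightarrow> real) \<Rightarrow> real \<Rightarrow> bool" where
  "lbound p l c \<longleftrightarrow> 0 \<le> c \<and>
     (\<forall>\<phi>\<in>schwartz. \<forall>\<psi>\<in>schwartz. \<forall>a b. l (\<lambda>x. a * \<phi> x + b * \<psi> x) = a * l \<phi> + b * l \<psi>) \<and>
     (\<forall>\<phi>\<in>schwartz. \<bar>l \<phi>\<bar> \<le> c * schwartz_norm p \<phi>)"

lemma hform_lin:
  assumes "hform p n P c" "hform p n Q d"
  shows "hform p n (\<lambda>\<phi>. a * P \<phi> + b * Q \<phi>) (cmod a * c + cmod b * d)"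
  unfolding hform_def lin_lin
proof (intro conjI allI impI)
  show "0 \<le> cmod a * c + cmod b * d" using assms by (auto simp: hform_def)
  fix cs assume cs: "schwartz_tensor cs"
  let ?N = "l2norm (Rn n) (tensor_fun n (tensor_opA p cs))"
  have "cmod (a * lin P cs + b * lin Q cs) \<le> cmod a * cmod (lin P cs) + cmod b * cmod (lin Q cs)"
    by (metis norm_mult norm_triangle_ineq)
  also have "\<dots> \<le> cmod a * (c * ?N) + cmod b * (d * ?N)"
    using assms cs by (intro add_mono mult_left_mono) (auto simp: hform_def)
  finally show "cmod (a * lin P cs + b * lin Q cs) \<le> (cmod a * c + cmod b * d) * ?N"
    by (simp add: algebra_simps)
qed

lemma hform_scale: "hform p n P c \<Longrightarrow> hform p n (\<lambda>\<phi>. a * P \<phi>) (cmod a * c)"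
  using hform_lin[of p n P c P c a 0] by simp

lemma hform_add: "hform p n P c \<Longrightarrow> hform p n Q d \<Longrightarrow> hform p n (\<lambda>\<phi>. P \<phi> + Q \<phi>) (c + d)"
  using hform_lin[of p n P c Q d 1 1] by simp

lemma hform_mono:
  assumes "hform p n P c" "c \<le> d"
  shows "hform p n P d"
proof -
  have "c * l2norm (Rn n) (tensor_fun n (tensor_opA p cs)) \<le> d * l2norm (Rn n) (tensor_fun n (tensor_opA p cs))" for cs
    using assms by (intro mult_right_mono) auto
  with assms show ?thesis by (auto simp: hform_def intro: order_trans)
qed

lemma hform_cong:
  assumes "hform p n P c" "\<And>\<phi>. \<phi> \<in> schwartz \<Longrightarrow> P \<phi> = Q \<phi>"
  shows "hform p n Q c"
  using assms lin_cong[of _ P Q] by (auto simp: hform_def)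

text \<open>On the diagonal this is the squared bound of \<open>l\<close>; for bilinear kernels the
  diagonal decides positivity.\<close>

lemma lbound_psd_le:
  assumes "lbound p l c"
  shows "psd_le (\<lambda>\<phi> \<psi>. l \<phi> * l \<psi>) (\<lambda>\<phi> \<psi>. c\<^sup>2 * ipA p \<phi> \<psi>)"
  unfolding psd_le_def
proof (rule psd_bilinear)
  fix \<phi> assume \<phi>: "\<phi> \<in> schwartz"
  have "\<bar>l \<phi>\<bar> \<le> c * schwartz_norm p \<phi>" using assms \<phi> by (auto simp: lbound_def)
  then have "\<bar>l \<phi>\<bar>\<^sup>2 \<le> (c * schwartz_norm p \<phi>)\<^sup>2" by (intro power_mono) auto
  then show "0 \<le> c\<^sup>2 * ipA p \<phi> \<phi> - l \<phi> * l \<phi>"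
    unfolding ipA_self by (simp add: power2_eq_square algebra_simps)
next
  fix \<phi> \<psi> \<theta> a b assume S: "\<phi> \<in> schwartz" "\<psi> \<in> schwartz" "\<theta> \<in> schwartz"
  have "l (\<lambda>x. a * \<phi> x + b * \<psi> x) = a * l \<phi> + b * l \<psi>" using assms S by (auto simp: lbound_def)
  then show "c\<^sup>2 * ipA p (\<lambda>x. a * \<phi> x + b * \<psi> x) \<theta> - l (\<lambda>x. a * \<phi> x + b * \<psi> x) * l \<theta> =
      a * (c\<^sup>2 * ipA p \<phi> \<theta> - l \<phi> * l \<theta>) + b * (c\<^sup>2 * ipA p \<psi> \<theta> - l \<psi> * l \<theta>)"
    by (simp only: ipA_lin_left[OF S]) (simp add: algebra_simps)
qed (simp add: mult.commute)

text \<open>The square of the modulus of \<open>lin\<close> is a Gram sum of a rank one kernel. That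
  kernel is a product of powers of \<open>l \<phi> * l \<psi>\<close> and
  \<open>l' \<phi> * l' \<psi>\<close>, each of which lies below a multiple of \<open>ipA p\<close>;
  multiplying these relations produces the kernel of the tensor norm, with the product of the
  constants.\<close>

lemma hform_product:
  assumes l: "lbound p l c" and l': "lbound p l' c'"
  shows "hform p (k + m) (\<lambda>\<phi>. complex_of_real (l \<phi> ^ k * l' \<phi> ^ m)) (c ^ k * c' ^ m)"
  unfolding hform_def
proof (intro conjI allI impI)
  have c: "0 \<le> c" "0 \<le> c'" using l l' by (auto simp: lbound_def)
  then show c0: "0 \<le> c ^ k * c' ^ m" by simp
  fix cs assume cs: "schwartz_tensor cs"
  let ?P = "\<lambda>\<phi>. l \<phi> ^ k * l' \<phi> ^ m"
  have sc: "schur (\<lambda>\<phi> \<psi>. c\<^sup>2 * ipA p \<phi> \<psi>)" for c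
    by (intro schur_mult schur_const schur_ip_opA) simp
  have "psd_le (\<lambda>\<phi> \<psi>. (l \<phi> * l \<psi>) ^ k * (l' \<phi> * l' \<psi>) ^ m)
      (\<lambda>\<phi> \<psi>. (c\<^sup>2 * ipA p \<phi> \<psi>) ^ k * (c'\<^sup>2 * ipA p \<phi> \<psi>) ^ m)"
    by (intro psd_le_mult psd_le_power lbound_psd_le l l' schur_power schur_rank1 sc)
  moreover have "(\<lambda>\<phi> \<psi>. (l \<phi> * l \<psi>) ^ k * (l' \<phi> * l' \<psi>) ^ m) = (\<lambda>\<phi> \<psi>. ?P \<phi> * ?P \<psi>)"
    by (simp add: fun_eq_iff power_mult_distrib mult_ac)
  \<comment> \<open>The summand \<open>0 * 0\<close> brings the kernel into the two-term shape of
    \<open>gram_lin\<close>.\<close>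
  moreover have "(\<lambda>\<phi> \<psi>. (c\<^sup>2 * ipA p \<phi> \<psi>) ^ k * (c'\<^sup>2 * ipA p \<phi> \<psi>) ^ m) =
      (\<lambda>\<phi> \<psi>. (c ^ k * c' ^ m)\<^sup>2 * ipA p \<phi> \<psi> ^ (k + m) + 0 * 0)"
  proof (intro ext)
    fix \<phi> \<psi>
    show "(c\<^sup>2 * ipA p \<phi> \<psi>) ^ k * (c'\<^sup>2 * ipA p \<phi> \<psi>) ^ m = (c ^ k * c' ^ m)\<^sup>2 * ipA p \<phi> \<psi> ^ (k + m) + 0 * 0"
      unfolding power_mult_distrib power_add power2_eq_square by (simp add: mult_ac)
  qed
  ultimately have "psd_le (\<lambda>\<phi> \<psi>. ?P \<phi> * ?P \<psi>) (\<lambda>\<phi> \<psi>. (c ^ k * c' ^ m)\<^sup>2 * ipA p \<phi> \<psi> ^ (k + m) + 0 * 0)"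
    by (simp only:)
  from psd_leD[OF this cs]
  have "Re (gram (\<lambda>\<phi> \<psi>. ?P \<phi> * ?P \<psi>) cs cs) \<le>
      Re (gram (\<lambda>\<phi> \<psi>. (c ^ k * c' ^ m)\<^sup>2 * ipA p \<phi> \<psi> ^ (k + m) + 0 * 0) cs cs)" .
  also have "\<dots> = (c ^ k * c' ^ m)\<^sup>2 * Re (gram (\<lambda>\<phi> \<psi>. ipA p \<phi> \<psi> ^ (k + m)) cs cs)"
    unfolding gram_lin[of "(c ^ k * c' ^ m)\<^sup>2" "\<lambda>\<phi> \<psi>. ipA p \<phi> \<psi> ^ (k + m)" 0 "\<lambda>_ _. 0"]
    by (simp only: Re_complex_of_real times_complex.sel of_real_0 mult_zero_left add_0_right Im_complex_of_real diff_zero)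
  finally have "(cmod (lin (\<lambda>\<phi>. complex_of_real (?P \<phi>)) cs))\<^sup>2 \<le>
      (c ^ k * c' ^ m)\<^sup>2 * (l2norm (Rn (k + m)) (tensor_fun (k + m) (tensor_opA p cs)))\<^sup>2"
    unfolding gram_rank1 tensor_opA_norm[OF cs] Re_complex_of_real .
  then have "(cmod (lin (\<lambda>\<phi>. complex_of_real (?P \<phi>)) cs))\<^sup>2 \<le>
      (c ^ k * c' ^ m * l2norm (Rn (k + m)) (tensor_fun (k + m) (tensor_opA p cs)))\<^sup>2"
    unfolding power_mult_distrib[of "c ^ k * c' ^ m"] .
  moreover have "0 \<le> c ^ k * c' ^ m * l2norm (Rn (k + m)) (tensor_fun (k + m) (tensor_opA p cs))"
    using c0 l2norm_nonneg by (rule mult_nonneg_nonneg)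
  ultimately show "cmod (lin (\<lambda>\<phi>. complex_of_real (?P \<phi>)) cs) \<le>
      c ^ k * c' ^ m * l2norm (Rn (k + m)) (tensor_fun (k + m) (tensor_opA p cs))"
    by (rule power2_le_imp_le)
qed

lemma hform_power:
  assumes "lbound p l c"
  shows "hform p n (\<lambda>\<phi>. complex_of_real (l \<phi> ^ n)) (c ^ n)"
  using hform_product[OF assms assms, of n 0] by simp

section \<open>The spaces of kernels\<close>

text \<open>\<open>closed_opA\<close> with its approximating sequence exposed, because forms are
  extended by evaluating them along that sequence.\<close>

definition approx :: "nat \<Rightarrow> nat \<Rightarrow> (nat \<Rightarrow> tensor) \<Rightarrow> kernel \<Rightarrow> kernel \<Rightarrow> bool" where
  "approx p n cs f h \<longleftrightarrow> (\<forall>k. schwartz_tensor (cs k)) \<and>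
     l2_lim (Rn n) (\<lambda>k. tensor_fun n (cs k)) f \<and>
     l2_lim (Rn n) (\<lambda>k. tensor_fun n (tensor_opA p (cs k))) h"

lemma closed_opA_approx: "closed_opA p n f h \<longleftrightarrow> (\<exists>cs. approx p n cs f h)"
  by (simp add: closed_opA_def approx_def)

lemma kernel_space_approx: "f \<in> kernel_space p n \<longleftrightarrow> (\<exists>cs h. approx p n cs f h)"
  by (auto simp: kernel_space_def closed_opA_approx)

lemma approxD:
  assumes "approx p n cs f h"
  shows "\<And>k. schwartz_tensor (cs k)" "l2_lim (Rn n) (\<lambda>k. tensor_fun n (cs k)) f"
    "l2_lim (Rn n) (\<lambda>k. tensor_fun n (tensor_opA p (cs k))) h"
    "square_integrable (Rn n) f" "square_integrable (Rn n) h"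
  using assms l2_limD(2) by (auto simp: approx_def)

lemma tensor_fun_combine:
  "tensor_fun n (tscale a cs @ tscale b es) = (\<lambda>x. a * tensor_fun n cs x + b * tensor_fun n es x)"
  by (simp add: fun_eq_iff tensor_fun_append tensor_fun_tscale)

lemma approx_combine:
  assumes "approx p n cs f h" "approx p n cs' f' h'"
  shows "approx p n (\<lambda>k. tscale a (cs k) @ tscale b (cs' k))
    (\<lambda>x. a * f x + b * f' x) (\<lambda>x. a * h x + b * h' x)"
  using assms unfolding approx_def
  by (auto simp: tensor_fun_combine intro!: l2_lim_combine)

lemma approx_tensor: "schwartz_tensor cs \<Longrightarrow> approx p n (\<lambda>_. cs) (tensor_fun n cs) (tensor_fun n (tensor_opA p cs))"
  by (auto simp: approx_def intro!: l2_lim_const)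

lemma approx_cong_AE:
  assumes "approx p n cs f h" "AE x in Rn n. f x = f' x" "f' \<in> borel_measurable (Rn n)"
  shows "approx p n cs f' h"
  using assms l2_lim_cong_AE[OF _ assms(2,3)] by (auto simp: approx_def)

text \<open>A limit of Schwartz tensors is tested by Schwartz tensors alone, so no density result is needed.\<close>

lemma tensor_limit_eq_0:
  assumes cs: "\<And>k. schwartz_tensor (cs k)" and lim: "l2_lim (Rn n) (\<lambda>k. tensor_fun n (cs k)) d"
    and orth: "\<And>es. schwartz_tensor es \<Longrightarrow> l2_inner (Rn n) d (tensor_fun n es) = 0"
  shows "AE x in Rn n. d x = 0"
proof -
  note d = l2_limD(2)[OF lim]
  have "l2_inner (Rn n) (tensor_fun n (cs k)) d = 0" for k
    using orth[OF cs[of k]] l2_inner_commute[of "Rn n" "tensor_fun n (cs k)" d] by simp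
  then have "l2_inner (Rn n) d d = 0"
    using l2_lim_inner[OF lim d] by (simp add: LIMSEQ_const_iff)
  then have "l2norm (Rn n) d = 0" using l2_inner_self[OF d] by simp
  with d show ?thesis by (rule l2norm_eq_0_AE)
qed

lemma tensor_opA_inner_commute:
  assumes "schwartz_tensor cs" "schwartz_tensor es"
  shows "l2_inner (Rn n) (tensor_fun n (tensor_opA p cs)) (tensor_fun n es) =
    l2_inner (Rn n) (tensor_fun n cs) (tensor_fun n (tensor_opA p es))"
proof -
  have "gram (\<lambda>\<phi> \<psi>. ip \<phi> \<psi> ^ n) (tensor_opA p cs) (tensor_opA 0 es) =
      gram (\<lambda>\<phi> \<psi>. ip \<phi> \<psi> ^ n) (tensor_opA 0 cs) (tensor_opA p es)"
    unfolding gram_tensor_opA using assms by (intro gram_cong) (simp_all add: ip_opA_pow_commute)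
  moreover have "tensor_opA 0 cs = cs" for cs by (induction cs) (auto simp: tensor_opA_def)
  ultimately show ?thesis using assms by (simp add: tensor_fun_inner)
qed

lemma approx_inner:
  assumes "approx p n cs f h" "schwartz_tensor es"
  shows "l2_inner (Rn n) h (tensor_fun n es) = l2_inner (Rn n) f (tensor_fun n (tensor_opA p es))"
proof -
  note a = approxD[OF assms(1)]
  have "(\<lambda>k. l2_inner (Rn n) (tensor_fun n (tensor_opA p (cs k))) (tensor_fun n es)) \<longlonglongrightarrow>
      l2_inner (Rn n) h (tensor_fun n es)"
    by (intro l2_lim_inner a tensor_fun_square_integrable assms)
  moreover have "(\<lambda>k. l2_inner (Rn n) (tensor_fun n (cs k)) (tensor_fun n (tensor_opA p es))) \<longlonglongrightarrow>
      l2_inner (Rn n) f (tensor_fun n (tensor_opA p es))"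
    by (intro l2_lim_inner a tensor_fun_square_integrable schwartz_tensor_opA assms)
  ultimately show ?thesis
    using tensor_opA_inner_commute[OF a(1) assms(2)] by (simp add: LIMSEQ_unique)
qed

text \<open>The operator is closable: by symmetry of \<open>A\<close> the difference of two images
  is orthogonal to all Schwartz tensors, and it is itself a limit of Schwartz tensors. This makes
  \<open>kernel_norm\<close> well defined.\<close>

lemma approx_unique:
  assumes "approx p n cs f h" "approx p n cs' f' h'" "AE x in Rn n. f x = f' x"
  shows "AE x in Rn n. h x = h' x"
proof -
  have c: "approx p n (\<lambda>k. tscale 1 (cs k) @ tscale (-1) (cs' k)) (\<lambda>x. f x - f' x) (\<lambda>x. h x - h' x)"
    using approx_combine[OF assms(1,2), of 1 "-1"] by simp
  have "AE x in Rn n. h x - h' x = 0"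
  proof (rule tensor_limit_eq_0)
    show "l2_lim (Rn n) (\<lambda>k. tensor_fun n (tensor_opA p (tscale 1 (cs k) @ tscale (-1) (cs' k)))) (\<lambda>x. h x - h' x)"
      by (rule approxD(3)[OF c])
    show "\<And>k. schwartz_tensor (tensor_opA p (tscale 1 (cs k) @ tscale (-1) (cs' k)))"
      using approxD(1)[OF c] by (rule schwartz_tensor_opA)
    fix es assume es: "schwartz_tensor es"
    have "(\<integral>x. (f x - f' x) * cnj (tensor_fun n (tensor_opA p es) x) \<partial>Rn n) = 0"
      using assms(3) by (intro integral_eq_zero_AE) auto
    then show "l2_inner (Rn n) (\<lambda>x. h x - h' x) (tensor_fun n es) = 0"
      using approx_inner[OF c es] by (simp add: l2_inner_def)
  qed
  then show ?thesis by simp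
qed

lemma kernel_norm_eq:
  assumes "approx p n cs f h"
  shows "kernel_norm p n f = l2norm (Rn n) h"
  unfolding kernel_norm_def
proof (rule the_equality)
  show "\<exists>h'. closed_opA p n f h' \<and> l2norm (Rn n) h = l2norm (Rn n) h'"
    using assms by (auto simp: closed_opA_approx)
  fix r assume "\<exists>h'. closed_opA p n f h' \<and> r = l2norm (Rn n) h'"
  then obtain h' cs' where h': "approx p n cs' f h'" "r = l2norm (Rn n) h'" by (auto simp: closed_opA_approx)
  have "AE x in Rn n. h' x = h x" by (rule approx_unique[OF h'(1) assms]) simp
  then show "r = l2norm (Rn n) h"
    unfolding h'(2) using approxD[OF assms] approxD[OF h'(1)]
    by (intro l2norm_cong_AE square_integrable_measurable)
qed

lemma kernel_norm_nonneg: "f \<in> kernel_space p n \<Longrightarrow> 0 \<le> kernel_norm p n f"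
  by (auto simp: kernel_space_approx kernel_norm_eq)

lemma kernel_space_square_integrable: "f \<in> kernel_space p n \<Longrightarrow> square_integrable (Rn n) f"
  by (auto simp: kernel_space_approx dest: approxD)

lemma kernel_space_cong_AE:
  assumes "f \<in> kernel_space p n" "AE x in Rn n. f x = f' x" "f' \<in> borel_measurable (Rn n)"
  shows "f' \<in> kernel_space p n" "kernel_norm p n f' = kernel_norm p n f"
proof -
  obtain cs h where a: "approx p n cs f h" using assms(1) by (auto simp: kernel_space_approx)
  have b: "approx p n cs f' h" by (rule approx_cong_AE[OF a assms(2,3)])
  then show "f' \<in> kernel_space p n" by (auto simp: kernel_space_approx)
  show "kernel_norm p n f' = kernel_norm p n f" by (simp add: kernel_norm_eq[OF a] kernel_norm_eq[OF b])
qed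

lemma kernel_space_lin:
  assumes "f \<in> kernel_space p n" "g \<in> kernel_space p n"
  shows "(\<lambda>x. a * f x + b * g x) \<in> kernel_space p n"
    "kernel_norm p n (\<lambda>x. a * f x + b * g x) \<le> cmod a * kernel_norm p n f + cmod b * kernel_norm p n g"
proof -
  obtain cs h cs' h' where 1: "approx p n cs f h" "approx p n cs' g h'"
    using assms by (auto simp: kernel_space_approx)
  note c = approx_combine[OF 1, of a b]
  then show "(\<lambda>x. a * f x + b * g x) \<in> kernel_space p n" by (auto simp: kernel_space_approx)
  have "l2norm (Rn n) (\<lambda>x. a * h x + b * h' x) \<le> l2norm (Rn n) (\<lambda>x. a * h x) + l2norm (Rn n) (\<lambda>x. b * h' x)"
    by (intro l2norm_triangle square_integrable_scale approxD[OF 1(1)] approxD[OF 1(2)])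
  then show "kernel_norm p n (\<lambda>x. a * f x + b * g x) \<le> cmod a * kernel_norm p n f + cmod b * kernel_norm p n g"
    by (simp only: kernel_norm_eq[OF c] kernel_norm_eq[OF 1(1)] kernel_norm_eq[OF 1(2)] l2norm_scale)
qed

lemma kernel_norm_tensor:
  assumes "schwartz_tensor cs"
  shows "tensor_fun n cs \<in> kernel_space p n"
    "kernel_norm p n (tensor_fun n cs) = l2norm (Rn n) (tensor_fun n (tensor_opA p cs))"
  using approx_tensor[OF assms] kernel_norm_eq[OF approx_tensor[OF assms]] by (auto simp: kernel_space_approx)

lemma kernel_norm_zero: "(\<lambda>_. 0) \<in> kernel_space p n" "kernel_norm p n (\<lambda>_. 0) = 0"
proof -
  have "tensor_fun n [] = (\<lambda>_. 0)" "tensor_opA p [] = []" by (simp_all add: tensor_fun_lin fun_eq_iff tensor_opA_def)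
  then show "(\<lambda>_. 0) \<in> kernel_space p n" "kernel_norm p n (\<lambda>_. 0) = 0"
    using kernel_norm_tensor[where cs="[]" and n=n and p=p] by auto
qed

text \<open>The sequences that witness membership for \<open>p\<close> and for \<open>q\<close> are
  unrelated, so the inequality for tensors has no common sequence to pass to the limit along.
  Instead the image \<open>h\<close> for \<open>p\<close> is tested against the tensors
  \<open>?A j\<close> that converge to it: symmetry moves the operator onto the sequence for
  \<open>q\<close>, where monotonicity applies, and \<open>j \<rightarrow> \<infinity>\<close>
  leaves \<open>\<parallel>h\<parallel>\<close> squared bounded by
  \<open>\<parallel>k\<parallel>\<close> times \<open>\<parallel>h\<parallel>\<close>.\<close>

lemma kernel_norm_mono:
  assumes "p \<le> q" "f \<in> kernel_space p n" "f \<in> kernel_space q n"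
  shows "kernel_norm p n f \<le> kernel_norm q n f"
proof -
  obtain cs h es k where 1: "approx p n cs f h" and 2: "approx q n es f k"
    using assms by (auto simp: kernel_space_approx)
  note a = approxD[OF 1] and b = approxD[OF 2]
  let ?A = "\<lambda>j. tensor_fun n (tensor_opA p (cs j))" and ?E = "\<lambda>j. tensor_fun n (tensor_opA p (es j))"
  have A: "square_integrable (Rn n) (?A j)" and E: "square_integrable (Rn n) (?E j)" for j
    using a(1) b(1) by (auto intro: tensor_fun_square_integrable)
  have le: "cmod (l2_inner (Rn n) h (?A j)) \<le> l2norm (Rn n) k * l2norm (Rn n) (?A j)" for j
  proof (rule tendsto_le)
    have "(\<lambda>i. l2_inner (Rn n) (tensor_fun n (es i)) (tensor_fun n (tensor_opA p (tensor_opA p (cs j))))) \<longlonglongrightarrow>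
        l2_inner (Rn n) f (tensor_fun n (tensor_opA p (tensor_opA p (cs j))))"
      by (intro l2_lim_inner b tensor_fun_square_integrable schwartz_tensor_opA a)
    moreover have "l2_inner (Rn n) (tensor_fun n (es i)) (tensor_fun n (tensor_opA p (tensor_opA p (cs j)))) =
        l2_inner (Rn n) (?E i) (?A j)" for i
      using tensor_opA_inner_commute[OF b(1) schwartz_tensor_opA[OF a(1)]] by simp
    ultimately show "(\<lambda>i. cmod (l2_inner (Rn n) (?E i) (?A j))) \<longlonglongrightarrow> cmod (l2_inner (Rn n) h (?A j))"
      using approx_inner[OF 1 schwartz_tensor_opA[OF a(1)], of p j] by (simp add: tendsto_norm)
    show "(\<lambda>i. l2norm (Rn n) (tensor_fun n (tensor_opA q (es i))) * l2norm (Rn n) (?A j)) \<longlonglongrightarrow>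
        l2norm (Rn n) k * l2norm (Rn n) (?A j)"
      by (intro tendsto_intros l2_lim_norm b)
    show "\<forall>\<^sub>F i in sequentially. cmod (l2_inner (Rn n) (?E i) (?A j)) \<le>
        l2norm (Rn n) (tensor_fun n (tensor_opA q (es i))) * l2norm (Rn n) (?A j)"
      by (intro always_eventually allI order_trans[OF cmod_l2_inner_le[OF E A]] mult_right_mono
          tensor_opA_norm_mono assms b) simp
  qed simp
  have "(\<lambda>j. cmod (l2_inner (Rn n) (?A j) h)) \<longlonglongrightarrow> cmod (l2_inner (Rn n) h h)"
    by (intro tendsto_norm l2_lim_inner a)
  then have "(\<lambda>j. cmod (l2_inner (Rn n) h (?A j))) \<longlonglongrightarrow> cmod (l2_inner (Rn n) h h)"
    by (subst l2_inner_commute) simp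
  moreover have "(\<lambda>j. l2norm (Rn n) k * l2norm (Rn n) (?A j)) \<longlonglongrightarrow> l2norm (Rn n) k * l2norm (Rn n) h"
    by (intro tendsto_intros l2_lim_norm a)
  ultimately have "cmod (l2_inner (Rn n) h h) \<le> l2norm (Rn n) k * l2norm (Rn n) h"
    by (rule LIMSEQ_le) (use le in auto)
  then have "l2norm (Rn n) h * l2norm (Rn n) h \<le> l2norm (Rn n) k * l2norm (Rn n) h"
    by (simp add: l2_inner_self[OF a(5)] norm_power power2_eq_square norm_mult)
  then have "l2norm (Rn n) h \<le> l2norm (Rn n) k"
    using l2norm_nonneg[of "Rn n" h] l2norm_nonneg[of "Rn n" k]
    by (cases "l2norm (Rn n) h = 0") (auto simp: mult_le_cancel_right)
  then show ?thesis by (simp only: kernel_norm_eq[OF 1] kernel_norm_eq[OF 2])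
qed

subsection \<open>Extension of bounded forms\<close>

definition ext :: "nat \<Rightarrow> nat \<Rightarrow> ((real \<Rightarrow> real) \<Rightarrow> complex) \<Rightarrow> kernel \<Rightarrow> complex" where
  "ext p n P f = (THE z. \<exists>cs h. approx p n cs f h \<and> (\<lambda>k. lin P (cs k)) \<longlonglongrightarrow> z)"

lemma hform_diff_le:
  assumes "hform p n P c" "schwartz_tensor cs" "schwartz_tensor es"
  shows "cmod (lin P cs - lin P es) \<le>
    c * l2norm (Rn n) (\<lambda>x. tensor_fun n (tensor_opA p cs) x - tensor_fun n (tensor_opA p es) x)"
proof -
  have "cmod (lin P (tscale 1 cs @ tscale (-1) es)) \<le>
      c * l2norm (Rn n) (tensor_fun n (tensor_opA p (tscale 1 cs @ tscale (-1) es)))"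
    using assms by (auto simp: hform_def simp del: lin_append tensor_opA_append)
  then show ?thesis by (simp add: tensor_fun_combine)
qed

text \<open>The bound of the form turns convergence of the images under the operator into the Cauchy
  property of the values. Two sequences for the same kernel have images with the same limit by
  \<open>approx_unique\<close>, so their values differ by a null sequence.\<close>

lemma ext_tendsto:
  assumes P: "hform p n P c" and a: "approx p n cs f h"
  shows "(\<lambda>k. lin P (cs k)) \<longlonglongrightarrow> ext p n P f"
proof -
  have c: "0 \<le> c" using P by (simp add: hform_def)
  note A = approxD[OF a]
  let ?A = "\<lambda>k. tensor_fun n (tensor_opA p (cs k))"
  have A2: "square_integrable (Rn n) (?A k)" for k using A(1) by (auto intro: tensor_fun_square_integrable)
  define e where "e k = c * l2norm (Rn n) (\<lambda>x. ?A k x - h x)" for k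
  have e: "e \<longlonglongrightarrow> 0" unfolding e_def[abs_def] using l2_limD(3)[OF A(3)] by (auto intro!: tendsto_eq_intros)
  have le: "cmod (lin P (cs j) - lin P (cs k)) \<le> e j + e k" for j k
  proof -
    have "l2norm (Rn n) (\<lambda>x. ?A j x - ?A k x) \<le> l2norm (Rn n) (\<lambda>x. ?A j x - h x) + l2norm (Rn n) (\<lambda>x. h x - ?A k x)"
      using l2norm_triangle[OF square_integrable_diff[OF A2 A(5)] square_integrable_diff[OF A(5) A2], of j k] by simp
    then have "l2norm (Rn n) (\<lambda>x. ?A j x - ?A k x) \<le> l2norm (Rn n) (\<lambda>x. ?A j x - h x) + l2norm (Rn n) (\<lambda>x. ?A k x - h x)"
      by (subst (2) l2norm_diff_commute)
    from mult_left_mono[OF this c] hform_diff_le[OF P A(1) A(1), of j k] show ?thesis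
      by (simp add: e_def algebra_simps)
  qed
  have "Cauchy (\<lambda>k. lin P (cs k))"
  proof (rule metric_CauchyI)
    fix r :: real assume "0 < r"
    then obtain N where N: "\<And>k. k \<ge> N \<Longrightarrow> \<bar>e k\<bar> < r / 2"
      using LIMSEQ_D[OF e, of "r/2"] by auto
    show "\<exists>M. \<forall>m\<ge>M. \<forall>n\<ge>M. dist (lin P (cs m)) (lin P (cs n)) < r"
    proof (intro exI allI impI)
      fix j k assume "j \<ge> N" "k \<ge> N"
      then show "dist (lin P (cs j)) (lin P (cs k)) < r"
        using le[of j k] N[of j] N[of k] by (simp add: dist_norm)
    qed
  qed
  then obtain z where z: "(\<lambda>k. lin P (cs k)) \<longlonglongrightarrow> z"
    using Cauchy_convergent convergent_def by blast
  have "ext p n P f = z"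
    unfolding ext_def
  proof (rule the_equality)
    show "\<exists>cs h. approx p n cs f h \<and> (\<lambda>k. lin P (cs k)) \<longlonglongrightarrow> z" using a z by blast
    fix z' assume "\<exists>cs h. approx p n cs f h \<and> (\<lambda>k. lin P (cs k)) \<longlonglongrightarrow> z'"
    then obtain cs' h' where a': "approx p n cs' f h'" and z': "(\<lambda>k. lin P (cs' k)) \<longlonglongrightarrow> z'" by blast
    note A' = approxD[OF a']
    have "l2_lim (Rn n) (\<lambda>k x. ?A k x - tensor_fun n (tensor_opA p (cs' k)) x) (\<lambda>x. h x - h' x)"
      by (rule l2_lim_diff[OF A(3) A'(3)])
    from l2_lim_norm[OF this]
    have "(\<lambda>k. c * l2norm (Rn n) (\<lambda>x. ?A k x - tensor_fun n (tensor_opA p (cs' k)) x)) \<longlonglongrightarrow>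
        c * l2norm (Rn n) (\<lambda>x. h x - h' x)" by (intro tendsto_intros)
    moreover have "l2norm (Rn n) (\<lambda>x. h x - h' x) = l2norm (Rn n) (\<lambda>_. 0 :: complex)"
      using approx_unique[OF a a'] A A'
      by (intro l2norm_cong_AE square_integrable_measurable square_integrable_diff) auto
    ultimately have "(\<lambda>k. c * l2norm (Rn n) (\<lambda>x. ?A k x - tensor_fun n (tensor_opA p (cs' k)) x)) \<longlonglongrightarrow> 0" by simp
    then have "(\<lambda>k. lin P (cs k) - lin P (cs' k)) \<longlonglongrightarrow> 0"
      by (rule Lim_null_comparison[rotated]) (use hform_diff_le[OF P A(1) A'(1)] in auto)
    moreover have "(\<lambda>k. lin P (cs k) - lin P (cs' k)) \<longlonglongrightarrow> z - z'" by (intro tendsto_intros z z')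
    ultimately show "z' = z" using LIMSEQ_unique by fastforce
  qed
  with z show ?thesis by simp
qed

lemma ext_le:
  assumes P: "hform p n P c" and f: "f \<in> kernel_space p n"
  shows "cmod (ext p n P f) \<le> c * kernel_norm p n f"
proof -
  obtain cs h where a: "approx p n cs f h" using f by (auto simp: kernel_space_approx)
  note A = approxD[OF a]
  have 1: "(\<lambda>k. cmod (lin P (cs k))) \<longlonglongrightarrow> cmod (ext p n P f)"
    by (intro tendsto_norm ext_tendsto[OF P a])
  have 2: "(\<lambda>k. c * l2norm (Rn n) (tensor_fun n (tensor_opA p (cs k)))) \<longlonglongrightarrow> c * l2norm (Rn n) h"
    by (intro tendsto_intros l2_lim_norm A)
  have "cmod (lin P (cs k)) \<le> c * l2norm (Rn n) (tensor_fun n (tensor_opA p (cs k)))" for k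
    using P A(1) by (auto simp: hform_def)
  then have "cmod (ext p n P f) \<le> c * l2norm (Rn n) h"
    by (intro tendsto_le[OF _ 2 1]) auto
  then show ?thesis by (simp only: kernel_norm_eq[OF a])
qed

lemma ext_lin:
  assumes P: "hform p n P c" and f: "f \<in> kernel_space p n" "g \<in> kernel_space p n"
  shows "ext p n P (\<lambda>x. a * f x + b * g x) = a * ext p n P f + b * ext p n P g"
proof -
  obtain cs h cs' h' where 1: "approx p n cs f h" and 2: "approx p n cs' g h'"
    using f by (auto simp: kernel_space_approx)
  have "(\<lambda>k. lin P (tscale a (cs k) @ tscale b (cs' k))) \<longlonglongrightarrow> ext p n P (\<lambda>x. a * f x + b * g x)"
    by (rule ext_tendsto[OF P approx_combine[OF 1 2]])
  moreover have "(\<lambda>k. a * lin P (cs k) + b * lin P (cs' k)) \<longlonglongrightarrow> a * ext p n P f + b * ext p n P g"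
    by (intro tendsto_intros ext_tendsto[OF P 1] ext_tendsto[OF P 2])
  ultimately show ?thesis using LIMSEQ_unique by fastforce
qed

lemma ext_form_lin:
  assumes P: "hform p n P c" and Q: "hform p n Q d" and f: "f \<in> kernel_space p n"
  shows "ext p n (\<lambda>\<phi>. a * P \<phi> + b * Q \<phi>) f = a * ext p n P f + b * ext p n Q f"
proof -
  obtain cs h where 1: "approx p n cs f h"
    using f by (auto simp: kernel_space_approx)
  have "(\<lambda>k. lin (\<lambda>\<phi>. a * P \<phi> + b * Q \<phi>) (cs k)) \<longlonglongrightarrow> ext p n (\<lambda>\<phi>. a * P \<phi> + b * Q \<phi>) f"
    by (rule ext_tendsto[OF hform_lin[OF P Q] 1])
  moreover have "(\<lambda>k. a * lin P (cs k) + b * lin Q (cs k)) \<longlonglongrightarrow> a * ext p n P f + b * ext p n Q f"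
    by (intro tendsto_intros ext_tendsto[OF P 1] ext_tendsto[OF Q 1])
  ultimately show ?thesis using LIMSEQ_unique by (fastforce simp: lin_lin)
qed

lemma ext_cong_AE:
  assumes P: "hform p n P c" and f: "f \<in> kernel_space p n" "AE x in Rn n. f x = f' x" "f' \<in> borel_measurable (Rn n)"
  shows "ext p n P f' = ext p n P f"
proof -
  obtain cs h where 1: "approx p n cs f h" using f by (auto simp: kernel_space_approx)
  show ?thesis
    using LIMSEQ_unique[OF ext_tendsto[OF P 1] ext_tendsto[OF P approx_cong_AE[OF 1 f(2,3)]]] by simp
qed

lemma ext_tensor:
  assumes "hform p n P c" "schwartz_tensor cs"
  shows "ext p n P (tensor_fun n cs) = lin P cs"
  using ext_tendsto[OF assms(1) approx_tensor[OF assms(2)]] by (simp add: LIMSEQ_const_iff)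

text \<open>Recognises an extended form as integration against a square integrable kernel, which is
  how membership in \<open>space_G\<close> is verified.\<close>

lemma ext_integral:
  assumes P: "hform p n P c" and f: "f \<in> kernel_space p n" and g: "square_integrable (Rn n) g"
    and eq: "\<And>cs. schwartz_tensor cs \<Longrightarrow> lin P cs = (\<integral>x. g x * tensor_fun n cs x \<partial>Rn n)"
  shows "ext p n P f = (\<integral>x. g x * f x \<partial>Rn n)"
proof -
  obtain cs h where 1: "approx p n cs f h" using f by (auto simp: kernel_space_approx)
  note A = approxD[OF 1]
  have i: "l2_inner (Rn n) k (\<lambda>x. cnj (g x)) = (\<integral>x. g x * k x \<partial>Rn n)" for k
    by (simp add: l2_inner_def mult.commute)
  have "(\<lambda>k. l2_inner (Rn n) (tensor_fun n (cs k)) (\<lambda>x. cnj (g x))) \<longlonglongrightarrow> l2_inner (Rn n) f (\<lambda>x. cnj (g x))"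
    by (intro l2_lim_inner A square_integrable_cnj g)
  then have "(\<lambda>k. lin P (cs k)) \<longlonglongrightarrow> (\<integral>x. g x * f x \<partial>Rn n)"
    unfolding i using eq[OF A(1)] by simp
  with ext_tendsto[OF P 1] show ?thesis using LIMSEQ_unique by blast
qed

section \<open>Gaussian analysis\<close>

text \<open>The sums are required for nonzero \<open>a\<close> only, so that after the constant term
  has been removed the series may be divided by \<open>a\<close> and the induction continues with
  the shifted coefficients.\<close>

lemma powser_real_eq_0:
  fixes c :: "nat \<Rightarrow> real"
  assumes "\<And>a. a \<noteq> 0 \<Longrightarrow> (\<lambda>n. c n * a ^ n) sums 0"
  shows "c n = 0"
  using assms
proof (induction n arbitrary: c)
  case 0
  have "((\<lambda>_::real. 0) \<longlongrightarrow> c 0) (at 0)"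
    by (rule powser_limit_0_strong[of 1]) (use 0 in auto)
  then show ?case by (simp add: tendsto_const_iff)
next
  case (Suc n)
  have c0: "c 0 = 0"
  proof -
    have "((\<lambda>_::real. 0) \<longlongrightarrow> c 0) (at 0)"
      by (rule powser_limit_0_strong[of 1]) (use Suc.prems in auto)
    then show ?thesis by (simp add: tendsto_const_iff)
  qed
  have "(\<lambda>n. c (Suc n) * a ^ n) sums 0" if "a \<noteq> 0" for a
  proof -
    have "(\<lambda>n. c (Suc n) * a ^ Suc n) sums 0"
      using Suc.prems[OF that] by (subst sums_Suc_iff) (simp add: c0)
    from sums_mult[OF this, of "1 / a"] show ?thesis using that by (simp add: field_simps)
  qed
  from Suc.IH[OF this] show ?case .
qed

lemma powser_eq_0:
  fixes c :: "nat \<Rightarrow> complex"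
  assumes "\<And>a::real. (\<lambda>n. of_real (a ^ n) * c n) sums 0"
  shows "c n = 0"
proof -
  have "(\<lambda>n. Re (c n) * a ^ n) sums 0" "(\<lambda>n. Im (c n) * a ^ n) sums 0" for a
    using sums_Re[OF assms[of a]] sums_Im[OF assms[of a]] by (simp_all add: mult.commute)
  from powser_real_eq_0[of "\<lambda>n. Re (c n)", OF this(1)] powser_real_eq_0[of "\<lambda>n. Im (c n)", OF this(2)]
  show ?thesis by (intro complex_eqI) auto
qed

lemma powser_exp_coeff:
  fixes c :: "nat \<Rightarrow> real"
  assumes "\<And>a. (\<lambda>n. a ^ n * c n) sums exp (a * t)"
  shows "c n = t ^ n / fact n"
proof -
  have "(\<lambda>n. (c n - t ^ n / fact n) * a ^ n) sums 0" for a
    using sums_diff[OF assms[of a] exp_converges[of "a * t"]]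
    by (simp add: algebra_simps power_mult_distrib divide_inverse)
  from powser_real_eq_0[of "\<lambda>n. c n - t ^ n / fact n", OF this] show ?thesis by simp
qed

section \<open>Hermite polynomials and their generating function\<close>

definition hermite_coeff :: "real \<Rightarrow> real \<Rightarrow> nat \<Rightarrow> real" where
  "hermite_coeff w x n = (\<Sum>k\<le>n div 2. w ^ k / fact k * (x ^ (n - 2 * k) / fact (n - 2 * k)))"

lemma wick_power_hermite:
  "wick_power n \<phi> \<omega> = fact n * hermite_coeff (- (1/2) * (l2norm lborel \<phi>)\<^sup>2) (\<omega> \<phi>) n"
  unfolding wick_power_def hermite_coeff_def sum_distrib_left
  by (intro sum.cong refl) (simp add: field_simps)

text \<open>The Cauchy product of the series of \<open>exp (z * x)\<close> and
  \<open>exp (z\<^sup>2 * w)\<close>. With \<open>w\<close> equal to minus half the squared norm of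
  \<phi>, the right side is the Wick exponential and the coefficients are the Wick powers divided by
  \<open>fact n\<close>.\<close>

lemma hermite_coeff_sums:
  "(\<lambda>n. z ^ n * hermite_coeff w x n) sums exp (z * x + z\<^sup>2 * w)"
proof -
  \<comment> \<open>The series of \<open>exp (z\<^sup>2 * w)\<close> spread over the even indices,
    so that it can enter a Cauchy product in powers of \<open>z\<close>.\<close>
  define b where "b j = (if even j then (z\<^sup>2 * w) ^ (j div 2) / fact (j div 2) else 0)" for j
  define a where "a j = (z * x) ^ j / fact j" for j
  have sa: "summable (\<lambda>k. norm (a k))" using summable_norm_exp[of "z * x"] by (simp add: a_def divide_inverse mult.commute)
  have ea: "(\<Sum>k. a k) = exp (z * x)" by (simp add: a_def exp_def divide_inverse mult.commute)
  have e: "(\<lambda>k. y ^ k / fact k) sums exp y" for y :: real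
    using exp_converges[of y] by (simp add: divide_inverse mult.commute)
  have even_sums: "(\<lambda>k. if even k then y ^ (k div 2) / fact (k div 2) else 0) sums exp y" for y :: real
  proof (subst sums_mono_reindex[where g = "\<lambda>k. 2 * k", symmetric])
    show "strict_mono (\<lambda>k::nat. 2 * k)" by (simp add: strict_mono_def)
    show "(\<lambda>k. if even (2 * k) then y ^ (2 * k div 2) / fact (2 * k div 2) else 0) sums exp y"
      using e by simp
  qed (auto simp: image_iff elim!: evenE)
  have bb: "b sums exp (z\<^sup>2 * w)" unfolding b_def[abs_def] by (rule even_sums)
  have "(\<lambda>k. if even k then \<bar>z\<^sup>2 * w\<bar> ^ (k div 2) / fact (k div 2) else 0) sums exp \<bar>z\<^sup>2 * w\<bar>"
    by (rule even_sums)
  moreover have "(\<lambda>k. if even k then \<bar>z\<^sup>2 * w\<bar> ^ (k div 2) / fact (k div 2) else 0) = (\<lambda>k. norm (b k))"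
    by (auto simp: b_def fun_eq_iff abs_mult power_mult_distrib power_abs)
  ultimately have sb: "summable (\<lambda>k. norm (b k))" by (simp add: sums_iff)
  have "(\<lambda>n. \<Sum>i\<le>n. b i * a (n - i)) sums ((\<Sum>k. b k) * (\<Sum>k. a k))"
    by (rule Cauchy_product_sums[OF sb sa])
  moreover have "(\<Sum>i\<le>n. b i * a (n - i)) = z ^ n * hermite_coeff w x n" for n
  proof -
    have "(\<Sum>i\<le>n. b i * a (n - i)) = (\<Sum>i\<in>(\<lambda>k. 2 * k) ` {..n div 2}. b i * a (n - i))"
    proof (rule sum.mono_neutral_right)
      show "(\<lambda>k. 2 * k) ` {..n div 2} \<subseteq> {..n}" by auto
      show "\<forall>i\<in>{..n} - (\<lambda>k. 2 * k) ` {..n div 2}. b i * a (n - i) = 0"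
      proof
        fix i assume i: "i \<in> {..n} - (\<lambda>k. 2 * k) ` {..n div 2}"
        have "odd i"
        proof
          assume "even i"
          then have "i = 2 * (i div 2)" "i div 2 \<le> n div 2" using i by (auto simp: div_le_mono)
          with i show False by blast
        qed
        then show "b i * a (n - i) = 0" by (simp add: b_def)
      qed
    qed simp
    also have "\<dots> = (\<Sum>k\<le>n div 2. b (2 * k) * a (n - 2 * k))"
      by (subst sum.reindex) (auto simp: inj_on_def)
    also have "\<dots> = z ^ n * hermite_coeff w x n"
      unfolding hermite_coeff_def sum_distrib_left
    proof (rule sum.cong[OF refl])
      fix k assume "k \<in> {..n div 2}"
      then have "n = 2 * k + (n - 2 * k)" by auto
      then have "z ^ n = (z\<^sup>2) ^ k * z ^ (n - 2 * k)" by (metis power_add power_mult)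
      then show "b (2 * k) * a (n - 2 * k) = z ^ n * (w ^ k / fact k * (x ^ (n - 2 * k) / fact (n - 2 * k)))"
        by (simp add: a_def b_def power_mult_distrib)
    qed
    finally show ?thesis .
  qed
  ultimately show ?thesis using bb ea by (simp add: sums_iff exp_add mult.commute)
qed

lemma hermite_coeff_abs_le: "\<bar>hermite_coeff w x n\<bar> \<le> hermite_coeff \<bar>w\<bar> \<bar>x\<bar> n"
  unfolding hermite_coeff_def
  by (rule order_trans[OF sum_abs]) (simp add: abs_mult power_abs)

lemma hermite_coeff_nonneg: "0 \<le> hermite_coeff \<bar>w\<bar> \<bar>x\<bar> n"
  using hermite_coeff_abs_le[of w x n] by linarith

text \<open>Absolute values turn the partial sum into one of a nonnegative series with a known sum.
  The bound does not depend on the number of terms and serves as the majorant in dominated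
  convergence.\<close>

lemma hermite_partial_sum_le:
  "\<bar>\<Sum>n<N. z ^ n * hermite_coeff w x n\<bar> \<le> exp (\<bar>z\<bar> * \<bar>x\<bar> + z\<^sup>2 * \<bar>w\<bar>)"
proof -
  have "\<bar>\<Sum>n<N. z ^ n * hermite_coeff w x n\<bar> \<le> (\<Sum>n<N. \<bar>z\<bar> ^ n * hermite_coeff \<bar>w\<bar> \<bar>x\<bar> n)"
    by (rule order_trans[OF sum_abs]) (auto intro!: sum_mono mult_left_mono hermite_coeff_abs_le simp: abs_mult power_abs)
  also have "\<dots> \<le> (\<Sum>n. \<bar>z\<bar> ^ n * hermite_coeff \<bar>w\<bar> \<bar>x\<bar> n)"
    using hermite_coeff_sums[of "\<bar>z\<bar>" "\<bar>w\<bar>" "\<bar>x\<bar>"]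
    by (intro sum_le_suminf) (auto simp: sums_iff hermite_coeff_nonneg)
  also have "\<dots> = exp (\<bar>z\<bar> * \<bar>x\<bar> + z\<^sup>2 * \<bar>w\<bar>)"
    using hermite_coeff_sums[of "\<bar>z\<bar>" "\<bar>w\<bar>" "\<bar>x\<bar>"] by (simp add: sums_iff)
  finally show ?thesis .
qed

lemma hermite_coeff_le: "\<bar>hermite_coeff w x n\<bar> \<le> exp (\<bar>x\<bar> + \<bar>w\<bar>)"
proof -
  have "\<bar>hermite_coeff w x n\<bar> \<le> hermite_coeff \<bar>w\<bar> \<bar>x\<bar> n" by (rule hermite_coeff_abs_le)
  also have "\<dots> \<le> (\<Sum>n<Suc n. 1 ^ n * hermite_coeff \<bar>w\<bar> \<bar>x\<bar> n)"
    using sum_nonneg[of "{..<n}" "hermite_coeff \<bar>w\<bar> \<bar>x\<bar>"] hermite_coeff_nonneg by simp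
  also have "\<dots> \<le> exp (\<bar>1\<bar> * \<bar>\<bar>x\<bar>\<bar> + 1\<^sup>2 * \<bar>\<bar>w\<bar>\<bar>)"
    using hermite_partial_sum_le[of 1 "\<bar>w\<bar>" "\<bar>x\<bar>" "Suc n"] by linarith
  finally show ?thesis by simp
qed

lemma std_normal_exp:
  "integrable lborel (\<lambda>x. std_normal_density x * exp (s * x))"
  "(\<integral>x. std_normal_density x * exp (s * x) \<partial>lborel) = exp (s\<^sup>2 / 2)"
proof -
  have "std_normal_density x * exp (s * x) = exp (s\<^sup>2 / 2) * normal_density s 1 x" for x
  proof -
    have "- x\<^sup>2 / 2 + s * x = s\<^sup>2 / 2 + (- (x - s)\<^sup>2 / 2)" by (simp add: power2_eq_square field_simps)
    then have "exp (- x\<^sup>2 / 2) * exp (s * x) = exp (s\<^sup>2 / 2) * exp (- (x - s)\<^sup>2 / 2)"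
      by (simp only: exp_add[symmetric])
    then show ?thesis by (simp add: normal_density_def)
  qed
  then show "integrable lborel (\<lambda>x. std_normal_density x * exp (s * x))"
    "(\<integral>x. std_normal_density x * exp (s * x) \<partial>lborel) = exp (s\<^sup>2 / 2)" by simp_all
qed

section \<open>The Gaussian law of the evaluations\<close>

locale white_noise_space =
  fixes M :: "functional measure"
  assumes white_noise: "white_noise_measure M"
begin

sublocale prob_space M
  using white_noise by (simp add: white_noise_measure_def)

lemma space_M: "space M = tempered"
  using white_noise by (simp add: white_noise_measure_def)

lemma eval_measurable:
  assumes "\<phi> \<in> schwartz" shows "(\<lambda>\<omega>. \<omega> \<phi>) \<in> borel_measurable M"
proof (rule measurableI)
  fix B :: "real set" assume B: "B \<in> sets borel"
  have "{\<omega> \<in> tempered. \<omega> \<phi> \<in> B} \<in> sets M"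
    using white_noise assms B by (auto simp: white_noise_measure_def intro!: sigma_sets.Basic)
  moreover have "(\<lambda>\<omega>. \<omega> \<phi>) -` B \<inter> space M = {\<omega> \<in> tempered. \<omega> \<phi> \<in> B}" by (auto simp: space_M)
  ultimately show "(\<lambda>\<omega>. \<omega> \<phi>) -` B \<inter> space M \<in> sets M" by simp
qed simp

lemma eval_lin:
  "\<omega> \<in> space M \<Longrightarrow> \<phi> \<in> schwartz \<Longrightarrow> \<psi> \<in> schwartz \<Longrightarrow> \<omega> (\<lambda>x. a * \<phi> x + b * \<psi> x) = a * \<omega> \<phi> + b * \<omega> \<psi>"
  by (auto simp: space_M tempered_def)

lemma eval_scale: "\<omega> \<in> space M \<Longrightarrow> \<phi> \<in> schwartz \<Longrightarrow> \<omega> (\<lambda>x. a * \<phi> x) = a * \<omega> \<phi>"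
  using eval_lin[of \<omega> \<phi> \<phi> a 0] by simp

text \<open>The characteristic functional at \<open>t\<close> times \<phi> is the characteristic
  function of the evaluation at \<open>t\<close>. Writing the law as an image of the standard normal
  distribution includes the degenerate case of norm 0.\<close>

lemma eval_distr:
  assumes "\<phi> \<in> schwartz"
  shows "distr M borel (\<lambda>\<omega>. \<omega> \<phi>) = distr std_normal_distribution borel (\<lambda>x. l2norm lborel \<phi> * x)"
proof (rule Levy_uniqueness)
  let ?v = "l2norm lborel \<phi>"
  note m = eval_measurable[OF assms]
  interpret N: real_distribution std_normal_distribution by (rule real_dist_normal_dist)
  show "real_distribution (distr M borel (\<lambda>\<omega>. \<omega> \<phi>))"
    using m by (simp add: real_distribution_distr)
  show "real_distribution (distr std_normal_distribution borel (\<lambda>x. ?v * x))"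
    by (intro N.real_distribution_distr) simp
  show "char (distr M borel (\<lambda>\<omega>. \<omega> \<phi>)) = char (distr std_normal_distribution borel (\<lambda>x. ?v * x))"
  proof
    fix t
    have "char (distr M borel (\<lambda>\<omega>. \<omega> \<phi>)) t = (\<integral>\<omega>. iexp (t * \<omega> \<phi>) \<partial>M)"
      unfolding char_def using m by (subst integral_distr) auto
    also have "\<dots> = (\<integral>\<omega>. exp (\<i> * complex_of_real (\<omega> (\<lambda>x. t * \<phi> x))) \<partial>M)"
      by (intro Bochner_Integration.integral_cong) (auto simp: eval_scale assms)
    also have "\<dots> = exp (- (1/2) * complex_of_real ((l2norm lborel (\<lambda>x. t * \<phi> x))\<^sup>2))"
      using white_noise schwartz_scale[OF assms] unfolding white_noise_measure_def by blast
    also have "\<dots> = complex_of_real (exp (- ((t * ?v)\<^sup>2) / 2))"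
      unfolding l2norm_scale by (simp add: power_mult_distrib flip: exp_of_real)
    also have "\<dots> = char std_normal_distribution (t * ?v)" by (simp add: char_std_normal_distribution)
    also have "\<dots> = char (distr std_normal_distribution borel (\<lambda>x. ?v * x)) t"
      unfolding char_def by (subst integral_distr) (auto simp: mult.assoc)
    finally show "char (distr M borel (\<lambda>\<omega>. \<omega> \<phi>)) t = char (distr std_normal_distribution borel (\<lambda>x. ?v * x)) t" .
  qed
qed

lemma exp_eval:
  assumes "\<phi> \<in> schwartz"
  shows "integrable M (\<lambda>\<omega>. exp (\<omega> \<phi>))" "(\<integral>\<omega>. exp (\<omega> \<phi>) \<partial>M) = exp ((l2norm lborel \<phi>)\<^sup>2 / 2)"
proof -
  let ?v = "l2norm lborel \<phi>"
  note m = eval_measurable[OF assms]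
  have "integrable (distr std_normal_distribution borel (\<lambda>x. ?v * x)) exp"
    by (subst integrable_distr_eq) (auto simp: integrable_density std_normal_exp)
  then show "integrable M (\<lambda>\<omega>. exp (\<omega> \<phi>))"
    unfolding eval_distr[OF assms, symmetric] using m by (simp add: integrable_distr_eq)
  have "(\<integral>\<omega>. exp (\<omega> \<phi>) \<partial>M) = (\<integral>x. exp x \<partial>distr M borel (\<lambda>\<omega>. \<omega> \<phi>))"
    using m by (subst integral_distr) auto
  also have "\<dots> = (\<integral>x. std_normal_density x * exp (?v * x) \<partial>lborel)"
    unfolding eval_distr[OF assms] by (simp add: integral_distr integral_density)
  finally show "(\<integral>\<omega>. exp (\<omega> \<phi>) \<partial>M) = exp (?v\<^sup>2 / 2)" by (simp add: std_normal_exp)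
qed

text \<open>The exponential of an absolute value is at most the sum of the two exponentials without
  it, and those are integrable by \<open>exp_eval\<close>.\<close>

lemma exp_abs_square_integrable:
  assumes "\<phi> \<in> schwartz"
  shows "square_integrable M (\<lambda>\<omega>. exp (c * \<bar>\<omega> \<phi>\<bar> + d) :: real)"
proof -
  note m = eval_measurable[OF assms]
  have "integrable M (\<lambda>\<omega>. (norm (exp (c * \<bar>\<omega> \<phi>\<bar> + d) :: real))\<^sup>2)"
  proof (rule Bochner_Integration.integrable_bound)
    show "integrable M (\<lambda>\<omega>. exp (2 * d) * (exp (\<omega> (\<lambda>x. (2 * c) * \<phi> x)) + exp (\<omega> (\<lambda>x. (- 2 * c) * \<phi> x))))"
      using exp_eval(1)[OF schwartz_scale[OF assms]] by (intro integrable_mult_right Bochner_Integration.integrable_add)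
    show "AE \<omega> in M. norm ((norm (exp (c * \<bar>\<omega> \<phi>\<bar> + d) :: real))\<^sup>2) \<le>
        norm (exp (2 * d) * (exp (\<omega> (\<lambda>x. (2 * c) * \<phi> x)) + exp (\<omega> (\<lambda>x. (- 2 * c) * \<phi> x))))"
    proof (rule AE_I2)
      fix \<omega> assume "\<omega> \<in> space M"
      then have e: "\<omega> (\<lambda>x. (2 * c) * \<phi> x) = 2 * c * \<omega> \<phi>" "\<omega> (\<lambda>x. (- 2 * c) * \<phi> x) = - 2 * c * \<omega> \<phi>"
        using eval_scale assms by blast+
      have "(exp (c * \<bar>\<omega> \<phi>\<bar> + d))\<^sup>2 = exp (2 * d) * exp (2 * c * \<bar>\<omega> \<phi>\<bar>)"
        by (simp add: power2_eq_square algebra_simps flip: exp_add)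
      also have "\<dots> \<le> exp (2 * d) * (exp (2 * c * \<omega> \<phi>) + exp (- 2 * c * \<omega> \<phi>))"
        by (intro mult_left_mono) (auto simp: abs_if)
      finally show "norm ((norm (exp (c * \<bar>\<omega> \<phi>\<bar> + d) :: real))\<^sup>2) \<le>
        norm (exp (2 * d) * (exp (\<omega> (\<lambda>x. (2 * c) * \<phi> x)) + exp (\<omega> (\<lambda>x. (- 2 * c) * \<phi> x))))"
        unfolding e by simp
    qed
  qed (use m in measurable)
  then show ?thesis using m unfolding square_integrable_def by (auto intro!: borel_measurable_exp borel_measurable_add borel_measurable_times)
qed

lemma wick_power_measurable:
  assumes "\<phi> \<in> schwartz"
  shows "wick_power n \<phi> \<in> borel_measurable M"
  unfolding wick_power_def[abs_def] using eval_measurable[OF assms] by measurable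

lemma wick_power_square_integrable:
  assumes "\<phi> \<in> schwartz"
  shows "square_integrable M (wick_power n \<phi>)"
proof -
  let ?w = "- (1/2) * (l2norm lborel \<phi>)\<^sup>2"
  have "integrable M (\<lambda>\<omega>. (norm (wick_power n \<phi> \<omega>))\<^sup>2)"
  proof (rule Bochner_Integration.integrable_bound)
    show "integrable M (\<lambda>\<omega>. (fact n)\<^sup>2 * (norm (exp (1 * \<bar>\<omega> \<phi>\<bar> + \<bar>?w\<bar>)))\<^sup>2)"
      by (intro integrable_mult_right square_integrable_integrable exp_abs_square_integrable assms)
    show "(\<lambda>\<omega>. (norm (wick_power n \<phi> \<omega>))\<^sup>2) \<in> borel_measurable M"
      using wick_power_measurable[OF assms] by measurable
    show "AE \<omega> in M. norm ((norm (wick_power n \<phi> \<omega>))\<^sup>2) \<le> norm ((fact n)\<^sup>2 * (norm (exp (1 * \<bar>\<omega> \<phi>\<bar> + \<bar>?w\<bar>)))\<^sup>2)"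
    proof (rule AE_I2)
      fix \<omega>
      have "\<bar>wick_power n \<phi> \<omega>\<bar> \<le> fact n * exp (1 * \<bar>\<omega> \<phi>\<bar> + \<bar>?w\<bar>)"
        unfolding wick_power_hermite abs_mult using hermite_coeff_le[of ?w "\<omega> \<phi>" n] by (intro mult_mono) auto
      then have "\<bar>wick_power n \<phi> \<omega>\<bar>\<^sup>2 \<le> (fact n * exp (1 * \<bar>\<omega> \<phi>\<bar> + \<bar>?w\<bar>))\<^sup>2" by (intro power_mono) auto
      then show "norm ((norm (wick_power n \<phi> \<omega>))\<^sup>2) \<le> norm ((fact n)\<^sup>2 * (norm (exp (1 * \<bar>\<omega> \<phi>\<bar> + \<bar>?w\<bar>)))\<^sup>2)"
        by (simp add: power_mult_distrib)
    qed
  qed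
  with wick_power_measurable[OF assms] show ?thesis by (simp add: square_integrable_def)
qed

text \<open>Closed form of the Wick exponential of \<open>a\<close> times \<phi>; the scalar
  \<open>a\<close> is kept apart as the variable of power series.\<close>

definition gauss_exp :: "real \<Rightarrow> (real \<Rightarrow> real) \<Rightarrow> functional \<Rightarrow> real" where
  "gauss_exp a \<phi> \<omega> = exp (a * \<omega> \<phi> - a\<^sup>2 * (l2norm lborel \<phi>)\<^sup>2 / 2)"

lemma wick_power_sums: "(\<lambda>n. a ^ n * (wick_power n \<phi> \<omega> / fact n)) sums gauss_exp a \<phi> \<omega>"
  using hermite_coeff_sums[of a "- (1/2) * (l2norm lborel \<phi>)\<^sup>2" "\<omega> \<phi>"]
  by (simp add: wick_power_hermite gauss_exp_def)

lemma gauss_exp_square_integrable: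
  assumes "\<phi> \<in> schwartz"
  shows "square_integrable M (gauss_exp a \<phi>)"
proof -
  have m: "gauss_exp a \<phi> \<in> borel_measurable M"
    unfolding gauss_exp_def[abs_def] using eval_measurable[OF assms] by measurable
  have "integrable M (\<lambda>\<omega>. (norm (gauss_exp a \<phi> \<omega>))\<^sup>2)"
  proof (rule Bochner_Integration.integrable_bound)
    show "integrable M (\<lambda>\<omega>. (norm (exp (\<bar>a\<bar> * \<bar>\<omega> \<phi>\<bar> + 0)))\<^sup>2)"
      by (intro square_integrable_integrable exp_abs_square_integrable assms)
    show "(\<lambda>\<omega>. (norm (gauss_exp a \<phi> \<omega>))\<^sup>2) \<in> borel_measurable M" using m by measurable
    show "AE \<omega> in M. norm ((norm (gauss_exp a \<phi> \<omega>))\<^sup>2) \<le> norm ((norm (exp (\<bar>a\<bar> * \<bar>\<omega> \<phi>\<bar> + 0)))\<^sup>2)"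
    proof (rule AE_I2)
      fix \<omega>
      have "a * \<omega> \<phi> \<le> \<bar>a\<bar> * \<bar>\<omega> \<phi>\<bar>" by (simp flip: abs_mult)
      moreover have "0 \<le> a\<^sup>2 * (l2norm lborel \<phi>)\<^sup>2 / 2" by simp
      ultimately have "a * \<omega> \<phi> - a\<^sup>2 * (l2norm lborel \<phi>)\<^sup>2 / 2 \<le> \<bar>a\<bar> * \<bar>\<omega> \<phi>\<bar> + 0" by linarith
      then show "norm ((norm (gauss_exp a \<phi> \<omega>))\<^sup>2) \<le> norm ((norm (exp (\<bar>a\<bar> * \<bar>\<omega> \<phi>\<bar> + 0)))\<^sup>2)"
        by (auto simp: gauss_exp_def intro!: power_mono)
    qed
  qed
  with m show ?thesis by (simp add: square_integrable_def)
qed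

lemma gauss_exp_inner:
  assumes "\<phi> \<in> schwartz" "\<psi> \<in> schwartz"
  shows "(\<integral>\<omega>. gauss_exp a \<phi> \<omega> * gauss_exp b \<psi> \<omega> \<partial>M) = exp (a * (b * ip \<phi> \<psi>))"
proof -
  let ?c = "- (a\<^sup>2 * ip \<phi> \<phi> + b\<^sup>2 * ip \<psi> \<psi>) / 2"
  let ?\<theta> = "\<lambda>x. a * \<phi> x + b * \<psi> x"
  have "(\<integral>\<omega>. gauss_exp a \<phi> \<omega> * gauss_exp b \<psi> \<omega> \<partial>M) = (\<integral>\<omega>. exp ?c * exp (\<omega> ?\<theta>) \<partial>M)"
  proof (rule Bochner_Integration.integral_cong[OF refl])
    fix \<omega> assume "\<omega> \<in> space M"
    then have "\<omega> ?\<theta> = a * \<omega> \<phi> + b * \<omega> \<psi>" by (rule eval_lin[OF _ assms])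
    then show "gauss_exp a \<phi> \<omega> * gauss_exp b \<psi> \<omega> = exp ?c * exp (\<omega> ?\<theta>)"
      unfolding gauss_exp_def l2norm_sq_ip by (simp add: field_simps flip: exp_add)
  qed
  also have "\<dots> = exp ?c * exp (ip ?\<theta> ?\<theta> / 2)"
    using exp_eval(2)[OF schwartz_lin(1)[OF assms]] by (simp add: l2norm_sq_ip)
  also have "ip ?\<theta> ?\<theta> = a\<^sup>2 * ip \<phi> \<phi> + 2 * a * b * ip \<phi> \<psi> + b\<^sup>2 * ip \<psi> \<psi>"
  proof -
    have "ip ?\<theta> ?\<theta> = a * ip \<phi> ?\<theta> + b * ip \<psi> ?\<theta>"
      by (rule ip_lin_left[OF assms schwartz_lin(1)[OF assms]])
    also have "ip \<phi> ?\<theta> = ip ?\<theta> \<phi>" by (rule ip_commute)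
    also have "\<dots> = a * ip \<phi> \<phi> + b * ip \<psi> \<phi>" by (rule ip_lin_left[OF assms assms(1)])
    also have "ip \<psi> ?\<theta> = ip ?\<theta> \<psi>" by (rule ip_commute)
    also have "\<dots> = a * ip \<phi> \<psi> + b * ip \<psi> \<psi>" by (rule ip_lin_left[OF assms assms(2)])
    also have "ip \<psi> \<phi> = ip \<phi> \<psi>" by (rule ip_commute)
    finally show ?thesis by (simp add: power2_eq_square algebra_simps)
  qed
  also have "exp ?c * exp ((a\<^sup>2 * ip \<phi> \<phi> + 2 * a * b * ip \<phi> \<psi> + b\<^sup>2 * ip \<psi> \<psi>) / 2) = exp (a * (b * ip \<phi> \<psi>))"
    by (simp add: field_simps flip: exp_add)
  finally show ?thesis .
qed

text \<open>Termwise integration against a square integrable function, by dominated convergence with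
  the majorant of \<open>hermite_partial_sum_le\<close>. It turns identities for exponentials into
  identities for Wick powers by comparing coefficients in \<open>a\<close>.\<close>

lemma wick_series_inner:
  assumes \<phi>: "\<phi> \<in> schwartz" and g: "square_integrable M g"
  shows "(\<lambda>n. a ^ n * (\<integral>\<omega>. wick_power n \<phi> \<omega> * g \<omega> \<partial>M) / fact n) sums (\<integral>\<omega>. gauss_exp a \<phi> \<omega> * g \<omega> \<partial>M)"
  unfolding sums_def
proof -
  let ?w = "- (1/2) * (l2norm lborel \<phi>)\<^sup>2"
  let ?S = "\<lambda>N \<omega>. \<Sum>n<N. a ^ n * (wick_power n \<phi> \<omega> / fact n)"
  note W = wick_power_square_integrable[OF \<phi>]
  have i: "integrable M (\<lambda>\<omega>. wick_power n \<phi> \<omega> * g \<omega>)" for n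
    by (intro square_integrable_mult_integrable W g)
  have "(\<lambda>N. \<integral>\<omega>. ?S N \<omega> * g \<omega> \<partial>M) \<longlonglongrightarrow> (\<integral>\<omega>. gauss_exp a \<phi> \<omega> * g \<omega> \<partial>M)"
  proof (rule integral_dominated_convergence)
    show "(\<lambda>\<omega>. gauss_exp a \<phi> \<omega> * g \<omega>) \<in> borel_measurable M"
      by (intro borel_measurable_times square_integrable_measurable gauss_exp_square_integrable \<phi> g)
    show "(\<lambda>\<omega>. ?S N \<omega> * g \<omega>) \<in> borel_measurable M" for N
      using W[THEN square_integrable_measurable] g[THEN square_integrable_measurable]
      by (intro borel_measurable_times borel_measurable_sum borel_measurable_divide) auto
    show "integrable M (\<lambda>\<omega>. exp (\<bar>a\<bar> * \<bar>\<omega> \<phi>\<bar> + a\<^sup>2 * \<bar>?w\<bar>) * norm (g \<omega>))"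
      by (intro square_integrable_mult_integrable exp_abs_square_integrable square_integrable_norm \<phi> g)
    show "AE \<omega> in M. (\<lambda>N. ?S N \<omega> * g \<omega>) \<longlonglongrightarrow> gauss_exp a \<phi> \<omega> * g \<omega>"
      using wick_power_sums by (intro AE_I2 tendsto_intros) (simp add: sums_def)
    show "AE \<omega> in M. norm (?S N \<omega> * g \<omega>) \<le> exp (\<bar>a\<bar> * \<bar>\<omega> \<phi>\<bar> + a\<^sup>2 * \<bar>?w\<bar>) * norm (g \<omega>)" for N
    proof (rule AE_I2)
      fix \<omega>
      have "\<bar>?S N \<omega>\<bar> \<le> exp (\<bar>a\<bar> * \<bar>\<omega> \<phi>\<bar> + a\<^sup>2 * \<bar>?w\<bar>)"
        using hermite_partial_sum_le[of a ?w "\<omega> \<phi>" N] by (simp add: wick_power_hermite)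
      then show "norm (?S N \<omega> * g \<omega>) \<le> exp (\<bar>a\<bar> * \<bar>\<omega> \<phi>\<bar> + a\<^sup>2 * \<bar>?w\<bar>) * norm (g \<omega>)"
        unfolding real_norm_def abs_mult by (intro mult_right_mono) auto
    qed
  qed
  moreover have "(\<integral>\<omega>. ?S N \<omega> * g \<omega> \<partial>M) = (\<Sum>n<N. a ^ n * (\<integral>\<omega>. wick_power n \<phi> \<omega> * g \<omega> \<partial>M) / fact n)" for N
  proof -
    have "(\<integral>\<omega>. ?S N \<omega> * g \<omega> \<partial>M) = (\<integral>\<omega>. (\<Sum>n<N. (a ^ n / fact n) * (wick_power n \<phi> \<omega> * g \<omega>)) \<partial>M)"
      by (simp add: sum_distrib_right mult.assoc)
    also have "\<dots> = (\<Sum>n<N. (a ^ n / fact n) * (\<integral>\<omega>. wick_power n \<phi> \<omega> * g \<omega> \<partial>M))"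
      using i by (subst Bochner_Integration.integral_sum) auto
    finally show ?thesis by simp
  qed
  ultimately show "(\<lambda>N. \<Sum>n<N. a ^ n * (\<integral>\<omega>. wick_power n \<phi> \<omega> * g \<omega> \<partial>M) / fact n) \<longlonglongrightarrow>
      (\<integral>\<omega>. gauss_exp a \<phi> \<omega> * g \<omega> \<partial>M)" by simp
qed

text \<open>Orthogonality by generating functions: the mean of the product of two Wick exponentials
  is \<open>exp (a * (b * ip \<phi> \<psi>))\<close>. Its coefficients are compared first in
  \<open>a\<close>, for fixed \<open>b\<close>, and then in \<open>b\<close>.\<close>

lemma wick_power_inner:
  assumes \<phi>: "\<phi> \<in> schwartz" and \<psi>: "\<psi> \<in> schwartz"
  shows "(\<integral>\<omega>. wick_power n \<phi> \<omega> * wick_power m \<psi> \<omega> \<partial>M) = (if n = m then fact n * ip \<phi> \<psi> ^ n else 0)"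
proof -
  let ?t = "ip \<phi> \<psi>"
  have 1: "(\<integral>\<omega>. wick_power n \<phi> \<omega> * gauss_exp b \<psi> \<omega> \<partial>M) / fact n = (b * ?t) ^ n / fact n" for b
  proof (rule powser_exp_coeff[where c = "\<lambda>n. (\<integral>\<omega>. wick_power n \<phi> \<omega> * gauss_exp b \<psi> \<omega> \<partial>M) / fact n"])
    fix a
    show "(\<lambda>n. a ^ n * ((\<integral>\<omega>. wick_power n \<phi> \<omega> * gauss_exp b \<psi> \<omega> \<partial>M) / fact n)) sums exp (a * (b * ?t))"
      using wick_series_inner[OF \<phi> gauss_exp_square_integrable[OF \<psi>], of a b] by (simp add: gauss_exp_inner[OF \<phi> \<psi>])
  qed
  let ?c = "\<lambda>m. (\<integral>\<omega>. wick_power m \<psi> \<omega> * wick_power n \<phi> \<omega> \<partial>M) / fact m"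
  have 2: "(\<lambda>m. b ^ m * ?c m) sums ((b * ?t) ^ n)" for b
  proof -
    have "(\<lambda>m. b ^ m * ?c m) sums (\<integral>\<omega>. gauss_exp b \<psi> \<omega> * wick_power n \<phi> \<omega> \<partial>M)"
      using wick_series_inner[OF \<psi> wick_power_square_integrable[OF \<phi>], of b n] by simp
    moreover have "(\<integral>\<omega>. gauss_exp b \<psi> \<omega> * wick_power n \<phi> \<omega> \<partial>M) = (b * ?t) ^ n"
      using 1[of b] by (simp add: mult.commute)
    ultimately show ?thesis by simp
  qed
  have 3: "(\<lambda>m. b ^ m * (if m = n then ?t ^ n else 0)) sums ((b * ?t) ^ n)" for b
    using sums_single[of n "\<lambda>m. b ^ m * ?t ^ n"] by (simp add: power_mult_distrib if_distrib cong: if_cong)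
  have "?c m - (if m = n then ?t ^ n else 0) = 0"
  proof (rule powser_real_eq_0[where c = "\<lambda>m. ?c m - (if m = n then ?t ^ n else 0)"])
    fix b
    show "(\<lambda>m. (?c m - (if m = n then ?t ^ n else 0)) * b ^ m) sums 0"
      using sums_diff[OF 2[of b] 3[of b]] by (simp add: algebra_simps)
  qed
  then show ?thesis by (auto simp: mult.commute field_simps split: if_splits)
qed

lemma tensor_wick_square_integrable [intro]:
  "schwartz_tensor cs \<Longrightarrow> square_integrable M (tensor_wick n cs)"
  unfolding tensor_wick_lin[abs_def]
  by (intro square_integrable_lin wick_power_square_integrable)

lemma tensor_wick_inner:
  assumes "schwartz_tensor cs" "schwartz_tensor es"
  shows "l2_inner M (tensor_wick n cs) (tensor_wick m es) =
    (if n = m then fact n * l2_inner (Rn n) (tensor_fun n cs) (tensor_fun n es) else 0)"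
proof -
  have "l2_inner M (tensor_wick n cs) (tensor_wick m es) =
      gram (\<lambda>\<phi> \<psi>. \<integral>x. wick_power n \<phi> x * wick_power m \<psi> x \<partial>M) cs es"
    unfolding tensor_wick_lin[abs_def]
    by (intro l2_inner_lin assms wick_power_square_integrable)
  also have "\<dots> = gram (\<lambda>\<phi> \<psi>. (if n = m then fact n else 0) * ip \<phi> \<psi> ^ n + 0 * 0) cs es"
    by (intro gram_cong assms) (simp add: wick_power_inner)
  also have "\<dots> = (if n = m then fact n * gram (\<lambda>\<phi> \<psi>. ip \<phi> \<psi> ^ n) cs es else 0)"
    by (subst gram_lin) simp
  finally show ?thesis using assms by (simp add: tensor_fun_inner)
qed

end

section \<open>Chaos decomposition\<close>

lemma sym_kernel_tensor:
  assumes "schwartz_tensor cs"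
  shows "sym_kernel n (tensor_fun n cs)"
proof -
  have "(\<Prod>i<n. \<phi> (x (\<pi> i))) = (\<Prod>i<n. \<phi> (x i))" if "\<pi> permutes {..<n}" for \<pi> x and \<phi> :: "real \<Rightarrow> real"
    using prod.permute[OF that, of "\<lambda>i. \<phi> (x i)"] by (simp add: comp_def)
  then show ?thesis
    unfolding sym_kernel_def using assms by (auto simp: tensor_fun_lin)
qed

lemma sym_kernel_lin:
  assumes "sym_kernel n f" "sym_kernel n g"
  shows "sym_kernel n (\<lambda>x. a * f x + b * g x)"
  unfolding sym_kernel_def
proof (intro conjI allI impI)
  show "square_integrable (Rn n) (\<lambda>x. a * f x + b * g x)"
    using assms by (auto simp: sym_kernel_def intro!: square_integrable_add square_integrable_scale)
  fix \<pi> :: "nat \<Rightarrow> nat" assume \<pi>: "\<pi> permutes {..<n}"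
  have "AE x in Rn n. f (\<lambda>i. x (\<pi> i)) = f x" "AE x in Rn n. g (\<lambda>i. x (\<pi> i)) = g x"
    using assms \<pi> by (auto simp: sym_kernel_def)
  then show "AE x in Rn n. a * f (\<lambda>i. x (\<pi> i)) + b * g (\<lambda>i. x (\<pi> i)) = a * f x + b * g x"
    by eventually_elim simp
qed

lemma l2norm_add_orthogonal:
  assumes f: "square_integrable M f" and g: "square_integrable M g" and o: "l2_inner M f g = 0"
  shows "(l2norm M (\<lambda>x. f x + g x))\<^sup>2 = (l2norm M f)\<^sup>2 + (l2norm M g)\<^sup>2"
proof -
  note fg = square_integrable_add[OF f g]
  have o': "l2_inner M g f = 0" using o l2_inner_commute[of M g f] by simp
  have "l2_inner M (\<lambda>x. f x + g x) (\<lambda>x. f x + g x) = l2_inner M f (\<lambda>x. f x + g x) + l2_inner M g (\<lambda>x. f x + g x)"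
    by (rule l2_inner_add_left[OF f g fg])
  also have "l2_inner M f (\<lambda>x. f x + g x) = cnj (l2_inner M (\<lambda>x. f x + g x) f)" by (rule l2_inner_commute)
  also have "l2_inner M (\<lambda>x. f x + g x) f = l2_inner M f f" using l2_inner_add_left[OF f g f] o' by simp
  also have "l2_inner M g (\<lambda>x. f x + g x) = cnj (l2_inner M (\<lambda>x. f x + g x) g)" by (rule l2_inner_commute)
  also have "l2_inner M (\<lambda>x. f x + g x) g = l2_inner M g g" using l2_inner_add_left[OF f g g] o by simp
  finally have "complex_of_real ((l2norm M (\<lambda>x. f x + g x))\<^sup>2) = complex_of_real ((l2norm M f)\<^sup>2 + (l2norm M g)\<^sup>2)"
    unfolding l2_inner_self[OF fg] l2_inner_self[OF f] l2_inner_self[OF g] by simp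
  then show ?thesis by (simp only: of_real_eq_iff)
qed

lemma l2norm_sum_orthogonal:
  assumes "finite I" "\<And>i. i \<in> I \<Longrightarrow> square_integrable M (f i)"
    "\<And>i j. i \<in> I \<Longrightarrow> j \<in> I \<Longrightarrow> i \<noteq> j \<Longrightarrow> l2_inner M (f i) (f j) = 0"
  shows "(l2norm M (\<lambda>x. \<Sum>i\<in>I. f i x))\<^sup>2 = (\<Sum>i\<in>I. (l2norm M (f i))\<^sup>2)"
  using assms
proof (induction I rule: finite_induct)
  case (insert a I)
  have "l2_inner M (\<lambda>x. \<Sum>i\<in>I. f i x) (f a) = (\<Sum>i\<in>I. l2_inner M (f i) (f a))"
    by (intro l2_inner_sum_left insert.prems) auto
  also have "\<dots> = 0" using insert by (intro sum.neutral ballI) auto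
  finally have "l2_inner M (f a) (\<lambda>x. \<Sum>i\<in>I. f i x) = 0"
    using l2_inner_commute[of M "f a"] by simp
  then have "(l2norm M (\<lambda>x. f a x + (\<Sum>i\<in>I. f i x)))\<^sup>2 = (l2norm M (f a))\<^sup>2 + (l2norm M (\<lambda>x. \<Sum>i\<in>I. f i x))\<^sup>2"
    by (intro l2norm_add_orthogonal square_integrable_sum insert.prems) auto
  with insert show ?case by simp
qed simp

context white_noise_space
begin

lemma wick_pairingD:
  assumes "wick_pairing M n f G"
  obtains cs where "\<And>k. schwartz_tensor (cs k)" "l2_lim (Rn n) (\<lambda>k. tensor_fun n (cs k)) f"
    "l2_lim M (\<lambda>k. tensor_wick n (cs k)) G"
  using assms by (auto simp: wick_pairing_def)

lemma wick_pairing_square_integrable: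
  assumes "wick_pairing M n f G"
  shows "square_integrable (Rn n) f" "square_integrable M G"
  using assms l2_limD(2) by (fastforce simp: wick_pairing_def)+

lemma tensor_wick_combine:
  "tensor_wick n (tscale a cs @ tscale b es) = (\<lambda>x. a * tensor_wick n cs x + b * tensor_wick n es x)"
  by (simp add: fun_eq_iff tensor_wick_lin)

lemma wick_pairing_lin:
  assumes "wick_pairing M n f G" "wick_pairing M n g H"
  shows "wick_pairing M n (\<lambda>x. a * f x + b * g x) (\<lambda>\<omega>. a * G \<omega> + b * H \<omega>)"
proof -
  obtain cs where cs: "\<And>k. schwartz_tensor (cs k)" "l2_lim (Rn n) (\<lambda>k. tensor_fun n (cs k)) f"
    "l2_lim M (\<lambda>k. tensor_wick n (cs k)) G" using wick_pairingD[OF assms(1)] by blast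
  obtain es where es: "\<And>k. schwartz_tensor (es k)" "l2_lim (Rn n) (\<lambda>k. tensor_fun n (es k)) g"
    "l2_lim M (\<lambda>k. tensor_wick n (es k)) H" using wick_pairingD[OF assms(2)] by blast
  show ?thesis
    unfolding wick_pairing_def
  proof (intro conjI exI)
    show "sym_kernel n (\<lambda>x. a * f x + b * g x)"
      using assms by (intro sym_kernel_lin) (auto simp: wick_pairing_def)
    show "\<forall>k. schwartz_tensor (tscale a (cs k) @ tscale b (es k))" using cs es by simp
    show "l2_lim (Rn n) (\<lambda>k. tensor_fun n (tscale a (cs k) @ tscale b (es k))) (\<lambda>x. a * f x + b * g x)"
      unfolding tensor_fun_combine by (intro l2_lim_combine cs es)
    show "l2_lim M (\<lambda>k. tensor_wick n (tscale a (cs k) @ tscale b (es k))) (\<lambda>\<omega>. a * G \<omega> + b * H \<omega>)"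
      unfolding tensor_wick_combine by (intro l2_lim_combine cs es)
  qed
qed

lemma wick_pairing_tensor:
  assumes "schwartz_tensor cs"
  shows "wick_pairing M n (tensor_fun n cs) (tensor_wick n cs)"
  unfolding wick_pairing_def using assms
  by (auto intro!: sym_kernel_tensor exI[of _ "\<lambda>_. cs"] l2_lim_const)

lemma wick_pairing_zero: "wick_pairing M n (\<lambda>_. 0) (\<lambda>_. 0)"
proof -
  have "tensor_fun n [] = (\<lambda>_. 0)" "tensor_wick n [] = (\<lambda>_. 0)"
    by (simp_all add: fun_eq_iff tensor_fun_lin tensor_wick_lin)
  with wick_pairing_tensor[of "[]" n] show ?thesis by simp
qed

lemma wick_pairing_inner_tensor:
  assumes "wick_pairing M n f G" "schwartz_tensor es"
  shows "l2_inner M G (tensor_wick m es) = (if n = m then fact n * l2_inner (Rn n) f (tensor_fun n es) else 0)"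
proof -
  obtain cs where cs: "\<And>k. schwartz_tensor (cs k)" "l2_lim (Rn n) (\<lambda>k. tensor_fun n (cs k)) f"
    "l2_lim M (\<lambda>k. tensor_wick n (cs k)) G" using wick_pairingD[OF assms(1)] by blast
  have 1: "(\<lambda>k. l2_inner M (tensor_wick n (cs k)) (tensor_wick m es)) \<longlonglongrightarrow> l2_inner M G (tensor_wick m es)"
    by (intro l2_lim_inner cs tensor_wick_square_integrable assms)
  have 2: "(\<lambda>k. l2_inner (Rn n) (tensor_fun n (cs k)) (tensor_fun n es)) \<longlonglongrightarrow> l2_inner (Rn n) f (tensor_fun n es)"
    by (intro l2_lim_inner cs tensor_fun_square_integrable assms)
  show ?thesis
  proof (cases "n = m")
    case True
    have "(\<lambda>k. fact n * l2_inner (Rn n) (tensor_fun n (cs k)) (tensor_fun n es)) \<longlonglongrightarrow>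
        fact n * l2_inner (Rn n) f (tensor_fun n es)" by (intro tendsto_intros 2)
    with 1 True show ?thesis
      by (simp add: tensor_wick_inner[OF cs(1) assms(2)] LIMSEQ_unique)
  next
    case False
    with 1 show ?thesis by (simp add: tensor_wick_inner[OF cs(1) assms(2)] LIMSEQ_const_iff)
  qed
qed

lemma wick_pairing_inner:
  assumes "wick_pairing M n f G" "wick_pairing M m g H"
  shows "l2_inner M G H = (if n = m then fact n * l2_inner (Rn n) f g else 0)"
proof -
  obtain cs where cs: "\<And>k. schwartz_tensor (cs k)" "l2_lim (Rn m) (\<lambda>k. tensor_fun m (cs k)) g"
    "l2_lim M (\<lambda>k. tensor_wick m (cs k)) H" using wick_pairingD[OF assms(2)] by blast
  note f = wick_pairing_square_integrable[OF assms(1)]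
  have 1: "(\<lambda>k. l2_inner M (tensor_wick m (cs k)) G) \<longlonglongrightarrow> l2_inner M H G"
    by (intro l2_lim_inner cs f)
  have e: "l2_inner M (tensor_wick m (cs k)) G =
      (if n = m then fact n * l2_inner (Rn n) (tensor_fun n (cs k)) f else 0)" for k
    using wick_pairing_inner_tensor[OF assms(1) cs(1), of m k] l2_inner_commute[of M "tensor_wick m (cs k)" G]
      l2_inner_commute[of "Rn n" "tensor_fun n (cs k)" f] by auto
  have "l2_inner M H G = (if n = m then fact n * l2_inner (Rn n) g f else 0)"
  proof (cases "n = m")
    case True
    have "(\<lambda>k. fact n * l2_inner (Rn n) (tensor_fun n (cs k)) f) \<longlonglongrightarrow> fact n * l2_inner (Rn n) g f"
      using cs(2) True by (intro tendsto_intros l2_lim_inner f) auto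
    with 1 True show ?thesis by (simp add: e LIMSEQ_unique)
  next
    case False
    with 1 show ?thesis by (simp add: e LIMSEQ_const_iff)
  qed
  then show ?thesis
    using l2_inner_commute[of M G H] l2_inner_commute[of "Rn n" f g] by auto
qed

lemma wick_pairing_norm:
  assumes "wick_pairing M n f G"
  shows "(l2norm M G)\<^sup>2 = fact n * (l2norm (Rn n) f)\<^sup>2"
proof -
  have "complex_of_real ((l2norm M G)\<^sup>2) = complex_of_real (fact n * (l2norm (Rn n) f)\<^sup>2)"
    using wick_pairing_inner[OF assms assms] wick_pairing_square_integrable[OF assms]
    by (simp add: l2_inner_self)
  then show ?thesis by (simp only: of_real_eq_iff)
qed

lemma has_chaos_inner:
  assumes "has_chaos M F f" "schwartz_tensor es"
  shows "l2_inner M F (tensor_wick n es) = fact n * l2_inner (Rn n) (f n) (tensor_fun n es)"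
proof -
  obtain G where G: "\<And>n. wick_pairing M n (f n) (G n)" "l2_lim M (\<lambda>N \<omega>. \<Sum>n<N. G n \<omega>) F"
    using assms by (auto simp: has_chaos_def)
  have es: "square_integrable M (tensor_wick n es)" using assms by auto
  have "(\<lambda>N. l2_inner M (\<lambda>\<omega>. \<Sum>n<N. G n \<omega>) (tensor_wick n es)) \<longlonglongrightarrow> l2_inner M F (tensor_wick n es)"
    by (intro l2_lim_inner G es)
  moreover have "l2_inner M (\<lambda>\<omega>. \<Sum>n<N. G n \<omega>) (tensor_wick n es) =
      fact n * l2_inner (Rn n) (f n) (tensor_fun n es)" if "N > n" for N
  proof -
    have "l2_inner M (\<lambda>\<omega>. \<Sum>n<N. G n \<omega>) (tensor_wick n es) = (\<Sum>m<N. l2_inner M (G m) (tensor_wick n es))"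
      by (intro l2_inner_sum_left es wick_pairing_square_integrable(2)[OF G(1)])
    also have "\<dots> = (\<Sum>m<N. if m = n then fact n * l2_inner (Rn n) (f n) (tensor_fun n es) else 0)"
      by (intro sum.cong refl) (simp add: wick_pairing_inner_tensor[OF G(1) assms(2)])
    finally show ?thesis using that by simp
  qed
  then have "(\<lambda>N. l2_inner M (\<lambda>\<omega>. \<Sum>n<N. G n \<omega>) (tensor_wick n es)) \<longlonglongrightarrow>
      fact n * l2_inner (Rn n) (f n) (tensor_fun n es)"
    by (intro tendsto_eventually) (auto simp: eventually_at_top_dense)
  ultimately show ?thesis by (rule LIMSEQ_unique)
qed

text \<open>Testing \<open>F\<close> against \<open>tensor_wick n es\<close> determines the inner
  products of its \<open>n\<close>-th kernel with all Schwartz tensors, and the difference of two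
  candidates is a limit of such tensors. Hence the choice made in \<open>chaos_kernel\<close>
  matters only on null sets.\<close>

lemma has_chaos_unique:
  assumes "has_chaos M F f" "has_chaos M F g"
  shows "AE x in Rn n. f n x = g n x"
proof -
  obtain G H where "wick_pairing M n (f n) G" "wick_pairing M n (g n) H"
    using assms unfolding has_chaos_def by blast
  then obtain cs es where cs: "\<And>k. schwartz_tensor (cs k)" "l2_lim (Rn n) (\<lambda>k. tensor_fun n (cs k)) (f n)"
    and es: "\<And>k. schwartz_tensor (es k)" "l2_lim (Rn n) (\<lambda>k. tensor_fun n (es k)) (g n)"
    unfolding wick_pairing_def by blast
  have "AE x in Rn n. f n x - g n x = 0"
  proof (rule tensor_limit_eq_0)
    show "schwartz_tensor (tscale 1 (cs k) @ tscale (-1) (es k))" for k using cs es by simp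
    show "l2_lim (Rn n) (\<lambda>k. tensor_fun n (tscale 1 (cs k) @ tscale (-1) (es k))) (\<lambda>x. f n x - g n x)"
      using l2_lim_diff[OF cs(2) es(2)] by (simp add: tensor_fun_combine)
    fix ts assume ts: "schwartz_tensor ts"
    have "fact n * l2_inner (Rn n) (f n) (tensor_fun n ts) = fact n * l2_inner (Rn n) (g n) (tensor_fun n ts)"
      by (simp only: has_chaos_inner[OF assms(1) ts, symmetric] has_chaos_inner[OF assms(2) ts, symmetric])
    then show "l2_inner (Rn n) (\<lambda>x. f n x - g n x) (tensor_fun n ts) = 0"
      using ts by (subst l2_inner_diff_left) (auto intro: l2_limD(2)[OF cs(2)] l2_limD(2)[OF es(2)])
  qed
  then show ?thesis by simp
qed

lemma has_chaos_lin:
  assumes "has_chaos M F f" "has_chaos M H h"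
  shows "has_chaos M (\<lambda>\<omega>. a * F \<omega> + b * H \<omega>) (\<lambda>n x. a * f n x + b * h n x)"
proof -
  obtain G where G: "\<And>n. wick_pairing M n (f n) (G n)" "l2_lim M (\<lambda>N \<omega>. \<Sum>n<N. G n \<omega>) F"
    using assms by (auto simp: has_chaos_def)
  obtain K where K: "\<And>n. wick_pairing M n (h n) (K n)" "l2_lim M (\<lambda>N \<omega>. \<Sum>n<N. K n \<omega>) H"
    using assms by (auto simp: has_chaos_def)
  have "l2_lim M (\<lambda>N \<omega>. \<Sum>n<N. a * G n \<omega> + b * K n \<omega>) (\<lambda>\<omega>. a * F \<omega> + b * H \<omega>)"
    using l2_lim_combine[OF G(2) K(2), of a b] by (simp add: sum.distrib sum_distrib_left)
  then show ?thesis
    unfolding has_chaos_def using wick_pairing_lin[OF G(1) K(1)]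
    by (intro exI[of _ "\<lambda>n \<omega>. a * G n \<omega> + b * K n \<omega>"]) auto
qed

text \<open>The tail of a chaos expansion has the same kernels, with those below \<open>N\<close>
  replaced by 0. Convergence of the partial sums in a Hida norm thereby becomes convergence of a
  numerical series.\<close>

lemma has_chaos_restrict:
  assumes G: "\<And>n. wick_pairing M n (f n) (G n)" "l2_lim M (\<lambda>N \<omega>. \<Sum>n<N. G n \<omega>) F"
  shows "has_chaos M (\<lambda>\<omega>. F \<omega> - (\<Sum>n<N. G n \<omega>)) (\<lambda>n. if n < N then (\<lambda>_. 0) else f n)"
    "has_chaos M (G m) (\<lambda>n. if n = m then f m else (\<lambda>_. 0))"
proof -
  note sq = wick_pairing_square_integrable(2)[OF G(1)]
  let ?G = "\<lambda>n. if n < N then (\<lambda>_. 0) else G n"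
  have "l2_lim M (\<lambda>K \<omega>. \<Sum>n<K. ?G n \<omega>) (\<lambda>\<omega>. F \<omega> - (\<Sum>n<N. G n \<omega>))"
    unfolding l2_lim_def
  proof (intro conjI allI)
    show "square_integrable M (\<lambda>\<omega>. \<Sum>n<K. ?G n \<omega>)" for K
      using sq by (intro square_integrable_sum) auto
    show "square_integrable M (\<lambda>\<omega>. F \<omega> - (\<Sum>n<N. G n \<omega>))"
      by (intro square_integrable_diff square_integrable_sum sq l2_limD(2)[OF G(2)])
    have e: "(\<Sum>n<K. ?G n \<omega>) = (\<Sum>n<K. G n \<omega>) - (\<Sum>n<N. G n \<omega>)" if "K \<ge> N" for K \<omega>
    proof -
      have s: "{..<K} = {..<N} \<union> {N..<K}" using that by auto
      have "(\<Sum>n<K. ?G n \<omega>) = (\<Sum>n<N. ?G n \<omega>) + (\<Sum>n\<in>{N..<K}. ?G n \<omega>)"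
        unfolding s by (rule sum.union_disjoint) auto
      moreover have "(\<Sum>n<K. G n \<omega>) = (\<Sum>n<N. G n \<omega>) + (\<Sum>n\<in>{N..<K}. G n \<omega>)"
        unfolding s by (rule sum.union_disjoint) auto
      ultimately show ?thesis by simp
    qed
    have "\<forall>\<^sub>F K in sequentially. l2norm M (\<lambda>x. (\<Sum>n<K. G n x) - F x) =
        l2norm M (\<lambda>x. (\<Sum>n<K. ?G n x) - (F x - (\<Sum>n<N. G n x)))"
      using eventually_ge_at_top[of N]
    proof eventually_elim
      case (elim K)
      show ?case unfolding e[OF elim] by (intro arg_cong[of _ _ "l2norm M"]) (simp add: fun_eq_iff)
    qed
    then show "(\<lambda>K. l2norm M (\<lambda>x. (\<Sum>n<K. ?G n x) - (F x - (\<Sum>n<N. G n x)))) \<longlonglongrightarrow> 0"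
      by (rule Lim_transform_eventually[OF l2_limD(3)[OF G(2)]])
  qed
  then show "has_chaos M (\<lambda>\<omega>. F \<omega> - (\<Sum>n<N. G n \<omega>)) (\<lambda>n. if n < N then (\<lambda>_. 0) else f n)"
    unfolding has_chaos_def using G(1) wick_pairing_zero by (intro exI[of _ ?G]) auto
  let ?H = "\<lambda>n. if n = m then G m else (\<lambda>_. 0)"
  have "l2_lim M (\<lambda>K \<omega>. \<Sum>n<K. ?H n \<omega>) (G m)"
    unfolding l2_lim_def
  proof (intro conjI allI)
    show "square_integrable M (\<lambda>\<omega>. \<Sum>n<K. ?H n \<omega>)" for K
      using sq by (intro square_integrable_sum) auto
    have e: "(\<Sum>n<K. ?H n \<omega>) = G m \<omega>" if "K > m" for K \<omega>
    proof -
      have "(\<Sum>n<K. ?H n \<omega>) = (\<Sum>n<K. if n = m then G m \<omega> else 0)" by (intro sum.cong) auto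
      with that show ?thesis by simp
    qed
    show "(\<lambda>K. l2norm M (\<lambda>x. (\<Sum>n<K. ?H n x) - G m x)) \<longlonglongrightarrow> 0"
    proof (rule tendsto_eventually)
      show "\<forall>\<^sub>F K in sequentially. l2norm M (\<lambda>x. (\<Sum>n<K. ?H n x) - G m x) = 0"
        using eventually_gt_at_top[of m] by eventually_elim (simp only: e diff_self l2norm_zero)
    qed
  qed (rule sq)
  then show "has_chaos M (G m) (\<lambda>n. if n = m then f m else (\<lambda>_. 0))"
    unfolding has_chaos_def using G(1) wick_pairing_zero by (intro exI[of _ ?H]) auto
qed

section \<open>Hida test functions\<close>

lemma hida_testI:
  assumes f: "has_chaos M F f" "\<And>p n. f n \<in> kernel_space p n"
    and s: "\<And>p. summable (\<lambda>n. fact n * (kernel_norm p n (f n))\<^sup>2)"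
  shows "F \<in> hida_test M"
  using assms by (auto simp: hida_test_def hida_space_def)

lemma chaos_kernel_AE:
  assumes "has_chaos M F f"
  shows "has_chaos M F (chaos_kernel M F)" "AE x in Rn n. chaos_kernel M F n x = f n x"
proof -
  show "has_chaos M F (chaos_kernel M F)" unfolding chaos_kernel_def using assms by (rule someI[where P = "has_chaos M F"])
  then show "AE x in Rn n. chaos_kernel M F n x = f n x" by (rule has_chaos_unique[OF _ assms])
qed

lemma has_chaos_measurable: "has_chaos M F f \<Longrightarrow> f n \<in> borel_measurable (Rn n)"
  unfolding has_chaos_def using wick_pairing_square_integrable(1) square_integrable_measurable by blast

lemma chaos_kernel_norm:
  assumes "has_chaos M F f" "\<And>n. f n \<in> kernel_space p n"
  shows "chaos_kernel M F n \<in> kernel_space p n" "kernel_norm p n (chaos_kernel M F n) = kernel_norm p n (f n)"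
proof -
  note a = chaos_kernel_AE[OF assms(1)]
  have "AE x in Rn n. f n x = chaos_kernel M F n x" using a(2)[of n] by eventually_elim simp
  from kernel_space_cong_AE[OF assms(2) this has_chaos_measurable[OF a(1)]]
  show "chaos_kernel M F n \<in> kernel_space p n" "kernel_norm p n (chaos_kernel M F n) = kernel_norm p n (f n)" by auto
qed

text \<open>Each \<open>hida_space M p\<close> may come with its own kernels. Since kernels are
  unique up to null sets and \<open>kernel_norm\<close> ignores null sets, the chosen
  \<open>chaos_kernel\<close> serves every \<open>p\<close> at once.\<close>

lemma hida_testD:
  assumes "F \<in> hida_test M"
  shows "has_chaos M F (chaos_kernel M F)" "chaos_kernel M F n \<in> kernel_space p n"
    "summable (\<lambda>n. fact n * (kernel_norm p n (chaos_kernel M F n))\<^sup>2)"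
proof -
  have "F \<in> hida_space M p" using assms by (auto simp: hida_test_def)
  then obtain f where f: "has_chaos M F f" "\<And>n. f n \<in> kernel_space p n"
    "summable (\<lambda>n. fact n * (kernel_norm p n (f n))\<^sup>2)" by (auto simp: hida_space_def)
  show "has_chaos M F (chaos_kernel M F)" by (rule chaos_kernel_AE[OF f(1)])
  show "chaos_kernel M F n \<in> kernel_space p n" by (rule chaos_kernel_norm[OF f(1,2)])
  show "summable (\<lambda>n. fact n * (kernel_norm p n (chaos_kernel M F n))\<^sup>2)"
    using f(3) by (simp add: chaos_kernel_norm[OF f(1,2)])
qed

lemma hida_norm_sq:
  assumes "F \<in> hida_test M"
  shows "(\<lambda>n. fact n * (kernel_norm p n (chaos_kernel M F n))\<^sup>2) sums (hida_norm M p F)\<^sup>2" "0 \<le> hida_norm M p F"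
proof -
  note s = hida_testD(3)[OF assms, of p]
  have 0: "0 \<le> (\<Sum>n. fact n * (kernel_norm p n (chaos_kernel M F n))\<^sup>2)"
    by (intro suminf_nonneg s) auto
  show "(\<lambda>n. fact n * (kernel_norm p n (chaos_kernel M F n))\<^sup>2) sums (hida_norm M p F)\<^sup>2"
    using s 0 by (simp add: hida_norm_def sums_iff)
  show "0 \<le> hida_norm M p F" using 0 by (simp add: hida_norm_def)
qed

lemma hida_norm_sums:
  assumes "has_chaos M F f" "\<And>p n. f n \<in> kernel_space p n"
    "\<And>p. summable (\<lambda>n. fact n * (kernel_norm p n (f n))\<^sup>2)"
  shows "(\<lambda>n. fact n * (kernel_norm p n (f n))\<^sup>2) sums (hida_norm M p F)\<^sup>2"
  using hida_norm_sq(1)[OF hida_testI[OF assms], of p] by (simp add: chaos_kernel_norm[OF assms(1,2)])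

lemma hida_test_lin:
  assumes "F \<in> hida_test M" "H \<in> hida_test M"
  shows "(\<lambda>\<omega>. a * F \<omega> + b * H \<omega>) \<in> hida_test M"
    "AE x in Rn n. chaos_kernel M (\<lambda>\<omega>. a * F \<omega> + b * H \<omega>) n x = a * chaos_kernel M F n x + b * chaos_kernel M H n x"
proof -
  note f = hida_testD[OF assms(1)] and h = hida_testD[OF assms(2)]
  note c = has_chaos_lin[OF f(1) h(1), of a b]
  show "AE x in Rn n. chaos_kernel M (\<lambda>\<omega>. a * F \<omega> + b * H \<omega>) n x = a * chaos_kernel M F n x + b * chaos_kernel M H n x"
    by (rule chaos_kernel_AE(2)[OF c])
  let ?f = "chaos_kernel M F" and ?h = "chaos_kernel M H"
  show "(\<lambda>\<omega>. a * F \<omega> + b * H \<omega>) \<in> hida_test M"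
  proof (rule hida_testI[OF c])
    show "(\<lambda>x. a * ?f n x + b * ?h n x) \<in> kernel_space p n" for p n by (intro kernel_space_lin f h)
    fix p
    have "summable (\<lambda>n. (2 * (cmod a)\<^sup>2) * (fact n * (kernel_norm p n (?f n))\<^sup>2) + (2 * (cmod b)\<^sup>2) * (fact n * (kernel_norm p n (?h n))\<^sup>2))"
      by (intro summable_add summable_mult f h)
    then show "summable (\<lambda>n. fact n * (kernel_norm p n (\<lambda>x. a * ?f n x + b * ?h n x))\<^sup>2)"
    proof (rule summable_comparison_test'[of _ 0])
      fix n
      let ?x = "cmod a * kernel_norm p n (?f n)" and ?y = "cmod b * kernel_norm p n (?h n)"
      have "(kernel_norm p n (\<lambda>x. a * ?f n x + b * ?h n x))\<^sup>2 \<le> (?x + ?y)\<^sup>2"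
        by (intro power_mono kernel_space_lin(2) kernel_norm_nonneg kernel_space_lin(1) f h)
      also have "\<dots> \<le> 2 * ?x\<^sup>2 + 2 * ?y\<^sup>2"
        using sum_squares_bound[of ?x ?y] by (simp add: power2_sum)
      finally have "fact n * (kernel_norm p n (\<lambda>x. a * ?f n x + b * ?h n x))\<^sup>2 \<le> fact n * (2 * ?x\<^sup>2 + 2 * ?y\<^sup>2)"
        by (intro mult_left_mono) auto
      then show "norm (fact n * (kernel_norm p n (\<lambda>x. a * ?f n x + b * ?h n x))\<^sup>2) \<le>
        (2 * (cmod a)\<^sup>2) * (fact n * (kernel_norm p n (?f n))\<^sup>2) + (2 * (cmod b)\<^sup>2) * (fact n * (kernel_norm p n (?h n))\<^sup>2)"
        by (simp add: power_mult_distrib algebra_simps)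
    qed
  qed
qed

lemma hida_norm_mono:
  assumes "F \<in> hida_test M" "p \<le> q"
  shows "hida_norm M p F \<le> hida_norm M q F"
proof (rule power2_le_imp_le)
  show "(hida_norm M p F)\<^sup>2 \<le> (hida_norm M q F)\<^sup>2"
    using hida_norm_sq(1)[OF assms(1), of p] hida_norm_sq(1)[OF assms(1), of q]
    by (rule sums_le[rotated]) (auto intro!: mult_left_mono power_mono kernel_norm_mono kernel_norm_nonneg hida_testD(2) assms)
qed (rule hida_norm_sq[OF assms(1)])

text \<open>For an element of a single chaos the Hida norm is explicit, so continuity of a
  distribution there becomes a bound in terms of the kernel.\<close>

lemma hida_single:
  assumes "wick_pairing M m g G" "\<And>p. g \<in> kernel_space p m"
  shows "G \<in> hida_test M" "hida_norm M p G = sqrt (fact m) * kernel_norm p m g"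
    "AE x in Rn n. chaos_kernel M G n x = (if n = m then g x else 0)"
proof -
  let ?f = "\<lambda>n. if n = m then g else (\<lambda>_. 0)"
  let ?G = "\<lambda>n. if n = m then G else (\<lambda>_. 0)"
  have w: "wick_pairing M n (?f n) (?G n)" for n using assms wick_pairing_zero by auto
  have "l2_lim M (\<lambda>N \<omega>. \<Sum>n<N. ?G n \<omega>) G"
    unfolding l2_lim_def
  proof (intro conjI allI)
    show "square_integrable M (\<lambda>\<omega>. \<Sum>n<K. ?G n \<omega>)" for K
      using wick_pairing_square_integrable[OF w] by (intro square_integrable_sum)
    have e: "(\<Sum>n<K. ?G n \<omega>) = G \<omega>" if "K > m" for K \<omega>
    proof -
      have "(\<Sum>n<K. ?G n \<omega>) = (\<Sum>n<K. if n = m then G \<omega> else 0)" by (intro sum.cong) auto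
      with that show ?thesis by simp
    qed
    show "(\<lambda>K. l2norm M (\<lambda>x. (\<Sum>n<K. ?G n x) - G x)) \<longlonglongrightarrow> 0"
    proof (rule tendsto_eventually)
      show "\<forall>\<^sub>F K in sequentially. l2norm M (\<lambda>x. (\<Sum>n<K. ?G n x) - G x) = 0"
        using eventually_gt_at_top[of m] by eventually_elim (simp only: e diff_self l2norm_zero)
    qed
  qed (rule wick_pairing_square_integrable[OF assms(1)])
  with w have c: "has_chaos M G ?f" unfolding has_chaos_def by (intro exI[of _ ?G]) auto
  have k: "?f n \<in> kernel_space p n" for p n using assms(2) kernel_norm_zero by auto
  have s: "(\<lambda>n. fact n * (kernel_norm p n (?f n))\<^sup>2) sums (fact m * (kernel_norm p m g)\<^sup>2)" for p
  proof -
    have "(\<lambda>n. fact n * (kernel_norm p n (?f n))\<^sup>2) = (\<lambda>n. if n = m then fact n * (kernel_norm p m g)\<^sup>2 else 0)"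
      by (auto simp: kernel_norm_zero fun_eq_iff)
    then show ?thesis using sums_single[of m "\<lambda>n. fact n * (kernel_norm p m g)\<^sup>2"] by simp
  qed
  note s' = sums_summable[OF s]
  show h: "G \<in> hida_test M" by (rule hida_testI[OF c k s'])
  have "(hida_norm M p G)\<^sup>2 = fact m * (kernel_norm p m g)\<^sup>2"
    using hida_norm_sums[OF c k s', of p] s[of p] by (rule sums_unique2)
  also have "\<dots> = (sqrt (fact m) * kernel_norm p m g)\<^sup>2" by (simp add: power_mult_distrib)
  finally show "hida_norm M p G = sqrt (fact m) * kernel_norm p m g"
    using hida_norm_sq(2)[OF h] kernel_norm_nonneg[OF assms(2)] by (simp add: power2_eq_iff_nonneg)
  show "AE x in Rn n. chaos_kernel M G n x = (if n = m then g x else 0)"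
    using chaos_kernel_AE(2)[OF c, of n] by eventually_elim auto
qed

lemma hida_zero: "(\<lambda>_. 0) \<in> hida_test M" "hida_norm M p (\<lambda>_. 0) = 0"
  using hida_single(1,2)[OF wick_pairing_zero kernel_norm_zero(1)] by (simp_all add: kernel_norm_zero)

lemma tensor_wick_hida:
  assumes "schwartz_tensor cs"
  shows "tensor_wick n cs \<in> hida_test M"
  using hida_single(1)[OF wick_pairing_tensor[OF assms] kernel_norm_tensor(1)[OF assms]] .

lemma hida_sum: "(\<And>n. n < N \<Longrightarrow> G n \<in> hida_test M) \<Longrightarrow> (\<lambda>\<omega>. \<Sum>n<(N::nat). G n \<omega>) \<in> hida_test M"
proof (induction N)
  case 0
  then show ?case using hida_zero by simp
next
  case (Suc N)
  then show ?case using hida_test_lin(1)[of "\<lambda>\<omega>. \<Sum>n<N. G n \<omega>" "G N" 1 1] by simp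
qed

lemma hida_partial_sums:
  assumes F: "F \<in> hida_test M" and G: "\<And>n. wick_pairing M n (f n) (G n)" "l2_lim M (\<lambda>N \<omega>. \<Sum>n<N. G n \<omega>) F"
    and f: "\<And>p n. f n \<in> kernel_space p n"
  shows "G n \<in> hida_test M" "(\<lambda>N. hida_norm M p (\<lambda>\<omega>. F \<omega> - (\<Sum>n<N. G n \<omega>))) \<longlonglongrightarrow> 0"
proof -
  have c: "has_chaos M F f" using G by (auto simp: has_chaos_def)
  let ?a = "\<lambda>n. fact n * (kernel_norm p n (f n))\<^sup>2"
  have s: "summable (\<lambda>n. fact n * (kernel_norm p n (f n))\<^sup>2)" for p
    using hida_testD(3)[OF F] by (simp add: chaos_kernel_norm[OF c f])
  show "G n \<in> hida_test M" using hida_single(1)[OF G(1) f] .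
  have r: "(hida_norm M p (\<lambda>\<omega>. F \<omega> - (\<Sum>n<N. G n \<omega>)))\<^sup>2 = suminf ?a - sum ?a {..<N}" for N
  proof -
    let ?g = "\<lambda>n. if n < N then (\<lambda>_. 0) else f n"
    have e: "(\<lambda>n. fact n * (kernel_norm q n (?g n))\<^sup>2) =
        (\<lambda>n. fact n * (kernel_norm q n (f n))\<^sup>2 - (if n \<in> {..<N} then fact n * (kernel_norm q n (f n))\<^sup>2 else 0))" for q
      by (auto simp: kernel_norm_zero)
    have s2: "(\<lambda>n. fact n * (kernel_norm q n (?g n))\<^sup>2) sums
        ((\<Sum>n. fact n * (kernel_norm q n (f n))\<^sup>2) - (\<Sum>n<N. fact n * (kernel_norm q n (f n))\<^sup>2))" for q
      unfolding e by (intro sums_diff summable_sums[OF s] sums_If_finite_set) simp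
    have k: "?g n \<in> kernel_space q n" for q n using f kernel_norm_zero by auto
    show ?thesis
      by (rule sums_unique2[OF hida_norm_sums[OF has_chaos_restrict(1)[OF G] k sums_summable[OF s2]] s2])
  qed
  have "(\<lambda>N. suminf ?a - sum ?a {..<N}) \<longlonglongrightarrow> suminf ?a - suminf ?a"
    by (intro tendsto_intros summable_LIMSEQ s)
  then have "(\<lambda>N. sqrt ((hida_norm M p (\<lambda>\<omega>. F \<omega> - (\<Sum>n<N. G n \<omega>)))\<^sup>2)) \<longlonglongrightarrow> sqrt 0"
    unfolding r by (intro tendsto_real_sqrt) simp
  moreover have "sqrt ((hida_norm M p (\<lambda>\<omega>. F \<omega> - (\<Sum>n<N. G n \<omega>)))\<^sup>2) = hida_norm M p (\<lambda>\<omega>. F \<omega> - (\<Sum>n<N. G n \<omega>))" for N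
  proof -
    have "(\<lambda>\<omega>. 1 * F \<omega> + (-1) * (\<Sum>n<N. G n \<omega>)) \<in> hida_test M"
      by (intro hida_test_lin(1) F hida_sum hida_single(1)[OF G(1) f])
    then have "0 \<le> hida_norm M p (\<lambda>\<omega>. F \<omega> - (\<Sum>n<N. G n \<omega>))"
      using hida_norm_sq(2) by simp
    then show ?thesis by simp
  qed
  ultimately show "(\<lambda>N. hida_norm M p (\<lambda>\<omega>. F \<omega> - (\<Sum>n<N. G n \<omega>))) \<longlonglongrightarrow> 0" by simp
qed

section \<open>Distributions act termwise on chaos expansions\<close>

lemma hida_dual_lin:
  assumes "\<Phi> \<in> hida_dual M p" "F \<in> hida_test M" "H \<in> hida_test M"
  shows "\<Phi> (\<lambda>\<omega>. a * F \<omega> + b * H \<omega>) = a * \<Phi> F + b * \<Phi> H"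
  using assms by (auto simp: hida_dual_def)

lemma hida_dual_sum:
  assumes "\<Phi> \<in> hida_dual M p" "\<And>n. n < N \<Longrightarrow> G n \<in> hida_test M"
  shows "\<Phi> (\<lambda>\<omega>. \<Sum>n<(N::nat). G n \<omega>) = (\<Sum>n<N. \<Phi> (G n))"
  using assms(2)
proof (induction N)
  case 0
  have "\<Phi> (\<lambda>\<omega>. 0 * 0 + 0 * 0) = 0" using hida_dual_lin[OF assms(1) hida_zero(1) hida_zero(1), of 0 0] by simp
  then show ?case by simp
next
  case (Suc N)
  then show ?case using hida_dual_lin[OF assms(1), of "\<lambda>\<omega>. \<Sum>n<N. G n \<omega>" "G N" 1 1] hida_sum[of N G] by simp
qed

lemma hida_dual_sums:
  assumes \<Phi>: "\<Phi> \<in> hida_dual M p"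
    and F: "F \<in> hida_test M" and G: "\<And>n. wick_pairing M n (f n) (G n)" "l2_lim M (\<lambda>N \<omega>. \<Sum>n<N. G n \<omega>) F"
    and f: "\<And>p n. f n \<in> kernel_space p n"
  shows "(\<lambda>n. \<Phi> (G n)) sums \<Phi> F"
proof -
  obtain C where C: "\<And>F. F \<in> hida_test M \<Longrightarrow> cmod (\<Phi> F) \<le> C * hida_norm M p F"
    using \<Phi> unfolding hida_dual_def by blast
  note h = hida_partial_sums[OF F G f]
  have "cmod (\<Phi> F - (\<Sum>n<N. \<Phi> (G n))) \<le> C * hida_norm M p (\<lambda>\<omega>. F \<omega> - (\<Sum>n<N. G n \<omega>))" for N
  proof -
    have e: "\<Phi> (\<lambda>\<omega>. 1 * F \<omega> + (-1) * (\<Sum>n<N. G n \<omega>)) = 1 * \<Phi> F + (-1) * (\<Sum>n<N. \<Phi> (G n))"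
      using hida_dual_lin[OF \<Phi> F hida_sum[of N G, OF h(1)], where a = 1 and b = "-1"] hida_dual_sum[OF \<Phi> h(1), where N = N] by simp
    have m: "(\<lambda>\<omega>. 1 * F \<omega> + (-1) * (\<Sum>n<N. G n \<omega>)) \<in> hida_test M"
      by (intro hida_test_lin(1) F hida_sum h)
    from C[OF m] show ?thesis unfolding e by simp
  qed
  moreover have "(\<lambda>N. C * hida_norm M p (\<lambda>\<omega>. F \<omega> - (\<Sum>n<N. G n \<omega>))) \<longlonglongrightarrow> C * 0"
    by (intro tendsto_intros h)
  ultimately have "(\<lambda>N. \<Phi> F - (\<Sum>n<N. \<Phi> (G n))) \<longlonglongrightarrow> 0"
    using Lim_null_comparison[of "\<lambda>N. \<Phi> F - (\<Sum>n<N. \<Phi> (G n))"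
        "\<lambda>N. C * hida_norm M p (\<lambda>\<omega>. F \<omega> - (\<Sum>n<N. G n \<omega>))" sequentially] by simp
  then have "(\<lambda>N. \<Phi> F - (\<Phi> F - (\<Sum>n<N. \<Phi> (G n)))) \<longlonglongrightarrow> \<Phi> F - 0" by (intro tendsto_intros)
  then show ?thesis by (simp add: sums_def)
qed

end

section \<open>Distributions given by sequences of forms\<close>

lemma series_Cauchy_Schwarz:
  fixes a b :: "nat \<Rightarrow> real"
  assumes a: "\<And>n. 0 \<le> a n" "summable (\<lambda>n. (a n)\<^sup>2)" and b: "\<And>n. 0 \<le> b n" "summable (\<lambda>n. (b n)\<^sup>2)"
  shows "summable (\<lambda>n. a n * b n)" "(\<Sum>n. a n * b n) \<le> sqrt (\<Sum>n. (a n)\<^sup>2) * sqrt (\<Sum>n. (b n)\<^sup>2)"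
proof -
  have le: "(\<Sum>n<N. a n * b n) \<le> sqrt (\<Sum>n. (a n)\<^sup>2) * sqrt (\<Sum>n. (b n)\<^sup>2)" for N
  proof -
    have "(\<Sum>n<N. a n * b n)\<^sup>2 \<le> (\<Sum>n<N. (a n)\<^sup>2) * (\<Sum>n<N. (b n)\<^sup>2)"
      by (rule Cauchy_Schwarz_ineq_sum)
    also have "\<dots> \<le> (\<Sum>n. (a n)\<^sup>2) * (\<Sum>n. (b n)\<^sup>2)"
      by (intro mult_mono sum_le_suminf a b sum_nonneg suminf_nonneg) auto
    finally have "sqrt ((\<Sum>n<N. a n * b n)\<^sup>2) \<le> sqrt ((\<Sum>n. (a n)\<^sup>2) * (\<Sum>n. (b n)\<^sup>2))"
      by (rule real_sqrt_le_mono)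
    moreover have "0 \<le> (\<Sum>n<N. a n * b n)" by (intro sum_nonneg mult_nonneg_nonneg a b)
    ultimately show ?thesis by (simp add: real_sqrt_mult)
  qed
  show "summable (\<lambda>n. a n * b n)"
    by (rule bounded_imp_summable[OF _ le[of "Suc _", unfolded lessThan_Suc_atMost]]) (simp add: a b)
  then show "(\<Sum>n. a n * b n) \<le> sqrt (\<Sum>n. (a n)\<^sup>2) * sqrt (\<Sum>n. (b n)\<^sup>2)"
    by (intro suminf_le_const le)
qed

text \<open>The \<open>n\<close>-th form of \<open>\<Phi>\<close> is \<open>n!\<close> times its \<open>n\<close>-th generalised kernel.\<close>

definition hida_forms :: "nat \<Rightarrow> (nat \<Rightarrow> (real \<Rightarrow> real) \<Rightarrow> complex) \<Rightarrow> (nat \<Rightarrow> real) \<Rightarrow> bool" where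
  "hida_forms p P c \<longleftrightarrow> (\<forall>n. hform p n (P n) (c n)) \<and> summable (\<lambda>n. (c n)\<^sup>2 / fact n)"

definition form_norm :: "(nat \<Rightarrow> real) \<Rightarrow> real" where
  "form_norm c = sqrt (\<Sum>n. (c n)\<^sup>2 / fact n)"

lemma hida_forms_lin:
  assumes "hida_forms p P c" "hida_forms p Q d"
  shows "hida_forms p (\<lambda>n \<phi>. a * P n \<phi> + b * Q n \<phi>) (\<lambda>n. cmod a * c n + cmod b * d n)"
  unfolding hida_forms_def
proof (intro conjI allI)
  show "hform p n (\<lambda>\<phi>. a * P n \<phi> + b * Q n \<phi>) (cmod a * c n + cmod b * d n)" for n
    using assms by (intro hform_lin) (auto simp: hida_forms_def)
  have "summable (\<lambda>n. 2 * (cmod a)\<^sup>2 * ((c n)\<^sup>2 / fact n) + 2 * (cmod b)\<^sup>2 * ((d n)\<^sup>2 / fact n))"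
    using assms by (intro summable_add summable_mult) (auto simp: hida_forms_def)
  then show "summable (\<lambda>n. (cmod a * c n + cmod b * d n)\<^sup>2 / fact n)"
  proof (rule summable_comparison_test'[of _ 0])
    fix n
    have "(cmod a * c n + cmod b * d n)\<^sup>2 \<le> 2 * (cmod a * c n)\<^sup>2 + 2 * (cmod b * d n)\<^sup>2"
      using sum_squares_bound[of "cmod a * c n" "cmod b * d n"] by (simp add: power2_sum)
    then have "(cmod a * c n + cmod b * d n)\<^sup>2 / fact n \<le> (2 * (cmod a * c n)\<^sup>2 + 2 * (cmod b * d n)\<^sup>2) / fact n"
      by (rule divide_right_mono) simp
    then show "norm ((cmod a * c n + cmod b * d n)\<^sup>2 / fact n) \<le>
      2 * (cmod a)\<^sup>2 * ((c n)\<^sup>2 / fact n) + 2 * (cmod b)\<^sup>2 * ((d n)\<^sup>2 / fact n)"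
      by (simp add: power_mult_distrib add_divide_distrib)
  qed
qed

context white_noise_space
begin

text \<open>The pairing of generalised kernels with the kernels of a test function; the weight
  \<open>fact n\<close> does not appear because the forms already contain it.\<close>

definition dist_of :: "nat \<Rightarrow> (nat \<Rightarrow> (real \<Rightarrow> real) \<Rightarrow> complex) \<Rightarrow> hida_functional" where
  "dist_of p P F = (if F \<in> hida_test M then \<Sum>n. ext p n (P n) (chaos_kernel M F n) else 0)"

lemma dist_of_sums:
  assumes P: "hida_forms p P c" and F: "F \<in> hida_test M"
  shows "(\<lambda>n. ext p n (P n) (chaos_kernel M F n)) sums dist_of p P F"
    "cmod (dist_of p P F) \<le> form_norm c * hida_norm M p F"
proof -
  let ?k = "chaos_kernel M F"
  have h: "hform p n (P n) (c n)" for n using P by (auto simp: hida_forms_def)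
  have c0: "0 \<le> c n" for n using h by (auto simp: hform_def)
  have k0: "0 \<le> kernel_norm p n (?k n)" for n by (intro kernel_norm_nonneg hida_testD F)
  \<comment> \<open>Cauchy-Schwarz with weights: the factor \<open>fact n\<close> in the squared
    Hida norm is matched by its inverse in \<open>form_norm\<close>.\<close>
  define a b where "a n = c n / sqrt (fact n)" and "b n = sqrt (fact n) * kernel_norm p n (?k n)" for n
  have ab: "a n * b n = c n * kernel_norm p n (?k n)" for n by (simp add: a_def b_def)
  have a: "(a n)\<^sup>2 = (c n)\<^sup>2 / fact n" and b: "(b n)\<^sup>2 = fact n * (kernel_norm p n (?k n))\<^sup>2" for n
    by (simp_all add: a_def b_def power_divide power_mult_distrib)
  have sa: "summable (\<lambda>n. (a n)\<^sup>2)" using P by (simp add: a hida_forms_def)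
  have sb: "summable (\<lambda>n. (b n)\<^sup>2)" using hida_testD(3)[OF F] by (simp add: b)
  have a0: "0 \<le> a n" and b0: "0 \<le> b n" for n using c0 k0 by (auto simp: a_def b_def)
  note cs = series_Cauchy_Schwarz[OF a0 sa b0 sb]
  have le: "cmod (ext p n (P n) (?k n)) \<le> a n * b n" for n
    unfolding ab by (intro ext_le h hida_testD F)
  have s: "summable (\<lambda>n. cmod (ext p n (P n) (?k n)))"
    by (rule summable_comparison_test'[OF cs(1), of 0]) (use le in simp)
  show "(\<lambda>n. ext p n (P n) (?k n)) sums dist_of p P F"
    using summable_norm_cancel[OF s] F by (simp add: dist_of_def summable_sums)
  have "cmod (dist_of p P F) \<le> (\<Sum>n. cmod (ext p n (P n) (?k n)))"
    using F summable_norm[OF s] by (simp add: dist_of_def)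
  also have "\<dots> \<le> (\<Sum>n. a n * b n)" by (intro suminf_le le s cs)
  also have "\<dots> \<le> sqrt (\<Sum>n. (a n)\<^sup>2) * sqrt (\<Sum>n. (b n)\<^sup>2)" by (rule cs)
  also have "\<dots> = form_norm c * hida_norm M p F"
    unfolding a b by (simp add: form_norm_def hida_norm_def)
  finally show "cmod (dist_of p P F) \<le> form_norm c * hida_norm M p F" .
qed

lemma dist_of_dual:
  assumes P: "hida_forms p P c"
  shows "dist_of p P \<in> hida_dual M p"
proof -
  have h: "hform p n (P n) (c n)" for n using P by (auto simp: hida_forms_def)
  have "dist_of p P (\<lambda>\<omega>. a * F \<omega> + b * H \<omega>) = a * dist_of p P F + b * dist_of p P H"
    if F: "F \<in> hida_test M" and H: "H \<in> hida_test M" for F H a b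
  proof -
    let ?L = "\<lambda>\<omega>. a * F \<omega> + b * H \<omega>"
    note L = hida_test_lin[OF F H, of a b]
    have "ext p n (P n) (chaos_kernel M ?L n) =
        a * ext p n (P n) (chaos_kernel M F n) + b * ext p n (P n) (chaos_kernel M H n)" for n
    proof -
      have "ext p n (P n) (chaos_kernel M ?L n) =
          ext p n (P n) (\<lambda>x. a * chaos_kernel M F n x + b * chaos_kernel M H n x)"
      proof (rule ext_cong_AE[OF h, symmetric])
        show "chaos_kernel M ?L n \<in> kernel_space p n" by (rule hida_testD(2)[OF L(1)])
        show "(\<lambda>x. a * chaos_kernel M F n x + b * chaos_kernel M H n x) \<in> borel_measurable (Rn n)"
          by (intro square_integrable_measurable kernel_space_square_integrable[of _ p] kernel_space_lin hida_testD F H)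
      qed (rule L)
      then show ?thesis by (simp add: ext_lin[OF h hida_testD(2)[OF F] hida_testD(2)[OF H]])
    qed
    then have "(\<lambda>n. a * ext p n (P n) (chaos_kernel M F n) + b * ext p n (P n) (chaos_kernel M H n)) sums dist_of p P ?L"
      using dist_of_sums(1)[OF P L(1)] by simp
    moreover have "(\<lambda>n. a * ext p n (P n) (chaos_kernel M F n) + b * ext p n (P n) (chaos_kernel M H n)) sums
        (a * dist_of p P F + b * dist_of p P H)"
      by (intro sums_add sums_mult dist_of_sums[OF P] F H)
    ultimately show ?thesis by (rule sums_unique2)
  qed
  moreover have "\<exists>C. \<forall>F\<in>hida_test M. cmod (dist_of p P F) \<le> C * hida_norm M p F"
    using dist_of_sums(2)[OF P] by blast
  ultimately show ?thesis unfolding hida_dual_def by (auto simp: dist_of_def)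
qed

lemma dist_of_hida_dist: "hida_forms p P c \<Longrightarrow> dist_of p P \<in> hida_dist M"
  using dist_of_dual by (auto simp: hida_dist_def)

lemma form_norm_nonneg: "hida_forms p P c \<Longrightarrow> 0 \<le> form_norm c"
  unfolding form_norm_def hida_forms_def by (auto intro!: suminf_nonneg)

lemma dist_of_norm:
  assumes P: "hida_forms p P c"
  shows "hida_dual_norm M p (dist_of p P) \<le> form_norm c"
  unfolding hida_dual_norm_def
proof (rule cSUP_least)
  show "{F \<in> hida_test M. hida_norm M p F \<le> 1} \<noteq> {}" using hida_zero by force
  fix F assume F: "F \<in> {F \<in> hida_test M. hida_norm M p F \<le> 1}"
  have "cmod (dist_of p P F) \<le> form_norm c * hida_norm M p F" using F by (intro dist_of_sums[OF P]) auto
  also have "\<dots> \<le> form_norm c * 1" using F form_norm_nonneg[OF P] by (intro mult_left_mono) auto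
  finally show "cmod (dist_of p P F) \<le> form_norm c" by simp
qed

lemma dist_of_lin:
  assumes P: "hida_forms p P c" and Q: "hida_forms p Q d"
  shows "dist_of p (\<lambda>n \<phi>. a * P n \<phi> + b * Q n \<phi>) = (\<lambda>F. a * dist_of p P F + b * dist_of p Q F)"
proof
  fix F
  show "dist_of p (\<lambda>n \<phi>. a * P n \<phi> + b * Q n \<phi>) F = a * dist_of p P F + b * dist_of p Q F"
  proof (cases "F \<in> hida_test M")
    case True
    have "ext p n (\<lambda>\<phi>. a * P n \<phi> + b * Q n \<phi>) (chaos_kernel M F n) =
       a * ext p n (P n) (chaos_kernel M F n) + b * ext p n (Q n) (chaos_kernel M F n)" for n
      using P Q by (intro ext_form_lin[of p n _ "c n" _ "d n"] hida_testD True) (auto simp: hida_forms_def)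
    then have "(\<lambda>n. a * ext p n (P n) (chaos_kernel M F n) + b * ext p n (Q n) (chaos_kernel M F n)) sums
        dist_of p (\<lambda>n \<phi>. a * P n \<phi> + b * Q n \<phi>) F"
      using dist_of_sums(1)[OF hida_forms_lin[OF P Q] True, of a b] by simp
    moreover have "(\<lambda>n. a * ext p n (P n) (chaos_kernel M F n) + b * ext p n (Q n) (chaos_kernel M F n)) sums
        (a * dist_of p P F + b * dist_of p Q F)"
      by (intro sums_add sums_mult dist_of_sums[OF P] dist_of_sums[OF Q] True)
    ultimately show ?thesis by (rule sums_unique2)
  qed (simp add: dist_of_def)
qed

text \<open>Strong differentiability in one of the dual Hilbert spaces suffices, because a neighbourhood of
  \<open>0\<close> in the inductive limit contains a ball of each of them.\<close>

lemma has_hida_derivative_dist_of: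
  assumes P: "\<And>r. r \<in> insert t A \<Longrightarrow> hida_forms p (P r) (c r)" and Q: "hida_forms p Q d"
    and s: "summable (\<lambda>n. (s n)\<^sup>2 / fact n)" and e: "(e \<longlongrightarrow> 0) (at t within A)"
    and le: "\<forall>\<^sub>F r in at t within A. \<forall>n. hform p n (\<lambda>\<phi>. (P r n \<phi> - P t n \<phi>) / of_real (r - t) - Q n \<phi>) (e r * s n)"
  shows "has_hida_derivative M (\<lambda>r. dist_of p (P r)) (dist_of p Q) t A"
  unfolding has_hida_derivative_def
proof (intro conjI ballI)
  show "dist_of p Q \<in> hida_dist M" by (rule dist_of_hida_dist[OF Q])
  show "dist_of p (P r) \<in> hida_dist M" if "r \<in> insert t A" for r by (rule dist_of_hida_dist[OF P[OF that]])
  fix V assume V: "V \<in> hida_nhds0 M"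
  then obtain \<epsilon> where \<epsilon>: "\<epsilon> > 0" "{\<Phi> \<in> hida_dual M p. hida_dual_norm M p \<Phi> < \<epsilon>} \<subseteq> V"
    unfolding hida_nhds0_def by blast
  have "((\<lambda>r. \<bar>e r\<bar> * form_norm s) \<longlongrightarrow> \<bar>0\<bar> * form_norm s) (at t within A)"
    by (intro tendsto_intros e)
  then have "\<forall>\<^sub>F r in at t within A. \<bar>e r\<bar> * form_norm s < \<epsilon>"
    by (rule order_tendstoD(2)) (use \<epsilon> in simp)
  moreover have "\<forall>\<^sub>F r in at t within A. r \<in> A" by (simp add: eventually_at_filter)
  ultimately show "\<forall>\<^sub>F r in at t within A.
      (\<lambda>F. (dist_of p (P r) F - dist_of p (P t) F) / complex_of_real (r - t) - dist_of p Q F) \<in> V"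
    using le
  proof eventually_elim
    case (elim r)
    let ?z = "1 / complex_of_real (r - t)"
    \<comment> \<open>The error of the difference quotient as nested two-term combinations, the
      shape to which \<open>dist_of_lin\<close> applies twice.\<close>
    let ?R = "\<lambda>n \<phi>. 1 * (?z * P r n \<phi> + (- ?z) * P t n \<phi>) + (-1) * Q n \<phi>"
    have r: "r \<in> insert t A" "t \<in> insert t A" using elim by auto
    have R: "hida_forms p ?R (\<lambda>n. e r * s n)"
      unfolding hida_forms_def
    proof (intro conjI allI)
      show "hform p n (?R n) (e r * s n)" for n
        using elim(3) by (rule hform_cong[OF spec[of _ n]]) (simp add: diff_divide_distrib)
      show "summable (\<lambda>n. (e r * s n)\<^sup>2 / fact n)"
        using summable_mult[OF s, of "(e r)\<^sup>2"] by (simp add: power_mult_distrib)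
    qed
    have "form_norm (\<lambda>n. e r * s n) = sqrt ((e r)\<^sup>2 * (\<Sum>n. (s n)\<^sup>2 / fact n))"
      unfolding form_norm_def using suminf_mult[OF s, of "(e r)\<^sup>2"] by (simp add: power_mult_distrib)
    also have "\<dots> = \<bar>e r\<bar> * form_norm s" by (simp add: real_sqrt_mult form_norm_def)
    finally have "hida_dual_norm M p (dist_of p ?R) < \<epsilon>"
      using dist_of_norm[OF R] elim(1) by linarith
    then have "dist_of p ?R \<in> V" using \<epsilon> dist_of_dual[OF R] by auto
    moreover have "dist_of p ?R = (\<lambda>F. 1 * (?z * dist_of p (P r) F + (- ?z) * dist_of p (P t) F) + (-1) * dist_of p Q F)"
      by (subst dist_of_lin[OF hida_forms_lin[OF P[OF r(1)] P[OF r(2)]] Q]) (simp only: dist_of_lin[OF P[OF r(1)] P[OF r(2)]])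
    ultimately show ?case by (simp add: diff_divide_distrib)
  qed
qed

section \<open>Wick exponentials and the \<open>S\<close>-transform\<close>

lemma tensor_single_norm:
  assumes "\<phi> \<in> schwartz"
  shows "(l2norm (Rn n) (tensor_fun n (tensor_opA p [(c, \<phi>)])))\<^sup>2 = (cmod c)\<^sup>2 * ((schwartz_norm p \<phi>)\<^sup>2) ^ n"
proof -
  have "schwartz_tensor [(c, \<phi>)]" using assms by simp
  from tensor_opA_norm[OF this, of n p]
  have "(l2norm (Rn n) (tensor_fun n (tensor_opA p [(c, \<phi>)])))\<^sup>2 = Re (c * cnj c * of_real (ipA p \<phi> \<phi> ^ n))"
    by (simp add: gram_def mult.assoc)
  also have "c * cnj c = complex_of_real ((cmod c)\<^sup>2)" by (rule complex_norm_square[symmetric])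
  finally show ?thesis unfolding ipA_self by (simp only: of_real_mult[symmetric] Re_complex_of_real)
qed

text \<open>\<open>wick_exp\<close> is a pointwise series, whereas a chaos expansion asks for an
  \<open>L\<^sup>2\<close> limit. Orthogonality of the terms bounds the distance of partial sums by
  the tail of a convergent series, and \<open>l2_lim_of_pointwise\<close> then identifies the two
  limits. All Hida norms are finite because the series of squared norms is an exponential
  series.\<close>

lemma wick_exp_chaos:
  assumes \<phi>: "\<phi> \<in> schwartz"
  defines "f \<equiv> \<lambda>n. tensor_fun n [(1 / fact n, \<phi>)]" and "G \<equiv> \<lambda>n. tensor_wick n [(1 / fact n, \<phi>)]"
  shows "\<And>n. wick_pairing M n (f n) (G n)" "l2_lim M (\<lambda>N \<omega>. \<Sum>n<N. G n \<omega>) (wick_exp \<phi>)"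
    "\<And>p n. f n \<in> kernel_space p n" "wick_exp \<phi> \<in> hida_test M"
proof -
  have st: "schwartz_tensor [(c, \<phi>)]" for c using \<phi> by simp
  show w: "wick_pairing M n (f n) (G n)" for n unfolding f_def G_def by (rule wick_pairing_tensor[OF st])
  show k: "f n \<in> kernel_space p n" for p n unfolding f_def by (rule kernel_norm_tensor[OF st])
  note sq = wick_pairing_square_integrable(2)[OF w]
  have kn: "fact n * (kernel_norm p n (f n))\<^sup>2 = ((schwartz_norm p \<phi>)\<^sup>2) ^ n / fact n" for p n
    unfolding f_def kernel_norm_tensor(2)[OF st] tensor_single_norm[OF \<phi>]
    by (simp add: power2_eq_square norm_divide)
  have sumk: "summable (\<lambda>n. fact n * (kernel_norm p n (f n))\<^sup>2)" for p
    unfolding kn using summable_exp[of "(schwartz_norm p \<phi>)\<^sup>2"] by (simp add: divide_inverse mult.commute)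
  have G0: "(l2norm M (G n))\<^sup>2 = fact n * (kernel_norm 0 n (f n))\<^sup>2" for n
  proof -
    have "tensor_opA 0 cs = cs" for cs by (induction cs) (auto simp: tensor_opA_def)
    then show ?thesis
      unfolding wick_pairing_norm[OF w] by (simp add: f_def kernel_norm_tensor(2)[OF st])
  qed
  let ?a = "\<lambda>n. (l2norm M (G n))\<^sup>2"
  have sa: "summable ?a" using sumk[of 0] by (simp add: G0)
  show lim: "l2_lim M (\<lambda>N \<omega>. \<Sum>n<N. G n \<omega>) (wick_exp \<phi>)"
  proof (rule l2_lim_of_pointwise)
    show "square_integrable M (\<lambda>\<omega>. \<Sum>n<N. G n \<omega>)" for N by (intro square_integrable_sum sq)
    fix \<omega>
    have "G n \<omega> = complex_of_real (wick_power n \<phi> \<omega> / fact n)" for n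
      by (simp add: G_def tensor_wick_lin)
    moreover have "(\<lambda>n. complex_of_real (wick_power n \<phi> \<omega> / fact n)) sums complex_of_real (gauss_exp 1 \<phi> \<omega>)"
      using wick_power_sums[of 1 \<phi> \<omega>] by (intro sums_of_real) simp
    ultimately have "(\<lambda>n. G n \<omega>) sums wick_exp \<phi> \<omega>"
      unfolding wick_exp_def by (simp add: sums_iff)
    then show "(\<lambda>N. \<Sum>n<N. G n \<omega>) \<longlonglongrightarrow> wick_exp \<phi> \<omega>" by (simp add: sums_def)
  next
    have "(\<lambda>k. suminf ?a - sum ?a {..<k}) \<longlonglongrightarrow> suminf ?a - suminf ?a"
      by (intro tendsto_intros summable_LIMSEQ sa)
    then show "(\<lambda>k. sqrt (suminf ?a - sum ?a {..<k})) \<longlonglongrightarrow> 0"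
      using tendsto_real_sqrt by fastforce
    fix k j :: nat assume "k \<le> j"
    then have s: "{..<j} = {..<k} \<union> {k..<j}" by auto
    have "(\<Sum>n<j. G n x) - (\<Sum>n<k. G n x) = (\<Sum>n\<in>{k..<j}. G n x)" for x
      unfolding s by (subst sum.union_disjoint) auto
    then have "(l2norm M (\<lambda>x. (\<Sum>n<j. G n x) - (\<Sum>n<k. G n x)))\<^sup>2 = (\<Sum>n\<in>{k..<j}. ?a n)"
      by (simp add: l2norm_sum_orthogonal[OF _ sq] wick_pairing_inner[OF w w])
    also have "\<dots> = sum ?a {..<j} - sum ?a {..<k}"
      unfolding s by (subst sum.union_disjoint) auto
    also have "\<dots> \<le> suminf ?a - sum ?a {..<k}"
      using sum_le_suminf[OF sa, of "{..<j}"] by simp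
    finally show "l2norm M (\<lambda>x. (\<Sum>n<j. G n x) - (\<Sum>n<k. G n x)) \<le> sqrt (suminf ?a - sum ?a {..<k})"
      by (rule real_le_rsqrt)
  qed
  show "wick_exp \<phi> \<in> hida_test M"
    using w lim k sumk by (intro hida_testI[of _ f]) (auto simp: has_chaos_def)
qed

lemma wick_exp_kernel:
  assumes "\<phi> \<in> schwartz"
  shows "AE x in Rn n. chaos_kernel M (wick_exp \<phi>) n x = tensor_fun n [(1 / fact n, \<phi>)] x"
proof -
  have "has_chaos M (wick_exp \<phi>) (\<lambda>n. tensor_fun n [(1 / fact n, \<phi>)])"
    unfolding has_chaos_def
    by (intro exI[of _ "\<lambda>n. tensor_wick n [(1 / fact n, \<phi>)]"] conjI allI wick_exp_chaos(1,2)[OF assms])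
  then show ?thesis by (rule chaos_kernel_AE(2))
qed

lemma S_transform_dist_of:
  assumes P: "hida_forms p P c" and \<phi>: "\<phi> \<in> schwartz"
  shows "(\<lambda>n. P n \<phi> / fact n) sums S_transform (dist_of p P) \<phi>"
proof -
  have "ext p n (P n) (chaos_kernel M (wick_exp \<phi>) n) = P n \<phi> / fact n" for n
  proof -
    have h: "hform p n (P n) (c n)" using P by (auto simp: hida_forms_def)
    have st: "schwartz_tensor [(1 / fact n, \<phi>)]" using \<phi> by simp
    have "ext p n (P n) (chaos_kernel M (wick_exp \<phi>) n) = ext p n (P n) (tensor_fun n [(1 / fact n, \<phi>)])"
      by (intro ext_cong_AE[OF h, symmetric] hida_testD(2) wick_exp_chaos(4) \<phi> wick_exp_kernel
          square_integrable_measurable tensor_fun_square_integrable st)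
    then show ?thesis by (simp add: ext_tensor[OF h st])
  qed
  then show ?thesis
    unfolding S_transform_def using dist_of_sums(1)[OF P wick_exp_chaos(4)[OF \<phi>]] by simp
qed

lemma hida_dual_mono:
  assumes "\<Phi> \<in> hida_dual M p" "p \<le> q"
  shows "\<Phi> \<in> hida_dual M q"
proof -
  obtain C where C: "\<And>F. F \<in> hida_test M \<Longrightarrow> cmod (\<Phi> F) \<le> C * hida_norm M p F"
    using assms(1) unfolding hida_dual_def by blast
  have "cmod (\<Phi> F) \<le> \<bar>C\<bar> * hida_norm M q F" if F: "F \<in> hida_test M" for F
  proof -
    have "cmod (\<Phi> F) \<le> \<bar>C\<bar> * hida_norm M p F"
      using C[OF F] hida_norm_sq(2)[OF F, of p] by (meson abs_ge_self mult_right_mono order_trans)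
    also have "\<dots> \<le> \<bar>C\<bar> * hida_norm M q F" by (intro mult_left_mono hida_norm_mono F assms) simp
    finally show ?thesis .
  qed
  then show ?thesis using assms(1) unfolding hida_dual_def by blast
qed

text \<open>Scaling \<phi> by \<open>a\<close> turns the S-transform into a power series in
  \<open>a\<close>, whose coefficients must vanish; so \<Phi> vanishes on Wick powers and, by
  linearity, on all \<open>tensor_wick n cs\<close>. Each chaos term of \<open>F\<close> is
  approximated by these in the norm with index \<open>p\<close>, the one for which \<Phi> is
  bounded, and \<open>hida_dual_sums\<close> adds up the terms.\<close>

lemma S_transform_eq_0:
  assumes \<Phi>: "\<Phi> \<in> hida_dual M p" and S: "\<And>\<phi>. \<phi> \<in> schwartz \<Longrightarrow> S_transform \<Phi> \<phi> = 0"
    and F: "F \<in> hida_test M"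
  shows "\<Phi> F = 0"
proof -
  obtain C where C: "\<And>F. F \<in> hida_test M \<Longrightarrow> cmod (\<Phi> F) \<le> C * hida_norm M p F"
    using \<Phi> unfolding hida_dual_def by blast
  have scale: "\<Phi> (\<lambda>\<omega>. a * F \<omega>) = a * \<Phi> F" if "F \<in> hida_test M" for a F
    using hida_dual_lin[OF \<Phi> that that, of a 0] by simp
  have W: "\<Phi> (tensor_wick n [(1, \<phi>)]) = 0" if \<phi>: "\<phi> \<in> schwartz" for n \<phi>
  proof -
    have "(\<lambda>n. of_real (a ^ n) * (\<Phi> (tensor_wick n [(1, \<phi>)]) / fact n)) sums 0" for a
    proof -
      have a\<phi>: "(\<lambda>x. a * \<phi> x) \<in> schwartz" by (rule schwartz_scale[OF \<phi>])
      note w = wick_exp_chaos[OF a\<phi>]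
      have "(\<lambda>n. \<Phi> (tensor_wick n [(1 / fact n, \<lambda>x. a * \<phi> x)])) sums \<Phi> (wick_exp (\<lambda>x. a * \<phi> x))"
        by (rule hida_dual_sums[OF \<Phi> w(4) w(1,2,3)])
      moreover have "\<Phi> (wick_exp (\<lambda>x. a * \<phi> x)) = 0" using S[OF a\<phi>] by (simp add: S_transform_def)
      moreover have "\<Phi> (tensor_wick n [(1 / fact n, \<lambda>x. a * \<phi> x)]) =
          of_real (a ^ n) * (\<Phi> (tensor_wick n [(1, \<phi>)]) / fact n)" for n
      proof -
        let ?z = "complex_of_real (a ^ n) / fact n"
        have st: "schwartz_tensor [(1, \<phi>)]" "schwartz_tensor [(?z, \<phi>)]" "schwartz_tensor [(1 / fact n, \<lambda>x. a * \<phi> x)]"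
          using \<phi> a\<phi> by auto
        have t: "tensor_fun n [(1 / fact n, \<lambda>x. a * \<phi> x)] = tensor_fun n [(?z, \<phi>)]"
          by (simp add: fun_eq_iff tensor_fun_lin prod.distrib)
        \<comment> \<open>The two random variables agree only on \<open>tempered\<close>, where
          \<omega> is linear. As functions they may differ, so their difference is treated as a Wick
          pairing with the kernel 0, which has Hida norm 0.\<close>
        have d: "wick_pairing M n (\<lambda>x. 1 * tensor_fun n [(?z, \<phi>)] x + (-1) * tensor_fun n [(1 / fact n, \<lambda>x. a * \<phi> x)] x)
            (\<lambda>\<omega>. 1 * tensor_wick n [(?z, \<phi>)] \<omega> + (-1) * tensor_wick n [(1 / fact n, \<lambda>x. a * \<phi> x)] \<omega>)"
          by (intro wick_pairing_lin wick_pairing_tensor st)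
        then have d': "wick_pairing M n (\<lambda>_. 0)
            (\<lambda>\<omega>. 1 * tensor_wick n [(?z, \<phi>)] \<omega> + (-1) * tensor_wick n [(1 / fact n, \<lambda>x. a * \<phi> x)] \<omega>)"
          by (simp add: t)
        have "cmod (\<Phi> (\<lambda>\<omega>. 1 * tensor_wick n [(?z, \<phi>)] \<omega> + (-1) * tensor_wick n [(1 / fact n, \<lambda>x. a * \<phi> x)] \<omega>)) \<le> C * 0"
          using C[OF hida_single(1)[OF d' kernel_norm_zero(1)]]
          by (simp only: hida_single(2)[OF d' kernel_norm_zero(1)] kernel_norm_zero(2) mult_zero_right)
        moreover have "\<Phi> (\<lambda>\<omega>. 1 * tensor_wick n [(?z, \<phi>)] \<omega> + (-1) * tensor_wick n [(1 / fact n, \<lambda>x. a * \<phi> x)] \<omega>) =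
            1 * \<Phi> (tensor_wick n [(?z, \<phi>)]) + (-1) * \<Phi> (tensor_wick n [(1 / fact n, \<lambda>x. a * \<phi> x)])"
          by (intro hida_dual_lin[OF \<Phi>] tensor_wick_hida st)
        moreover have "tensor_wick n [(?z, \<phi>)] = (\<lambda>\<omega>. ?z * tensor_wick n [(1, \<phi>)] \<omega>)"
          by (simp add: fun_eq_iff tensor_wick_lin)
        ultimately show ?thesis
          using scale[OF tensor_wick_hida[OF st(1)], of ?z n] by simp
      qed
      ultimately show ?thesis by simp
    qed
    from powser_eq_0[of "\<lambda>n. \<Phi> (tensor_wick n [(1, \<phi>)]) / fact n", OF this] show ?thesis by simp
  qed
  have T: "\<Phi> (tensor_wick n cs) = 0" if "schwartz_tensor cs" for n cs
    using that
  proof (induction cs)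
    case Nil
    have "tensor_wick n [] = (\<lambda>_. 0)" by (simp add: fun_eq_iff tensor_wick_lin)
    then show ?case using scale[OF hida_zero(1), of 0] by simp
  next
    case (Cons a cs)
    obtain c \<phi> where a: "a = (c, \<phi>)" by force
    have e: "tensor_wick n (a # cs) = (\<lambda>\<omega>. c * tensor_wick n [(1, \<phi>)] \<omega> + 1 * tensor_wick n cs \<omega>)"
      by (simp add: fun_eq_iff tensor_wick_lin a)
    have "\<Phi> (tensor_wick n (a # cs)) = c * \<Phi> (tensor_wick n [(1, \<phi>)]) + 1 * \<Phi> (tensor_wick n cs)"
      unfolding e using Cons.prems by (intro hida_dual_lin[OF \<Phi>] tensor_wick_hida) (auto simp: a)
    then show ?case using Cons W by (simp add: a)
  qed
  let ?k = "chaos_kernel M F"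
  note k = hida_testD[OF F]
  obtain G where G: "\<And>n. wick_pairing M n (?k n) (G n)" "l2_lim M (\<lambda>N \<omega>. \<Sum>n<N. G n \<omega>) F"
    using k(1) by (auto simp: has_chaos_def)
  have "\<Phi> (G n) = 0" for n
  proof -
    obtain cs h where a: "approx p n cs (?k n) h" using k(2)[of n p] by (auto simp: kernel_space_approx)
    note A = approxD[OF a]
    let ?d = "\<lambda>j x. 1 * ?k n x + (-1) * tensor_fun n (cs j) x"
    let ?D = "\<lambda>j \<omega>. 1 * G n \<omega> + (-1) * tensor_wick n (cs j) \<omega>"
    have w: "wick_pairing M n (?d j) (?D j)" for j by (intro wick_pairing_lin G wick_pairing_tensor A)
    have kd: "?d j \<in> kernel_space q n" for q j by (intro kernel_space_lin k kernel_norm_tensor A)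
    have nd: "kernel_norm p n (?d j) = l2norm (Rn n) (\<lambda>x. tensor_fun n (tensor_opA p (cs j)) x - h x)" for j
    proof -
      have "approx p n (\<lambda>i. tscale 1 (cs i) @ tscale (-1) (cs j)) (?d j)
          (\<lambda>x. 1 * h x + (-1) * tensor_fun n (tensor_opA p (cs j)) x)"
        by (intro approx_combine a approx_tensor A)
      from kernel_norm_eq[OF this] show ?thesis by (subst l2norm_diff_commute) simp
    qed
    have "cmod (\<Phi> (G n)) \<le> C * (sqrt (fact n) * l2norm (Rn n) (\<lambda>x. tensor_fun n (tensor_opA p (cs j)) x - h x))" for j
    proof -
      have "\<Phi> (?D j) = 1 * \<Phi> (G n) + (-1) * \<Phi> (tensor_wick n (cs j))"
        by (intro hida_dual_lin[OF \<Phi>] tensor_wick_hida A hida_single(1)[OF G(1) k(2)])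
      then have e: "\<Phi> (?D j) = \<Phi> (G n)" using T[OF A(1)] by simp
      have "cmod (\<Phi> (?D j)) \<le> C * hida_norm M p (?D j)" by (rule C[OF hida_single(1)[OF w kd]])
      then show ?thesis unfolding e hida_single(2)[OF w kd] nd .
    qed
    moreover have "(\<lambda>j. C * (sqrt (fact n) * l2norm (Rn n) (\<lambda>x. tensor_fun n (tensor_opA p (cs j)) x - h x))) \<longlonglongrightarrow> C * (sqrt (fact n) * 0)"
      by (intro tendsto_intros l2_limD(3)[OF A(3)])
    ultimately have "cmod (\<Phi> (G n)) \<le> C * (sqrt (fact n) * 0)"
      by (intro LIMSEQ_le_const) auto
    then show ?thesis by simp
  qed
  then show ?thesis using hida_dual_sums[OF \<Phi> F G k(2)] by (simp add: sums_iff)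
qed

text \<open>The two distributions may be bounded with respect to different indices; their difference
  is bounded with respect to the larger one.\<close>

lemma S_transform_inject:
  assumes "\<Phi> \<in> hida_dist M" "\<Psi> \<in> hida_dist M" "\<And>\<phi>. \<phi> \<in> schwartz \<Longrightarrow> S_transform \<Phi> \<phi> = S_transform \<Psi> \<phi>"
  shows "\<Phi> = \<Psi>"
proof
  fix F
  obtain p q where "\<Phi> \<in> hida_dual M p" "\<Psi> \<in> hida_dual M q" using assms by (auto simp: hida_dist_def)
  then have d: "\<Phi> \<in> hida_dual M (max p q)" "\<Psi> \<in> hida_dual M (max p q)" by (auto intro: hida_dual_mono)
  let ?D = "\<lambda>F. \<Phi> F - \<Psi> F"
  obtain C where C: "\<And>F. F \<in> hida_test M \<Longrightarrow> cmod (\<Phi> F) \<le> C * hida_norm M (max p q) F"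
    using d(1) unfolding hida_dual_def by blast
  obtain C' where C': "\<And>F. F \<in> hida_test M \<Longrightarrow> cmod (\<Psi> F) \<le> C' * hida_norm M (max p q) F"
    using d(2) unfolding hida_dual_def by blast
  have "cmod (?D F) \<le> (C + C') * hida_norm M (max p q) F" if "F \<in> hida_test M" for F
    using norm_triangle_ineq4[of "\<Phi> F" "\<Psi> F"] C[OF that] C'[OF that] by (simp add: distrib_right)
  moreover have "?D (\<lambda>\<omega>. a * F \<omega> + b * G \<omega>) = a * ?D F + b * ?D G" if "F \<in> hida_test M" "G \<in> hida_test M" for F G a b
    using hida_dual_lin[OF d(1) that] hida_dual_lin[OF d(2) that] by (simp add: algebra_simps)
  moreover have "?D F = 0" if "F \<notin> hida_test M" for F using d that by (auto simp: hida_dual_def)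
  ultimately have D: "?D \<in> hida_dual M (max p q)" unfolding hida_dual_def by blast
  have S: "S_transform ?D \<phi> = 0" if "\<phi> \<in> schwartz" for \<phi> using assms(3)[OF that] by (simp add: S_transform_def)
  show "\<Phi> F = \<Psi> F"
  proof (cases "F \<in> hida_test M")
    case True
    from S_transform_eq_0[OF D S True] show ?thesis by simp
  next
    case False
    then show ?thesis using d by (auto simp: hida_dual_def)
  qed
qed

section \<open>Wick products, white noise and the spaces \<open>space_G\<close>\<close>

lemma wick_product_eq:
  assumes "\<Theta> \<in> hida_dist M" "\<And>\<phi>. \<phi> \<in> schwartz \<Longrightarrow> S_transform \<Theta> \<phi> = S_transform \<Phi> \<phi> * S_transform \<Psi> \<phi>"
  shows "wick_product M \<Phi> \<Psi> = \<Theta>"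
  unfolding wick_product_def
proof (rule the_equality)
  show "\<Theta> \<in> hida_dist M \<and> (\<forall>\<phi>\<in>schwartz. S_transform \<Theta> \<phi> = S_transform \<Phi> \<phi> * S_transform \<Psi> \<phi>)"
    using assms by blast
  fix \<Theta>' assume "\<Theta>' \<in> hida_dist M \<and> (\<forall>\<phi>\<in>schwartz. S_transform \<Theta>' \<phi> = S_transform \<Phi> \<phi> * S_transform \<Psi> \<phi>)"
  then show "\<Theta>' = \<Theta>" using assms by (intro S_transform_inject) auto
qed

lemma continuous_eq_AE:
  fixes f g :: "real \<Rightarrow> complex"
  assumes "continuous_on UNIV f" "continuous_on UNIV g" "AE x in lborel. f x = g x"
  shows "f = g"
proof -
  have "open {x. f x \<noteq> g x}" by (intro open_Collect_neq assms)
  moreover have "negligible {x. f x \<noteq> g x}"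
    using AE_completion[OF assms(3)] AE_iff_null_sets[of "{x. f x \<noteq> g x}" lebesgue] \<open>open _\<close>
    by (simp add: negligible_iff_null_sets)
  ultimately have "{x. f x \<noteq> g x} = {}" using open_not_negligible by blast
  then show ?thesis by auto
qed

text \<open>The first kernel of the Wick exponential is \<phi> itself. Its continuous representative
  is unique because nonempty open sets have positive measure; the first coordinate carries the
  one-fold product measure to Lebesgue measure on the line.\<close>

lemma S_transform_white_noise:
  assumes \<phi>: "\<phi> \<in> schwartz"
  shows "S_transform (white_noise M t) \<phi> = complex_of_real (\<phi> t)"
proof -
  let ?k = "chaos_kernel M (wick_exp \<phi>) 1"
  interpret product_sigma_finite "\<lambda>_::nat. lborel :: real measure" by standard
  have c: "continuous_on UNIV (\<lambda>x. complex_of_real (\<phi> x))"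
    using schwartz_isCont[OF \<phi>] by (intro continuous_intros continuous_at_imp_continuous_on) auto
  have k: "AE x in Rn 1. ?k x = complex_of_real (\<phi> (x 0))"
    using wick_exp_kernel[OF \<phi>, of 1] by (simp add: tensor_fun_lin)
  have "(THE z. \<exists>\<psi>. continuous_on UNIV \<psi> \<and> (AE x in Rn 1. ?k x = \<psi> (x 0)) \<and> z = \<psi> t) = complex_of_real (\<phi> t)"
  proof (rule the_equality)
    show "\<exists>\<psi>. continuous_on UNIV \<psi> \<and> (AE x in Rn 1. ?k x = \<psi> (x 0)) \<and> complex_of_real (\<phi> t) = \<psi> t"
      using c k by (intro exI[of _ "\<lambda>x. complex_of_real (\<phi> x)"]) auto
    fix z assume "\<exists>\<psi>. continuous_on UNIV \<psi> \<and> (AE x in Rn 1. ?k x = \<psi> (x 0)) \<and> z = \<psi> t"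
    then obtain \<psi> where \<psi>: "continuous_on UNIV \<psi>" "AE x in Rn 1. ?k x = \<psi> (x 0)" "z = \<psi> t" by blast
    have one: "{..<1::nat} = {0}" by auto
    have "AE x in Rn 1. \<psi> (x 0) = complex_of_real (\<phi> (x 0))"
      using \<psi>(2) k by eventually_elim simp
    moreover have m: "{x \<in> space (lborel :: real measure). \<psi> x = complex_of_real (\<phi> x)} \<in> sets lborel"
      using closed_Collect_eq[OF \<psi>(1) c] by simp
    ultimately have "AE x in distr (Rn 1) lborel (\<lambda>x. x 0). \<psi> x = complex_of_real (\<phi> x)"
      by (subst AE_distr_iff) auto
    then have "AE x in lborel. \<psi> x = complex_of_real (\<phi> x)"
      unfolding one distr_singleton .
    from continuous_eq_AE[OF \<psi>(1) c this] show "z = complex_of_real (\<phi> t)" using \<psi>(3) by simp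
  qed
  then show ?thesis
    using wick_exp_chaos(4)[OF \<phi>] by (simp add: S_transform_def white_noise_def)
qed

text \<open>For a functional given by a square integrable \<open>g\<close>, Fubini identifies the
  \<open>n\<close>-th form with integration against \<open>\<alpha> n\<close> times the tensor power
  of \<open>g\<close>. Dividing by \<open>fact n\<close> gives the generalised kernel, and its
  weighted squared norms are the terms of the series assumed summable.\<close>

lemma dist_of_space_G:
  assumes P: "hida_forms p (\<lambda>n \<phi>. \<alpha> n * complex_of_real ((\<integral>x. g x * \<phi> x \<partial>lborel) ^ n)) c"
    and g: "square_integrable lborel (g :: real \<Rightarrow> real)"
    and s: "summable (\<lambda>n. (cmod (\<alpha> n))\<^sup>2 / fact n * (2 powr s * (l2norm lborel g)\<^sup>2) ^ n)"
  shows "dist_of p (\<lambda>n \<phi>. \<alpha> n * complex_of_real ((\<integral>x. g x * \<phi> x \<partial>lborel) ^ n)) \<in> space_G M s"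
    (is "dist_of p ?P \<in> _")
  unfolding space_G_def
proof (intro CollectI conjI exI)
  show "dist_of p ?P \<in> hida_dist M" by (rule dist_of_hida_dist[OF P])
  let ?g = "\<lambda>(n::nat) x. complex_of_real (\<Prod>i<n. g (x i))"
  let ?f = "\<lambda>(n::nat) x. \<alpha> n / fact n * ?g n x"
  have gp: "square_integrable (Rn n) (\<lambda>x. \<Prod>i<n. g (x i))" for n
    by (intro tensor_prod_square_integrable g)
  have gn: "square_integrable (Rn n) (?g n)" for n
    by (intro square_integrable_of_real gp)
  then have fn: "square_integrable (Rn n) (?f n)" for n by (intro square_integrable_scale)
  show "\<forall>n. sym_kernel n (?f n)"
  proof
    fix n :: nat
    have "(\<Prod>i<n. g (x (\<pi> i))) = (\<Prod>i<n. g (x i))" if "\<pi> permutes {..<n}" for \<pi> x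
      using prod.permute[OF that, of "\<lambda>i. g (x i)"] by (simp add: comp_def)
    then show "sym_kernel n (?f n)"
      unfolding sym_kernel_def by (intro conjI fn allI impI AE_I2) (simp only:)
  qed
  have nf: "(l2norm (Rn n) (?f n))\<^sup>2 = (cmod (\<alpha> n))\<^sup>2 / (fact n)\<^sup>2 * ((l2norm lborel g)\<^sup>2) ^ n" for n
  proof -
    have "(l2norm (Rn n) (?g n))\<^sup>2 = (\<integral>x. (\<Prod>i<n. g (x i)) * (\<Prod>i<n. g (x i)) \<partial>Rn n)"
      unfolding l2norm_of_real l2norm_sq by (simp add: power2_eq_square)
    also have "\<dots> = ip g g ^ n" using tensor_prod_inner[of n "\<lambda>_. g" "\<lambda>_. g"] g by simp
    finally show ?thesis
      unfolding l2norm_scale l2norm_sq_ip by (simp add: power_mult_distrib norm_divide power_divide)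
  qed
  show "summable (\<lambda>n. fact n * 2 powr (s * real n) * (l2norm (Rn n) (?f n))\<^sup>2)"
  proof -
    have "fact n * 2 powr (s * real n) * (l2norm (Rn n) (?f n))\<^sup>2 =
        (cmod (\<alpha> n))\<^sup>2 / fact n * (2 powr s * (l2norm lborel g)\<^sup>2) ^ n" for n
    proof -
      have "2 powr (s * real n) = (2 powr s) ^ n" by (simp add: powr_powr[symmetric] powr_realpow)
      then show ?thesis unfolding nf by (simp add: power_mult_distrib power2_eq_square[of "fact n"])
    qed
    with s show ?thesis by simp
  qed
  show "\<forall>F\<in>hida_test M. (\<lambda>n. fact n * (\<integral>x. ?f n x * chaos_kernel M F n x \<partial>Rn n)) sums dist_of p ?P F"
  proof
    fix F assume F: "F \<in> hida_test M"
    have "ext p n (?P n) (chaos_kernel M F n) = (\<integral>x. (\<alpha> n * ?g n x) * chaos_kernel M F n x \<partial>Rn n)" for n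
    proof (rule ext_integral)
      show "hform p n (?P n) (c n)" using P by (auto simp: hida_forms_def)
      show "chaos_kernel M F n \<in> kernel_space p n" by (rule hida_testD(2)[OF F])
      show "square_integrable (Rn n) (\<lambda>x. \<alpha> n * ?g n x)" by (intro square_integrable_scale gn)
      fix cs assume cs: "schwartz_tensor cs"
      have "integrable (Rn n) (\<lambda>x. ?g n x * complex_of_real (\<Prod>i<n. \<phi> (x i)))" if "\<phi> \<in> schwartz" for \<phi>
        by (intro square_integrable_mult_integrable gn square_integrable_of_real tensor_prod_square_integrable
            schwartz_square_integrable that)
      from integral_lin(2)[OF cs this]
      have "(\<integral>x. lin (\<lambda>\<phi>. ?g n x * complex_of_real (\<Prod>i<n. \<phi> (x i))) cs \<partial>Rn n) =
          lin (\<lambda>\<phi>. \<integral>x. ?g n x * complex_of_real (\<Prod>i<n. \<phi> (x i)) \<partial>Rn n) cs" .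
      also have "\<dots> = lin (\<lambda>\<phi>. complex_of_real ((\<integral>x. g x * \<phi> x \<partial>lborel) ^ n)) cs"
      proof (rule lin_cong[OF cs])
        fix \<phi> assume \<phi>: "\<phi> \<in> schwartz"
        have "(\<integral>x. ?g n x * complex_of_real (\<Prod>i<n. \<phi> (x i)) \<partial>Rn n) =
            complex_of_real (\<integral>x. (\<Prod>i<n. g (x i)) * (\<Prod>i<n. \<phi> (x i)) \<partial>Rn n)"
          by (simp only: of_real_mult[symmetric] integral_complex_of_real)
        also have "(\<integral>x. (\<Prod>i<n. g (x i)) * (\<Prod>i<n. \<phi> (x i)) \<partial>Rn n) = (\<Prod>i<n. \<integral>x. g x * \<phi> x \<partial>lborel)"
          by (intro tensor_prod_inner g schwartz_square_integrable \<phi>)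
        finally show "(\<integral>x. ?g n x * complex_of_real (\<Prod>i<n. \<phi> (x i)) \<partial>Rn n) =
            complex_of_real ((\<integral>x. g x * \<phi> x \<partial>lborel) ^ n)" by simp
      qed
      finally have e: "lin (\<lambda>\<phi>. complex_of_real ((\<integral>x. g x * \<phi> x \<partial>lborel) ^ n)) cs =
          (\<integral>x. ?g n x * tensor_fun n cs x \<partial>Rn n)"
        unfolding tensor_fun_lin lin_mult_left by simp
      have "lin (?P n) cs = \<alpha> n * lin (\<lambda>\<phi>. complex_of_real ((\<integral>x. g x * \<phi> x \<partial>lborel) ^ n)) cs"
        by (rule lin_mult_left)
      also have "\<dots> = (\<integral>x. \<alpha> n * (?g n x * tensor_fun n cs x) \<partial>Rn n)" unfolding e by (rule integral_mult_right_zero[symmetric])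
      finally show "lin (?P n) cs = (\<integral>x. \<alpha> n * ?g n x * tensor_fun n cs x \<partial>Rn n)" by (simp only: mult.assoc)
    qed
    also have "(\<integral>x. (\<alpha> n * ?g n x) * chaos_kernel M F n x \<partial>Rn n) =
        fact n * (\<integral>x. ?f n x * chaos_kernel M F n x \<partial>Rn n)" for n
    proof -
      have "(\<integral>x. (\<alpha> n * ?g n x) * chaos_kernel M F n x \<partial>Rn n) =
          (\<integral>x. fact n * (?f n x * chaos_kernel M F n x) \<partial>Rn n)"
        by (intro Bochner_Integration.integral_cong refl) simp
      then show ?thesis by (simp only: integral_mult_right_zero)
    qed
    finally show "(\<lambda>n. fact n * (\<integral>x. ?f n x * chaos_kernel M F n x \<partial>Rn n)) sums dist_of p ?P F"
      using dist_of_sums(1)[OF P F] by simp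
  qed
qed

end

section \<open>Derivatives of the heat kernel\<close>

definition hki :: "nat \<Rightarrow> real \<Rightarrow> real \<Rightarrow> real \<Rightarrow> complex" where
  "hki n N x \<xi> = (\<i> * of_real \<xi>) ^ n * iexp (\<xi> * x) * of_real (exp (- N * \<xi>\<^sup>2 / 2))"

text \<open>\<open>hk n N x\<close> is the \<open>n\<close>-th derivative at \<open>x\<close> of the Gaussian density with variance \<open>N\<close>, written by
  Fourier inversion.\<close>

definition hk :: "nat \<Rightarrow> real \<Rightarrow> real \<Rightarrow> complex" where
  "hk n N x = (\<integral>\<xi>. hki n N x \<xi> \<partial>lborel) / of_real (2 * pi)"

text \<open>What remains of the Fourier integral of \<open>hk n N x\<close> when absolute values are
  taken inside, hence a bound uniform in \<open>x\<close>.\<close>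

definition mom :: "nat \<Rightarrow> real \<Rightarrow> real" where
  "mom n N = (\<integral>\<xi>. \<bar>\<xi>\<bar> ^ n * exp (- N * \<xi>\<^sup>2 / 2) \<partial>lborel) / (2 * pi)"

text \<open>Up to a constant, the Fourier transform of the density of variance \<open>N\<close> is
  the density of variance \<open>1 / N\<close>; each factor \<xi> therefore counts as
  \<open>1 / sqrt N\<close> in the moments.\<close>

lemma gaussian_eq_normal_density:
  assumes "(N::real) > 0"
  shows "exp (- N * \<xi>\<^sup>2 / 2) = sqrt (2 * pi / N) * normal_density 0 (1 / sqrt N) \<xi>"
  using assms by (simp add: normal_density_def power_divide real_sqrt_divide real_sqrt_mult)

lemma norm_hki: "norm (hki n N x \<xi>) = \<bar>\<xi>\<bar> ^ n * exp (- N * \<xi>\<^sup>2 / 2)"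
  by (simp add: hki_def norm_mult norm_power)

lemma mom_integrable:
  assumes "(N::real) > 0"
  shows "integrable lborel (\<lambda>\<xi>. \<bar>\<xi>\<bar> ^ n * exp (- N * \<xi>\<^sup>2 / 2))"
proof -
  have "integrable lborel (\<lambda>\<xi>. sqrt (2 * pi / N) * (normal_density 0 (1 / sqrt N) \<xi> * \<bar>\<xi> - 0\<bar> ^ n))"
    using integrable_normal_moment_abs[of "1 / sqrt N" 0 n] assms by (intro integrable_mult_right) auto
  moreover have "(\<lambda>\<xi>. sqrt (2 * pi / N) * (normal_density 0 (1 / sqrt N) \<xi> * \<bar>\<xi> - 0\<bar> ^ n)) =
      (\<lambda>\<xi>. \<bar>\<xi>\<bar> ^ n * exp (- N * \<xi>\<^sup>2 / 2))"
    unfolding gaussian_eq_normal_density[OF assms] by (simp add: mult_ac)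
  ultimately show ?thesis by (simp only:)
qed

lemma hki_integrable:
  assumes "N > 0"
  shows "integrable lborel (hki n N x)"
proof (rule Bochner_Integration.integrable_bound[OF mom_integrable[OF assms, of n]])
  show "hki n N x \<in> borel_measurable lborel" unfolding hki_def[abs_def] by measurable
qed (simp add: norm_hki)

lemma four_power: "(4::real) ^ k = (2 ^ k)\<^sup>2"
  by (simp add: power2_eq_square flip: power_mult_distrib)

text \<open>Together with \<open>fact_double_Suc_ge\<close> this places the square of the double
  factorial of \<open>2 * k\<close> between the factorials of \<open>2 * k\<close> and
  \<open>2 * k + 1\<close>, which gives even and odd moments the common bound
  \<open>sqrt (fact n)\<close>.\<close>

lemma fact_double_le: "fact (2 * k) \<le> (4 ^ k * (fact k)\<^sup>2 :: real)"
proof (induction k)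
  case (Suc k)
  have "fact (2 * Suc k) = (real (2 * k + 2) * real (2 * k + 1)) * fact (2 * k)" by (simp add: algebra_simps)
  also have "\<dots> \<le> (4 * (real k + 1)\<^sup>2) * (4 ^ k * (fact k)\<^sup>2)"
    by (rule mult_mono[OF _ Suc]) (auto simp: power2_eq_square algebra_simps)
  also have "\<dots> = 4 ^ Suc k * (fact (Suc k))\<^sup>2" by (simp add: power2_eq_square algebra_simps)
  finally show ?case .
qed simp

lemma fact_double_Suc_ge: "(4 ^ k * (fact k)\<^sup>2 :: real) \<le> fact (2 * k + 1)"
proof (induction k)
  case (Suc k)
  have "(4 ^ Suc k * (fact (Suc k))\<^sup>2 :: real) = (4 * (real k + 1)\<^sup>2) * (4 ^ k * (fact k)\<^sup>2)"
    by (simp add: power2_eq_square algebra_simps)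
  also have "\<dots> \<le> (real (2 * k + 3) * real (2 * k + 2)) * fact (2 * k + 1)"
    by (rule mult_mono[OF _ Suc]) (auto simp: power2_eq_square algebra_simps)
  also have "\<dots> = fact (2 * Suc k + 1)" by (simp add: algebra_simps)
  finally show ?case .
qed simp

text \<open>The exact even and odd moments are compared with \<open>sqrt (fact n)\<close>. A bound
  that loses a factor exponential in \<open>n\<close> would spoil the sharp condition for membership
  in \<open>space_G\<close>.\<close>

lemma normal_abs_moment_le:
  assumes \<sigma>: "\<sigma> > 0"
  shows "(\<integral>x. normal_density 0 \<sigma> x * \<bar>x\<bar> ^ n \<partial>lborel) \<le> \<sigma> ^ n * sqrt (fact n)"
proof (cases "even n")
  case True
  then obtain k where n: "n = 2 * k" by (elim evenE)
  have "(\<integral>x. normal_density 0 \<sigma> x * \<bar>x\<bar> ^ n \<partial>lborel) = fact (2 * k) / ((2 / \<sigma>\<^sup>2) ^ k * fact k)"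
    using integral_normal_moment_even[OF \<sigma>, of 0 k] by (simp add: n power_even_abs)
  also have "\<dots> = \<sigma> ^ n * (fact (2 * k) / (2 ^ k * fact k))"
    using \<sigma> by (simp add: n power_divide flip: power_mult)
  also have "fact (2 * k) / (2 ^ k * fact k) \<le> sqrt (fact n)"
  proof -
    have "sqrt (fact (2 * k)) \<le> sqrt ((2 ^ k * fact k)\<^sup>2)"
      using fact_double_le[of k] by (intro real_sqrt_le_mono) (simp only: four_power power_mult_distrib)
    then have "sqrt (fact (2 * k)) \<le> 2 ^ k * fact k" by simp
    then have "sqrt (fact (2 * k)) * sqrt (fact (2 * k)) \<le> sqrt (fact (2 * k)) * (2 ^ k * fact k)"
      by (intro mult_left_mono) auto
    then show ?thesis by (simp add: n field_simps)
  qed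
  finally show ?thesis using \<sigma> by (simp add: mult_left_mono)
next
  case False
  then obtain k where n: "n = 2 * k + 1" by (elim oddE)
  have "(\<integral>x. normal_density 0 \<sigma> x * \<bar>x\<bar> ^ n \<partial>lborel) = 2 ^ k * \<sigma> ^ (2 * k + 1) * fact k * sqrt (2 / pi)"
    using integral_normal_moment_abs_odd[OF \<sigma>, of 0 k] by (simp add: n)
  also have "\<dots> = \<sigma> ^ n * ((2 ^ k * fact k) * sqrt (2 / pi))" by (simp add: n)
  also have "(2 ^ k * fact k) * sqrt (2 / pi) \<le> sqrt (fact n) * 1"
  proof (rule mult_mono)
    have "sqrt ((2 ^ k * fact k)\<^sup>2) \<le> sqrt (fact n)"
      using fact_double_Suc_ge[of k] unfolding n
      by (intro real_sqrt_le_mono) (simp only: four_power power_mult_distrib)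
    then show "2 ^ k * fact k \<le> sqrt (fact n)" by simp
    show "sqrt (2 / pi) \<le> 1" using pi_gt3 by (simp add: real_sqrt_le_1_iff)
  qed auto
  finally show ?thesis using \<sigma> by (simp add: mult_left_mono)
qed

lemma mom_nonneg: "0 \<le> mom n N"
  unfolding mom_def by (intro divide_nonneg_nonneg integral_nonneg_AE) auto

lemma mom_le:
  assumes "N > 0"
  shows "mom n N \<le> sqrt (2 * pi / N) / (2 * pi) * ((1 / sqrt N) ^ n * sqrt (fact n))"
proof -
  have "(\<integral>\<xi>. \<bar>\<xi>\<bar> ^ n * exp (- N * \<xi>\<^sup>2 / 2) \<partial>lborel) =
      (\<integral>\<xi>. sqrt (2 * pi / N) * (normal_density 0 (1 / sqrt N) \<xi> * \<bar>\<xi>\<bar> ^ n) \<partial>lborel)"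
    unfolding gaussian_eq_normal_density[OF assms] by (simp add: mult_ac)
  also have "\<dots> = sqrt (2 * pi / N) * (\<integral>\<xi>. normal_density 0 (1 / sqrt N) \<xi> * \<bar>\<xi>\<bar> ^ n \<partial>lborel)"
    by (rule integral_mult_right_zero)
  also have "\<dots> \<le> sqrt (2 * pi / N) * ((1 / sqrt N) ^ n * sqrt (fact n))"
    using assms by (intro mult_left_mono normal_abs_moment_le) auto
  finally show ?thesis unfolding mom_def by (simp add: divide_right_mono)
qed

lemma mom_antimono:
  assumes "0 < N" "N \<le> N'"
  shows "mom n N' \<le> mom n N"
  unfolding mom_def
proof (intro divide_right_mono integral_mono mom_integrable)
  fix \<xi> :: real
  have "N * \<xi>\<^sup>2 \<le> N' * \<xi>\<^sup>2" using assms by (intro mult_right_mono) auto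
  then show "\<bar>\<xi>\<bar> ^ n * exp (- N' * \<xi>\<^sup>2 / 2) \<le> \<bar>\<xi>\<bar> ^ n * exp (- N * \<xi>\<^sup>2 / 2)"
    by (intro mult_left_mono) auto
qed (use assms in auto)

section \<open>Estimates and Taylor expansions of the heat kernel\<close>

lemma cmod_integral_le_mom:
  assumes "N > 0" "\<And>\<xi>. cmod (f \<xi>) \<le> c * (\<bar>\<xi>\<bar> ^ n * exp (- N * \<xi>\<^sup>2 / 2))"
  shows "cmod ((\<integral>\<xi>. f \<xi> \<partial>lborel) / of_real (2 * pi)) \<le> c * mom n N"
proof -
  have "cmod (\<integral>\<xi>. f \<xi> \<partial>lborel) \<le> (\<integral>\<xi>. c * (\<bar>\<xi>\<bar> ^ n * exp (- N * \<xi>\<^sup>2 / 2)) \<partial>lborel)"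
  proof (rule order_trans[OF integral_norm_bound integral_mono'])
    show "0 \<le> c * (\<bar>\<xi>\<bar> ^ n * exp (- N * \<xi>\<^sup>2 / 2))" for \<xi>
      by (rule order_trans[OF norm_ge_zero assms(2)])
  qed (use assms mom_integrable[OF assms(1), of n] in auto)
  then show ?thesis by (simp add: norm_divide mom_def divide_right_mono)
qed

lemma hk_le: "N > 0 \<Longrightarrow> cmod (hk n N x) \<le> mom n N"
  unfolding hk_def using cmod_integral_le_mom[of N "hki n N x" 1 n] by (simp add: norm_hki)

text \<open>The expansion of the oscillating factor inside the Fourier integral. The quadratic
  remainder contributes two factors \<xi>, hence a moment of order \<open>n + 2\<close>.\<close>

lemma hk_x_taylor:
  assumes N: "N > 0"
  shows "cmod (hk n N y - hk n N x - of_real (y - x) * hk (n + 1) N x) \<le> (y - x)\<^sup>2 / 2 * mom (n + 2) N"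
proof -
  have i: "integrable lborel (hki n N x)" for n x by (rule hki_integrable[OF N])
  have eq: "hk n N y - hk n N x - of_real (y - x) * hk (n + 1) N x =
      (\<integral>\<xi>. hki n N y \<xi> - hki n N x \<xi> - of_real (y - x) * hki (n + 1) N x \<xi> \<partial>lborel) / of_real (2 * pi)"
    unfolding hk_def using i by (simp add: diff_divide_distrib)
  show ?thesis unfolding eq
  proof (rule cmod_integral_le_mom[OF N])
    fix \<xi>
    have "hki n N y \<xi> - hki n N x \<xi> - of_real (y - x) * hki (n + 1) N x \<xi> =
        hki n N x \<xi> * (iexp (\<xi> * (y - x)) - (\<Sum>k\<le>1. (\<i> * of_real (\<xi> * (y - x))) ^ k / fact k))"
    proof -
      have "iexp (\<xi> * y) = iexp (\<xi> * x) * iexp (\<xi> * (y - x))"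
        by (simp add: algebra_simps flip: exp_add)
      then show ?thesis by (simp add: hki_def algebra_simps)
    qed
    also have "cmod \<dots> \<le> cmod (hki n N x \<xi>) * (\<bar>\<xi> * (y - x)\<bar> ^ Suc 1 / fact (Suc 1))"
      unfolding norm_mult by (intro mult_left_mono iexp_approx1) auto
    also have "\<bar>\<xi> * (y - x)\<bar> ^ Suc 1 = \<bar>\<xi>\<bar>\<^sup>2 * (y - x)\<^sup>2"
      by (simp add: numeral_2_eq_2[symmetric] power_mult_distrib)
    also have "cmod (hki n N x \<xi>) * (\<bar>\<xi>\<bar>\<^sup>2 * (y - x)\<^sup>2 / fact (Suc 1)) =
        (y - x)\<^sup>2 / 2 * (\<bar>\<xi>\<bar> ^ (n + 2) * exp (- N * \<xi>\<^sup>2 / 2))"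
      unfolding norm_hki power_add by simp
    finally show "cmod (hki n N y \<xi> - hki n N x \<xi> - of_real (y - x) * hki (n + 1) N x \<xi>) \<le>
        (y - x)\<^sup>2 / 2 * (\<bar>\<xi>\<bar> ^ (n + 2) * exp (- N * \<xi>\<^sup>2 / 2))" .
  qed
qed

lemma exp_taylor2: "\<bar>exp y - 1 - y\<bar> \<le> y\<^sup>2 / 2 * exp \<bar>y\<bar>" for y :: real
proof -
  obtain t where t: "\<bar>t\<bar> \<le> \<bar>y\<bar>" "exp y = (\<Sum>m<2. y ^ m / fact m) + exp t / fact 2 * y ^ 2"
    using Maclaurin_exp_le[of y 2] by blast
  then have "exp y - 1 - y = y\<^sup>2 / 2 * exp t" by (simp add: numeral_2_eq_2)
  moreover have "exp t \<le> exp \<bar>y\<bar>" using t by auto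
  moreover have "0 \<le> y\<^sup>2 / 2 * exp t" by simp
  moreover have "y\<^sup>2 / 2 * exp t \<le> y\<^sup>2 / 2 * exp \<bar>y\<bar>" using t by (intro mult_left_mono) auto
  ultimately show ?thesis by linarith
qed

text \<open>Differentiating the integrand in \<open>N\<close> multiplies it by minus half of the
  square of \<xi>, which is also half the second derivative in \<open>x\<close>: the heat equation.
  The exponential in the remainder is paid for by lowering the variance to \<open>N0\<close>, whence
  the condition on the size of \<open>N' - N\<close>.\<close>

lemma hk_N_taylor:
  assumes N0: "0 < N0" "\<bar>N' - N\<bar> \<le> N - N0"
  shows "cmod (hk n N' x - hk n N x - of_real ((N' - N) / 2) * hk (n + 2) N x) \<le> (N' - N)\<^sup>2 * mom (n + 4) N0"
proof -
  have N: "0 < N" "0 < N'" using N0 by linarith+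
  have i: "integrable lborel (hki n N x)" "integrable lborel (hki n N' x)" for n x using hki_integrable N by auto
  have eq: "hk n N' x - hk n N x - of_real ((N' - N) / 2) * hk (n + 2) N x =
      (\<integral>\<xi>. hki n N' x \<xi> - hki n N x \<xi> - of_real ((N' - N) / 2) * hki (n + 2) N x \<xi> \<partial>lborel) / of_real (2 * pi)"
    unfolding hk_def using i by (simp add: diff_divide_distrib)
  show ?thesis unfolding eq
  proof (rule cmod_integral_le_mom[OF N0(1)])
    fix \<xi> :: real
    let ?y = "- ((N' - N) * \<xi>\<^sup>2 / 2)"
    have "hki n N' x \<xi> - hki n N x \<xi> - of_real ((N' - N) / 2) * hki (n + 2) N x \<xi> =
        hki n N x \<xi> * of_real (exp ?y - 1 - ?y)"
    proof -
      have e: "exp (- N' * \<xi>\<^sup>2 / 2) = exp (- N * \<xi>\<^sup>2 / 2) * exp ?y"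
        by (simp add: field_simps flip: exp_add)
      have "(\<i> * complex_of_real \<xi>) ^ (n + 2) = - ((\<i> * of_real \<xi>) ^ n * of_real (\<xi>\<^sup>2))"
      proof -
        have "(\<i> * complex_of_real \<xi>)\<^sup>2 = - of_real (\<xi>\<^sup>2)" by (simp add: power_mult_distrib)
        then show ?thesis unfolding power_add by simp
      qed
      moreover have "B * P * of_real (E * e) - B * P * of_real E - of_real ((N' - N) / 2) * (- (B * of_real (\<xi>\<^sup>2)) * P * of_real E) =
          B * P * of_real E * of_real (e - 1 - ?y)" for B P :: complex and E e :: real
        by (simp add: algebra_simps add_divide_distrib diff_divide_distrib)
      ultimately show ?thesis unfolding hki_def e by simp
    qed
    also have "cmod \<dots> = \<bar>\<xi>\<bar> ^ n * exp (- N * \<xi>\<^sup>2 / 2) * \<bar>exp ?y - 1 - ?y\<bar>"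
      unfolding norm_mult norm_hki norm_of_real ..
    also have "\<dots> \<le> \<bar>\<xi>\<bar> ^ n * exp (- N * \<xi>\<^sup>2 / 2) * (?y\<^sup>2 / 2 * exp \<bar>?y\<bar>)"
      by (intro mult_left_mono exp_taylor2) auto
    also have "\<dots> = (N' - N)\<^sup>2 / 8 * (\<bar>\<xi>\<bar> ^ (n + 4) * (exp (- N * \<xi>\<^sup>2 / 2) * exp \<bar>?y\<bar>))"
      by (simp add: power_add power_mult_distrib power_divide mult_ac)
    also have "\<dots> \<le> (N' - N)\<^sup>2 * (\<bar>\<xi>\<bar> ^ (n + 4) * exp (- N0 * \<xi>\<^sup>2 / 2))"
    proof (intro mult_mono)
      have "\<bar>?y\<bar> = \<bar>N' - N\<bar> * \<xi>\<^sup>2 / 2" by (simp add: abs_mult)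
      also have "\<dots> \<le> (N - N0) * \<xi>\<^sup>2 / 2" using N0 by (intro divide_right_mono mult_right_mono) auto
      finally show "exp (- N * \<xi>\<^sup>2 / 2) * exp \<bar>?y\<bar> \<le> exp (- N0 * \<xi>\<^sup>2 / 2)"
        by (simp add: algebra_simps diff_divide_distrib flip: exp_add)
    qed auto
    finally show "cmod (hki n N' x \<xi> - hki n N x \<xi> - of_real ((N' - N) / 2) * hki (n + 2) N x \<xi>) \<le>
        (N' - N)\<^sup>2 * (\<bar>\<xi>\<bar> ^ (n + 4) * exp (- N0 * \<xi>\<^sup>2 / 2))" .
  qed
qed

lemma hki_sums: "(\<lambda>n. hki n N x \<xi> * of_real (b ^ n / fact n)) sums hki 0 N (x + b) \<xi>"
proof -
  have "(\<lambda>n. (\<i> * of_real (\<xi> * b)) ^ n / fact n) sums iexp (\<xi> * b)"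
    using exp_converges[of "\<i> * of_real (\<xi> * b)"] by (simp add: scaleR_conv_of_real field_simps)
  from sums_mult[OF this, of "hki 0 N x \<xi>"]
  have "(\<lambda>n. hki 0 N x \<xi> * ((\<i> * of_real (\<xi> * b)) ^ n / fact n)) sums (hki 0 N x \<xi> * iexp (\<xi> * b))" .
  moreover have "hki 0 N x \<xi> * iexp (\<xi> * b) = hki 0 N (x + b) \<xi>"
    by (simp add: hki_def algebra_simps exp_add)
  moreover have "hki 0 N x \<xi> * ((\<i> * of_real (\<xi> * b)) ^ n / fact n) = hki n N x \<xi> * of_real (b ^ n / fact n)" for n
    by (simp add: hki_def power_mult_distrib)
  ultimately show ?thesis by simp
qed

text \<open>Rescaling by \<open>sqrt N\<close> reduces the Fourier integral to the characteristic
  function of the standard normal distribution.\<close>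

lemma hk_zero:
  assumes N: "N > 0"
  shows "hk 0 N x = of_real (normal_density 0 (sqrt N) x)"
proof -
  let ?c = "1 / sqrt N"
  have c: "?c > 0" "N * ?c\<^sup>2 = 1" using N by (auto simp: power_divide)
  have "(\<integral>\<xi>. hki 0 N x \<xi> \<partial>lborel) = \<bar>?c\<bar> *\<^sub>R (\<integral>\<xi>. hki 0 N x (0 + ?c * \<xi>) \<partial>lborel)"
    by (rule lborel_integral_real_affine) (use c in auto)
  also have "(\<lambda>\<xi>. hki 0 N x (0 + ?c * \<xi>)) = (\<lambda>\<xi>. sqrt (2 * pi) *\<^sub>R (std_normal_density \<xi> *\<^sub>R iexp ((x * ?c) * \<xi>)))"
  proof
    fix \<xi>
    have "N * (?c * \<xi>)\<^sup>2 = \<xi>\<^sup>2" using N by (simp add: power_mult_distrib power_divide)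
    then show "hki 0 N x (0 + ?c * \<xi>) = sqrt (2 * pi) *\<^sub>R (std_normal_density \<xi> *\<^sub>R iexp ((x * ?c) * \<xi>))"
      by (simp add: hki_def std_normal_density_def scaleR_conv_of_real mult_ac)
  qed
  also have "(\<integral>\<xi>. sqrt (2 * pi) *\<^sub>R (std_normal_density \<xi> *\<^sub>R iexp ((x * ?c) * \<xi>)) \<partial>lborel) =
      sqrt (2 * pi) *\<^sub>R (\<integral>\<xi>. std_normal_density \<xi> *\<^sub>R iexp ((x * ?c) * \<xi>) \<partial>lborel)"
    by (rule Bochner_Integration.integral_scaleR_right)
  also have "(\<integral>\<xi>. std_normal_density \<xi> *\<^sub>R iexp ((x * ?c) * \<xi>) \<partial>lborel) =
      char std_normal_distribution (x * ?c)"
    unfolding char_def by (subst integral_density) auto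
  also have "char std_normal_distribution (x * ?c) = complex_of_real (exp (- (x * ?c)\<^sup>2 / 2))"
    by (simp add: char_std_normal_distribution)
  finally have "hk 0 N x = complex_of_real (?c * (sqrt (2 * pi) * exp (- (x * ?c)\<^sup>2 / 2)) / (2 * pi))"
    unfolding hk_def using c by (simp add: scaleR_conv_of_real)
  also have "?c * (sqrt (2 * pi) * exp (- (x * ?c)\<^sup>2 / 2)) / (2 * pi) = normal_density 0 (sqrt N) x"
    using N by (simp add: normal_density_def power_mult_distrib power_divide real_sqrt_mult field_simps)
  finally show ?thesis .
qed

text \<open>The Taylor series of the density at \<open>x\<close> with increment \<open>b\<close>.
  Under the Fourier integral it is the exponential series of \<open>\<i> * \<xi> * b\<close>,
  integrated termwise by dominated convergence. It evaluates the S-transform of the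
  solution.\<close>

lemma hk_sums:
  assumes N: "N > 0"
  shows "(\<lambda>n. hk n N x * of_real (b ^ n / fact n)) sums of_real (normal_density 0 (sqrt N) (x + b))"
  unfolding sums_def
proof -
  let ?S = "\<lambda>K \<xi>. \<Sum>n<K. hki n N x \<xi> * of_real (b ^ n / fact n)"
  have i: "integrable lborel (hki n N x)" for n x by (rule hki_integrable[OF N])
  have m: "hki n N x \<in> borel_measurable lborel" for n x using i by auto
  have "(\<lambda>K. \<integral>\<xi>. ?S K \<xi> \<partial>lborel) \<longlonglongrightarrow> (\<integral>\<xi>. hki 0 N (x + b) \<xi> \<partial>lborel)"
  proof (rule integral_dominated_convergence)
    let ?w = "\<lambda>\<xi>. exp (b\<^sup>2 / N) * (\<bar>\<xi>\<bar> ^ 0 * exp (- (N / 2) * \<xi>\<^sup>2 / 2))"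
    show "integrable lborel ?w"
      using mom_integrable[of "N / 2" 0] N by (intro integrable_mult_right) auto
    show "?S K \<in> borel_measurable lborel" for K using m by (intro borel_measurable_sum borel_measurable_times) auto
    show "hki 0 N (x + b) \<in> borel_measurable lborel" by (rule m)
    show "AE \<xi> in lborel. (\<lambda>K. ?S K \<xi>) \<longlonglongrightarrow> hki 0 N (x + b) \<xi>"
      using hki_sums by (simp add: sums_def)
    show "AE \<xi> in lborel. cmod (?S K \<xi>) \<le> ?w \<xi>" for K
    proof (rule AE_I2)
      fix \<xi> :: real
      have "cmod (?S K \<xi>) \<le> (\<Sum>n<K. (\<bar>\<xi>\<bar> * \<bar>b\<bar>) ^ n / fact n * exp (- N * \<xi>\<^sup>2 / 2))"
        by (rule order_trans[OF norm_sum]) (simp add: norm_mult norm_hki norm_power power_mult_distrib norm_divide power_abs field_simps)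
      also have "\<dots> = (\<Sum>n<K. (\<bar>\<xi>\<bar> * \<bar>b\<bar>) ^ n / fact n) * exp (- N * \<xi>\<^sup>2 / 2)" by (simp add: sum_distrib_right)
      also have "\<dots> \<le> exp (\<bar>\<xi>\<bar> * \<bar>b\<bar>) * exp (- N * \<xi>\<^sup>2 / 2)"
      proof (rule mult_right_mono)
        have "(\<lambda>n. (\<bar>\<xi>\<bar> * \<bar>b\<bar>) ^ n / fact n) sums exp (\<bar>\<xi>\<bar> * \<bar>b\<bar>)"
          using exp_converges[of "\<bar>\<xi>\<bar> * \<bar>b\<bar>"] by (simp add: divide_inverse mult.commute)
        then show "(\<Sum>n<K. (\<bar>\<xi>\<bar> * \<bar>b\<bar>) ^ n / fact n) \<le> exp (\<bar>\<xi>\<bar> * \<bar>b\<bar>)"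
          using sum_le_suminf[of "\<lambda>n. (\<bar>\<xi>\<bar> * \<bar>b\<bar>) ^ n / fact n" "{..<K}"] by (simp add: sums_iff)
      qed simp
      \<comment> \<open>Completing the square absorbs the linear exponent into half of the Gaussian
        exponent, which leaves an integrable majorant.\<close>
      also have "\<dots> \<le> exp (b\<^sup>2 / N + - (N / 2) * \<xi>\<^sup>2 / 2)"
      proof -
        have "0 \<le> (\<bar>b\<bar> - N / 2 * \<bar>\<xi>\<bar>)\<^sup>2 / N" using N by simp
        also have "\<dots> = b\<^sup>2 / N + N / 4 * \<xi>\<^sup>2 - \<bar>\<xi>\<bar> * \<bar>b\<bar>" using N by (simp add: power2_eq_square field_simps)
        finally show ?thesis by (simp flip: exp_add)
      qed
      finally show "cmod (?S K \<xi>) \<le> ?w \<xi>" by (simp only: exp_add power_0 mult_1)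
    qed
  qed
  moreover have "(\<integral>\<xi>. ?S K \<xi> \<partial>lborel) = (\<Sum>n<K. (\<integral>\<xi>. hki n N x \<xi> \<partial>lborel) * of_real (b ^ n / fact n))" for K
    using i by (subst Bochner_Integration.integral_sum) auto
  ultimately have "(\<lambda>K. (\<Sum>n<K. (\<integral>\<xi>. hki n N x \<xi> \<partial>lborel) * of_real (b ^ n / fact n)) / of_real (2 * pi)) \<longlonglongrightarrow>
      (\<integral>\<xi>. hki 0 N (x + b) \<xi> \<partial>lborel) / of_real (2 * pi)"
    by (intro tendsto_intros) auto
  moreover have "(\<Sum>n<K. (\<integral>\<xi>. hki n N x \<xi> \<partial>lborel) * of_real (b ^ n / fact n)) / of_real (2 * pi) =
      (\<Sum>n<K. hk n N x * of_real (b ^ n / fact n))" for K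
    unfolding hk_def sum_divide_distrib by (intro sum.cong refl) (simp only: times_divide_eq_left)
  ultimately have "(\<lambda>K. \<Sum>n<K. hk n N x * of_real (b ^ n / fact n)) \<longlonglongrightarrow> hk 0 N (x + b)"
    by (simp only: hk_def[symmetric])
  then show "(\<lambda>K. \<Sum>n<K. hk n N x * of_real (b ^ n / fact n)) \<longlonglongrightarrow> of_real (normal_density 0 (sqrt N) (x + b))"
    by (simp only: hk_zero[OF N])
qed

section \<open>Summability of the bounds\<close>

lemma summable_poly_geometric:
  fixes q :: real
  assumes "0 \<le> q" "q < 1"
  shows "summable (\<lambda>n. (real n + 4) ^ 4 * q ^ n)"
proof -
  let ?c = "(q + 1) / 2"
  have "(\<lambda>n. ((real (Suc n) + 4) / (real n + 4)) ^ 4 * q) \<longlonglongrightarrow> 1 ^ 4 * q"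
  proof (intro tendsto_intros)
    show "(\<lambda>n. (real (Suc n) + 4) / (real n + 4)) \<longlonglongrightarrow> 1" by real_asymp
  qed
  then have "\<forall>\<^sub>F n in sequentially. ((real (Suc n) + 4) / (real n + 4)) ^ 4 * q < ?c"
    by (rule order_tendstoD(2)) (use assms in simp)
  then obtain N where N: "\<And>n. n \<ge> N \<Longrightarrow> ((real (Suc n) + 4) / (real n + 4)) ^ 4 * q < ?c"
    by (auto simp: eventually_sequentially)
  have "norm ((real (Suc n) + 4) ^ 4 * q ^ Suc n) \<le> ?c * norm ((real n + 4) ^ 4 * q ^ n)" if "n \<ge> N" for n
  proof -
    have "(real (Suc n) + 4) ^ 4 * q ^ Suc n = (((real (Suc n) + 4) / (real n + 4)) ^ 4 * q) * ((real n + 4) ^ 4 * q ^ n)"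
      by (simp add: power_divide)
    also have "\<dots> \<le> ?c * ((real n + 4) ^ 4 * q ^ n)"
      using N[OF that] assms by (intro mult_right_mono) auto
    finally show ?thesis using assms by simp
  qed
  then show ?thesis using assms by (intro summable_ratio_test[of ?c N]) auto
qed

lemma fact_add_le: "fact (n + j) \<le> (fact n * (real n + 4) ^ j :: real)" if "j \<le> 4"
  using that
proof (induction j)
  case (Suc j)
  have "fact (n + Suc j) = (real n + real j + 1) * fact (n + j)" by (simp add: algebra_simps)
  also have "\<dots> \<le> (real n + 4) * (fact n * (real n + 4) ^ j)"
    using Suc by (intro mult_mono) auto
  finally show ?case by (simp add: mult_ac)
qed simp

text \<open>One majorant for all estimates. Four extra moments are enough: a spatial derivative of
  order at most 2 together with its quadratic Taylor remainder, and the second order remainder in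
  the variance, each reach order \<open>n + 4\<close>.\<close>

definition hk_bound :: "real \<Rightarrow> real \<Rightarrow> nat \<Rightarrow> real" where
  "hk_bound N L n = (\<Sum>j\<le>4. mom (n + j) N) * L ^ n"

lemma hk_bound_ge:
  assumes "j \<le> 4" "0 \<le> L" "0 < N0" "N0 \<le> N"
  shows "mom (n + j) N * L ^ n \<le> hk_bound N0 L n"
proof -
  have "mom (n + j) N \<le> mom (n + j) N0" by (intro mom_antimono assms)
  also have "\<dots> \<le> (\<Sum>j\<le>4. mom (n + j) N0)"
    using assms(1) mom_nonneg by (intro member_le_sum) auto
  finally show ?thesis
    unfolding hk_bound_def using assms by (intro mult_right_mono) auto
qed

lemma hk_bound_nonneg: "0 \<le> L \<Longrightarrow> 0 \<le> hk_bound N L n"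
  unfolding hk_bound_def by (intro mult_nonneg_nonneg sum_nonneg mom_nonneg) auto

text \<open>A moment of order \<open>n + j\<close> is at most a constant times
  \<open>sqrt (fact n)\<close>, a polynomial in \<open>n\<close> and the \<open>n\<close>-th power
  of \<open>1 / sqrt N\<close>. Squaring and dividing by \<open>fact n\<close> leaves a polynomial
  times a geometric sequence of ratio \<open>L\<^sup>2 / N\<close>.\<close>

lemma hk_bound_summable:
  assumes N: "N > 0" and L: "0 \<le> L" "L\<^sup>2 < N"
  shows "summable (\<lambda>n. (hk_bound N L n)\<^sup>2 / fact n)"
proof -
  define K where "K = sqrt (2 * pi / N) / (2 * pi) * (\<Sum>j\<le>4. (1 / sqrt N) ^ j)"
  have K: "0 \<le> K" unfolding K_def using N by (intro mult_nonneg_nonneg sum_nonneg) auto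
  have m: "(\<Sum>j\<le>4. mom (n + j) N) \<le> K * (sqrt (fact n) * (real n + 4)\<^sup>2 * (1 / sqrt N) ^ n)" for n
  proof -
    have "(\<Sum>j\<le>4. mom (n + j) N) \<le>
        (\<Sum>j\<le>4. sqrt (2 * pi / N) / (2 * pi) * (1 / sqrt N) ^ j * (sqrt (fact n) * (real n + 4)\<^sup>2 * (1 / sqrt N) ^ n))"
    proof (rule sum_mono)
      fix j :: nat assume j: "j \<in> {..4}"
      have "fact (n + j) \<le> (fact n * (real n + 4) ^ j :: real)" using j by (intro fact_add_le) auto
      also have "\<dots> \<le> fact n * (real n + 4) ^ 4" using j by (intro mult_left_mono power_increasing) auto
      finally have s: "sqrt (fact (n + j)) \<le> sqrt (fact n) * (real n + 4)\<^sup>2"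
        by (intro real_le_lsqrt) (auto simp: power_mult_distrib)
      have "mom (n + j) N \<le> sqrt (2 * pi / N) / (2 * pi) * ((1 / sqrt N) ^ (n + j) * sqrt (fact (n + j)))"
        by (rule mom_le[OF N])
      also have "\<dots> \<le> sqrt (2 * pi / N) / (2 * pi) * ((1 / sqrt N) ^ (n + j) * (sqrt (fact n) * (real n + 4)\<^sup>2))"
        using N by (intro mult_left_mono s) auto
      finally show "mom (n + j) N \<le> sqrt (2 * pi / N) / (2 * pi) * (1 / sqrt N) ^ j * (sqrt (fact n) * (real n + 4)\<^sup>2 * (1 / sqrt N) ^ n)"
        by (simp add: power_add mult_ac)
    qed
    also have "\<dots> = K * (sqrt (fact n) * (real n + 4)\<^sup>2 * (1 / sqrt N) ^ n)"
      unfolding K_def sum_distrib_left sum_distrib_right ..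
    finally show ?thesis .
  qed
  have q: "0 \<le> L\<^sup>2 / N" "L\<^sup>2 / N < 1" using N L by auto
  have "summable (\<lambda>n. K\<^sup>2 * ((real n + 4) ^ 4 * (L\<^sup>2 / N) ^ n))"
    by (intro summable_mult summable_poly_geometric q)
  then show ?thesis
  proof (rule summable_comparison_test'[of _ 0])
    fix n
    have "hk_bound N L n \<le> (K * (sqrt (fact n) * (real n + 4)\<^sup>2 * (1 / sqrt N) ^ n)) * L ^ n"
      unfolding hk_bound_def using L by (intro mult_right_mono m) auto
    then have "(hk_bound N L n)\<^sup>2 \<le> ((K * (sqrt (fact n) * (real n + 4)\<^sup>2 * (1 / sqrt N) ^ n)) * L ^ n)\<^sup>2"
      by (intro power_mono hk_bound_nonneg L)
    also have "\<dots> = K\<^sup>2 * ((real n + 4) ^ 4 * (L\<^sup>2 / N) ^ n) * fact n"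
    proof -
      have "((1 / sqrt N) ^ n)\<^sup>2 = ((1 / sqrt N)\<^sup>2) ^ n" unfolding power_mult[symmetric] by (simp only: mult.commute)
      also have "(1 / sqrt N)\<^sup>2 = 1 / N" using N by (simp add: power_divide)
      finally have "((1 / sqrt N) ^ n)\<^sup>2 = (1 / N) ^ n" .
      moreover have "(L ^ n)\<^sup>2 = (L\<^sup>2) ^ n" unfolding power_mult[symmetric] by (simp only: mult.commute)
      moreover have "(L\<^sup>2 / N) ^ n = (1 / N) ^ n * (L\<^sup>2) ^ n" by (simp flip: power_mult_distrib)
      moreover have "((real n + 4)\<^sup>2)\<^sup>2 = (real n + 4) ^ 4" by (simp flip: power_mult)
      ultimately show ?thesis by (simp add: power_mult_distrib mult_ac)
    qed
    finally have "(hk_bound N L n)\<^sup>2 / fact n \<le> K\<^sup>2 * ((real n + 4) ^ 4 * (L\<^sup>2 / N) ^ n)"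
      by (simp add: divide_le_eq)
    then show "norm ((hk_bound N L n)\<^sup>2 / fact n) \<le> K\<^sup>2 * ((real n + 4) ^ 4 * (L\<^sup>2 / N) ^ n)" by simp
  qed
qed

section \<open>Lebesgue's differentiation theorem on the line\<close>

definition segm :: "real \<Rightarrow> real \<Rightarrow> real set" where
  "segm x r = {min x r..max x r}"

lemma segm_cball: "segm x r = cball ((x + r) / 2) (\<bar>r - x\<bar> / 2)"
  by (auto simp: segm_def cball_eq_atLeastAtMost min_def max_def field_simps abs_if)

lemma content_segm: "Henstock_Kurzweil_Integration.content (segm x r) = \<bar>r - x\<bar>"
  by (auto simp: segm_def min_def max_def)

text \<open>Henstock's lemma controls the total length of disjoint intervals on which the average of \<open>f\<close> is
  far from its value at the tag, and Vitali's theorem covers the exceptional set by such intervals.\<close>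

lemma negligible_bad_averages:
  fixes f :: "real \<Rightarrow> real"
  assumes f: "f integrable_on cbox a b" and \<epsilon>: "\<epsilon> > 0"
  shows "negligible {x. \<forall>d>0. \<exists>r. r \<noteq> x \<and> \<bar>r - x\<bar> < d \<and> segm x r \<subseteq> cbox a b \<and>
      \<epsilon> * \<bar>r - x\<bar> \<le> \<bar>\<bar>r - x\<bar> * f x - integral (segm x r) f\<bar>}" (is "negligible ?S")
  unfolding negligible_outer_le
proof (intro allI impI)
  fix e :: real assume e: "e > 0"
  obtain \<gamma> where \<gamma>: "gauge \<gamma>"
    "\<And>p. \<lbrakk>p tagged_partial_division_of (cbox a b); \<gamma> fine p\<rbrakk> \<Longrightarrow>
       (\<Sum>(x, k)\<in>p. norm (Henstock_Kurzweil_Integration.content k *\<^sub>R f x - integral k f)) < \<epsilon> * e"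
    using Henstock_lemma[OF f, of "\<epsilon> * e"] e \<epsilon> by auto
  define K where "K = {(x, r). r \<noteq> x \<and> segm x r \<subseteq> cbox a b \<and> segm x r \<subseteq> \<gamma> x \<and>
      \<epsilon> * \<bar>r - x\<bar> \<le> \<bar>\<bar>r - x\<bar> * f x - integral (segm x r) f\<bar>}"
  let ?a = "\<lambda>(x, r). (x + r) / 2 :: real" and ?r = "\<lambda>(x, r). \<bar>r - x\<bar> / 2 :: real"
  have ball: "cball (?a i) (?r i) = segm (fst i) (snd i)" for i by (cases i) (simp add: segm_cball)
  obtain C where C: "countable C" "C \<subseteq> K"
    "pairwise (\<lambda>i j. disjnt (cball (?a i) (?r i)) (cball (?a j) (?r j))) C"
    "negligible (?S - (\<Union>i\<in>C. cball (?a i) (?r i)))"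
  proof (rule Vitali_covering_theorem_cballs[of K ?r ?S ?a])
    show "0 < ?r i" if "i \<in> K" for i using that by (auto simp: K_def)
    fix x d :: real assume x: "x \<in> ?S" and d: "0 < d"
    have "open (\<gamma> x)" "x \<in> \<gamma> x" using \<gamma>(1) by (auto simp: gauge_def)
    then obtain d' where d': "d' > 0" "ball x d' \<subseteq> \<gamma> x" by (auto simp: open_contains_ball)
    from x d d' obtain r where r: "r \<noteq> x" "\<bar>r - x\<bar> < min d d'" "segm x r \<subseteq> cbox a b"
      "\<epsilon> * \<bar>r - x\<bar> \<le> \<bar>\<bar>r - x\<bar> * f x - integral (segm x r) f\<bar>" by (auto dest!: spec[of _ "min d d'"])
    have "segm x r \<subseteq> ball x d'" using r(2) by (auto simp: segm_def dist_real_def)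
    then have "(x, r) \<in> K" using r d' by (auto simp: K_def)
    moreover have "x \<in> cball (?a (x, r)) (?r (x, r))" unfolding ball by (simp add: segm_def)
    moreover have "?r (x, r) < d"
    proof -
      have "\<bar>r - x\<bar> < d" "0 \<le> \<bar>r - x\<bar>" using r(2) by simp_all
      then have "\<bar>r - x\<bar> / 2 < d" by (simp add: field_simps)
      then show ?thesis by simp
    qed
    ultimately show "\<exists>i. i \<in> K \<and> x \<in> cball (?a i) (?r i) \<and> ?r i < d" by blast
  qed
  let ?I = "\<lambda>i. segm (fst i) (snd i)"
  have Ce: "(\<Union>i\<in>C. cball (?a i) (?r i)) = (\<Union>i\<in>C. ?I i)" by (simp only: ball)
  have dis: "?I i \<inter> ?I j = {}" if "i \<in> C" "j \<in> C" "i \<noteq> j" for i j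
    using C(3) that unfolding pairwise_def ball disjnt_def by blast
  \<comment> \<open>A uniform bound for finite subfamilies suffices for the countable union. For a
    finite disjoint family, the lower bound in \<open>K\<close> and Henstock's lemma give at most
    \<open>\<epsilon> * e\<close> for \<epsilon> times the total length, and \<epsilon>
    cancels.\<close>
  have bound: "measure lebesgue (\<Union>i\<in>D. ?I i) \<le> e" if D: "D \<subseteq> C" "finite D" for D
  proof -
    let ?g = "\<lambda>i. (fst i, ?I i)"
    have ne: "?I i \<noteq> {}" for i :: "real \<times> real" by (auto simp: segm_def)
    have inj: "inj_on ?g D"
    proof (rule inj_onI)
      fix i j assume ij: "i \<in> D" "j \<in> D" "?g i = ?g j"
      show "i = j"
      proof (rule ccontr)
        assume "i \<noteq> j"
        then have "?I i \<inter> ?I j = {}" using dis ij D by blast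
        moreover have "?I i = ?I j" using ij(3) by (rule Pair_inject)
        ultimately have "?I i = {}" by blast
        with ne[of i] show False by (rule notE)
      qed
    qed
    have "?g ` D tagged_partial_division_of cbox a b"
      unfolding tagged_partial_division_of_def
    proof (intro conjI allI impI)
      show "finite (?g ` D)" using D by simp
    next
      fix x k assume "(x, k) \<in> ?g ` D"
      then obtain i where i: "i \<in> D" "x = fst i" "k = ?I i" by auto
      then have "i \<in> K" using D C by auto
      with i show "x \<in> k" "k \<subseteq> cbox a b" by (auto simp: K_def segm_def)
      show "\<exists>a b. k = cbox a b" unfolding i(3) segm_def by (intro exI) (rule box_real(2)[symmetric])
    next
      fix x1 k1 x2 k2 assume a: "(x1, k1) \<in> ?g ` D \<and> (x2, k2) \<in> ?g ` D \<and> (x1, k1) \<noteq> (x2, k2)"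
      then obtain i j where ij: "i \<in> D" "j \<in> D" "i \<noteq> j" "k1 = ?I i" "k2 = ?I j" by auto
      then have "k1 \<inter> k2 = {}" using dis D by blast
      then show "interior k1 \<inter> interior k2 = {}" using interior_subset by blast
    qed
    moreover have "\<gamma> fine (?g ` D)" using D C by (force simp: fine_def K_def)
    ultimately have "(\<Sum>(x, k)\<in>?g ` D. norm (Henstock_Kurzweil_Integration.content k *\<^sub>R f x - integral k f)) < \<epsilon> * e"
      by (rule \<gamma>(2))
    then have "(\<Sum>i\<in>D. \<bar>\<bar>snd i - fst i\<bar> * f (fst i) - integral (?I i) f\<bar>) < \<epsilon> * e"
      by (simp add: sum.reindex[OF inj] content_segm)
    moreover have "(\<Sum>i\<in>D. \<epsilon> * \<bar>snd i - fst i\<bar>) \<le> (\<Sum>i\<in>D. \<bar>\<bar>snd i - fst i\<bar> * f (fst i) - integral (?I i) f\<bar>)"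
      using D C by (intro sum_mono) (auto simp: K_def)
    ultimately have "\<epsilon> * (\<Sum>i\<in>D. \<bar>snd i - fst i\<bar>) < \<epsilon> * e" by (simp add: sum_distrib_left)
    then have "(\<Sum>i\<in>D. \<bar>snd i - fst i\<bar>) \<le> e" using \<epsilon> by simp
    moreover have "measure lebesgue (\<Union>i\<in>D. ?I i) \<le> (\<Sum>i\<in>D. measure lebesgue (?I i))"
      using D(2) by (intro measure_UNION_le) (auto simp: segm_def)
    moreover have "measure lebesgue (?I i) = \<bar>snd i - fst i\<bar>" for i
      using content_segm[of "fst i" "snd i"] by (simp add: segm_def)
    ultimately show ?thesis by simp
  qed
  have Im: "?I i \<in> lmeasurable" for i by (simp add: segm_def lmeasurable_interval)
  have Um: "(\<Union>i\<in>C. ?I i) \<in> lmeasurable"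
    by (rule fmeasurable_UN_bound[OF C(1) Im bound]) auto
  have Ub: "measure lebesgue (\<Union>i\<in>C. ?I i) \<le> e"
    by (rule measure_UN_bound[OF C(1) Im bound]) auto
  let ?N = "?S - (\<Union>i\<in>C. ?I i)"
  have N: "negligible ?N" using C(4) by (simp only: Ce)
  have Nm: "?N \<in> lmeasurable" by (rule negligible_imp_measurable[OF N])
  show "\<exists>T. ?S \<subseteq> T \<and> T \<in> lmeasurable \<and> measure lebesgue T \<le> e"
  proof (intro exI conjI)
    show "?S \<subseteq> (\<Union>i\<in>C. ?I i) \<union> ?N" by blast
    show "(\<Union>i\<in>C. ?I i) \<union> ?N \<in> lmeasurable" by (intro fmeasurable.Un Um Nm)
    have "measure lebesgue ((\<Union>i\<in>C. ?I i) \<union> ?N) \<le> measure lebesgue (\<Union>i\<in>C. ?I i) + measure lebesgue ?N"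
      using Um Nm by (intro measure_Un_le) auto
    then show "measure lebesgue ((\<Union>i\<in>C. ?I i) \<union> ?N) \<le> e"
      using Ub negligible_imp_measure0[OF N] by simp
  qed
qed

text \<open>The averages are over segments with \<open>x\<close> as an endpoint, as the difference
  quotients of indefinite integrals require. The exceptional set is the union of the bad sets over
  the thresholds \<open>inverse (real (Suc k))\<close> and an exhausting sequence of boxes.\<close>

lemma AE_averages_tendsto:
  fixes f :: "real \<Rightarrow> real"
  assumes f: "integrable lborel f"
  shows "AE x in lebesgue. ((\<lambda>r. (\<integral>y. indicator (segm x r) y * f y \<partial>lborel) / \<bar>r - x\<bar>) \<longlongrightarrow> f x) (at x)"
proof -
  let ?B = "\<lambda>m k. {x. \<forall>d>0. \<exists>r. r \<noteq> x \<and> \<bar>r - x\<bar> < d \<and> segm x r \<subseteq> cbox (- real m) (real m) \<and>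
      inverse (real (Suc k)) * \<bar>r - x\<bar> \<le> \<bar>\<bar>r - x\<bar> * f x - integral (segm x r) f\<bar>}"
  have si: "set_integrable lborel S f" if "S \<in> sets lborel" for S
    unfolding set_integrable_def using that by (intro integrable_mult_indicator f) auto
  have ii: "(\<integral>y. indicator (segm x r) y * f y \<partial>lborel) = integral (segm x r) f" for x r
    using set_borel_integral_eq_integral(2)[OF si[of "segm x r"]] by (simp add: segm_def set_lebesgue_integral_def)
  have "f integrable_on cbox (- real m) (real m)" for m
    using set_borel_integral_eq_integral(1)[OF si[of "cbox (- real m) (real m)"]] by simp
  then have "negligible (?B m k)" for m k
    by (intro negligible_bad_averages) auto
  then have neg: "negligible (\<Union>m. \<Union>k. ?B m k)"
    by (intro negligible_countable_Union[of "range _"] ) auto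
  have lim: "((\<lambda>r. (\<integral>y. indicator (segm x r) y * f y \<partial>lborel) / \<bar>r - x\<bar>) \<longlongrightarrow> f x) (at x)"
    if x: "x \<notin> (\<Union>m. \<Union>k. ?B m k)" for x
  proof (rule tendstoI)
    fix e :: real assume "e > 0"
    then obtain k where k: "inverse (real (Suc k)) < e" using reals_Archimedean by blast
    obtain m :: nat where m: "\<bar>x\<bar> + 1 < real m" using reals_Archimedean2 by blast
    have "x \<notin> ?B m k" using x by blast
    then obtain d where d: "d > 0" "\<And>r. r \<noteq> x \<Longrightarrow> \<bar>r - x\<bar> < d \<Longrightarrow> segm x r \<subseteq> cbox (- real m) (real m) \<Longrightarrow>
      \<bar>\<bar>r - x\<bar> * f x - integral (segm x r) f\<bar> < inverse (real (Suc k)) * \<bar>r - x\<bar>"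
      by (auto simp: not_le)
    have "dist (integral (segm x r) f / \<bar>r - x\<bar>) (f x) < e" if r: "r \<noteq> x" "dist r x < min d 1" for r
    proof -
      have "segm x r \<subseteq> cbox (- real m) (real m)" using r m by (auto simp: segm_def dist_real_def)
      then have "\<bar>\<bar>r - x\<bar> * f x - integral (segm x r) f\<bar> < inverse (real (Suc k)) * \<bar>r - x\<bar>"
        using r by (intro d) (auto simp: dist_real_def)
      also have "\<dots> \<le> e * \<bar>r - x\<bar>" using k by (intro mult_right_mono) auto
      finally have l: "\<bar>\<bar>r - x\<bar> * f x - integral (segm x r) f\<bar> < e * \<bar>r - x\<bar>" .
      have "integral (segm x r) f / \<bar>r - x\<bar> - f x = - (\<bar>r - x\<bar> * f x - integral (segm x r) f) / \<bar>r - x\<bar>"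
        using r by (simp add: field_simps)
      then have "\<bar>integral (segm x r) f / \<bar>r - x\<bar> - f x\<bar> = \<bar>\<bar>r - x\<bar> * f x - integral (segm x r) f\<bar> / \<bar>r - x\<bar>"
        by (simp only: abs_divide abs_minus_cancel abs_abs)
      also have "\<dots> < e" using l r by (simp add: divide_less_eq)
      finally show ?thesis by (simp add: dist_real_def)
    qed
    then show "\<forall>\<^sub>F r in at x. dist ((\<integral>y. indicator (segm x r) y * f y \<partial>lborel) / \<bar>r - x\<bar>) (f x) < e"
      unfolding ii eventually_at using d by (intro exI[of _ "min d 1"]) auto
  qed
  show ?thesis
  proof (rule AE_I')
    show "(\<Union>m. \<Union>k. ?B m k) \<in> null_sets lebesgue" using neg by (simp only: negligible_iff_null_sets)
    show "{x \<in> space lebesgue. \<not> ((\<lambda>r. (\<integral>y. indicator (segm x r) y * f y \<partial>lborel) / \<bar>r - x\<bar>) \<longlongrightarrow> f x) (at x)} \<subseteq> (\<Union>m. \<Union>k. ?B m k)"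
      using lim by blast
  qed
qed

section \<open>The stochastic transport-diffusion equation\<close>

lemma lbound_lin:
  assumes "lbound p l c" "lbound p l' c'"
  shows "lbound p (\<lambda>\<phi>. a * l \<phi> + b * l' \<phi>) (\<bar>a\<bar> * c + \<bar>b\<bar> * c')"
  unfolding lbound_def
proof (intro conjI ballI allI)
  show "0 \<le> \<bar>a\<bar> * c + \<bar>b\<bar> * c'" using assms by (auto simp: lbound_def)
  fix \<phi> \<psi> :: "real \<Rightarrow> real" and s t :: real assume S: "\<phi> \<in> schwartz" "\<psi> \<in> schwartz"
  then have "l (\<lambda>x. s * \<phi> x + t * \<psi> x) = s * l \<phi> + t * l \<psi>" "l' (\<lambda>x. s * \<phi> x + t * \<psi> x) = s * l' \<phi> + t * l' \<psi>"
    using assms by (auto simp: lbound_def)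
  then show "a * l (\<lambda>x. s * \<phi> x + t * \<psi> x) + b * l' (\<lambda>x. s * \<phi> x + t * \<psi> x) =
      s * (a * l \<phi> + b * l' \<phi>) + t * (a * l \<psi> + b * l' \<psi>)" by (simp add: algebra_simps)
next
  fix \<phi> :: "real \<Rightarrow> real" assume S: "\<phi> \<in> schwartz"
  have "\<bar>a * l \<phi> + b * l' \<phi>\<bar> \<le> \<bar>a\<bar> * \<bar>l \<phi>\<bar> + \<bar>b\<bar> * \<bar>l' \<phi>\<bar>" by (metis abs_mult abs_triangle_ineq)
  also have "\<dots> \<le> \<bar>a\<bar> * (c * schwartz_norm p \<phi>) + \<bar>b\<bar> * (c' * schwartz_norm p \<phi>)"
    using assms S by (intro add_mono mult_left_mono) (auto simp: lbound_def)
  finally show "\<bar>a * l \<phi> + b * l' \<phi>\<bar> \<le> (\<bar>a\<bar> * c + \<bar>b\<bar> * c') * schwartz_norm p \<phi>" by (simp add: algebra_simps)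
qed

text \<open>Linearity is taken from a crude bound, obtained from a linear combination; the direct
  estimate then supplies the small constant.\<close>

lemma lbound_improve:
  assumes "lbound p l c" "0 \<le> c'" "\<And>\<phi>. \<phi> \<in> schwartz \<Longrightarrow> \<bar>l \<phi>\<bar> \<le> c' * schwartz_norm p \<phi>"
  shows "lbound p l c'"
  using assms by (auto simp: lbound_def)

lemma lbound_integral:
  assumes h: "square_integrable lborel (h :: real \<Rightarrow> real)"
  shows "lbound p (\<lambda>\<phi>. \<integral>x. h x * \<phi> x \<partial>lborel) (l2norm lborel h / 2 ^ p)"
  unfolding lbound_def
proof (intro conjI ballI allI)
  show "0 \<le> l2norm lborel h / 2 ^ p" by simp
  fix \<phi> \<psi> :: "real \<Rightarrow> real" and a b :: real assume S: "\<phi> \<in> schwartz" "\<psi> \<in> schwartz"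
  have "integrable lborel (\<lambda>x. h x * \<phi> x)" "integrable lborel (\<lambda>x. h x * \<psi> x)"
    by (intro square_integrable_mult_integrable h schwartz_square_integrable S)+
  then have "(\<integral>x. a * (h x * \<phi> x) + b * (h x * \<psi> x) \<partial>lborel) = a * (\<integral>x. h x * \<phi> x \<partial>lborel) + b * (\<integral>x. h x * \<psi> x \<partial>lborel)"
    by simp
  then show "(\<integral>x. h x * (a * \<phi> x + b * \<psi> x) \<partial>lborel) = a * (\<integral>x. h x * \<phi> x \<partial>lborel) + b * (\<integral>x. h x * \<psi> x \<partial>lborel)"
    by (simp add: algebra_simps)
next
  fix \<phi> :: "real \<Rightarrow> real" assume S: "\<phi> \<in> schwartz"
  have "\<bar>\<integral>x. h x * \<phi> x \<partial>lborel\<bar> \<le> l2norm lborel h * l2norm lborel \<phi>"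
    using l2_Cauchy_Schwarz[OF h schwartz_square_integrable[OF S]] by simp
  also have "l2norm lborel \<phi> \<le> schwartz_norm p \<phi> / 2 ^ p"
    using schwartz_norm_ge[OF S, of p 0] by (simp add: schwartz_norm_def field_simps)
  finally show "\<bar>\<integral>x. h x * \<phi> x \<partial>lborel\<bar> \<le> l2norm lborel h / 2 ^ p * schwartz_norm p \<phi>"
    by (simp add: mult_left_mono)
qed

lemma lbound_eval:
  assumes "1 \<le> p"
  shows "lbound p (\<lambda>\<phi>. \<phi> t) 1"
  unfolding lbound_def
proof (intro conjI ballI allI)
  fix \<phi> :: "real \<Rightarrow> real" assume S: "\<phi> \<in> schwartz"
  show "\<bar>\<phi> t\<bar> \<le> 1 * schwartz_norm p \<phi>"
    using schwartz_sup_le[OF S, of t] schwartz_norm_mono[OF S assms] by simp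
qed auto

section \<open>Perturbation of powers of functionals\<close>

lemma hform_zero: "0 \<le> c \<Longrightarrow> hform p n (\<lambda>_. 0) c"
  using lin_mult_left[of 0 "\<lambda>_. 0"] by (simp add: hform_def)

lemma hform_sum:
  assumes "finite I" "\<And>i. i \<in> I \<Longrightarrow> hform p n (P i) (c i)"
  shows "hform p n (\<lambda>\<phi>. \<Sum>i\<in>I. P i \<phi>) (\<Sum>i\<in>I. c i)"
  using assms by (induction I rule: finite_induct) (auto intro: hform_zero hform_add)

text \<open>The part of the binomial expansion of a perturbed power with at least \<open>j\<close>
  factors \<open>d\<close>. As \<delta> is at most \<eta>, each power of \<delta> with exponent
  \<open>k \<ge> j\<close> is at most \<open>(\<delta> / \<eta>) ^ j * \<eta> ^ k\<close>, and what
  remains is part of the expansion of \<open>(L + \<eta>) ^ n\<close>. A slight increase of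
  \<open>L\<close> thus buys \<open>j\<close> small factors, uniformly in \<open>n\<close>.\<close>

lemma hform_binomial_tail:
  assumes d: "lbound p d \<delta>" and l: "lbound p l L" and \<eta>: "0 < \<eta>" "\<delta> \<le> \<eta>"
  shows "hform p n (\<lambda>\<phi>. complex_of_real (\<Sum>k\<in>{j..n}. of_nat (n choose k) * d \<phi> ^ k * l \<phi> ^ (n - k))) ((\<delta> / \<eta>) ^ j * (L + \<eta>) ^ n)"
proof -
  have \<delta>: "0 \<le> \<delta>" and L: "0 \<le> L" using d l by (auto simp: lbound_def)
  have q: "0 \<le> \<delta> / \<eta>" "\<delta> / \<eta> \<le> 1" using \<delta> \<eta> by auto
  have "hform p n (\<lambda>\<phi>. \<Sum>k\<in>{j..n}. of_nat (n choose k) * complex_of_real (d \<phi> ^ k * l \<phi> ^ (n - k)))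
      (\<Sum>k\<in>{j..n}. cmod (of_nat (n choose k)) * (\<delta> ^ k * L ^ (n - k)))"
  proof (rule hform_sum)
    fix k assume "k \<in> {j..n}"
    then show "hform p n (\<lambda>\<phi>. of_nat (n choose k) * complex_of_real (d \<phi> ^ k * l \<phi> ^ (n - k)))
        (cmod (of_nat (n choose k)) * (\<delta> ^ k * L ^ (n - k)))"
      using hform_product[OF d l, of k "n - k"] by (intro hform_scale) simp
  qed simp
  moreover have "(\<Sum>k\<in>{j..n}. cmod (of_nat (n choose k)) * (\<delta> ^ k * L ^ (n - k))) \<le> (\<delta> / \<eta>) ^ j * (L + \<eta>) ^ n"
  proof -
    have "(\<Sum>k\<in>{j..n}. cmod (of_nat (n choose k)) * (\<delta> ^ k * L ^ (n - k))) \<le>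
        (\<Sum>k\<in>{j..n}. (\<delta> / \<eta>) ^ j * (of_nat (n choose k) * \<eta> ^ k * L ^ (n - k)))"
    proof (rule sum_mono)
      fix k assume k: "k \<in> {j..n}"
      have "\<delta> ^ k = (\<delta> / \<eta>) ^ k * \<eta> ^ k" using \<eta> by (simp add: power_divide)
      also have "\<dots> \<le> (\<delta> / \<eta>) ^ j * \<eta> ^ k" using k q \<eta> by (intro mult_right_mono power_decreasing) auto
      finally have "real (n choose k) * L ^ (n - k) * \<delta> ^ k \<le> real (n choose k) * L ^ (n - k) * ((\<delta> / \<eta>) ^ j * \<eta> ^ k)"
        using L by (intro mult_left_mono) auto
      then show "cmod (of_nat (n choose k)) * (\<delta> ^ k * L ^ (n - k)) \<le> (\<delta> / \<eta>) ^ j * (of_nat (n choose k) * \<eta> ^ k * L ^ (n - k))"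
        by (simp add: mult_ac)
    qed
    also have "\<dots> = (\<delta> / \<eta>) ^ j * (\<Sum>k\<in>{j..n}. of_nat (n choose k) * \<eta> ^ k * L ^ (n - k))"
      by (simp only: sum_distrib_left)
    also have "\<dots> \<le> (\<delta> / \<eta>) ^ j * (\<Sum>k\<le>n. of_nat (n choose k) * \<eta> ^ k * L ^ (n - k))"
      using q L \<eta> by (intro mult_left_mono sum_mono2) auto
    also have "(\<Sum>k\<le>n. of_nat (n choose k) * \<eta> ^ k * L ^ (n - k)) = (L + \<eta>) ^ n"
      by (subst add.commute) (simp add: binomial_ring)
    finally show ?thesis .
  qed
  ultimately have "hform p n (\<lambda>\<phi>. \<Sum>k\<in>{j..n}. of_nat (n choose k) * complex_of_real (d \<phi> ^ k * l \<phi> ^ (n - k))) ((\<delta> / \<eta>) ^ j * (L + \<eta>) ^ n)"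
    by (rule hform_mono)
  then show ?thesis by (rule hform_cong) (simp add: mult.assoc)
qed

lemma hform_power_diff:
  assumes d: "lbound p d \<delta>" and l: "lbound p l L" and \<eta>: "0 < \<eta>" "\<delta> \<le> \<eta>"
  shows "hform p n (\<lambda>\<phi>. complex_of_real ((l \<phi> + d \<phi>) ^ n - l \<phi> ^ n)) (\<delta> / \<eta> * (L + \<eta>) ^ n)"
    "hform p n (\<lambda>\<phi>. complex_of_real ((l \<phi> + d \<phi>) ^ n - l \<phi> ^ n - of_nat n * d \<phi> * l \<phi> ^ (n - 1))) ((\<delta> / \<eta>)\<^sup>2 * (L + \<eta>) ^ n)"
proof -
  have b: "(l \<phi> + d \<phi>) ^ n = (\<Sum>k\<in>{0..n}. of_nat (n choose k) * d \<phi> ^ k * l \<phi> ^ (n - k))" for \<phi>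
    by (subst add.commute) (simp add: binomial_ring atMost_atLeast0)
  have 1: "(l \<phi> + d \<phi>) ^ n - l \<phi> ^ n = (\<Sum>k\<in>{1..n}. of_nat (n choose k) * d \<phi> ^ k * l \<phi> ^ (n - k))" for \<phi>
    unfolding b by (subst sum.atLeast_Suc_atMost) auto
  have 2: "(l \<phi> + d \<phi>) ^ n - l \<phi> ^ n - of_nat n * d \<phi> * l \<phi> ^ (n - 1) =
      (\<Sum>k\<in>{2..n}. of_nat (n choose k) * d \<phi> ^ k * l \<phi> ^ (n - k))" for \<phi>
  proof (cases "n = 0")
    case False
    then show ?thesis unfolding 1 by (subst sum.atLeast_Suc_atMost) (auto simp: numeral_2_eq_2)
  qed simp
  show "hform p n (\<lambda>\<phi>. complex_of_real ((l \<phi> + d \<phi>) ^ n - l \<phi> ^ n)) (\<delta> / \<eta> * (L + \<eta>) ^ n)"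
    using hform_binomial_tail[OF assms, of n 1] unfolding 1 by simp
  show "hform p n (\<lambda>\<phi>. complex_of_real ((l \<phi> + d \<phi>) ^ n - l \<phi> ^ n - of_nat n * d \<phi> * l \<phi> ^ (n - 1))) ((\<delta> / \<eta>)\<^sup>2 * (L + \<eta>) ^ n)"
    using hform_binomial_tail[OF assms, of n 2] unfolding 2 .
qed

text \<open>The left side times \<eta> is a single term of the binomial expansion of
  \<open>(L + \<eta>) ^ n\<close>.\<close>

lemma power_deriv_le:
  assumes "0 \<le> L" "0 < \<eta>"
  shows "real n * L ^ (n - 1) \<le> (L + \<eta>) ^ n / \<eta>"
proof (cases n)
  case (Suc m)
  have "real n * L ^ (n - 1) * \<eta> = of_nat (n choose 1) * \<eta> ^ 1 * L ^ (n - 1)" by simp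
  also have "\<dots> \<le> (\<Sum>k\<le>n. of_nat (n choose k) * \<eta> ^ k * L ^ (n - k))"
    using assms Suc by (intro member_le_sum) auto
  also have "\<dots> = (L + \<eta>) ^ n" by (subst add.commute) (simp add: binomial_ring)
  finally show ?thesis using assms by (simp add: field_simps)
qed (use assms in simp)

text \<open>Combines the bound of a scalar coefficient by a moment with the bound of a form by a
  power of \<open>L\<close>; \<alpha> and \<beta> carry the factors that tend to 0.\<close>

lemma hform_hk:
  assumes P: "hform p n P c" and z: "cmod z \<le> \<alpha> * mom (n + j) N" and c: "c \<le> \<beta> * L ^ n"
    and "j \<le> 4" "0 < N0" "N0 \<le> N" "0 \<le> \<alpha>" "0 \<le> \<beta>" "0 \<le> L"
  shows "hform p n (\<lambda>\<phi>. z * P \<phi>) (\<alpha> * \<beta> * hk_bound N0 L n)"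
proof (rule hform_mono[OF hform_scale[OF P]])
  have c0: "0 \<le> c" using P by (simp add: hform_def)
  have "cmod z * c \<le> (\<alpha> * mom (n + j) N) * (\<beta> * L ^ n)"
    using assms c0 by (intro mult_mono) (auto intro!: mult_nonneg_nonneg mom_nonneg)
  also have "\<dots> = (\<alpha> * \<beta>) * (mom (n + j) N * L ^ n)" by (simp add: mult_ac)
  also have "\<dots> \<le> (\<alpha> * \<beta>) * hk_bound N0 L n"
    using assms by (intro mult_left_mono hk_bound_ge) auto
  finally show "cmod z * c \<le> \<alpha> * \<beta> * hk_bound N0 L n" .
qed

section \<open>Indefinite integrals\<close>

lemma integral_increment:
  fixes h :: "real \<Rightarrow> real"
  assumes h: "integrable lborel h" and "0 \<le> t" "0 \<le> r" "r \<noteq> t"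
  shows "((\<integral>x. indicator {0..r} x * h x \<partial>lborel) - (\<integral>x. indicator {0..t} x * h x \<partial>lborel)) / (r - t) =
    (\<integral>x. indicator (segm t r) x * h x \<partial>lborel) / \<bar>r - t\<bar>"
proof -
  have i: "integrable lborel (\<lambda>x. indicator S x * h x)" if "S \<in> sets lborel" for S
    using integrable_mult_indicator[OF that h] by simp
  have *: "(\<integral>x. indicator {0..b} x * h x \<partial>lborel) - (\<integral>x. indicator {0..a} x * h x \<partial>lborel) =
      (\<integral>x. indicator {a..b} x * h x \<partial>lborel)" if "0 \<le> a" "a \<le> b" for a b
  proof -
    have "(\<integral>x. indicator {0..b} x * h x \<partial>lborel) =
        (\<integral>x. indicator {0..a} x * h x + indicator {a..b} x * h x \<partial>lborel)"
    proof (rule integral_cong_AE)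
      show "AE x in lborel. indicator {0..b} x * h x = indicator {0..a} x * h x + indicator {a..b} x * h x"
        using AE_lborel_singleton[of a] by eventually_elim (use that in \<open>auto simp: indicator_def\<close>)
    qed (use i in \<open>auto intro!: borel_measurable_integrable borel_measurable_add\<close>)
    then show ?thesis using i by simp
  qed
  show ?thesis
  proof (cases "t \<le> r")
    case True
    then show ?thesis using *[of t r] assms by (simp add: segm_def)
  next
    case False
    then have "(\<integral>x. indicator (segm t r) x * h x \<partial>lborel) =
        (\<integral>x. indicator {0..t} x * h x \<partial>lborel) - (\<integral>x. indicator {0..r} x * h x \<partial>lborel)"
      using *[of r t] assms by (simp add: segm_def)
    moreover have "\<bar>r - t\<bar> = - (r - t)" using False by simp
    ultimately show ?thesis using assms by (simp add: divide_simps) (simp add: algebra_simps)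
  qed
qed

lemma integral_initial_tendsto_0:
  fixes h :: "real \<Rightarrow> real"
  assumes h: "integrable lborel h"
  shows "((\<lambda>t. \<integral>x. indicator {0..t} x * h x \<partial>lborel) \<longlongrightarrow> 0) (at_right 0)"
  unfolding tendsto_at_iff_sequentially
proof (intro allI impI)
  fix X :: "nat \<Rightarrow> real" assume X: "\<forall>i. X i \<in> {0<..} - {0}" "X \<longlonglongrightarrow> 0"
  have "(\<lambda>i. \<integral>x. indicator {0..X i} x * h x \<partial>lborel) \<longlonglongrightarrow> (\<integral>x. 0 \<partial>(lborel :: real measure))"
  proof (rule integral_dominated_convergence[where w = "\<lambda>x. \<bar>h x\<bar>"])
    show "AE x in lborel. (\<lambda>i. indicator {0..X i} x * h x) \<longlonglongrightarrow> 0"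
      using AE_lborel_singleton[of 0]
    proof eventually_elim
      case (elim x)
      have "\<forall>\<^sub>F i in sequentially. X i < \<bar>x\<bar>" using X(2) elim by (intro order_tendstoD(2)[of X 0]) auto
      then have "\<forall>\<^sub>F i in sequentially. indicator {0..X i} x * h x = 0"
        by eventually_elim (auto simp: indicator_def)
      then show ?case by (rule tendsto_eventually)
    qed
  qed (use h in \<open>auto simp: indicator_def intro!: borel_measurable_times\<close>)
  then show "((\<lambda>t. \<integral>x. indicator {0..t} x * h x \<partial>lborel) \<circ> X) \<longlonglongrightarrow> 0" by (simp add: comp_def)
qed

text \<open>The coefficients are real and integrable over the whole line, after truncation to a
  bounded time interval; \<open>sg1\<close> is stated beside \<open>sg2\<close> because the line has
  infinite measure. \<open>noise_less\<close> is the bound of \<kappa> by \<open>4 ^ p\<close>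
  multiplied out, and \<open>1 \<le> p\<close> makes point evaluations bounded.\<close>

locale transport_equation = white_noise_space M for M +
  fixes nu sg :: "real \<Rightarrow> real" and T :: real and p :: nat
  assumes T_pos: "0 < T" and nu: "integrable lborel nu" and sg2: "square_integrable lborel sg" and sg1: "integrable lborel sg"
    and variance_pos: "\<And>t. t \<in> {0<..T} \<Longrightarrow> 0 < (\<integral>x. indicator {0..t} x * nu x \<partial>lborel)"
    and p: "1 \<le> p"
    and noise_less: "\<And>t. t \<in> {0<..T} \<Longrightarrow> (\<integral>x. indicator {0..t} x * (sg x)\<^sup>2 \<partial>lborel) <
      4 ^ p * (\<integral>x. indicator {0..t} x * nu x \<partial>lborel)"
begin

definition N where "N t = (\<integral>x. indicator {0..t} x * nu x \<partial>lborel)"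
definition g where "g t = (\<lambda>x. indicator {0..t} x * sg x :: real)"
definition b where "b t \<phi> = (\<integral>x. g t x * \<phi> x \<partial>lborel)"
text \<open>An upper bound for the norm of \<open>b t\<close> in the dual of
  \<open>H\<^sub>p\<close>, chosen so that \<open>noise_less\<close> becomes the summability
  condition of \<open>hk_bound_summable\<close>.\<close>

definition L where "L t = l2norm lborel (g t) / 2 ^ p"

lemma indicator_square_integrable:
  assumes "square_integrable lborel (h :: real \<Rightarrow> real)" "S \<in> sets lborel"
  shows "square_integrable lborel (\<lambda>x. indicator S x * h x)"
proof -
  have "integrable lborel (\<lambda>x. indicator S x * (norm (h x))\<^sup>2)"
    using integrable_mult_indicator[OF assms(2) square_integrable_integrable[OF assms(1)]] by simp
  moreover have "(\<lambda>x. indicator S x * (norm (h x))\<^sup>2) = (\<lambda>x. (norm (indicator S x * h x))\<^sup>2)"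
    by (auto simp: indicator_def)
  moreover have "(\<lambda>x. indicator S x * h x) \<in> borel_measurable lborel"
    using assms by (intro borel_measurable_times borel_measurable_indicator) (auto simp: square_integrable_def)
  ultimately show ?thesis by (simp add: square_integrable_def)
qed

lemma g_square_integrable: "square_integrable lborel (g t)"
  unfolding g_def by (intro indicator_square_integrable sg2) simp

lemma g_norm: "(l2norm lborel (g t))\<^sup>2 = (\<integral>x. indicator {0..t} x * (sg x)\<^sup>2 \<partial>lborel)"
  unfolding l2norm_sq by (intro Bochner_Integration.integral_cong) (auto simp: g_def indicator_def)

lemma N_pos: "t \<in> {0<..T} \<Longrightarrow> 0 < N t"
  using variance_pos by (simp add: N_def)

lemma L_nonneg: "0 \<le> L t"
  by (simp add: L_def)

lemma L_less: "t \<in> {0<..T} \<Longrightarrow> (L t)\<^sup>2 < N t"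
proof -
  assume t: "t \<in> {0<..T}"
  have "((2::real) ^ p)\<^sup>2 = 4 ^ p" by (simp add: four_power)
  then have "(L t)\<^sup>2 = (\<integral>x. indicator {0..t} x * (sg x)\<^sup>2 \<partial>lborel) / 4 ^ p"
    unfolding L_def power_divide g_norm by simp
  then show ?thesis using noise_less[OF t] by (simp add: N_def divide_less_eq mult.commute)
qed

lemma lbound_b: "lbound p (b t) (L t)"
  unfolding b_def[abs_def] L_def by (rule lbound_integral[OF g_square_integrable])

text \<open>The forms of the \<open>k\<close>-th spatial derivative of the solution; the
  denominators \<open>fact n\<close> of the kernels disappear because forms carry the factor
  \<open>fact n\<close>.\<close>

definition U :: "nat \<Rightarrow> real \<Rightarrow> real \<Rightarrow> nat \<Rightarrow> (real \<Rightarrow> real) \<Rightarrow> complex" where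
  "U k t x n \<phi> = hk (n + k) (N t) x * complex_of_real (b t \<phi> ^ n)"

lemma forms_U:
  assumes t: "t \<in> {0<..T}" and k: "k \<le> 4"
  shows "hida_forms p (U k t x) (hk_bound (N t) (L t))"
  unfolding hida_forms_def
proof (intro conjI allI)
  fix n
  have "hform p n (\<lambda>\<phi>. hk (n + k) (N t) x * complex_of_real (b t \<phi> ^ n)) (1 * 1 * hk_bound (N t) (L t) n)"
    using hk_le[OF N_pos[OF t], of "n + k" x] N_pos[OF t] k L_nonneg
    by (intro hform_hk[OF hform_power[OF lbound_b], of _ _ _ k]) auto
  then show "hform p n (U k t x n) (hk_bound (N t) (L t) n)" unfolding U_def[abs_def] by simp
qed (rule hk_bound_summable[OF N_pos[OF t] L_nonneg L_less[OF t]])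

text \<open>Only the scalar coefficients depend on \<open>x\<close>, so their Taylor expansion is
  multiplied by a fixed form. The remainder uses the moment of order \<open>n + k + 2\<close>, which
  explains \<open>k \<le> 2\<close>.\<close>

lemma derivative_x:
  assumes t: "t \<in> {0<..T}" and k: "k \<le> 2"
  shows "has_hida_derivative M (\<lambda>y. dist_of p (U k t y)) (dist_of p (U (k + 1) t x)) x UNIV"
proof (rule has_hida_derivative_dist_of)
  show "hida_forms p (U k t y) (hk_bound (N t) (L t))" for y using k by (intro forms_U t) auto
  show "hida_forms p (U (k + 1) t x) (hk_bound (N t) (L t))" using k by (intro forms_U t) auto
  show "summable (\<lambda>n. (hk_bound (N t) (L t) n)\<^sup>2 / fact n)"
    by (rule hk_bound_summable[OF N_pos[OF t] L_nonneg L_less[OF t]])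
  show "((\<lambda>y. \<bar>y - x\<bar>) \<longlongrightarrow> 0) (at x)" by (auto intro!: tendsto_eq_intros)
  have "hform p n (\<lambda>\<phi>. (U k t y n \<phi> - U k t x n \<phi>) / of_real (y - x) - U (k + 1) t x n \<phi>) (\<bar>y - x\<bar> * hk_bound (N t) (L t) n)"
    if y: "y \<noteq> x" for y n
  proof -
    let ?w = "hk (n + k) (N t) y - hk (n + k) (N t) x - of_real (y - x) * hk (n + k + 1) (N t) x"
    let ?z = "?w / complex_of_real (y - x)"
    have "cmod ?w \<le> (y - x)\<^sup>2 / 2 * mom (n + k + 2) (N t)" by (rule hk_x_taylor[OF N_pos[OF t]])
    also have "\<dots> \<le> (y - x)\<^sup>2 * mom (n + k + 2) (N t)" by (intro mult_right_mono mom_nonneg) auto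
    finally have w: "cmod ?w \<le> \<bar>y - x\<bar> * (\<bar>y - x\<bar> * mom (n + k + 2) (N t))" by (simp add: power2_eq_square mult.assoc[symmetric])
    have "cmod ?z = cmod ?w / \<bar>y - x\<bar>" by (simp only: norm_divide norm_of_real)
    also have "\<dots> \<le> \<bar>y - x\<bar> * mom (n + (k + 2)) (N t)" using w y by (simp add: divide_le_eq mult.commute add.assoc)
    finally have z: "cmod ?z \<le> \<bar>y - x\<bar> * mom (n + (k + 2)) (N t)" .
    have "hform p n (\<lambda>\<phi>. ?z * complex_of_real (b t \<phi> ^ n)) (\<bar>y - x\<bar> * 1 * hk_bound (N t) (L t) n)"
      using N_pos[OF t] k L_nonneg
      by (intro hform_hk[OF hform_power[OF lbound_b] z]) auto
    then have "hform p n (\<lambda>\<phi>. ?z * complex_of_real (b t \<phi> ^ n)) (\<bar>y - x\<bar> * hk_bound (N t) (L t) n)" by simp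
    then show ?thesis
    proof (rule hform_cong)
      fix \<phi>
      have "complex_of_real (y - x) \<noteq> 0" using y by simp
      then show "?z * complex_of_real (b t \<phi> ^ n) = (U k t y n \<phi> - U k t x n \<phi>) / of_real (y - x) - U (k + 1) t x n \<phi>"
        unfolding U_def by (simp add: field_simps del: of_real_diff)
    qed
  qed
  then show "\<forall>\<^sub>F y in at x. \<forall>n. hform p n (\<lambda>\<phi>. (U k t y n \<phi> - U k t x n \<phi>) / of_real (y - x) - U (k + 1) t x n \<phi>) (\<bar>y - x\<bar> * hk_bound (N t) (L t) n)"
    by (auto simp: eventually_at_filter)
qed

text \<open>The product rule applied to the \<open>n\<close>-th power of \<open>b t\<close>: one of
  \<open>n\<close> factors is replaced by the evaluation at \<open>t\<close>. These are the forms of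
  the Wick product with white noise. For \<open>n = 0\<close> the truncated exponent is harmless
  because of the factor \<open>n\<close>.\<close>

definition \<Theta> :: "real \<Rightarrow> real \<Rightarrow> nat \<Rightarrow> (real \<Rightarrow> real) \<Rightarrow> complex" where
  "\<Theta> t x n \<phi> = of_nat n * hk n (N t) x * complex_of_real (\<phi> t * b t \<phi> ^ (n - 1))"

text \<open>The functional \<open>l\<close> is general because two cases occur: the evaluation at
  \<open>t\<close>, and the error made when a difference quotient is replaced by it.\<close>

lemma hform_derivative_power:
  assumes l: "lbound p l c" and z: "cmod z \<le> mom n (N t)" and "0 < N0" "N0 \<le> N t" "0 < \<eta>"
  shows "hform p n (\<lambda>\<phi>. of_nat n * z * complex_of_real (l \<phi> * b t \<phi> ^ (n - 1))) (c / \<eta> * hk_bound N0 (L t + \<eta>) n)"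
proof -
  have c: "0 \<le> c" using l by (simp add: lbound_def)
  show ?thesis
  proof (cases n)
    case 0
    then show ?thesis using c assms L_nonneg[of t] by (auto intro!: hform_zero divide_nonneg_pos mult_nonneg_nonneg hk_bound_nonneg)
  next
    case (Suc m)
    have "hform p n (\<lambda>\<phi>. complex_of_real (l \<phi> ^ 1 * b t \<phi> ^ m)) (c ^ 1 * L t ^ m)"
      using hform_product[OF l lbound_b, of 1 m] Suc by simp
    then have "hform p n (\<lambda>\<phi>. of_nat n * complex_of_real (l \<phi> * b t \<phi> ^ (n - 1))) (cmod (of_nat n) * (c * L t ^ (n - 1)))"
      using Suc by (intro hform_scale) simp
    moreover have "cmod (of_nat n) * (c * L t ^ (n - 1)) \<le> c / \<eta> * (L t + \<eta>) ^ n"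
      using mult_left_mono[OF power_deriv_le[OF L_nonneg[of t] \<open>0 < \<eta>\<close>, of n] c] by (simp add: mult_ac)
    ultimately have "hform p n (\<lambda>\<phi>. z * (of_nat n * complex_of_real (l \<phi> * b t \<phi> ^ (n - 1)))) (1 * (c / \<eta>) * hk_bound N0 (L t + \<eta>) n)"
      using assms c L_nonneg[of t] by (intro hform_hk[where j = 0]) auto
    then show ?thesis by (simp add: mult_ac)
  qed
qed

text \<open>\<open>N0\<close> is the midpoint between \<open>(L t)\<^sup>2\<close> and
  \<open>N t\<close>, and \<eta> is half the distance from \<open>L t\<close> to
  \<open>sqrt N0\<close>. Room below \<open>N t\<close> serves the expansion in the variance, room
  above \<open>L t\<close> the binomial tails.\<close>

lemma gap:
  assumes t: "t \<in> {0<..T}"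
  obtains \<eta> N0 where "0 < \<eta>" "0 < N0" "N0 < N t" "(L t + \<eta>)\<^sup>2 < N0"
proof -
  let ?N0 = "((L t)\<^sup>2 + N t) / 2"
  let ?\<eta> = "(sqrt ?N0 - L t) / 2"
  have 1: "(L t)\<^sup>2 < ?N0" "?N0 < N t" using L_less[OF t] by auto
  have 2: "0 < ?N0" using N_pos[OF t] by (simp add: add_nonneg_pos)
  have 3: "L t < sqrt ?N0" using 1(1) by (rule real_less_rsqrt)
  have "L t + ?\<eta> < sqrt ?N0" "0 \<le> L t + ?\<eta>" using 3 L_nonneg[of t] by (auto simp: field_simps)
  then have "(L t + ?\<eta>)\<^sup>2 < (sqrt ?N0)\<^sup>2" by (intro power_strict_mono) auto
  then have "(L t + ?\<eta>)\<^sup>2 < ?N0" using 2 by simp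
  with 1 2 3 show thesis by (intro that[of ?\<eta> ?N0]) auto
qed

lemma forms_\<Theta>:
  assumes t: "t \<in> {0<..T}"
  obtains c where "hida_forms p (\<Theta> t x) c"
proof -
  obtain \<eta> N0 where g: "0 < \<eta>" "0 < N0" "N0 < N t" "(L t + \<eta>)\<^sup>2 < N0" using gap[OF t] .
  have "hida_forms p (\<Theta> t x) (\<lambda>n. 1 / \<eta> * hk_bound N0 (L t + \<eta>) n)"
    unfolding hida_forms_def
  proof (intro conjI allI)
    show "hform p n (\<Theta> t x n) (1 / \<eta> * hk_bound N0 (L t + \<eta>) n)" for n
      unfolding \<Theta>_def[abs_def] using g by (intro hform_derivative_power lbound_eval p hk_le N_pos t) auto
    show "summable (\<lambda>n. (1 / \<eta> * hk_bound N0 (L t + \<eta>) n)\<^sup>2 / fact n)"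
      using summable_mult[OF hk_bound_summable[OF g(2) _ g(4)], of "(1 / \<eta>)\<^sup>2"] L_nonneg[of t] g(1)
      by (simp add: power_mult_distrib power_divide)
  qed
  then show thesis by (rule that)
qed

lemma S_transform_U:
  assumes "t \<in> {0<..T}" "k \<le> 4" "\<phi> \<in> schwartz"
  shows "(\<lambda>n. hk (n + k) (N t) x * complex_of_real (b t \<phi> ^ n / fact n)) sums S_transform (dist_of p (U k t x)) \<phi>"
  using S_transform_dist_of[OF forms_U[OF assms(1,2)] assms(3), of x] by (simp add: U_def)

text \<open>Multiplication of the S-transform by \<open>\<phi> t\<close> shifts the index by one:
  the \<open>n\<close>-th term for \<open>U 1\<close> is the term with index \<open>Suc n\<close>
  for \<Theta>, whose term with index 0 vanishes.\<close>

lemma wick_product_\<Theta>: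
  assumes t: "t \<in> {0<..T}"
  shows "wick_product M (white_noise M t) (dist_of p (U 1 t x)) = dist_of p (\<Theta> t x)"
proof (rule wick_product_eq)
  obtain c where c: "hida_forms p (\<Theta> t x) c" using forms_\<Theta>[OF t] .
  show "dist_of p (\<Theta> t x) \<in> hida_dist M" by (rule dist_of_hida_dist[OF c])
  fix \<phi> assume \<phi>: "\<phi> \<in> schwartz"
  have "(\<lambda>n. complex_of_real (\<phi> t) * (hk (n + 1) (N t) x * complex_of_real (b t \<phi> ^ n / fact n))) sums
      (complex_of_real (\<phi> t) * S_transform (dist_of p (U 1 t x)) \<phi>)"
    by (intro sums_mult S_transform_U t \<phi>) simp
  moreover have "complex_of_real (\<phi> t) * (hk (n + 1) (N t) x * complex_of_real (b t \<phi> ^ n / fact n)) =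
      \<Theta> t x (Suc n) \<phi> / fact (Suc n)" for n
  proof -
    have e: "complex_of_nat (Suc n) * z / fact (Suc n) = z / fact n" for z
      by (simp del: of_nat_Suc)
    have "\<Theta> t x (Suc n) \<phi> = of_nat (Suc n) * (complex_of_real (\<phi> t) * (hk (n + 1) (N t) x * complex_of_real (b t \<phi> ^ n)))"
      by (simp add: \<Theta>_def mult_ac del: of_nat_Suc)
    then show ?thesis by (simp only: e) simp
  qed
  ultimately have "(\<lambda>n. \<Theta> t x (Suc n) \<phi> / fact (Suc n)) sums (complex_of_real (\<phi> t) * S_transform (dist_of p (U 1 t x)) \<phi>)"
    by (simp only:)
  then have "(\<lambda>n. \<Theta> t x n \<phi> / fact n) sums (complex_of_real (\<phi> t) * S_transform (dist_of p (U 1 t x)) \<phi> + \<Theta> t x 0 \<phi> / fact 0)"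
    by (subst sums_Suc_iff[symmetric]) simp
  then have "(\<lambda>n. \<Theta> t x n \<phi> / fact n) sums (complex_of_real (\<phi> t) * S_transform (dist_of p (U 1 t x)) \<phi>)"
    by (simp add: \<Theta>_def)
  then show "S_transform (dist_of p (\<Theta> t x)) \<phi> = S_transform (white_noise M t) \<phi> * S_transform (dist_of p (U 1 t x)) \<phi>"
    unfolding S_transform_white_noise[OF \<phi>] by (rule sums_unique2[OF S_transform_dist_of[OF c \<phi>]])
qed

text \<open>The summability criterion is used a second time, with \<open>sqrt ?G\<close> in place of
  \<open>L t\<close>; its condition is then the hypothesis on \<open>s\<close>. The weights of
  \<open>space_G\<close> act directly on the \<open>L\<^sup>2\<close> norm of \<open>g t\<close>, so
  no power of 2 from \<open>A\<close> enters.\<close>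

lemma U_space_G:
  assumes t: "t \<in> {0<..T}"
    and s: "2 powr s * (\<integral>x. indicator {0..t} x * (sg x)\<^sup>2 \<partial>lborel) < N t"
  shows "dist_of p (U 0 t x) \<in> space_G M s"
proof -
  have U0: "U 0 t x = (\<lambda>n \<phi>. hk n (N t) x * complex_of_real ((\<integral>y. g t y * \<phi> y \<partial>lborel) ^ n))"
    by (simp add: U_def b_def fun_eq_iff)
  let ?G = "2 powr s * (l2norm lborel (g t))\<^sup>2"
  have G: "0 \<le> ?G" "?G < N t" using s by (simp_all add: g_norm)
  have "summable (\<lambda>n. (cmod (hk n (N t) x))\<^sup>2 / fact n * ?G ^ n)"
  proof (rule summable_comparison_test'[of _ 0])
    show "summable (\<lambda>n. (hk_bound (N t) (sqrt ?G) n)\<^sup>2 / fact n)"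
      using G by (intro hk_bound_summable N_pos t) auto
    fix n
    have "cmod (hk n (N t) x) * sqrt ?G ^ n \<le> mom (n + 0) (N t) * sqrt ?G ^ n"
      using hk_le[OF N_pos[OF t], of n x] by (intro mult_right_mono) auto
    also have "\<dots> \<le> hk_bound (N t) (sqrt ?G) n" using N_pos[OF t] by (intro hk_bound_ge) auto
    finally have "(cmod (hk n (N t) x) * sqrt ?G ^ n)\<^sup>2 \<le> (hk_bound (N t) (sqrt ?G) n)\<^sup>2" by (intro power_mono) auto
    moreover have "(sqrt ?G ^ n)\<^sup>2 = ?G ^ n"
      unfolding power_mult[symmetric] mult.commute[of n 2] unfolding power_mult using G by simp
    ultimately have "(cmod (hk n (N t) x))\<^sup>2 * ?G ^ n \<le> (hk_bound (N t) (sqrt ?G) n)\<^sup>2"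
      unfolding power_mult_distrib by simp
    then have "(cmod (hk n (N t) x))\<^sup>2 * ?G ^ n / fact n \<le> (hk_bound (N t) (sqrt ?G) n)\<^sup>2 / fact n"
      by (rule divide_right_mono) simp
    then show "norm ((cmod (hk n (N t) x))\<^sup>2 / fact n * ?G ^ n) \<le> (hk_bound (N t) (sqrt ?G) n)\<^sup>2 / fact n"
      using G by simp
  qed
  then show ?thesis
    unfolding U0 using forms_U[OF t, of 0 x] unfolding U0 by (intro dist_of_space_G g_square_integrable) auto
qed

text \<open>The S-transform is a Gaussian density shifted by \<open>b t \<phi>\<close>. An affine
  substitution moves the dependence on \<open>t\<close> into the argument of \<open>f\<close>; since
  \<open>f\<close> is bounded and continuous, and variance and shift tend to 0, dominated
  convergence applies.\<close>

lemma U_dirac: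
  assumes \<phi>: "\<phi> \<in> schwartz"
  shows "dirac_sequence T (\<lambda>t x. S_transform (dist_of p (U 0 t x)) \<phi>)"
  unfolding dirac_sequence_def
proof (intro ballI conjI)
  fix f assume f: "f \<in> schwartz"
  have S: "S_transform (dist_of p (U 0 t x)) \<phi> = complex_of_real (normal_density 0 (sqrt (N t)) (x + b t \<phi>))"
    if t: "t \<in> {0<..T}" for t x
    using S_transform_U[OF t _ \<phi>, of 0 x] hk_sums[OF N_pos[OF t], of x "b t \<phi>"] by (simp add: sums_unique2)
  have fm: "f \<in> borel_measurable borel" by (rule schwartz_measurable[OF f])
  have fb: "\<bar>f x\<bar> \<le> schwartz_norm 1 f" for x by (rule schwartz_sup_le[OF f])
  have sub: "(\<integral>x. normal_density 0 (sqrt (N t)) (x + b t \<phi>) * f x \<partial>lborel) =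
      (\<integral>z. std_normal_density z * f (sqrt (N t) * z - b t \<phi>) \<partial>lborel)" if t: "t \<in> {0<..T}" for t
  proof -
    let ?c = "sqrt (N t)"
    have c: "?c > 0" "(N t) > 0" using N_pos[OF t] by auto
    have "(\<integral>x. normal_density 0 ?c (x + b t \<phi>) * f x \<partial>lborel) =
        \<bar>?c\<bar> *\<^sub>R (\<integral>z. normal_density 0 ?c ((- b t \<phi> + ?c * z) + b t \<phi>) * f (- b t \<phi> + ?c * z) \<partial>lborel)"
      by (rule lborel_integral_real_affine) (use c in auto)
    also have "\<dots> = (\<integral>z. ?c * (normal_density 0 ?c ((- b t \<phi> + ?c * z) + b t \<phi>) * f (- b t \<phi> + ?c * z)) \<partial>lborel)"
      using c by simp
    also have "\<dots> = (\<integral>z. std_normal_density z * f (?c * z - b t \<phi>) \<partial>lborel)"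
    proof (rule Bochner_Integration.integral_cong[OF refl])
      fix z
      have "?c * normal_density 0 ?c (?c * z) = std_normal_density z"
        using c by (simp add: normal_density_def power_mult_distrib real_sqrt_mult)
      then show "?c * (normal_density 0 ?c ((- b t \<phi> + ?c * z) + b t \<phi>) * f (- b t \<phi> + ?c * z)) =
          std_normal_density z * f (?c * z - b t \<phi>)"
        by (simp add: algebra_simps)
    qed
    finally show ?thesis .
  qed
  show "integrable lborel (\<lambda>x. S_transform (dist_of p (U 0 t x)) \<phi> * complex_of_real (f x))" if t: "t \<in> {0<..T}" for t
  proof -
    have "integrable lborel (\<lambda>x. normal_density 0 (sqrt (N t)) (x + b t \<phi>) * f x)"
    proof (rule Bochner_Integration.integrable_bound)
      have "integrable lborel (\<lambda>x. normal_density 0 (sqrt (N t)) (b t \<phi> + 1 * x))"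
        using N_pos[OF t] by (intro lborel_integrable_real_affine integrable_normal_density) auto
      then show "integrable lborel (\<lambda>x. schwartz_norm 1 f * normal_density 0 (sqrt (N t)) (x + b t \<phi>))"
        by (intro integrable_mult_right) (simp add: add.commute)
      show "AE x in lborel. norm (normal_density 0 (sqrt (N t)) (x + b t \<phi>) * f x) \<le>
          norm (schwartz_norm 1 f * normal_density 0 (sqrt (N t)) (x + b t \<phi>))"
      proof (rule AE_I2)
        fix x
        show "norm (normal_density 0 (sqrt (N t)) (x + b t \<phi>) * f x) \<le>
          norm (schwartz_norm 1 f * normal_density 0 (sqrt (N t)) (x + b t \<phi>))"
          using mult_left_mono[OF fb[of x] normal_density_nonneg[of 0 "sqrt (N t)" "x + b t \<phi>"]] by (simp add: abs_mult mult.commute)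
      qed
    qed (use fm in measurable)
    from integrable_of_real[OF this] show ?thesis by (simp add: S[OF t])
  qed
  have N0: "(N \<longlongrightarrow> 0) (at_right 0)"
    unfolding N_def[abs_def] by (rule integral_initial_tendsto_0[OF nu])
  have b0: "((\<lambda>t. b t \<phi>) \<longlongrightarrow> 0) (at_right 0)"
  proof -
    have "integrable lborel (\<lambda>x. sg x * \<phi> x)"
      by (intro square_integrable_mult_integrable sg2 schwartz_square_integrable \<phi>)
    from integral_initial_tendsto_0[OF this] show ?thesis by (simp add: b_def g_def mult.assoc)
  qed
  have "((\<lambda>t. \<integral>z. std_normal_density z * f (sqrt (N t) * z - b t \<phi>) \<partial>lborel) \<longlongrightarrow> f 0) (at_right 0)"
    unfolding tendsto_at_iff_sequentially
  proof (intro allI impI)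
    fix X :: "nat \<Rightarrow> real" assume X: "\<forall>i. X i \<in> {0<..} - {0}" "X \<longlonglongrightarrow> 0"
    have NX: "(\<lambda>i. N (X i)) \<longlonglongrightarrow> 0" using N0 X by (auto simp: tendsto_at_iff_sequentially comp_def)
    have bX: "(\<lambda>i. b (X i) \<phi>) \<longlonglongrightarrow> 0" using b0 X by (auto simp: tendsto_at_iff_sequentially comp_def)
    have "(\<lambda>i. \<integral>z. std_normal_density z * f (sqrt (N (X i)) * z - b (X i) \<phi>) \<partial>lborel) \<longlonglongrightarrow>
        (\<integral>z. std_normal_density z * f 0 \<partial>lborel)"
    proof (rule integral_dominated_convergence[where w = "\<lambda>z. std_normal_density z * schwartz_norm 1 f"])
      show "AE z in lborel. (\<lambda>i. std_normal_density z * f (sqrt (N (X i)) * z - b (X i) \<phi>)) \<longlonglongrightarrow> std_normal_density z * f 0"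
      proof (intro AE_I2 tendsto_intros)
        fix z
        have "(\<lambda>i. sqrt (N (X i)) * z - b (X i) \<phi>) \<longlonglongrightarrow> sqrt 0 * z - 0" by (intro tendsto_intros NX bX)
        then show "(\<lambda>i. f (sqrt (N (X i)) * z - b (X i) \<phi>)) \<longlonglongrightarrow> f 0"
          using isCont_tendsto_compose[OF schwartz_isCont[OF f, of 0]] by simp
      qed
      show "AE z in lborel. norm (std_normal_density z * f (sqrt (N (X i)) * z - b (X i) \<phi>)) \<le> std_normal_density z * schwartz_norm 1 f" for i
        using fb by (auto simp: abs_mult intro!: mult_left_mono)
      show "(\<lambda>z. std_normal_density z * f (sqrt (N (X i)) * z - b (X i) \<phi>)) \<in> borel_measurable lborel" for i
        using fm by measurable
    qed auto
    then show "((\<lambda>t. \<integral>z. std_normal_density z * f (sqrt (N t) * z - b t \<phi>) \<partial>lborel) \<circ> X) \<longlonglongrightarrow> f 0"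
      by (simp add: comp_def)
  qed
  then have "((\<lambda>t. complex_of_real (\<integral>z. std_normal_density z * f (sqrt (N t) * z - b t \<phi>) \<partial>lborel)) \<longlongrightarrow> complex_of_real (f 0)) (at_right 0)"
    by (rule tendsto_of_real)
  moreover have "\<forall>\<^sub>F t in at_right 0. complex_of_real (\<integral>z. std_normal_density z * f (sqrt (N t) * z - b t \<phi>) \<partial>lborel) =
      (\<integral>x. S_transform (dist_of p (U 0 t x)) \<phi> * complex_of_real (f x) \<partial>lborel)" if "0 < T"
    unfolding eventually_at_right_field
  proof (intro exI[of _ T] conjI that allI impI)
    fix t assume "0 < t" "t < T"
    then have t: "t \<in> {0<..T}" by simp
    show "complex_of_real (\<integral>z. std_normal_density z * f (sqrt (N t) * z - b t \<phi>) \<partial>lborel) =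
      (\<integral>x. S_transform (dist_of p (U 0 t x)) \<phi> * complex_of_real (f x) \<partial>lborel)"
      unfolding S[OF t] sub[OF t, symmetric] by (simp only: of_real_mult[symmetric] integral_complex_of_real)
  qed
  ultimately show "((\<lambda>t. \<integral>x. S_transform (dist_of p (U 0 t x)) \<phi> * complex_of_real (f x) \<partial>lborel) \<longlongrightarrow> complex_of_real (f 0)) (at_right 0)"
    using T_pos by (blast intro: Lim_transform_eventually)
qed

section \<open>The derivative in time and the equation\<close>

definition avg where "avg h t r = (\<integral>x. indicator (segm t r) x * h x \<partial>lborel) / \<bar>r - t\<bar>"

text \<open>The error of \<open>(b r - b t) / (r - t)\<close> as an approximation of \<open>\<sigma>(t) \<delta>\<^sub>t\<close>: the mean square
  oscillation of \<open>\<sigma>\<close> on the segment, plus the Hoelder modulus of \<open>t \<mapsto> \<delta>\<^sub>t\<close>.\<close>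

definition err where
  "err t r = sqrt (avg (\<lambda>x. (sg x)\<^sup>2) t r - 2 * sg t * avg sg t r + (sg t)\<^sup>2) + \<bar>sg t\<bar> * sqrt \<bar>r - t\<bar>"

text \<open>On the segment, \<open>sg x * \<phi> x - sg t * \<phi> t\<close> splits into
  \<open>\<phi> x * (sg x - sg t)\<close> and \<open>sg t * (\<phi> x - \<phi> t)\<close>. The first
  part is bounded by Cauchy-Schwarz and the sup bound of \<phi>, the second by its Hoelder
  bound.\<close>

lemma b_increment:
  assumes "0 \<le> t" "0 \<le> r" "r \<noteq> t" and \<phi>: "\<phi> \<in> schwartz"
  shows "\<bar>(b r \<phi> - b t \<phi>) / (r - t) - sg t * \<phi> t\<bar> \<le> err t r * schwartz_norm p \<phi>" "0 \<le> err t r"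
proof -
  let ?J = "segm t r" and ?\<Delta> = "\<bar>r - t\<bar>" and ?n = "schwartz_norm 1 \<phi>"
  have \<Delta>: "0 < ?\<Delta>" using assms by simp
  have J: "?J \<in> sets lborel" by (simp add: segm_def)
  have Jf: "emeasure lborel ?J < \<infinity>" by (simp add: segm_def emeasure_lborel_Icc_eq)
  have Ji: "integrable lborel (indicat_real ?J)" by (rule integrable_real_indicator[OF J Jf])
  have Jm: "(\<integral>x. indicat_real ?J x \<partial>lborel) = ?\<Delta>"
    using J content_segm[of t r] by (simp add: segm_def measure_lborel_Icc)
  have i: "integrable lborel (\<lambda>x. indicat_real ?J x * h x)" if "integrable lborel h" for h :: "real \<Rightarrow> real"
    using integrable_mult_indicator[OF J that] by simp
  have s\<phi>: "integrable lborel (\<lambda>x. sg x * \<phi> x)"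
    by (intro square_integrable_mult_integrable sg2 schwartz_square_integrable \<phi>)
  have s2: "integrable lborel (\<lambda>x. (sg x)\<^sup>2)" using sg2 by (simp add: square_integrable_def)
  have \<phi>i: "integrable lborel \<phi>" by (rule schwartz_integrable[OF \<phi>])
  have \<phi>J: "square_integrable lborel (\<lambda>x. indicat_real ?J x * \<phi> x)"
    by (intro indicator_square_integrable schwartz_square_integrable \<phi> J)
  have sqJ: "square_integrable lborel (\<lambda>x. indicat_real ?J x * sg t)"
  proof -
    have "(\<lambda>x. (norm (indicat_real ?J x * sg t))\<^sup>2) = (\<lambda>x. indicat_real ?J x * (sg t)\<^sup>2)"
      by (auto simp: indicator_def)
    with Ji J show ?thesis by (simp add: square_integrable_def)
  qed
  have oJ: "square_integrable lborel (\<lambda>x. indicat_real ?J x * (sg x - sg t))"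
    using square_integrable_diff[OF indicator_square_integrable[OF sg2 J] sqJ] by (simp add: algebra_simps)
  \<comment> \<open>The mean square of \<open>sg x - sg t\<close> over the segment, expanded so that
    only averages of \<open>sg\<close> and of its square enter; these converge at Lebesgue
    points.\<close>
  let ?V = "avg (\<lambda>x. (sg x)\<^sup>2) t r - 2 * sg t * avg sg t r + (sg t)\<^sup>2"
  have V: "(l2norm lborel (\<lambda>x. indicat_real ?J x * (sg x - sg t)))\<^sup>2 = ?\<Delta> * ?V"
  proof -
    have "(l2norm lborel (\<lambda>x. indicat_real ?J x * (sg x - sg t)))\<^sup>2 =
        (\<integral>x. indicat_real ?J x * (sg x)\<^sup>2 - 2 * sg t * (indicat_real ?J x * sg x) + (sg t)\<^sup>2 * indicat_real ?J x \<partial>lborel)"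
      unfolding l2norm_sq by (intro Bochner_Integration.integral_cong) (auto simp: indicator_def power2_diff)
    also have "\<dots> = (\<integral>x. indicat_real ?J x * (sg x)\<^sup>2 \<partial>lborel) - 2 * sg t * (\<integral>x. indicat_real ?J x * sg x \<partial>lborel) + (sg t)\<^sup>2 * ?\<Delta>"
      using i[OF s2] i[OF sg1] Ji by (simp add: Jm[symmetric] del: integral_indicator)
    also have "\<dots> = ?\<Delta> * ?V" using \<Delta> by (simp add: avg_def field_simps)
    finally show ?thesis .
  qed
  have V0: "0 \<le> ?V" using V \<Delta> zero_le_power2[of "l2norm lborel (\<lambda>x. indicat_real ?J x * (sg x - sg t))"]
    by (simp add: zero_le_mult_iff)
  then show "0 \<le> err t r" by (simp add: err_def)
  have n\<phi>: "l2norm lborel (\<lambda>x. indicat_real ?J x * \<phi> x) \<le> sqrt ?\<Delta> * ?n"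
  proof (rule power2_le_imp_le)
    have "(l2norm lborel (\<lambda>x. indicat_real ?J x * \<phi> x))\<^sup>2 \<le> (\<integral>x. ?n\<^sup>2 * indicat_real ?J x \<partial>lborel)"
      unfolding l2norm_sq
    proof (intro integral_mono integrable_mult_right Ji square_integrable_integrable[OF \<phi>J])
      fix x
      have "\<bar>\<phi> x\<bar>\<^sup>2 \<le> ?n\<^sup>2" by (intro power_mono schwartz_sup_le \<phi>) auto
      then show "(norm (indicat_real ?J x * \<phi> x))\<^sup>2 \<le> ?n\<^sup>2 * indicat_real ?J x" by (auto simp: indicator_def)
    qed
    also have "\<dots> = (sqrt ?\<Delta> * ?n)\<^sup>2" unfolding integral_mult_right_zero Jm by (simp add: power_mult_distrib)
    finally show "(l2norm lborel (\<lambda>x. indicat_real ?J x * \<phi> x))\<^sup>2 \<le> (sqrt ?\<Delta> * ?n)\<^sup>2" .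
  qed simp
  have A: "\<bar>\<integral>x. indicat_real ?J x * \<phi> x * (indicat_real ?J x * (sg x - sg t)) \<partial>lborel\<bar> \<le> ?\<Delta> * (sqrt ?V * ?n)"
  proof -
    have "\<bar>\<integral>x. indicat_real ?J x * \<phi> x * (indicat_real ?J x * (sg x - sg t)) \<partial>lborel\<bar> \<le>
        l2norm lborel (\<lambda>x. indicat_real ?J x * \<phi> x) * l2norm lborel (\<lambda>x. indicat_real ?J x * (sg x - sg t))"
      using l2_Cauchy_Schwarz[OF \<phi>J oJ] by simp
    also have "l2norm lborel (\<lambda>x. indicat_real ?J x * (sg x - sg t)) = sqrt (?\<Delta> * ?V)"
      unfolding V[symmetric] by simp
    also have "l2norm lborel (\<lambda>x. indicat_real ?J x * \<phi> x) * sqrt (?\<Delta> * ?V) \<le> (sqrt ?\<Delta> * ?n) * sqrt (?\<Delta> * ?V)"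
      using \<Delta> V0 by (intro mult_right_mono n\<phi>) simp
    also have "\<dots> = sqrt ?\<Delta> * sqrt ?\<Delta> * (sqrt ?V * ?n)" by (simp add: real_sqrt_mult mult_ac)
    also have "sqrt ?\<Delta> * sqrt ?\<Delta> = ?\<Delta>" by simp
    finally show ?thesis .
  qed
  have B: "\<bar>\<integral>x. indicat_real ?J x * (\<phi> x - \<phi> t) \<partial>lborel\<bar> \<le> ?\<Delta> * (sqrt ?\<Delta> * ?n)"
  proof -
    have "norm (\<integral>x. indicat_real ?J x * (\<phi> x - \<phi> t) \<partial>lborel) \<le> (\<integral>x. (sqrt ?\<Delta> * ?n) * indicat_real ?J x \<partial>lborel)"
    proof (rule order_trans[OF integral_norm_bound integral_mono'])
      show "integrable lborel (\<lambda>x. (sqrt ?\<Delta> * ?n) * indicat_real ?J x)" using Ji by (intro integrable_mult_right)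
      fix x
      have "\<bar>\<phi> x - \<phi> t\<bar> \<le> sqrt ?\<Delta> * ?n" if "x \<in> ?J"
      proof -
        have "\<bar>\<phi> x - \<phi> t\<bar> \<le> sqrt \<bar>x - t\<bar> * ?n" by (rule schwartz_Holder[OF \<phi>])
        also have "\<dots> \<le> sqrt ?\<Delta> * ?n"
          using that by (intro mult_right_mono) (auto simp: segm_def)
        finally show ?thesis .
      qed
      then show "norm (indicat_real ?J x * (\<phi> x - \<phi> t)) \<le> (sqrt ?\<Delta> * ?n) * indicat_real ?J x"
        by (simp add: indicator_def)
      show "0 \<le> (sqrt ?\<Delta> * ?n) * indicat_real ?J x" by simp
    qed
    then show ?thesis unfolding integral_mult_right_zero Jm by (simp add: mult_ac)
  qed
  have "(b r \<phi> - b t \<phi>) / (r - t) = (\<integral>x. indicat_real ?J x * (sg x * \<phi> x) \<partial>lborel) / ?\<Delta>"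
    unfolding b_def g_def mult.assoc by (rule integral_increment[OF s\<phi> assms(1-3)])
  also have "(\<integral>x. indicat_real ?J x * (sg x * \<phi> x) \<partial>lborel) =
      (\<integral>x. indicat_real ?J x * \<phi> x * (indicat_real ?J x * (sg x - sg t)) +
        (sg t * (indicat_real ?J x * (\<phi> x - \<phi> t)) + sg t * \<phi> t * indicat_real ?J x) \<partial>lborel)"
    by (intro Bochner_Integration.integral_cong) (auto simp: indicator_def algebra_simps)
  also have "\<dots> = (\<integral>x. indicat_real ?J x * \<phi> x * (indicat_real ?J x * (sg x - sg t)) \<partial>lborel) +
      (sg t * (\<integral>x. indicat_real ?J x * (\<phi> x - \<phi> t) \<partial>lborel) + sg t * \<phi> t * ?\<Delta>)"
  proof -
    have 1: "integrable lborel (\<lambda>x. indicat_real ?J x * \<phi> x * (indicat_real ?J x * (sg x - sg t)))"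
      by (rule square_integrable_mult_integrable[OF \<phi>J oJ])
    have 2: "integrable lborel (\<lambda>x. indicat_real ?J x * (\<phi> x - \<phi> t))"
      using Bochner_Integration.integrable_diff[OF i[OF \<phi>i] integrable_mult_left[OF Ji, of "\<phi> t"]] by (simp add: algebra_simps)
    show ?thesis
      unfolding Jm[symmetric] using 1 2 Ji by (simp only: Bochner_Integration.integral_add integrable_mult_right Bochner_Integration.integrable_add integral_mult_right_zero)
  qed
  finally have E: "(b r \<phi> - b t \<phi>) / (r - t) - sg t * \<phi> t =
      ((\<integral>x. indicat_real ?J x * \<phi> x * (indicat_real ?J x * (sg x - sg t)) \<partial>lborel) +
      sg t * (\<integral>x. indicat_real ?J x * (\<phi> x - \<phi> t) \<partial>lborel)) / ?\<Delta>"
    using \<Delta> by (simp add: field_simps)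
  have "\<bar>(b r \<phi> - b t \<phi>) / (r - t) - sg t * \<phi> t\<bar> \<le> (?\<Delta> * (sqrt ?V * ?n) + \<bar>sg t\<bar> * (?\<Delta> * (sqrt ?\<Delta> * ?n))) / ?\<Delta>"
  proof -
    have C: "\<bar>sg t * (\<integral>x. indicat_real ?J x * (\<phi> x - \<phi> t) \<partial>lborel)\<bar> \<le> \<bar>sg t\<bar> * (?\<Delta> * (sqrt ?\<Delta> * ?n))"
      unfolding abs_mult by (intro mult_left_mono B) simp
    show ?thesis
      unfolding E abs_divide abs_abs
      by (rule divide_right_mono[OF order_trans[OF abs_triangle_ineq add_mono[OF A C]]]) simp
  qed
  also have "\<dots> = err t r * ?n"
  proof -
    have cancel: "(q * (a * m) + s * (q * (c * m))) / q = (a + s * c) * m" if "q > 0" for q a m s c :: real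
    proof -
      have "q * (a * m) + s * (q * (c * m)) = q * ((a + s * c) * m)" by (simp only: distrib_left distrib_right mult_ac)
      then show ?thesis using that by simp
    qed
    show ?thesis unfolding err_def by (rule cancel[OF \<Delta>])
  qed
  also have "\<dots> \<le> err t r * schwartz_norm p \<phi>"
    using V0 p by (intro mult_left_mono schwartz_norm_mono \<phi>) (auto simp: err_def)
  finally show "\<bar>(b r \<phi> - b t \<phi>) / (r - t) - sg t * \<phi> t\<bar> \<le> err t r * schwartz_norm p \<phi>" .
qed

end

text \<open>With \<open>z\<close> the time increment, the error of a difference quotient of the
  products \<open>h * \<beta>\<close> is split into the Taylor remainder of \<open>h\<close>, the
  change of \<open>\<beta>\<close> in the first order term, the error of the quotient
  \<open>q\<close> against its limit \<open>v\<close>, the second order remainder of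
  \<open>\<beta>\<close>, and the error \<open>e\<close> in the derivative of the
  functional.\<close>

lemma quotient_decomposition:
  fixes h h' H z q v m e s \<beta> \<beta>' \<gamma> :: complex
  assumes "z \<noteq> 0"
  shows "(h' - h - z * q * H) / z * \<beta>' + q * H * (\<beta>' - \<beta>) + (q - v) * H * \<beta> +
      h / z * (\<beta>' - \<beta> - m * (z * (e + s)) * \<gamma>) + m * h * (e * \<gamma>) =
    (h' * \<beta>' - h * \<beta>) / z - (v * (H * \<beta>) + m * h * (s * \<gamma>))"
  using assms by (simp add: field_simps)

context transport_equation
begin

text \<open>The five terms of \<open>quotient_decomposition\<close> are bounded separately
  (\<open>F1\<close> to \<open>F5\<close>), each by a factor that tends to 0 times
  \<open>hk_bound N0 (L t + \<eta>) n\<close>. That the factor does not depend on \<open>n\<close>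
  gives convergence in the dual norm.\<close>

lemma derivative_t:
  assumes t: "t \<in> {0<..T}"
    and lim: "(avg nu t \<longlongrightarrow> nu t) (at t)" "(avg sg t \<longlongrightarrow> sg t) (at t)" "(avg (\<lambda>x. (sg x)\<^sup>2) t \<longlongrightarrow> (sg t)\<^sup>2) (at t)"
  shows "has_hida_derivative M (\<lambda>r. dist_of p (U 0 r x))
    (dist_of p (\<lambda>n \<phi>. of_real (1/2 * nu t) * U 2 t x n \<phi> + of_real (sg t) * \<Theta> t x n \<phi>)) t {0<..T}"
proof -
  obtain \<eta> N0 where g: "0 < \<eta>" "0 < N0" "N0 < N t" "(L t + \<eta>)\<^sup>2 < N0" using gap[OF t] .
  obtain c where c: "hida_forms p (\<Theta> t x) c" using forms_\<Theta>[OF t] .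
  \<comment> \<open>A bound for the norm of \<open>b r - b t\<close>: the quotient is within
    \<open>err t r\<close> of \<open>sg t\<close> times the evaluation at \<open>t\<close>, whose
    norm is at most 1.\<close>
  define \<delta> where "\<delta> r = \<bar>r - t\<bar> * (err t r + \<bar>sg t\<bar>)" for r
  define D where "D r = (N r - N t) / (r - t)" for r
  \<comment> \<open>The summands are the small factors of \<open>F1\<close> to \<open>F5\<close>, in
    this order.\<close>
  define e where "e r = (D r)\<^sup>2 * \<bar>r - t\<bar> + \<bar>D r\<bar> * (\<delta> r / \<eta>) + \<bar>D r - nu t\<bar> + \<bar>r - t\<bar> * ((err t r + \<bar>sg t\<bar>) / \<eta>)\<^sup>2 + err t r / \<eta>" for r
  let ?L = "L t + \<eta>" and ?A = "{0<..T}"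
  have L0: "0 \<le> L t" "0 \<le> ?L" using L_nonneg[of t] g by auto
  have Dr: "D r = avg nu t r" if "r \<in> ?A" "r \<noteq> t" for r
    unfolding D_def N_def avg_def using t that by (intro integral_increment nu) auto
  have le: "at t within ?A \<le> at t" by (rule at_le) simp
  have evA: "\<forall>\<^sub>F r in at t within ?A. r \<in> ?A \<and> r \<noteq> t" by (simp add: eventually_at_filter)
  have rt: "((\<lambda>r. r) \<longlongrightarrow> t) (at t within ?A)" by (rule tendsto_ident_at)
  have Dlim: "(D \<longlongrightarrow> nu t) (at t within ?A)"
  proof (rule Lim_transform_eventually[OF tendsto_mono[OF le lim(1)]])
    show "\<forall>\<^sub>F r in at t within ?A. avg nu t r = D r" using evA by eventually_elim (simp add: Dr)
  qed
  have elim: "(err t \<longlongrightarrow> 0) (at t within ?A)"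
  proof -
    have "((\<lambda>r. sqrt (avg (\<lambda>x. (sg x)\<^sup>2) t r - 2 * sg t * avg sg t r + (sg t)\<^sup>2) + \<bar>sg t\<bar> * sqrt \<bar>r - t\<bar>) \<longlongrightarrow>
        sqrt ((sg t)\<^sup>2 - 2 * sg t * sg t + (sg t)\<^sup>2) + \<bar>sg t\<bar> * sqrt \<bar>t - t\<bar>) (at t within ?A)"
      by (intro tendsto_intros rt tendsto_mono[OF le lim(2)] tendsto_mono[OF le lim(3)])
    then show ?thesis by (simp add: err_def[abs_def] power2_eq_square)
  qed
  have \<delta>lim: "(\<delta> \<longlongrightarrow> 0) (at t within ?A)"
  proof -
    have "((\<lambda>r. \<bar>r - t\<bar> * (err t r + \<bar>sg t\<bar>)) \<longlongrightarrow> \<bar>t - t\<bar> * (0 + \<bar>sg t\<bar>)) (at t within ?A)"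
      by (intro tendsto_intros rt elim)
    then show ?thesis by (simp add: \<delta>_def[abs_def])
  qed
  have e0: "(e \<longlongrightarrow> 0) (at t within ?A)"
  proof -
    have "((\<lambda>r. (D r)\<^sup>2 * \<bar>r - t\<bar> + \<bar>D r\<bar> * (\<delta> r / \<eta>) + \<bar>D r - nu t\<bar> + \<bar>r - t\<bar> * ((err t r + \<bar>sg t\<bar>) / \<eta>)\<^sup>2 + err t r / \<eta>) \<longlongrightarrow>
        (nu t)\<^sup>2 * \<bar>t - t\<bar> + \<bar>nu t\<bar> * (0 / \<eta>) + \<bar>nu t - nu t\<bar> + \<bar>t - t\<bar> * ((0 + \<bar>sg t\<bar>) / \<eta>)\<^sup>2 + 0 / \<eta>) (at t within ?A)"
      using g by (intro tendsto_intros rt elim Dlim \<delta>lim) auto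
    then show ?thesis by (simp add: e_def[abs_def])
  qed
  have evN: "\<forall>\<^sub>F r in at t within ?A. \<bar>N r - N t\<bar> < N t - N0"
  proof -
    have "((\<lambda>r. \<bar>D r * (r - t)\<bar>) \<longlongrightarrow> \<bar>nu t * (t - t)\<bar>) (at t within ?A)"
      by (intro tendsto_intros rt Dlim)
    then have "\<forall>\<^sub>F r in at t within ?A. \<bar>D r * (r - t)\<bar> < N t - N0"
      by (rule order_tendstoD(2)) (use g in simp)
    with evA show ?thesis by eventually_elim (simp add: D_def)
  qed
  have ev\<delta>: "\<forall>\<^sub>F r in at t within ?A. \<delta> r < \<eta>"
    using \<delta>lim g(1) by (rule order_tendstoD(2))
  show ?thesis
  proof (rule has_hida_derivative_dist_of)
    show "hida_forms p (U 0 r x) (hk_bound (N r) (L r))" if "r \<in> insert t ?A" for r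
      using that t by (intro forms_U) auto
    show "hida_forms p (\<lambda>n \<phi>. of_real (1/2 * nu t) * U 2 t x n \<phi> + of_real (sg t) * \<Theta> t x n \<phi>)
        (\<lambda>n. cmod (of_real (1/2 * nu t)) * hk_bound (N t) (L t) n + cmod (of_real (sg t)) * c n)"
      by (intro hida_forms_lin forms_U t c) simp
    show "summable (\<lambda>n. (hk_bound N0 ?L n)\<^sup>2 / fact n)" by (rule hk_bound_summable[OF g(2) L0(2) g(4)])
    show "(e \<longlongrightarrow> 0) (at t within ?A)" by (rule e0)
    show "\<forall>\<^sub>F r in at t within ?A. \<forall>n. hform p n (\<lambda>\<phi>. (U 0 r x n \<phi> - U 0 t x n \<phi>) / of_real (r - t) -
        (of_real (1/2 * nu t) * U 2 t x n \<phi> + of_real (sg t) * \<Theta> t x n \<phi>)) (e r * hk_bound N0 ?L n)"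
      using evA evN ev\<delta>
    proof eventually_elim
      case (elim r)
      then have r: "r \<in> ?A" "r \<noteq> t" "0 \<le> t" "0 \<le> r" and Nr: "\<bar>N r - N t\<bar> \<le> N t - N0" and \<delta>r: "\<delta> r \<le> \<eta>" using t by auto
      let ?\<Delta> = "\<bar>r - t\<bar>" and ?z = "complex_of_real (r - t)"
      have \<Delta>: "0 < ?\<Delta>" and z: "?z \<noteq> 0" and cz: "cmod ?z = ?\<Delta>" using r by (auto simp only: norm_of_real) (auto simp: right_minus_eq)
      have err0: "0 \<le> err t r" using b_increment(2)[OF r(3,4,2) schwartz_zero] .
      have \<delta>0: "0 \<le> \<delta> r" using err0 by (simp add: \<delta>_def)
      let ?e = "\<lambda>\<phi>. (b r \<phi> - b t \<phi>) / (r - t) - sg t * \<phi> t"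
      let ?d = "\<lambda>\<phi>. b r \<phi> - b t \<phi>"
      have le: "lbound p ?e (err t r)"
      proof (rule lbound_improve[OF _ err0])
        have "lbound p (\<lambda>\<phi>. (1 / (r - t)) * (1 * b r \<phi> + (-1) * b t \<phi>) + (- sg t) * \<phi> t)
          (\<bar>1 / (r - t)\<bar> * (\<bar>1\<bar> * L r + \<bar>-1\<bar> * L t) + \<bar>- sg t\<bar> * 1)"
          by (intro lbound_lin lbound_b lbound_eval p)
        then show "lbound p ?e (\<bar>1 / (r - t)\<bar> * (\<bar>1\<bar> * L r + \<bar>-1\<bar> * L t) + \<bar>- sg t\<bar> * 1)"
          by (simp add: diff_divide_distrib)
      qed (rule b_increment(1)[OF r(3,4,2)])
      have ld: "lbound p ?d (\<delta> r)"
      proof -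
        have "lbound p (\<lambda>\<phi>. (r - t) * ?e \<phi> + ((r - t) * sg t) * \<phi> t) (\<bar>r - t\<bar> * err t r + \<bar>(r - t) * sg t\<bar> * 1)"
          by (intro lbound_lin le lbound_eval p)
        moreover have "(\<lambda>\<phi>. (r - t) * ?e \<phi> + ((r - t) * sg t) * \<phi> t) = ?d"
        proof
          fix \<phi>
          have "(r - t) * (?d \<phi> / (r - t)) = ?d \<phi>" using r by simp
          then show "(r - t) * ?e \<phi> + ((r - t) * sg t) * \<phi> t = ?d \<phi>" unfolding right_diff_distrib[of "r - t" "?d \<phi> / (r - t)"] by simp
        qed
        moreover have "\<bar>r - t\<bar> * err t r + \<bar>(r - t) * sg t\<bar> * 1 = \<delta> r"
          by (simp only: \<delta>_def abs_mult mult_1_right distrib_left)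
        ultimately show ?thesis by (simp only:)
      qed
      \<comment> \<open>Writing \<open>b r\<close> as \<open>b t\<close> plus the increment yields a
        bound below \<open>L t + \<eta>\<close>, with parameters taken at the fixed time
        \<open>t\<close>.\<close>
      have lb: "lbound p (b r) (L t + \<delta> r)"
        using lbound_lin[OF lbound_b[of t] ld, of 1 1] by simp
      show ?case
      proof
        fix n
        let ?h' = "hk n (N r) x" and ?h = "hk n (N t) x" and ?h2 = "hk (n + 2) (N t) x" and ?B = "hk_bound N0 ?L n"
        let ?w = "?h' - ?h - of_real ((N r - N t) / 2) * ?h2"
        have Nt: "0 < N t" using N_pos[OF t] .
        have "L t ^ n \<le> 1 * ?L ^ n" using L0 g by (simp add: power_mono)
        moreover have "(L t + \<delta> r) ^ n \<le> 1 * ?L ^ n" using L0 \<delta>0 \<delta>r by (simp add: power_mono)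
        moreover have "cmod (?w / ?z) \<le> ((D r)\<^sup>2 * ?\<Delta>) * mom (n + 4) N0"
        proof -
          have "cmod (?w / ?z) \<le> (N r - N t)\<^sup>2 * mom (n + 4) N0 / ?\<Delta>"
            unfolding norm_divide cz by (intro divide_right_mono hk_N_taylor g Nr) simp
          also have "(N r - N t)\<^sup>2 * mom (n + 4) N0 / ?\<Delta> = ((D r)\<^sup>2 * ?\<Delta>) * mom (n + 4) N0"
          proof -
            have "(N r - N t)\<^sup>2 = (D r)\<^sup>2 * (?\<Delta> * ?\<Delta>)" using r by (simp add: D_def power_divide power2_eq_square)
            moreover have "a * (q * q) * m / q = a * q * m" if "q > 0" for a q m :: real using that by simp
            ultimately show ?thesis using \<Delta> by (simp only:)
          qed
          finally show ?thesis .
        qed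
        ultimately have F1: "hform p n (\<lambda>\<phi>. ?w / ?z * complex_of_real (b r \<phi> ^ n)) (((D r)\<^sup>2 * ?\<Delta>) * 1 * ?B)"
          using g L0 by (intro hform_hk[OF hform_power[OF lb], where j = 4 and N = N0]) auto
        have "cmod (of_real (D r / 2) * ?h2) \<le> \<bar>D r\<bar> * mom (n + 2) (N t)"
          unfolding norm_mult norm_of_real by (intro mult_mono hk_le Nt) auto
        then have F2: "hform p n (\<lambda>\<phi>. of_real (D r / 2) * ?h2 * complex_of_real ((b t \<phi> + ?d \<phi>) ^ n - b t \<phi> ^ n)) (\<bar>D r\<bar> * (\<delta> r / \<eta>) * ?B)"
          using g L0 \<delta>0 by (intro hform_hk[OF hform_power_diff(1)[OF ld lbound_b g(1) \<delta>r], where j = 2 and N = "N t"]) auto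
        have "cmod (of_real ((D r - nu t) / 2) * ?h2) \<le> \<bar>D r - nu t\<bar> * mom (n + 2) (N t)"
          unfolding norm_mult norm_of_real by (intro mult_mono hk_le Nt) auto
        then have F3: "hform p n (\<lambda>\<phi>. of_real ((D r - nu t) / 2) * ?h2 * complex_of_real (b t \<phi> ^ n)) (\<bar>D r - nu t\<bar> * 1 * ?B)"
          using g L0 \<open>L t ^ n \<le> 1 * ?L ^ n\<close> by (intro hform_hk[OF hform_power[OF lbound_b], where j = 2 and N = "N t"]) auto
        have "cmod (?h / ?z) \<le> (1 / ?\<Delta>) * mom (n + 0) (N t)"
          unfolding norm_divide cz using hk_le[OF Nt, of n x] \<Delta> by (simp add: divide_right_mono)
        then have F4: "hform p n (\<lambda>\<phi>. ?h / ?z * complex_of_real ((b t \<phi> + ?d \<phi>) ^ n - b t \<phi> ^ n - of_nat n * ?d \<phi> * b t \<phi> ^ (n - 1)))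
            ((1 / ?\<Delta>) * (\<delta> r / \<eta>)\<^sup>2 * ?B)"
          using g L0 \<Delta> by (intro hform_hk[OF hform_power_diff(2)[OF ld lbound_b g(1) \<delta>r], where j = 0 and N = "N t"]) auto
        have F5: "hform p n (\<lambda>\<phi>. of_nat n * ?h * complex_of_real (?e \<phi> * b t \<phi> ^ (n - 1))) (err t r / \<eta> * ?B)"
          using g by (intro hform_derivative_power le hk_le Nt) auto
        note F = hform_add[OF hform_add[OF hform_add[OF hform_add[OF F1 F2] F3] F4] F5]
        \<comment> \<open>The binomial remainder is quadratic in \<open>\<delta> r\<close>, which
          itself carries a factor \<open>?\<Delta>\<close>; one such factor survives the
          division.\<close>
        have "(1 / ?\<Delta>) * (\<delta> r / \<eta>)\<^sup>2 = ?\<Delta> * ((err t r + \<bar>sg t\<bar>) / \<eta>)\<^sup>2"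
          using \<Delta> by (simp add: \<delta>_def power_mult_distrib power_divide power2_eq_square)
        then have bd: "((D r)\<^sup>2 * ?\<Delta>) * 1 * ?B + \<bar>D r\<bar> * (\<delta> r / \<eta>) * ?B + \<bar>D r - nu t\<bar> * 1 * ?B + (1 / ?\<Delta>) * (\<delta> r / \<eta>)\<^sup>2 * ?B + err t r / \<eta> * ?B = e r * ?B"
          by (simp only: e_def distrib_right mult_1_right)
        show "hform p n (\<lambda>\<phi>. (U 0 r x n \<phi> - U 0 t x n \<phi>) / of_real (r - t) -
            (of_real (1/2 * nu t) * U 2 t x n \<phi> + of_real (sg t) * \<Theta> t x n \<phi>)) (e r * ?B)"
        proof (rule hform_cong[OF F[unfolded bd]])
          fix \<phi>
          define \<beta> where "\<beta> = complex_of_real (b t \<phi> ^ n)"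
          define \<beta>' where "\<beta>' = complex_of_real (b r \<phi> ^ n)"
          define \<gamma> where "\<gamma> = complex_of_real (b t \<phi> ^ (n - 1))"
          define d where "d = complex_of_real (?d \<phi>)"
          define ep where "ep = complex_of_real (?e \<phi>)"
          define s where "s = complex_of_real (sg t * \<phi> t)"
          have d: "d = ?z * (ep + s)"
          proof -
            have "?d \<phi> = (r - t) * (?e \<phi> + sg t * \<phi> t)" using r by simp
            then show ?thesis unfolding d_def ep_def s_def by (metis of_real_add of_real_mult)
          qed
          have Dz: "of_real ((N r - N t) / 2) = ?z * of_real (D r / 2)"
          proof -
            have "(r - t) * D r = N r - N t" using r by (simp add: D_def)
            then have "(N r - N t) / 2 = (r - t) * (D r / 2)" by simp
            then show ?thesis by (simp only: of_real_mult)
          qed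
          have bb: "b t \<phi> + ?d \<phi> = b r \<phi>" by simp
          have 1: "?w / ?z * \<beta>' + of_real (D r / 2) * ?h2 * (\<beta>' - \<beta>) + of_real ((D r - nu t) / 2) * ?h2 * \<beta> +
              ?h / ?z * (\<beta>' - \<beta> - of_nat n * d * \<gamma>) + of_nat n * ?h * (ep * \<gamma>) =
              (?h' * \<beta>' - ?h * \<beta>) / ?z - (of_real (1/2 * nu t) * (?h2 * \<beta>) + of_nat n * ?h * (s * \<gamma>))"
          proof -
            have v: "of_real ((D r - nu t) / 2) = of_real (D r / 2) - complex_of_real (1/2 * nu t)"
              by (simp add: diff_divide_distrib)
            show ?thesis unfolding Dz d v by (rule quotient_decomposition[OF z])
          qed
          show "?w / ?z * complex_of_real (b r \<phi> ^ n) +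
              of_real (D r / 2) * ?h2 * complex_of_real ((b t \<phi> + ?d \<phi>) ^ n - b t \<phi> ^ n) +
              of_real ((D r - nu t) / 2) * ?h2 * complex_of_real (b t \<phi> ^ n) +
              ?h / ?z * complex_of_real ((b t \<phi> + ?d \<phi>) ^ n - b t \<phi> ^ n - of_nat n * ?d \<phi> * b t \<phi> ^ (n - 1)) +
              of_nat n * ?h * complex_of_real (?e \<phi> * b t \<phi> ^ (n - 1)) =
              (U 0 r x n \<phi> - U 0 t x n \<phi>) / of_real (r - t) - (of_real (1/2 * nu t) * U 2 t x n \<phi> + of_real (sg t) * \<Theta> t x n \<phi>)"
          proof -
            have "complex_of_real ((b t \<phi> + ?d \<phi>) ^ n - b t \<phi> ^ n) = \<beta>' - \<beta>"
              unfolding bb \<beta>_def \<beta>'_def by (rule of_real_diff)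
            moreover have "complex_of_real ((b t \<phi> + ?d \<phi>) ^ n - b t \<phi> ^ n - of_nat n * ?d \<phi> * b t \<phi> ^ (n - 1)) = \<beta>' - \<beta> - of_nat n * d * \<gamma>"
              unfolding bb \<beta>_def \<beta>'_def \<gamma>_def d_def by simp
            moreover have "complex_of_real (?e \<phi> * b t \<phi> ^ (n - 1)) = ep * \<gamma>" unfolding ep_def \<gamma>_def by (rule of_real_mult)
            moreover have "of_real (sg t) * \<Theta> t x n \<phi> = of_nat n * ?h * (s * \<gamma>)"
              unfolding \<Theta>_def s_def \<gamma>_def by simp
            ultimately show ?thesis
              unfolding U_def add_0_right \<beta>_def[symmetric] \<beta>'_def[symmetric] using 1 by (simp only:)
          qed
        qed
      qed
    qed
  qed
qed

lemma equation:
  assumes t: "t \<in> {0<..T}"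
    and lim: "(avg nu t \<longlongrightarrow> nu t) (at t)" "(avg sg t \<longlongrightarrow> sg t) (at t)" "(avg (\<lambda>x. (sg x)\<^sup>2) t \<longlongrightarrow> (sg t)\<^sup>2) (at t)"
  shows "\<exists>Dx. \<forall>x. \<exists>Dt Dxx.
        has_hida_derivative M (\<lambda>r. dist_of p (U 0 r x)) Dt t {0<..T} \<and>
        has_hida_derivative M (\<lambda>x. dist_of p (U 0 t x)) (Dx x) x UNIV \<and>
        has_hida_derivative M Dx Dxx x UNIV \<and>
        Dt = (\<lambda>F. 1/2 * complex_of_real (nu t) * Dxx F
               + complex_of_real (sg t) * wick_product M (white_noise M t) (Dx x) F)"
proof (intro exI[of _ "\<lambda>x. dist_of p (U 1 t x)"] allI)
  fix x
  obtain c where c: "hida_forms p (\<Theta> t x) c" using forms_\<Theta>[OF t] .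
  have "dist_of p (\<lambda>n \<phi>. of_real (1/2 * nu t) * U 2 t x n \<phi> + of_real (sg t) * \<Theta> t x n \<phi>) =
      (\<lambda>F. of_real (1/2 * nu t) * dist_of p (U 2 t x) F + of_real (sg t) * dist_of p (\<Theta> t x) F)"
    by (rule dist_of_lin[OF forms_U[OF t] c]) simp
  then show "\<exists>Dt Dxx.
        has_hida_derivative M (\<lambda>r. dist_of p (U 0 r x)) Dt t {0<..T} \<and>
        has_hida_derivative M (\<lambda>x. dist_of p (U 0 t x)) (dist_of p (U 1 t x)) x UNIV \<and>
        has_hida_derivative M (\<lambda>x. dist_of p (U 1 t x)) Dxx x UNIV \<and>
        Dt = (\<lambda>F. 1/2 * complex_of_real (nu t) * Dxx F
               + complex_of_real (sg t) * wick_product M (white_noise M t) (dist_of p (U 1 t x)) F)"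
    using derivative_t[OF t lim, of x] derivative_x[OF t, of 0 x] derivative_x[OF t, of 1 x] wick_product_\<Theta>[OF t, of x]
    by (intro exI[of _ "dist_of p (\<lambda>n \<phi>. of_real (1/2 * nu t) * U 2 t x n \<phi> + of_real (sg t) * \<Theta> t x n \<phi>)"]
        exI[of _ "dist_of p (U 2 t x)"] conjI) (simp_all add: numeral_2_eq_2)
qed

end

section \<open>Coefficients with values in the extended reals\<close>

text \<open>Kernels and Schwartz functions are integrated over \<open>lborel\<close>, the
  coefficients over \<open>lebesgue\<close>. A Borel version bridges the two, and truncation to a
  bounded interval turns local integrability into integrability on the line.\<close>

lemma ereal_borel_version:
  fixes f :: "real \<Rightarrow> ereal"
  assumes f: "f \<in> borel_measurable (lebesgue_on {0..})"
  obtains h where "h \<in> borel_measurable borel"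
    "AE x in lborel. h x = indicator {0..T} x * real_of_ereal (f x)"
    "(\<lambda>x. indicator {0..T} x * real_of_ereal (f x)) \<in> borel_measurable lebesgue"
proof -
  have "(\<lambda>x. real_of_ereal (f x)) \<in> borel_measurable (lebesgue_on {0..})"
    using f by measurable
  then have "(\<lambda>x. indicator {0..} x *\<^sub>R real_of_ereal (f x)) \<in> borel_measurable lebesgue"
    by (subst (asm) borel_measurable_restrict_space_iff) auto
  then have "(\<lambda>x. indicator {0..T} x * (indicator {0..} x *\<^sub>R real_of_ereal (f x))) \<in> borel_measurable lebesgue"
    by (intro borel_measurable_times[OF borel_measurable_indicator]) auto
  moreover have "(\<lambda>x. indicator {0..T} x * (indicator {0..} x *\<^sub>R real_of_ereal (f x))) = (\<lambda>x. indicator {0..T} x * real_of_ereal (f x))"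
    by (auto simp: indicator_def)
  ultimately have m: "(\<lambda>x. indicator {0..T} x * real_of_ereal (f x)) \<in> borel_measurable lebesgue" by simp
  from completion_ex_borel_measurable_real[OF m] obtain h where h: "h \<in> borel_measurable lborel"
    "AE x in lborel. indicator {0..T} x * real_of_ereal (f x) = h x" by blast
  have "AE x in lborel. h x = indicator {0..T} x * real_of_ereal (f x)" using h(2) by eventually_elim simp
  with h(1) m that show thesis by simp
qed

lemma integral_lebesgue_eq_lborel:
  fixes h k :: "real \<Rightarrow> real"
  assumes "h \<in> borel_measurable lborel" "AE x in lborel. h x = k x" "k \<in> borel_measurable lebesgue"
  shows "integrable lborel h \<longleftrightarrow> integrable lebesgue k" "(\<integral>x. h x \<partial>lborel) = (\<integral>x. k x \<partial>lebesgue)"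
proof -
  have hm: "h \<in> borel_measurable lebesgue" using assms(1) by (rule measurable_completion)
  have ae: "AE x in lebesgue. h x = k x" using assms(2) by (rule AE_completion)
  have "integrable lborel h = integrable lebesgue h" using assms(1) by (simp add: integrable_completion)
  also have "\<dots> = integrable lebesgue k" by (rule integrable_cong_AE[OF hm assms(3) ae])
  finally show "integrable lborel h \<longleftrightarrow> integrable lebesgue k" .
  have "(\<integral>x. h x \<partial>lborel) = (\<integral>x. h x \<partial>lebesgue)" using assms(1) by (simp add: integral_completion)
  also have "\<dots> = (\<integral>x. k x \<partial>lebesgue)" by (rule integral_cong_AE[OF hm assms(3) ae])
  finally show "(\<integral>x. h x \<partial>lborel) = (\<integral>x. k x \<partial>lebesgue)" .
qed

lemma initial_integral_lebesgue:
  fixes h k :: "real \<Rightarrow> real"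
  assumes "h \<in> borel_measurable lborel" "AE x in lborel. h x = indicator {0..T} x * k x"
    "(\<lambda>x. indicator {0..T} x * k x) \<in> borel_measurable lebesgue" "t \<le> T"
  shows "(LINT x:{0..t}|lebesgue. k x) = (\<integral>x. indicator {0..t} x * h x \<partial>lborel)"
proof -
  have k: "(\<lambda>x. indicator {0..t} x * k x) = (\<lambda>x. indicator {0..t} x * (indicator {0..T} x * k x))"
    using assms(4) by (auto simp: indicator_def)
  have "(\<integral>x. indicator {0..t} x * h x \<partial>lborel) = (\<integral>x. indicator {0..t} x * k x \<partial>lebesgue)"
  proof (rule integral_lebesgue_eq_lborel(2))
    show "(\<lambda>x. indicator {0..t} x * h x) \<in> borel_measurable lborel"
      using assms(1) by (intro borel_measurable_times borel_measurable_indicator) auto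
    show "AE x in lborel. indicator {0..t} x * h x = indicator {0..t} x * k x"
      using assms(2) by eventually_elim (use assms(4) in \<open>auto simp: indicator_def\<close>)
    show "(\<lambda>x. indicator {0..t} x * k x) \<in> borel_measurable lebesgue"
      unfolding k by (rule borel_measurable_times[OF borel_measurable_indicator assms(3)]) auto
  qed
  then show ?thesis by (simp add: set_lebesgue_integral_def)
qed

text \<open>An inequality, since \<open>real_of_ereal\<close> sends infinite values to 0; for
  finiteness of integrals it is the right direction.\<close>

lemma e2ennreal_abs_ge: "ennreal (real_of_ereal \<bar>x\<bar>) \<le> e2ennreal \<bar>x\<bar>"
  by (cases x) auto

lemma e2ennreal_sq_ge: "ennreal ((real_of_ereal x)\<^sup>2) \<le> e2ennreal (x\<^sup>2)"
  by (cases x) (auto simp: power2_eq_square)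

theorem theorem5p2:
  fixes M :: "functional measure" and \<nu> \<sigma> :: "real \<Rightarrow> ereal"
  assumes "white_noise_measure M"
    and "\<forall>t\<ge>0. 0 < \<nu> t" and "locally_integrable \<nu>"
    and "locally_square_integrable \<sigma>"
    and "Bfun (kappa \<nu> \<sigma>) (at_right 0)"
  shows "\<forall>T::nat. T \<ge> 1 \<longrightarrow> (\<exists>(s::real) (u :: real \<Rightarrow> real \<Rightarrow> hida_functional).
    (\<forall>t\<in>{0<..real T}. \<forall>x. u t x \<in> space_G M s) \<and>
    (\<forall>\<phi>\<in>schwartz. dirac_sequence (real T) (\<lambda>t x. S_transform (u t x) \<phi>)) \<and>
    (AE t in lebesgue. t \<in> {0<..real T} \<longrightarrow>
      (\<exists>Dx. \<forall>x. \<exists>Dt Dxx.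
        has_hida_derivative M (\<lambda>r. u r x) Dt t {0<..real T} \<and>
        has_hida_derivative M (u t) (Dx x) x UNIV \<and>
        has_hida_derivative M Dx Dxx x UNIV \<and>
        Dt = (\<lambda>F. 1/2 * complex_of_real (real_of_ereal (\<nu> t)) * Dxx F
               + complex_of_real (real_of_ereal (\<sigma> t)) * wick_product M (white_noise M t) (Dx x) F))) \<and>
    (\<forall>s'. \<forall>t\<in>{0<..real T}. 2 powr s' * kappa \<nu> \<sigma> t < 1 \<longrightarrow>
      (\<forall>x. u t x \<in> space_G M s')))"
proof (intro allI impI)
  fix Tn :: nat assume Tn: "Tn \<ge> 1"
  define T where "T = real Tn"
  have T: "0 < T" using Tn by (simp add: T_def)
  interpret white_noise_space M by unfold_locales (rule assms(1))
  obtain nu where nu_version: "nu \<in> borel_measurable borel"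
    "AE x in lborel. nu x = indicator {0..T} x * real_of_ereal (\<nu> x)"
    "(\<lambda>x. indicator {0..T} x * real_of_ereal (\<nu> x)) \<in> borel_measurable lebesgue"
    using ereal_borel_version[of \<nu> T] assms(3) by (auto simp: locally_integrable_def)
  obtain sg where sg_version: "sg \<in> borel_measurable borel"
    "AE x in lborel. sg x = indicator {0..T} x * real_of_ereal (\<sigma> x)"
    "(\<lambda>x. indicator {0..T} x * real_of_ereal (\<sigma> x)) \<in> borel_measurable lebesgue"
    using ereal_borel_version[of \<sigma> T] assms(4) by (auto simp: locally_square_integrable_def)
  have \<nu>fin: "(\<integral>\<^sup>+r\<in>{0..T}. e2ennreal \<bar>\<nu> r\<bar> \<partial>lebesgue) < \<infinity>"
    using assms(3) T by (auto simp: locally_integrable_def)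
  have \<sigma>fin: "(\<integral>\<^sup>+r\<in>{0..T}. e2ennreal ((\<sigma> r)\<^sup>2) \<partial>lebesgue) < \<infinity>"
    using assms(4) T by (auto simp: locally_square_integrable_def)
  have nu_int: "integrable lborel nu"
  proof -
    have "integrable lebesgue (\<lambda>x. indicator {0..T} x * real_of_ereal (\<nu> x))"
    proof (rule integrableI_bounded[OF nu_version(3)])
      have "(\<integral>\<^sup>+x. ennreal (norm (indicator {0..T} x * real_of_ereal (\<nu> x))) \<partial>lebesgue) \<le>
          (\<integral>\<^sup>+r\<in>{0..T}. e2ennreal \<bar>\<nu> r\<bar> \<partial>lebesgue)"
        by (rule nn_integral_mono) (auto simp: indicator_def e2ennreal_abs_ge)
      with \<nu>fin show "(\<integral>\<^sup>+x. ennreal (norm (indicator {0..T} x * real_of_ereal (\<nu> x))) \<partial>lebesgue) < \<infinity>"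
        by (rule le_less_trans[rotated])
    qed
    then show ?thesis using integral_lebesgue_eq_lborel(1)[of nu, OF _ nu_version(2,3)] nu_version(1) by simp
  qed
  have sg2_AE: "AE x in lborel. (sg x)\<^sup>2 = indicator {0..T} x * (real_of_ereal (\<sigma> x))\<^sup>2"
    using sg_version(2) by eventually_elim (auto simp: indicator_def)
  have sg2_m: "(\<lambda>x. indicator {0..T} x * (real_of_ereal (\<sigma> x))\<^sup>2) \<in> borel_measurable lebesgue"
  proof -
    have "(\<lambda>x. (indicator {0..T} x * real_of_ereal (\<sigma> x))\<^sup>2) \<in> borel_measurable lebesgue"
      using sg_version(3) by (rule borel_measurable_power)
    moreover have "(\<lambda>x. (indicator {0..T} x * real_of_ereal (\<sigma> x))\<^sup>2) = (\<lambda>x. indicator {0..T} x * (real_of_ereal (\<sigma> x))\<^sup>2)"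
      by (auto simp: indicator_def)
    ultimately show ?thesis by simp
  qed
  have sg2_int: "integrable lborel (\<lambda>x. (sg x)\<^sup>2)"
  proof -
    have "integrable lebesgue (\<lambda>x. indicator {0..T} x * (real_of_ereal (\<sigma> x))\<^sup>2)"
    proof (rule integrableI_bounded[OF sg2_m])
      have "(\<integral>\<^sup>+x. ennreal (norm (indicator {0..T} x * (real_of_ereal (\<sigma> x))\<^sup>2)) \<partial>lebesgue) \<le>
          (\<integral>\<^sup>+r\<in>{0..T}. e2ennreal ((\<sigma> r)\<^sup>2) \<partial>lebesgue)"
        by (rule nn_integral_mono) (auto simp: indicator_def e2ennreal_sq_ge)
      with \<sigma>fin show "(\<integral>\<^sup>+x. ennreal (norm (indicator {0..T} x * (real_of_ereal (\<sigma> x))\<^sup>2)) \<partial>lebesgue) < \<infinity>"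
        by (rule le_less_trans[rotated])
    qed
    then show ?thesis
      using integral_lebesgue_eq_lborel(1)[of "\<lambda>x. (sg x)\<^sup>2", OF _ sg2_AE sg2_m] sg_version(1) by simp
  qed
  have sg_sq: "square_integrable lborel sg" using sg_version(1) sg2_int by (simp add: square_integrable_def)
  \<comment> \<open>Almost everywhere \<open>sg\<close> is its product with the indicator of a
    bounded interval, and both factors are square integrable.\<close>
  have sg_int: "integrable lborel sg"
  proof -
    have "integrable lborel (indicat_real {0..T})"
      by (rule integrable_real_indicator) (auto simp: emeasure_lborel_Icc_eq)
    moreover have "(\<lambda>x. (norm (indicat_real {0..T} x))\<^sup>2) = indicat_real {0..T}" by (auto simp: indicator_def)
    ultimately have "square_integrable lborel (indicat_real {0..T})" by (simp add: square_integrable_def)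
    then have i: "integrable lborel (\<lambda>x. indicat_real {0..T} x * sg x)"
      using sg_sq by (rule square_integrable_mult_integrable)
    have "integrable lborel sg = integrable lborel (\<lambda>x. indicat_real {0..T} x * sg x)"
    proof (rule integrable_cong_AE)
      show "AE x in lborel. sg x = indicat_real {0..T} x * sg x"
        using sg_version(2) by eventually_elim (auto simp: indicator_def)
    qed (use sg_version(1) i in auto)
    with i show ?thesis by simp
  qed
  let ?N = "\<lambda>t. \<integral>x. indicator {0..t} x * nu x \<partial>lborel"
  let ?G = "\<lambda>t. \<integral>x. indicator {0..t} x * (sg x)\<^sup>2 \<partial>lborel"
  have kappa: "kappa \<nu> \<sigma> t = ?G t / ?N t" if "t \<le> T" for t
  proof -
    have "(LINT r:{0..t}|lebesgue. (real_of_ereal (\<sigma> r))\<^sup>2) = ?G t"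
      using sg_version(1) by (intro initial_integral_lebesgue[OF _ sg2_AE sg2_m that]) simp
    moreover have "(LINT r:{0..t}|lebesgue. real_of_ereal (\<nu> r)) = ?N t"
      using nu_version(1) by (intro initial_integral_lebesgue[OF _ nu_version(2,3) that]) simp
    ultimately show ?thesis by (simp add: kappa_def)
  qed
  \<comment> \<open>An infinite value of \<nu> would become 0 under \<open>real_of_ereal\<close>, so
    strict positivity survives only where \<nu> is finite; local integrability makes this almost
    everywhere.\<close>
  have nu_pos: "AE x in lborel. x \<in> {0..T} \<longrightarrow> 0 < nu x"
  proof -
    have m: "(\<lambda>x. if x \<in> {0..} then \<nu> x else 0) \<in> borel_measurable lebesgue"
      using assms(3) by (subst measurable_restrict_space_iff[symmetric]) (auto simp: locally_integrable_def)
    have m': "(\<lambda>x. e2ennreal \<bar>if x \<in> {0..} then \<nu> x else 0\<bar> * indicator {0..T} x) \<in> borel_measurable lebesgue"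
    proof (intro borel_measurable_times_ennreal borel_measurable_indicator)
      have "(\<lambda>x::ereal. e2ennreal \<bar>x\<bar>) \<in> borel_measurable borel" by measurable
      from measurable_compose[OF m this]
      show "(\<lambda>x. e2ennreal \<bar>if x \<in> {0..} then \<nu> x else 0\<bar>) \<in> borel_measurable lebesgue" .
    qed auto
    have e: "(\<lambda>x. e2ennreal \<bar>if x \<in> {0..} then \<nu> x else 0\<bar> * indicator {0..T} x) = (\<lambda>x. e2ennreal \<bar>\<nu> x\<bar> * indicator {0..T} x)"
      by (auto simp: indicator_def)
    have "AE x in lebesgue. e2ennreal \<bar>\<nu> x\<bar> * indicator {0..T} x \<noteq> \<infinity>"
      using \<nu>fin m' unfolding e by (intro nn_integral_PInf_AE) auto
    then have "AE x in lborel. e2ennreal \<bar>\<nu> x\<bar> * indicator {0..T} x \<noteq> \<infinity>"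
      by (simp only: AE_completion_iff)
    with nu_version(2) show ?thesis
    proof eventually_elim
      case (elim x)
      show ?case
      proof
        assume x: "x \<in> {0..T}"
        then have "0 < \<nu> x" using assms(2) by auto
        with elim x show "0 < nu x" by (cases "\<nu> x") auto
      qed
    qed
  qed
  have i1: "integrable lborel (\<lambda>x. indicator {0..t} x * nu x)" "integrable lborel (\<lambda>x. indicator {0..t} x * (sg x)\<^sup>2)" for t :: real
    using integrable_mult_indicator[OF _ nu_int, of "{0..t}"] integrable_mult_indicator[OF _ sg2_int, of "{0..t}"] by simp_all
  have var_mono: "?N a \<le> ?N b" if "a \<le> b" "b \<le> T" for a b
    by (rule integral_mono_AE[OF i1(1) i1(1)]) (use nu_pos in \<open>eventually_elim, use that in \<open>auto simp: indicator_def\<close>\<close>)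
  have G_mono: "?G a \<le> ?G b" if "a \<le> b" for a b
    by (rule integral_mono[OF i1(2) i1(2)]) (use that in \<open>auto simp: indicator_def\<close>)
  have G_nonneg: "0 \<le> ?G t" for t by (intro integral_nonneg_AE) auto
  have var_pos: "0 < ?N t" if t: "t \<in> {0<..T}" for t
  proof -
    have nn: "AE x in lborel. 0 \<le> indicator {0..t} x * nu x"
      using nu_pos by eventually_elim (use t in \<open>auto simp: indicator_def\<close>)
    have "?N t \<noteq> 0"
    proof
      assume "?N t = 0"
      then have "AE x in lborel. indicator {0..t} x * nu x = 0"
        using integral_nonneg_eq_0_iff_AE[OF i1(1) nn] by simp
      with nu_pos have "AE x in lborel. x \<notin> {0..t}"
        by eventually_elim (use t in \<open>auto simp: indicator_def split: if_splits\<close>)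
      then have "{0..t} \<in> null_sets lborel" by (subst AE_iff_null_sets) auto
      then show False using t by (auto simp: null_sets_def emeasure_lborel_Icc_eq)
    qed
    moreover have "0 \<le> ?N t" by (rule integral_nonneg_AE[OF nn])
    ultimately show ?thesis by simp
  qed
  \<comment> \<open>Near 0 the constant comes from the hypothesis on \<open>kappa\<close>. From some
    \<open>e > 0\<close> on, both integrals are monotone, so their quotient is at most
    \<open>?G T / ?N e\<close>. The sum of the two constants serves the whole interval.\<close>
  obtain C where C: "C > 0" "\<And>t. t \<in> {0<..T} \<Longrightarrow> ?G t \<le> C * ?N t"
  proof -
    obtain K where K: "K > 0" "\<forall>\<^sub>F t in at_right 0. norm (kappa \<nu> \<sigma> t) \<le> K"
      using assms(5) by (auto simp: Bfun_def)
    then obtain d where d: "d > 0" "\<And>t. 0 < t \<Longrightarrow> t < d \<Longrightarrow> \<bar>kappa \<nu> \<sigma> t\<bar> \<le> K"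
      by (auto simp: eventually_at_right_field)
    define e where "e = min d T / 2"
    have e: "0 < e" "e < d" "e \<le> T" "e \<in> {0<..T}" using d T by (auto simp: e_def)
    have "?G t \<le> (K + ?G T / ?N e) * ?N t" if t: "t \<in> {0<..T}" for t
    proof (cases "t < e")
      case True
      have "\<bar>kappa \<nu> \<sigma> t\<bar> \<le> K" using d(2)[of t] True t e by auto
      then have "?G t / ?N t \<le> K" unfolding kappa[OF order.strict_implies_order[OF less_le_trans[OF True e(3)]]]
        by (rule abs_le_D1)
      then have "?G t \<le> K * ?N t" using var_pos[OF t] by (simp add: divide_le_eq)
      also have "\<dots> \<le> (K + ?G T / ?N e) * ?N t"
        using var_pos[OF t] var_pos[OF e(4)] G_nonneg[of T] by (intro mult_right_mono) auto
      finally show ?thesis .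
    next
      case False
      have "?G t \<le> ?G T" using t by (intro G_mono) auto
      also have "\<dots> = ?G T / ?N e * ?N e" using var_pos[OF e(4)] by simp
      also have "\<dots> \<le> ?G T / ?N e * ?N t"
        using False t var_pos[OF e(4)] G_nonneg[of T] by (intro mult_left_mono var_mono) auto
      also have "\<dots> \<le> (K + ?G T / ?N e) * ?N t"
        using var_pos[OF t] K by (intro mult_right_mono) auto
      finally show ?thesis .
    qed
    moreover have "K + ?G T / ?N e > 0" using K var_pos[OF e(4)] G_nonneg[of T] by (intro add_pos_nonneg) auto
    ultimately show thesis using that by blast
  qed
  obtain p0 where p0: "C < 4 ^ p0" using real_arch_pow[of 4 C] by auto
  \<comment> \<open>The successor guarantees \<open>1 \<le> p\<close>, as point evaluations
    require.\<close>
  define p where "p = Suc p0"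
  have p: "C < 4 ^ p" using p0 C(1) by (simp add: p_def)
  have less: "?G t < 4 ^ p * ?N t" if t: "t \<in> {0<..T}" for t
    using C(2)[OF t] mult_strict_right_mono[OF p var_pos[OF t]] by linarith
  interpret transport_equation M nu sg T p
    by unfold_locales (use T nu_int sg_sq sg_int var_pos less in \<open>auto simp: p_def\<close>)
  \<comment> \<open>Chosen so that \<open>2 powr s\<close> is the inverse of \<open>4 ^ p\<close>;
    the uniform bound of \<open>kappa\<close> then puts the solution into one space for all
    times.\<close>
  define s where "s = - 2 * real p"
  have s: "2 powr s = 1 / 4 ^ p"
  proof -
    have "2 powr s = inverse (2 powr (real (2 * p)))" by (simp add: s_def powr_minus)
    also have "2 powr (real (2 * p)) = 2 ^ (2 * p)" by (rule powr_realpow) simp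
    also have "(2::real) ^ (2 * p) = 4 ^ p" by (simp add: power_mult)
    finally show ?thesis by (simp add: inverse_eq_divide)
  qed
  have U_G: "dist_of p (U 0 t x) \<in> space_G M s'" if t: "t \<in> {0<..T}" and "2 powr s' * kappa \<nu> \<sigma> t < 1" for t x s'
  proof (rule U_space_G[OF t])
    have "2 powr s' * (?G t / ?N t) < 1" using that kappa[of t] by auto
    then show "2 powr s' * ?G t < N t" using var_pos[OF t] by (simp add: N_def divide_less_eq)
  qed
  show "\<exists>(s::real) (u :: real \<Rightarrow> real \<Rightarrow> hida_functional).
    (\<forall>t\<in>{0<..real Tn}. \<forall>x. u t x \<in> space_G M s) \<and>
    (\<forall>\<phi>\<in>schwartz. dirac_sequence (real Tn) (\<lambda>t x. S_transform (u t x) \<phi>)) \<and>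
    (AE t in lebesgue. t \<in> {0<..real Tn} \<longrightarrow>
      (\<exists>Dx. \<forall>x. \<exists>Dt Dxx.
        has_hida_derivative M (\<lambda>r. u r x) Dt t {0<..real Tn} \<and>
        has_hida_derivative M (u t) (Dx x) x UNIV \<and>
        has_hida_derivative M Dx Dxx x UNIV \<and>
        Dt = (\<lambda>F. 1/2 * complex_of_real (real_of_ereal (\<nu> t)) * Dxx F
               + complex_of_real (real_of_ereal (\<sigma> t)) * wick_product M (white_noise M t) (Dx x) F))) \<and>
    (\<forall>s'. \<forall>t\<in>{0<..real Tn}. 2 powr s' * kappa \<nu> \<sigma> t < 1 \<longrightarrow>
      (\<forall>x. u t x \<in> space_G M s'))"
    unfolding T_def[symmetric]
  proof (intro exI[of _ s] exI[of _ "\<lambda>t x. dist_of p (U 0 t x)"] conjI ballI allI impI)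
    fix t x assume t: "t \<in> {0<..T}"
    then have "t \<le> T" by simp
    have "kappa \<nu> \<sigma> t < 4 ^ p"
      unfolding kappa[OF \<open>t \<le> T\<close>] using less[OF t] by (subst pos_divide_less_eq[OF var_pos[OF t]])
    then have "2 powr s * kappa \<nu> \<sigma> t < 1" by (simp add: s)
    then show "dist_of p (U 0 t x) \<in> space_G M s" by (rule U_G[OF t])
  next
    fix \<phi> assume "\<phi> \<in> schwartz"
    then show "dirac_sequence T (\<lambda>t x. S_transform (dist_of p (U 0 t x)) \<phi>)" by (rule U_dirac)
  next
    fix s' t x assume "t \<in> {0<..T}" "2 powr s' * kappa \<nu> \<sigma> t < 1"
    then show "dist_of p (U 0 t x) \<in> space_G M s'" by (rule U_G)
  next
    \<comment> \<open>The admissible times are the common Lebesgue points of \<open>nu\<close>,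
      \<open>sg\<close> and the square of \<open>sg\<close> at which the Borel versions agree with
      the given coefficients.\<close>
    show "AE t in lebesgue. t \<in> {0<..T} \<longrightarrow>
      (\<exists>Dx. \<forall>x. \<exists>Dt Dxx.
        has_hida_derivative M (\<lambda>r. dist_of p (U 0 r x)) Dt t {0<..T} \<and>
        has_hida_derivative M (\<lambda>x. dist_of p (U 0 t x)) (Dx x) x UNIV \<and>
        has_hida_derivative M Dx Dxx x UNIV \<and>
        Dt = (\<lambda>F. 1/2 * complex_of_real (real_of_ereal (\<nu> t)) * Dxx F
               + complex_of_real (real_of_ereal (\<sigma> t)) * wick_product M (white_noise M t) (Dx x) F))"
      using AE_averages_tendsto[OF nu_int] AE_averages_tendsto[OF sg_int] AE_averages_tendsto[OF sg2_int]
        AE_completion[OF nu_version(2)] AE_completion[OF sg_version(2)]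
    proof eventually_elim
      case (elim t)
      show ?case
      proof
        assume t: "t \<in> {0<..T}"
        have e: "real_of_ereal (\<nu> t) = nu t" "real_of_ereal (\<sigma> t) = sg t" using elim(4,5) t by auto
        show "\<exists>Dx. \<forall>x. \<exists>Dt Dxx.
          has_hida_derivative M (\<lambda>r. dist_of p (U 0 r x)) Dt t {0<..T} \<and>
          has_hida_derivative M (\<lambda>x. dist_of p (U 0 t x)) (Dx x) x UNIV \<and>
          has_hida_derivative M Dx Dxx x UNIV \<and>
          Dt = (\<lambda>F. 1/2 * complex_of_real (real_of_ereal (\<nu> t)) * Dxx F
               + complex_of_real (real_of_ereal (\<sigma> t)) * wick_product M (white_noise M t) (Dx x) F)"
          unfolding e using elim(1-3) by (intro equation t) (simp_all add: avg_def[abs_def])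
      qed
    qed
  qed
qed

end
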